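(* Let $w$ be a signed Gauss word on letters $a_1,\dots,a_n$ and let $(S_w,\gamma_w)$ be a minimal realization of $w$. Let $\varphi_w,\varphi_{a_1},\dots,\varphi_{a_n}\in H_1(S_w,\mathbb Z)$ be the homology classes of $\gamma_w$ and of the curves $\gamma_{a_1},\dots,\gamma_{a_n}$ obtained by splitting the crossings $a_1,\dots,a_n$. Put $\alpha_{a_j}(w)=\langle\varphi_w,\varphi_{a_j}\rangle$ and $\beta_{a_ia_j}(w)=\langle\varphi_{a_i},\varphi_{a_j}\rangle$. Then $H_1(S_w,\mathbb Z)=(0)$ if and only if $\alpha_{a_j}(w)=0$ and $\beta_{a_ia_j}(w)=0$ for every $i,j=1,2,\dots,n$.
   Context: Surfaces are compact, oriented, triangulated (PL) 2-manifolds. An oriented PL-normal curve (one component) on a connected surface $\Sigma$ is an oriented closed trail in the 1-skeleton whose only self-intersections are transverse double points (crossings). At a crossing one of the two strands travels the crossing positively and the other negatively: a strand travels it positively iff the other strand crosses it from its left to its right. A signed Gauss word on letters $a_1,\dots,a_n$ is a word, considered up to cyclic permutation, in which each of the symbols $a_1,\dots,a_n,a_1^{-1},\dots,a_n^{-1}$ occurs exactly once. $(\Sigma,\gamma)$ is a realization of $w$ if the crossings of $\gamma$ can be labelled $a_1,\dots,a_n$ so that following $\gamma$ and writing $a_i$ (resp. $a_i^{-1}$) each time $a_i$ is travelled positively (resp. negatively) gives $w$. A minimal realization $(S_w,\gamma_w)$ of $w$ is a realization on a closed connected surface of minimum genus among all realizations of $w$ on closed connected surfaces. Splitting: at each crossing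 $a_t$, smoothing the crossing consistently with the orientation of $\gamma_w$ yields an oriented curve of two components $\gamma'_{a_t}\cup\gamma_{a_t}$. Writing $w=a_t\,u\,a_t^{-1}\,v$ up to cyclic permutation, $\gamma'_{a_t}$ is the component that reads the word $u$ and $\gamma_{a_t}$ the component that reads the word $v$. Intersection number: for transverse oriented curves $\gamma_1,\gamma_2$ on an oriented surface, $\langle\gamma_1,\gamma_2\rangle=\sum_{c\in\gamma_1\cap\gamma_2}\epsilon_c$ with $\epsilon_c=+1$ if $\gamma_1$ travels $c$ positively and $-1$ if negatively. For homology classes, $\langle\varphi_1,\varphi_2\rangle$ is the value on transverse representatives. *)

theory Defs
  imports Complex_Main "HOL-Algebra.Coset" "HOL-Algebra.Elementary_Groups"
begin

section \<open>Closed oriented triangulated surfaces\<close>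

text \<open>
  A closed oriented triangulated surface is given by the set of its positively (counterclockwise)
  oriented triangles, each listed with all three of its rotations. The underlying abstract
  simplicial complex consists of the vertices, edges and triangles below. Every finite abstract
  simplicial complex has a copy with vertices in \<open>nat\<close>.
\<close>

type_synonym surface = "(nat \<times> nat \<times> nat) set"

definition verts :: "surface \<Rightarrow> nat set" where
  "verts T = {a. \<exists>b c. (a, b, c) \<in> T}"

definition edges :: "surface \<Rightarrow> nat set set" where
  "edges T = {{a, b} | a b. \<exists>c. (a, b, c) \<in> T}"

definition triangles :: "surface \<Rightarrow> nat set set" where
  "triangles T = {{a, b, c} | a b c. (a, b, c) \<in> T}"

definition link_verts :: "surface \<Rightarrow> nat \<Rightarrow> nat set" where
  "link_verts T x = {b. \<exists>c. (x, b, c) \<in> T}"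

definition ccw_next :: "surface \<Rightarrow> nat \<Rightarrow> nat \<Rightarrow> nat" where
  "ccw_next T x b = (THE c. (x, b, c) \<in> T)"

text \<open>
  In the following definition, the condition \<open>(b, a, c) \<notin> T\<close> excludes two triangles with the same
  three vertices. The next two conditions say that every edge lies in exactly two triangles, which
  induce opposite directions on it, and the last one that every vertex link is a single circle.
\<close>

definition closed_oriented_surface :: "surface \<Rightarrow> bool" where
  "closed_oriented_surface T \<longleftrightarrow>
     finite T \<and> T \<noteq> {} \<and>
     (\<forall>a b c. (a, b, c) \<in> T \<longrightarrow>
        a \<noteq> b \<and> b \<noteq> c \<and> a \<noteq> c \<and> (b, c, a) \<in> T \<and> (b, a, c) \<notin> T) \<and>
     (\<forall>a b c d. (a, b, c) \<in> T \<and> (a, b, d) \<in> T \<longrightarrow> c = d) \<and>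
     (\<forall>a b c. (a, b, c) \<in> T \<longrightarrow> (\<exists>d. (b, a, d) \<in> T)) \<and>
     (\<forall>x. \<forall>b\<in>link_verts T x. \<forall>c\<in>link_verts T x. \<exists>k. c = (ccw_next T x ^^ k) b)"

definition connected_surface :: "surface \<Rightarrow> bool" where
  "connected_surface T \<longleftrightarrow>
     (\<forall>a\<in>verts T. \<forall>b\<in>verts T. (a, b) \<in> {(u, v). {u, v} \<in> edges T}\<^sup>*)"

definition euler_char :: "surface \<Rightarrow> int" where
  "euler_char T = int (card (verts T)) - int (card (edges T)) + int (card (triangles T))"

text \<open>For closed connected oriented surfaces the Euler characteristic is \<open>2 - 2g\<close>.\<close>

definition genus :: "surface \<Rightarrow> int" where
  "genus T = (2 - euler_char T) div 2"


section \<open>PL-normal curves\<close>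

text \<open>
  A component is a closed walk, given by its cyclic list of vertices; a curve is a list of
  components. A strand \<open>(p, x, q)\<close> is a passage of a curve through the vertex \<open>x\<close>, coming from \<open>p\<close>
  and going on to \<open>q\<close>. On a trail, different passages yield different triples.
\<close>

definition darts :: "nat list \<Rightarrow> (nat \<times> nat) list" where
  "darts c = zip c (rotate1 c)"

definition curve_darts :: "nat list list \<Rightarrow> (nat \<times> nat) list" where
  "curve_darts \<gamma> = concat (map darts \<gamma>)"

definition strand_at :: "nat list \<Rightarrow> nat \<Rightarrow> nat \<times> nat \<times> nat" where
  "strand_at c i = (c ! ((i + length c - 1) mod length c), c ! i, c ! (Suc i mod length c))"

definition strands :: "nat list list \<Rightarrow> (nat \<times> nat \<times> nat) set" where
  "strands \<gamma> = {strand_at c i | c i. c \<in> set \<gamma> \<and> i < length c}"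

definition mid :: "nat \<times> nat \<times> nat \<Rightarrow> nat" where
  "mid s = fst (snd s)"

text \<open>
  \<open>between T x b c\<close>: the vertices met strictly between \<open>b\<close> and \<open>c\<close> when turning counterclockwise
  around \<open>x\<close> from \<open>b\<close> to \<open>c\<close>. The left side of the strand \<open>(p, x, q)\<close> is met when turning
  counterclockwise from \<open>q\<close> to \<open>p\<close>.
\<close>

definition between :: "surface \<Rightarrow> nat \<Rightarrow> nat \<Rightarrow> nat \<Rightarrow> nat set" where
  "between T x b c =
     {d. \<exists>i j. 0 < i \<and> i < j \<and> j < card (link_verts T x) \<and>
          d = (ccw_next T x ^^ i) b \<and> c = (ccw_next T x ^^ j) b}"

fun left_side :: "surface \<Rightarrow> nat \<times> nat \<times> nat \<Rightarrow> nat set" where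
  "left_side T (p, x, q) = between T x q p"

fun right_side :: "surface \<Rightarrow> nat \<times> nat \<times> nat \<Rightarrow> nat set" where
  "right_side T (p, x, q) = between T x p q"

text \<open>\<open>positive_wrt T s s'\<close>: the strand \<open>s'\<close> crosses the strand \<open>s\<close> from the left of \<open>s\<close> to its
  right.\<close>

definition positive_wrt ::
    "surface \<Rightarrow> nat \<times> nat \<times> nat \<Rightarrow> nat \<times> nat \<times> nat \<Rightarrow> bool" where
  "positive_wrt T s s' \<longleftrightarrow>
     mid s' = mid s \<and> fst s' \<in> left_side T s \<and> snd (snd s') \<in> right_side T s"

definition normal_curve :: "surface \<Rightarrow> nat list list \<Rightarrow> bool" where
  "normal_curve T \<gamma> \<longleftrightarrow>
     [] \<notin> set \<gamma> \<and>
     (\<forall>(a, b)\<in>set (curve_darts \<gamma>). {a, b} \<in> edges T) \<and>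
     distinct (map (\<lambda>(a, b). {a, b}) (curve_darts \<gamma>)) \<and>
     (\<forall>x. card {s \<in> strands \<gamma>. mid s = x} \<le> 2) \<and>
     (\<forall>s\<in>strands \<gamma>. \<forall>s'\<in>strands \<gamma>. s \<noteq> s' \<and> mid s = mid s' \<longrightarrow>
        positive_wrt T s s' \<or> positive_wrt T s' s)"

definition crossings :: "nat list list \<Rightarrow> nat set" where
  "crossings \<gamma> = {x. \<exists>s\<in>strands \<gamma>. \<exists>s'\<in>strands \<gamma>. s \<noteq> s' \<and> mid s = x \<and> mid s' = x}"

definition travels_positively :: "surface \<Rightarrow> nat list list \<Rightarrow> nat \<times> nat \<times> nat \<Rightarrow> bool" where
  "travels_positively T \<gamma> s \<longleftrightarrow> (\<exists>s'\<in>strands \<gamma>. positive_wrt T s s')"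


section \<open>Signed Gauss words and their realizations\<close>

text \<open>\<open>Pos i\<close> is the symbol \<open>a_i\<close> and \<open>Inv i\<close> is its formal inverse.\<close>

datatype symbol = Pos nat | Inv nat

text \<open>Words are represented by lists; they enter below only up to rotation.\<close>

definition signed_gauss_word :: "nat \<Rightarrow> symbol list \<Rightarrow> bool" where
  "signed_gauss_word n w \<longleftrightarrow> distinct w \<and> set w = Pos ` {1..n} \<union> Inv ` {1..n}"

definition read_symbol :: "surface \<Rightarrow> nat list \<Rightarrow> (nat \<Rightarrow> nat) \<Rightarrow> nat \<Rightarrow> symbol" where
  "read_symbol T c lab i =
     (if travels_positively T [c] (strand_at c i) then Pos (lab (c ! i)) else Inv (lab (c ! i)))"

definition read_word :: "surface \<Rightarrow> nat list \<Rightarrow> (nat \<Rightarrow> nat) \<Rightarrow> symbol list" where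
  "read_word T c lab =
     map (read_symbol T c lab) (filter (\<lambda>i. c ! i \<in> crossings [c]) [0..<length c])"

text \<open>A realization on a closed connected surface, together with the labelling of its crossings.\<close>

definition realization ::
    "nat \<Rightarrow> symbol list \<Rightarrow> surface \<Rightarrow> nat list \<Rightarrow> (nat \<Rightarrow> nat) \<Rightarrow> bool" where
  "realization n w T c lab \<longleftrightarrow>
     closed_oriented_surface T \<and> connected_surface T \<and> normal_curve T [c] \<and>
     bij_betw lab (crossings [c]) {1..n} \<and> (\<exists>k. read_word T c lab = rotate k w)"

definition minimal_realization ::
    "nat \<Rightarrow> symbol list \<Rightarrow> surface \<Rightarrow> nat list \<Rightarrow> (nat \<Rightarrow> nat) \<Rightarrow> bool" where
  "minimal_realization n w T c lab \<longleftrightarrow>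
     realization n w T c lab \<and>
     (\<forall>T' c' lab'. realization n w T' c' lab' \<longrightarrow> genus T \<le> genus T')"


section \<open>Splitting a crossing\<close>

definition occurrence :: "surface \<Rightarrow> nat list \<Rightarrow> (nat \<Rightarrow> nat) \<Rightarrow> symbol \<Rightarrow> nat" where
  "occurrence T c lab a =
     (THE i. i < length c \<and> c ! i \<in> crossings [c] \<and> read_symbol T c lab i = a)"

text \<open>The closed walk that follows \<open>c\<close> cyclically from position \<open>i\<close> on, up to its return to the same
  vertex at position \<open>j\<close>.\<close>

definition segment :: "nat list \<Rightarrow> nat \<Rightarrow> nat \<Rightarrow> nat list" where
  "segment c i j = take ((j + length c - i) mod length c) (rotate i c)"

text \<open>
  If the word is cyclically \<open>a_t u a_t^{-1} v\<close>, the first component of the smoothed curve reads \<open>u\<close>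
  and the second one reads \<open>v\<close>.
\<close>

definition split :: "surface \<Rightarrow> nat list \<Rightarrow> (nat \<Rightarrow> nat) \<Rightarrow> nat \<Rightarrow> nat list \<times> nat list" where
  "split T c lab t =
     (let i = occurrence T c lab (Pos t); j = occurrence T c lab (Inv t)
      in (segment c i j, segment c j i))"

definition split_curve :: "surface \<Rightarrow> nat list \<Rightarrow> (nat \<Rightarrow> nat) \<Rightarrow> nat \<Rightarrow> nat list" where
  "split_curve T c lab t = snd (split T c lab t)"


section \<open>Simplicial homology in dimension one\<close>

text \<open>
  Chains are alternating integer-valued functions on oriented simplices. The boundary of the
  oriented triangle \<open>[x, a, b]\<close> has coefficient \<open>1\<close> at \<open>[a, b]\<close>, and that of the oriented edge
  \<open>[a, b]\<close> has coefficient \<open>1\<close> at \<open>b\<close>.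
\<close>

type_synonym chain = "nat \<Rightarrow> nat \<Rightarrow> int"

definition chains1 :: "surface \<Rightarrow> chain set" where
  "chains1 T = {f. (\<forall>a b. f b a = - f a b) \<and> (\<forall>a b. {a, b} \<notin> edges T \<longrightarrow> f a b = 0)}"

definition chains2 :: "surface \<Rightarrow> (nat \<Rightarrow> nat \<Rightarrow> nat \<Rightarrow> int) set" where
  "chains2 T = {g. (\<forall>a b c. g b a c = - g a b c \<and> g a c b = - g a b c) \<and>
                   (\<forall>a b c. {a, b, c} \<notin> triangles T \<longrightarrow> g a b c = 0)}"

definition boundary1 :: "surface \<Rightarrow> chain \<Rightarrow> nat \<Rightarrow> int" where
  "boundary1 T f b = (\<Sum>a\<in>verts T. f a b)"

definition boundary2 :: "surface \<Rightarrow> (nat \<Rightarrow> nat \<Rightarrow> nat \<Rightarrow> int) \<Rightarrow> chain" where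
  "boundary2 T g a b = (\<Sum>x\<in>verts T. g x a b)"

definition cycle_group :: "surface \<Rightarrow> chain monoid" where
  "cycle_group T =
     \<lparr>carrier = {f \<in> chains1 T. boundary1 T f = (\<lambda>v. 0)},
      monoid.mult = (\<lambda>f g a b. f a b + g a b), one = (\<lambda>a b. 0)\<rparr>"

definition boundaries :: "surface \<Rightarrow> chain set" where
  "boundaries T = boundary2 T ` chains2 T"

definition H1 :: "surface \<Rightarrow> chain set monoid" where
  "H1 T = cycle_group T Mod boundaries T"

definition chain_class :: "surface \<Rightarrow> chain \<Rightarrow> chain set" where
  "chain_class T f = boundaries T #>\<^bsub>cycle_group T\<^esub> f"

definition curve_chain :: "nat list list \<Rightarrow> chain" where
  "curve_chain \<gamma> a b =
     int (count_list (curve_darts \<gamma>) (a, b)) - int (count_list (curve_darts \<gamma>) (b, a))"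

definition curve_class :: "surface \<Rightarrow> nat list list \<Rightarrow> chain set" where
  "curve_class T \<gamma> = chain_class T (curve_chain \<gamma>)"


section \<open>Intersection numbers\<close>

definition transverse :: "surface \<Rightarrow> nat list list \<Rightarrow> nat list list \<Rightarrow> bool" where
  "transverse T \<gamma>1 \<gamma>2 \<longleftrightarrow> normal_curve T (\<gamma>1 @ \<gamma>2)"

definition curve_intersection :: "surface \<Rightarrow> nat list list \<Rightarrow> nat list list \<Rightarrow> int" where
  "curve_intersection T \<gamma>1 \<gamma>2 =
     (\<Sum>x\<in>mid ` strands \<gamma>1 \<inter> mid ` strands \<gamma>2.
        if \<exists>s\<in>strands \<gamma>1. \<exists>s'\<in>strands \<gamma>2. mid s = x \<and> positive_wrt T s s' then 1 else - 1)"

text \<open>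
  The 1-skeleton of a given triangulation may be too small to contain transverse representatives
  of two homology classes, so representatives are taken in iterated stellar subdivisions.
  \<open>stellar T \<sigma> x\<close> stars the edge or triangle \<open>\<sigma>\<close> at the new vertex \<open>x\<close>: a triangle containing \<open>\<sigma>\<close> is
  replaced by the triangles obtained by substituting \<open>x\<close> for one vertex of \<open>\<sigma>\<close>.
\<close>

fun subst_vertex :: "nat \<Rightarrow> nat \<Rightarrow> nat \<times> nat \<times> nat \<Rightarrow> nat \<times> nat \<times> nat" where
  "subst_vertex y x (a, b, c) =
     (if a = y then x else a, if b = y then x else b, if c = y then x else c)"

fun tri_verts :: "nat \<times> nat \<times> nat \<Rightarrow> nat set" where
  "tri_verts (a, b, c) = {a, b, c}"

definition stellar :: "surface \<Rightarrow> nat set \<Rightarrow> nat \<Rightarrow> surface" where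
  "stellar T \<sigma> x =
     {t \<in> T. \<not> \<sigma> \<subseteq> tri_verts t} \<union>
     {subst_vertex y x t | y t. t \<in> T \<and> \<sigma> \<subseteq> tri_verts t \<and> y \<in> \<sigma>}"

text \<open>The chain map induced by starring the edge between \<open>u\<close> and \<open>v\<close> sends \<open>[u, v]\<close> to
  \<open>[u, x] + [x, v]\<close>.\<close>

definition subdivide_edge :: "nat \<Rightarrow> nat \<Rightarrow> nat \<Rightarrow> chain \<Rightarrow> chain" where
  "subdivide_edge u v x f a b =
     (if (a, b) \<in> {(u, x), (x, v)} then f u v
      else if (a, b) \<in> {(v, x), (x, u)} then f v u
      else if {a, b} = {u, v} then 0
      else f a b)"

text \<open>\<open>subdivision T T' F\<close>: \<open>T'\<close> is an iterated stellar subdivision of \<open>T\<close>, and \<open>F\<close> is the induced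
  map from the 1-chains of \<open>T\<close> to those of \<open>T'\<close>.\<close>

inductive subdivision :: "surface \<Rightarrow> surface \<Rightarrow> (chain \<Rightarrow> chain) \<Rightarrow> bool" for T :: surface where
  trivial: "subdivision T T id"
| star_edge: "subdivision T T' F \<Longrightarrow> {u, v} \<in> edges T' \<Longrightarrow> x \<notin> verts T' \<Longrightarrow>
    subdivision T (stellar T' {u, v} x) (subdivide_edge u v x \<circ> F)"
| star_triangle: "subdivision T T' F \<Longrightarrow> \<sigma> \<in> triangles T' \<Longrightarrow> x \<notin> verts T' \<Longrightarrow>
    subdivision T (stellar T' \<sigma> x) F"

definition represents ::
    "surface \<Rightarrow> (chain \<Rightarrow> chain) \<Rightarrow> nat list list \<Rightarrow> chain set \<Rightarrow> bool" where
  "represents T' F \<gamma> \<phi> \<longleftrightarrow> (\<exists>f\<in>\<phi>. curve_class T' \<gamma> = chain_class T' (F f))"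

definition intersection_number :: "surface \<Rightarrow> chain set \<Rightarrow> chain set \<Rightarrow> int" where
  "intersection_number T \<phi>1 \<phi>2 =
     (THE k. \<exists>T' F \<gamma>1 \<gamma>2. subdivision T T' F \<and> transverse T' \<gamma>1 \<gamma>2 \<and>
        represents T' F \<gamma>1 \<phi>1 \<and> represents T' F \<gamma>2 \<phi>2 \<and>
        k = curve_intersection T' \<gamma>1 \<gamma>2)"

definition alpha :: "surface \<Rightarrow> nat list \<Rightarrow> (nat \<Rightarrow> nat) \<Rightarrow> nat \<Rightarrow> int" where
  "alpha T c lab j =
     intersection_number T (curve_class T [c]) (curve_class T [split_curve T c lab j])"

definition beta :: "surface \<Rightarrow> nat list \<Rightarrow> (nat \<Rightarrow> nat) \<Rightarrow> nat \<Rightarrow> nat \<Rightarrow> int" where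
  "beta T c lab i j =
     intersection_number T (curve_class T [split_curve T c lab i])
       (curve_class T [split_curve T c lab j])"

end

theory Submission
  imports Defs "HOL-Library.Nat_Bijection"
begin

text \<open>
  A 1-cycle on the surface is the difference, edge by edge, of a potential on the corners of the triangles,
  and the jumps of this potential across the edges are the intersection numbers of the cycle with chains.
  The resulting pairing is antisymmetric and nondegenerate modulo boundaries,
  and transverse curves compute it after barycentric subdivisions, where one curve runs along dual edges.

  If all \<open>\<alpha>\<close> and \<open>\<beta>\<close> vanish, the potentials of \<open>\<gamma>\<close> and of the \<open>n\<close> split curves have jumps along \<open>\<gamma>\<close> that sum to
  zero over every loop of \<open>\<gamma>\<close>, and after a correction at the vertices they are constant on each face of the ribbon
  graph of \<open>\<gamma>\<close>. These \<open>n + 1\<close> cycles are linearly independent, so the ribbon graph has at least \<open>n + 1\<close> faces.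
  As it has \<open>n\<close> more edges than vertices, capping its boundary circles by discs produces a realization with
  positive Euler characteristic. By minimality the given surface also has genus at most zero. There, a cycle that
  does not bound and another one pairing nontrivially with it would be independent modulo the coboundaries of
  vertices and the boundaries of triangles, which gives more independent 1-chains than edges.
\<close>

section \<open>Vertex links\<close>

text \<open>\<open>intersection_number\<close> is a definite description over all iterated
  subdivisions and all transverse representatives, while the split curves share edges with
  \<open>\<gamma>\<close> and so are not transverse to it as they stand. Everything therefore goes
  through \<open>pairing\<close>, which is defined on cycles without moving them. It is twice the
  count for transverse curves and is kept by every stellar move, which makes the described number
  unique. For existence, one curve is refined and the other cycle is pushed onto dual edges; its
  dual weights must lie in \<open>{-1, 0, 1}\<close>, and averaging the potential over a barycentric
  subdivision roughly halves them.

  A potential of a cycle is determined up to one constant per vertex. This freedom is what all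
  corrections use: it makes corners agree on triangles in the proof of nondegeneracy, and it removes
  the jumps along \<open>\<gamma>\<close> in the count of faces.

  Euler characteristic \<open>1\<close> is the right threshold because \<open>genus\<close> rounds
  down: \<open>euler_char \<ge> 1\<close> and \<open>genus \<le> 0\<close> say the same, so
  minimality transfers the bound from the capped ribbon graph to the given surface.\<close>

lemma cyclic_orbit:
  assumes fin: "finite A" and maps: "f ` A \<subseteq> A" and inj: "inj_on f A" and b: "b \<in> A"
    and orb: "\<And>c. c \<in> A \<Longrightarrow> \<exists>k. c = (f ^^ k) b"
  shows "bij_betw (\<lambda>k. (f ^^ k) b) {..<card A} A" and "(f ^^ card A) b = b"
proof -
  have mem: "(f ^^ k) b \<in> A" for k
    using maps b by (induction k) auto
  have "\<not> inj_on (\<lambda>k. (f ^^ k) b) {..card A}"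
  proof
    assume "inj_on (\<lambda>k. (f ^^ k) b) {..card A}"
    then have "card {..card A} \<le> card A"
      using mem fin by (intro card_inj_on_le[of _ _ A]) auto
    then show False by simp
  qed
  then obtain i j where ij: "i < j" "j \<le> card A" "(f ^^ i) b = (f ^^ j) b"
    by (auto simp: inj_on_def) (metis nat_neq_iff)
  have cancel: "(f ^^ i) u = (f ^^ i) v \<Longrightarrow> u = v" if "u \<in> A" "v \<in> A" for u v i
    using that
  proof (induction i arbitrary: u v)
    case (Suc i)
    have "f u \<in> A" "f v \<in> A" using Suc.prems maps by auto
    moreover have "(f ^^ i) (f u) = (f ^^ i) (f v)" using Suc.prems by (simp add: funpow_swap1)
    ultimately have "f u = f v" using Suc.IH by blast
    then show ?case using inj Suc.prems by (auto dest: inj_onD)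
  qed simp
  \<comment> \<open>Injectivity cancels the common \<open>i\<close> steps, so the repetition is a
    return to \<open>b\<close> after \<open>p \<le> card A\<close> steps. As the first
    \<open>p\<close> powers already reach all of \<open>A\<close>, this forces
    \<open>p = card A\<close>.\<close>
  define p where "p = j - i"
  have p: "0 < p" "p \<le> card A" using ij by (auto simp: p_def)
  have "(f ^^ i) ((f ^^ p) b) = (f ^^ i) b"
    using ij by (metis p_def funpow_add le_add_diff_inverse less_imp_le o_apply)
  then have per: "(f ^^ p) b = b" using cancel mem b by blast
  have img: "(\<lambda>k. (f ^^ k) b) ` {..<p} = A"
  proof
    show "A \<subseteq> (\<lambda>k. (f ^^ k) b) ` {..<p}"
    proof
      fix c assume "c \<in> A"
      then obtain k where "c = (f ^^ k) b" using orb by blast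
      then have "c = (f ^^ (k mod p)) b" using funpow_mod_eq[OF per] by simp
      then show "c \<in> (\<lambda>k. (f ^^ k) b) ` {..<p}" using p by auto
    qed
  qed (use mem in auto)
  have "card A \<le> p" using card_image_le[of "{..<p}" "\<lambda>k. (f ^^ k) b"] img by simp
  then have pc: "p = card A" using p by simp
  show "bij_betw (\<lambda>k. (f ^^ k) b) {..<card A} A"
    using img pc by (simp add: bij_betw_def eq_card_imp_inj_on)
  show "(f ^^ card A) b = b" using per pc by simp
qed

locale surf =
  fixes T :: surface
  assumes surface: "closed_oriented_surface T"
begin

abbreviation nx :: "nat \<Rightarrow> nat \<Rightarrow> nat" where "nx \<equiv> ccw_next T"

lemma finite_T: "finite T" and T_ne: "T \<noteq> {}"
  using surface by (auto simp: closed_oriented_surface_def)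

lemma tri_distinct:
  assumes "(a, b, c) \<in> T" shows "a \<noteq> b" "b \<noteq> c" "a \<noteq> c" "b \<noteq> a" "c \<noteq> b" "c \<noteq> a"
  using surface assms unfolding closed_oriented_surface_def by metis+

lemma rot: "(a, b, c) \<in> T \<Longrightarrow> (b, c, a) \<in> T"
  using surface unfolding closed_oriented_surface_def by metis

lemma rot2: "(a, b, c) \<in> T \<Longrightarrow> (c, a, b) \<in> T"
  using rot by blast

lemma no_mirror: "(a, b, c) \<in> T \<Longrightarrow> (b, a, c) \<notin> T"
  using surface unfolding closed_oriented_surface_def by metis

lemma tri_unique: "(a, b, c) \<in> T \<Longrightarrow> (a, b, d) \<in> T \<Longrightarrow> c = d"
  using surface unfolding closed_oriented_surface_def by metis

lemma tri_unique2: "(a, b, c) \<in> T \<Longrightarrow> (a, b', c) \<in> T \<Longrightarrow> b = b'"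
  using rot2 tri_unique by blast

lemma opposite: "(a, b, c) \<in> T \<Longrightarrow> \<exists>d. (b, a, d) \<in> T"
  using surface unfolding closed_oriented_surface_def by metis

lemma nx_eq: "(x, b, c) \<in> T \<Longrightarrow> nx x b = c"
  unfolding ccw_next_def using tri_unique by blast

lemma link_iff: "b \<in> link_verts T x \<longleftrightarrow> (x, b, nx x b) \<in> T"
  unfolding link_verts_def using nx_eq by auto

lemma tri_link: "(x, b, c) \<in> T \<Longrightarrow> b \<in> link_verts T x" "(x, b, c) \<in> T \<Longrightarrow> c \<in> link_verts T x"
  unfolding link_verts_def using opposite rot by (blast, blast)

lemma link_sym: "b \<in> link_verts T x \<Longrightarrow> x \<in> link_verts T b"
  unfolding link_verts_def using opposite by blast

lemma tri_verts_mem: "(a, b, c) \<in> T \<Longrightarrow> a \<in> verts T" "(a, b, c) \<in> T \<Longrightarrow> b \<in> verts T"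
  "(a, b, c) \<in> T \<Longrightarrow> c \<in> verts T"
  unfolding verts_def using rot rot2 by blast+

lemma finite_verts: "finite (verts T)"
proof -
  have "verts T = fst ` T" unfolding verts_def by force
  then show ?thesis using finite_T by simp
qed

lemma link_subset: "link_verts T x \<subseteq> verts T"
  unfolding link_verts_def using tri_verts_mem by blast

lemma finite_link: "finite (link_verts T x)"
  using link_subset finite_verts finite_subset by blast

lemma edges_iff: "{a, b} \<in> edges T \<longleftrightarrow> b \<in> link_verts T a"
proof
  assume "{a, b} \<in> edges T"
  then obtain a' b' c where *: "{a, b} = {a', b'}" "(a', b', c) \<in> T" unfolding edges_def by auto
  then have "b' \<in> link_verts T a'" "a' \<in> link_verts T b'" using tri_link link_sym by blast+
  then show "b \<in> link_verts T a" using * by (auto simp: doubleton_eq_iff)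
next
  assume "b \<in> link_verts T a"
  then show "{a, b} \<in> edges T" unfolding edges_def link_verts_def by auto
qed

lemma edge_ne: "b \<in> link_verts T a \<Longrightarrow> a \<noteq> b"
  unfolding link_verts_def using tri_distinct by blast

lemma nx_link: "b \<in> link_verts T x \<Longrightarrow> nx x b \<in> link_verts T x"
  using link_iff tri_link by blast

lemma nx_inj: "inj_on (nx x) (link_verts T x)"
  by (rule inj_onI) (metis link_iff tri_unique2)

lemma link_orbit:
  assumes "b \<in> link_verts T x"
  shows "bij_betw (\<lambda>k. (nx x ^^ k) b) {..<card (link_verts T x)} (link_verts T x)"
    and "(nx x ^^ card (link_verts T x)) b = b"
proof -
  have "nx x ` link_verts T x \<subseteq> link_verts T x" using nx_link by auto
  moreover have "\<exists>k. c = (nx x ^^ k) b" if "c \<in> link_verts T x" for c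
    using surface assms that unfolding closed_oriented_surface_def by metis
  ultimately show "bij_betw (\<lambda>k. (nx x ^^ k) b) {..<card (link_verts T x)} (link_verts T x)"
    "(nx x ^^ card (link_verts T x)) b = b"
    using cyclic_orbit[OF finite_link _ nx_inj assms] by blast+
qed

lemma nx_pow_link: "b \<in> link_verts T x \<Longrightarrow> (nx x ^^ k) b \<in> link_verts T x"
  by (induction k) (auto intro: nx_link)

lemma nx_pow_tri: "b \<in> link_verts T x \<Longrightarrow> (x, (nx x ^^ k) b, (nx x ^^ Suc k) b) \<in> T"
  using nx_pow_link[of b x k] link_iff by auto

lemma nx_pow_ex:
  assumes "b \<in> link_verts T x" "c \<in> link_verts T x"
  obtains k where "k < card (link_verts T x)" "c = (nx x ^^ k) b"
  using link_orbit(1)[OF assms(1)] assms(2) by (auto simp: bij_betw_def)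

lemma nx_pow_inj:
  assumes "b \<in> link_verts T x" "(nx x ^^ i) b = (nx x ^^ j) b"
    "i < card (link_verts T x)" "j < card (link_verts T x)"
  shows "i = j"
  using link_orbit(1)[OF assms(1)] assms by (auto simp: bij_betw_def dest: inj_onD)

lemma betweenE:
  assumes "d \<in> between T x b c"
  obtains i j where "0 < i" "i < j" "j < card (link_verts T x)"
    "d = (nx x ^^ i) b" "c = (nx x ^^ j) b"
  using assms unfolding between_def by blast

text \<open>Reachability in the link without touching either end is the form of betweenness that
  survives a change of surface: paths in the link can be mapped step by step to the link in the
  subdivided or the capped surface.\<close>

lemma between_iff_trancl:
  assumes b: "b \<in> link_verts T x" and c: "c \<in> link_verts T x" and "b \<noteq> c"
  shows "d \<in> between T x b c \<longleftrightarrow> (b, d) \<in> {(e, f). (x, e, f) \<in> T \<and> f \<notin> {b, c}}\<^sup>+"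
proof -
  let ?R = "{(e, f). (x, e, f) \<in> T \<and> f \<notin> {b, c}}"
  obtain j where j: "j < card (link_verts T x)" "c = (nx x ^^ j) b"
    using nx_pow_ex b c by blast
  have j0: "0 < j" using j \<open>b \<noteq> c\<close> by (cases j) auto
  have fwd: "(b, (nx x ^^ i) b) \<in> ?R\<^sup>+" if "0 < i" "i < j" for i
    using that
  proof (induction i)
    case (Suc i)
    have "(nx x ^^ Suc i) b \<noteq> c" using nx_pow_inj[OF b, of "Suc i" j] j Suc by auto
    moreover have "(nx x ^^ Suc i) b \<noteq> b" using nx_pow_inj[OF b, of "Suc i" 0] j Suc by auto
    ultimately have "((nx x ^^ i) b, (nx x ^^ Suc i) b) \<in> ?R"
      using nx_pow_tri[OF b, of i] by auto
    then show ?case using Suc by (cases "i = 0") (auto intro: trancl_into_trancl)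
  qed simp
  have bwd: "\<exists>i. 0 < i \<and> i < j \<and> d = (nx x ^^ i) b" if "(b, d) \<in> ?R\<^sup>+" for d
    using that
  proof (induction rule: trancl_induct)
    case (base y)
    then have "y = (nx x ^^ 1) b" "y \<noteq> c" using nx_eq by auto
    then show ?case using j j0 by (metis Suc_lessI less_one One_nat_def)
  next
    case (step y z)
    then obtain i where i: "0 < i" "i < j" "y = (nx x ^^ i) b" by blast
    then have "z = (nx x ^^ Suc i) b" "z \<noteq> c" using nx_eq step by auto
    then show ?case using j i by (metis Suc_lessI zero_less_Suc)
  qed
  show ?thesis
  proof
    assume "d \<in> between T x b c"
    then obtain i' j' where *: "0 < i'" "i' < j'" "j' < card (link_verts T x)"
      "d = (nx x ^^ i') b" "c = (nx x ^^ j') b" by (rule betweenE)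
    then have "j' = j" using nx_pow_inj[OF b] j by metis
    then show "(b, d) \<in> ?R\<^sup>+" using fwd * by blast
  next
    assume "(b, d) \<in> ?R\<^sup>+"
    then show "d \<in> between T x b c" unfolding between_def using bwd j by blast
  qed
qed

lemma between_link:
  assumes "b \<in> link_verts T x" "d \<in> between T x b c"
  shows "c \<in> link_verts T x" "d \<in> link_verts T x" "b \<noteq> c" "d \<noteq> b" "d \<noteq> c"
proof -
  obtain i j where *: "0 < i" "i < j" "j < card (link_verts T x)"
    "d = (nx x ^^ i) b" "c = (nx x ^^ j) b" using assms(2) by (rule betweenE)
  show "c \<in> link_verts T x" "d \<in> link_verts T x" using * nx_pow_link assms(1) by auto
  show "b \<noteq> c" using nx_pow_inj[OF assms(1), of 0 j] * by auto
  show "d \<noteq> b" using nx_pow_inj[OF assms(1), of 0 i] * by auto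
  show "d \<noteq> c" using nx_pow_inj[OF assms(1), of i j] * by auto
qed

text \<open>The base point moves from \<open>b\<close> to \<open>d\<close> by lowering the
  exponents, and a full turn brings \<open>b\<close> back at the end. Together with asymmetry,
  transitivity and totality below, this gives the axioms of a cyclic order, after which arguments
  about sides are formal.\<close>

lemma between_rotate:
  assumes b: "b \<in> link_verts T x" and "d \<in> between T x b c"
  shows "c \<in> between T x d b"
proof -
  obtain i j where *: "0 < i" "i < j" "j < card (link_verts T x)"
    "d = (nx x ^^ i) b" "c = (nx x ^^ j) b" using assms(2) by (rule betweenE)
  have "c = (nx x ^^ (j - i)) d" using * by (metis funpow_add le_add_diff_inverse2 less_imp_le o_apply)
  moreover have "(nx x ^^ (card (link_verts T x) - i)) d = (nx x ^^ card (link_verts T x)) b"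
    using * by (metis (no_types, lifting) funpow_add le_add_diff_inverse2 less_imp_le less_trans o_apply)
  then have "b = (nx x ^^ (card (link_verts T x) - i)) d" using link_orbit(2)[OF b] by simp
  moreover have "0 < j - i" "j - i < card (link_verts T x) - i" "card (link_verts T x) - i < card (link_verts T x)"
    using * by auto
  ultimately show ?thesis unfolding between_def by blast
qed

lemma between_asym:
  assumes b: "b \<in> link_verts T x" and "d \<in> between T x b c"
  shows "c \<notin> between T x b d"
proof
  assume "c \<in> between T x b d"
  then obtain i' j' where 1: "0 < i'" "i' < j'" "j' < card (link_verts T x)"
    "c = (nx x ^^ i') b" "d = (nx x ^^ j') b" by (rule betweenE)
  obtain i j where 2: "0 < i" "i < j" "j < card (link_verts T x)"
    "d = (nx x ^^ i) b" "c = (nx x ^^ j) b" using assms(2) by (rule betweenE)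
  have "i = j'" "j = i'" using nx_pow_inj[OF b] 1 2 by (metis less_trans)+
  then show False using 1 2 by simp
qed

lemma between_trans:
  assumes b: "b \<in> link_verts T x" and "d \<in> between T x b c" "c \<in> between T x b e"
  shows "d \<in> between T x b e"
proof -
  obtain i' j' where 1: "0 < i'" "i' < j'" "j' < card (link_verts T x)"
    "c = (nx x ^^ i') b" "e = (nx x ^^ j') b" using assms(3) by (rule betweenE)
  obtain i j where 2: "0 < i" "i < j" "j < card (link_verts T x)"
    "d = (nx x ^^ i) b" "c = (nx x ^^ j) b" using assms(2) by (rule betweenE)
  have "j = i'" using nx_pow_inj[OF b] 1 2 by (metis less_trans)
  then have "0 < i \<and> i < j' \<and> j' < card (link_verts T x) \<and> d = (nx x ^^ i) b \<and> e = (nx x ^^ j') b"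
    using 1 2 by simp
  then show ?thesis unfolding between_def by blast
qed

lemma between_total:
  assumes b: "b \<in> link_verts T x" and "c \<in> link_verts T x" "d \<in> link_verts T x"
    "b \<noteq> c" "d \<noteq> b" "d \<noteq> c"
  shows "d \<in> between T x b c \<or> c \<in> between T x b d"
proof -
  obtain i where i: "i < card (link_verts T x)" "d = (nx x ^^ i) b" using nx_pow_ex assms by metis
  obtain j where j: "j < card (link_verts T x)" "c = (nx x ^^ j) b" using nx_pow_ex assms by metis
  have "i \<noteq> 0" "j \<noteq> 0" "i \<noteq> j" using i j assms by (metis funpow_0)+
  then consider "0 < i \<and> i < j" | "0 < j \<and> j < i" by linarith
  then show ?thesis using i j unfolding between_def by cases blast+
qed

end

section \<open>Corner potentials\<close>

text \<open>The value \<open>G x a b\<close> belongs to the corner at \<open>x\<close> of the triangle \<open>(x, a, b)\<close>.\<close>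

definition corner_potential :: "surface \<Rightarrow> chain \<Rightarrow> (nat \<Rightarrow> nat \<Rightarrow> nat \<Rightarrow> int) \<Rightarrow> bool" where
  "corner_potential T z G \<longleftrightarrow>
     (\<forall>x a b c. (x, a, b) \<in> T \<and> (x, b, c) \<in> T \<longrightarrow> z x b = G x b c - G x a b)"

text \<open>Both directions of every edge contribute, which makes this twice the intersection number.\<close>

definition flux :: "surface \<Rightarrow> (nat \<Rightarrow> nat \<Rightarrow> nat \<Rightarrow> int) \<Rightarrow> chain \<Rightarrow> int" where
  "flux T G f = (\<Sum>(a, b, c)\<in>T. (G b c a - G a b c) * f a b)"

definition cycles :: "surface \<Rightarrow> chain set" where
  "cycles T = {f \<in> chains1 T. boundary1 T f = (\<lambda>v. 0)}"

lemma corner_potentialD: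
  "corner_potential T z G \<Longrightarrow> (x, a, b) \<in> T \<Longrightarrow> (x, b, c) \<in> T \<Longrightarrow> z x b = G x b c - G x a b"
  unfolding corner_potential_def by blast

lemma cycles_antisym: "f \<in> cycles T \<Longrightarrow> f b a = - f a b"
  unfolding cycles_def chains1_def by blast

lemma cycles_edge: "f \<in> cycles T \<Longrightarrow> f a b \<noteq> 0 \<Longrightarrow> {a, b} \<in> edges T"
  unfolding cycles_def chains1_def by blast

lemma corner_potential_scale:
  "corner_potential T z G \<Longrightarrow> corner_potential T (\<lambda>a b. k * z a b) (\<lambda>a b c. k * G a b c)"
  unfolding corner_potential_def by (auto simp: right_diff_distrib)

lemma corner_potential_shift:
  "corner_potential T z G \<Longrightarrow> corner_potential T z (\<lambda>a b c. G a b c - k a)"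
  unfolding corner_potential_def by simp

lemma chains2_swap: "g \<in> chains2 T \<Longrightarrow> g b a c = - g a b c" "g \<in> chains2 T \<Longrightarrow> g a c b = - g a b c"
  unfolding chains2_def by blast+

lemma chains2_cyclic: "g \<in> chains2 T \<Longrightarrow> g b c a = g a b c"
  using chains2_swap[of g T] by (metis minus_minus)

context surf
begin

lemma rot_sum: "(\<Sum>(a, b, c)\<in>T. h b c a) = (\<Sum>(a, b, c)\<in>T. h a b c)"
  by (rule sum.reindex_bij_witness[where i = "\<lambda>(a, b, c). (c, a, b)" and j = "\<lambda>(a, b, c). (b, c, a)"])
    (auto intro: rot rot2)

text \<open>Sending a triangle to its neighbour across the edge listed first is an involution of
  \<open>T\<close>, because every edge lies in exactly two triangles that induce opposite directions
  on it.\<close>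

lemma flip_sum: "(\<Sum>(a, b, c)\<in>T. h b a (nx b a)) = (\<Sum>(a, b, c)\<in>T. h a b c)"
proof -
  have *: "(b, a, nx b a) \<in> T" "nx a b = c" if "(a, b, c) \<in> T" for a b c
    using that link_iff link_sym tri_link nx_eq by blast+
  show ?thesis
    by (rule sum.reindex_bij_witness[where i = "\<lambda>(a, b, c). (b, a, nx b a)"
          and j = "\<lambda>(a, b, c). (b, a, nx b a)"]) (use * in auto)
qed

text \<open>Crossing the edge from its right to its left raises the corners at both ends by the same
  amount \<open>z a b\<close>, by antisymmetry of \<open>z\<close>. Hence the differences of corners
  are a function on directed edges. Around a triangle they sum to zero, so they form a cocycle, the
  Poincare dual of \<open>z\<close>.\<close>

lemma potential_other_end:
  assumes z: "corner_potential T z G" "z \<in> cycles T" and t: "(a, b, c) \<in> T" "(b, a, d) \<in> T"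
  shows "G b c a - G a b c = G b a d - G a d b"
proof -
  have "z a b = G a b c - G a d b" "z b a = G b a d - G b c a"
    using corner_potentialD[OF z(1)] rot rot2 t by blast+
  then show ?thesis using cycles_antisym[OF z(2), of b a] by simp
qed

text \<open>Summation by parts. \<open>2 * f a b\<close> is the change of \<open>K\<close> across
  the edge, taken at both ends; the part in the right-hand triangle is moved to its own summand by
  \<open>flip_sum\<close>, and the terms symmetric in \<open>G\<close> and \<open>K\<close> cancel
  by rotation. What remains is visibly antisymmetric, whence \<open>flux_antisym\<close>.\<close>

lemma flux_eq:
  assumes z: "corner_potential T z G" "z \<in> cycles T" and f: "corner_potential T f K" "f \<in> cycles T"
  shows "flux T G f = (\<Sum>(a, b, c)\<in>T. G b c a * K a b c - G a b c * K b c a)"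
proof -
  have f2: "2 * f a b = (K a b c + K b c a) - (K a d b + K b a d)"
    if "(a, b, c) \<in> T" "(b, a, d) \<in> T" for a b c d
    using potential_other_end[OF f that] corner_potentialD[OF f(1), of a d b c] that rot2 by force
  have "2 * flux T G f = (\<Sum>(a, b, c)\<in>T. (G b c a - G a b c) * (2 * f a b))"
    unfolding flux_def sum_distrib_left by (rule sum.cong) auto
  also have "\<dots> = (\<Sum>(a, b, c)\<in>T. (G b c a - G a b c) * (K a b c + K b c a)
       + (G a (nx b a) b - G b a (nx b a)) * (K b a (nx b a) + K a (nx b a) b))"
  proof (rule sum.cong; clarify)
    fix a b c assume t: "(a, b, c) \<in> T"
    then have t': "(b, a, nx b a) \<in> T" using opposite nx_eq by blast
    show "(G b c a - G a b c) * (2 * f a b) = (G b c a - G a b c) * (K a b c + K b c a)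
       + (G a (nx b a) b - G b a (nx b a)) * (K b a (nx b a) + K a (nx b a) b)"
    proof -
      have e: "G a (nx b a) b - G b a (nx b a) = - (G b c a - G a b c)"
        using potential_other_end[OF z t t'] by simp
      show ?thesis unfolding e f2[OF t t'] by (simp add: algebra_simps)
    qed
  qed
  also have "\<dots> = (\<Sum>(a, b, c)\<in>T. (G b c a - G a b c) * (K a b c + K b c a))
       + (\<Sum>(a, b, c)\<in>T. (G a (nx b a) b - G b a (nx b a)) * (K b a (nx b a) + K a (nx b a) b))"
    by (simp add: case_prod_beta sum.distrib)
  also have "\<dots> = 2 * (\<Sum>(a, b, c)\<in>T. (G b c a - G a b c) * (K a b c + K b c a))"
    using flip_sum[of "\<lambda>a b c. (G b c a - G a b c) * (K a b c + K b c a)"] by simp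
  finally have "flux T G f = (\<Sum>(a, b, c)\<in>T. (G b c a - G a b c) * (K a b c + K b c a))" by simp
  also have "\<dots> = (\<Sum>(a, b, c)\<in>T. G b c a * K a b c - G a b c * K b c a)
      + ((\<Sum>(a, b, c)\<in>T. G b c a * K b c a) - (\<Sum>(a, b, c)\<in>T. G a b c * K a b c))"
    unfolding sum_subtractf[symmetric] sum.distrib[symmetric]
    by (rule sum.cong) (auto simp: algebra_simps)
  also have "\<dots> = (\<Sum>(a, b, c)\<in>T. G b c a * K a b c - G a b c * K b c a)"
    using rot_sum[of "\<lambda>a b c. G a b c * K a b c"] by simp
  finally show ?thesis .
qed

lemma flux_antisym:
  assumes "corner_potential T z G" "z \<in> cycles T" "corner_potential T f K" "f \<in> cycles T"
  shows "flux T G f = - flux T K z"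
  unfolding flux_eq[OF assms] flux_eq[OF assms(3,4,1,2)] sum_negf[symmetric]
  by (rule sum.cong) auto

lemma boundary1_link:
  assumes "f \<in> chains1 T"
  shows "boundary1 T f x = (\<Sum>a\<in>link_verts T x. f a x)"
  unfolding boundary1_def
proof (rule sum.mono_neutral_right[OF finite_verts link_subset], clarify)
  fix a assume "a \<notin> link_verts T x"
  then have "{a, x} \<notin> edges T" using edges_iff link_sym by blast
  then show "f a x = 0" using assms unfolding chains1_def by blast
qed

lemma potential_sum:
  assumes "corner_potential T z G" "b \<in> link_verts T x"
  shows "G x ((nx x ^^ k) b) ((nx x ^^ Suc k) b) = G x b (nx x b) + (\<Sum>j=1..k. z x ((nx x ^^ j) b))"
proof (induction k)
  case (Suc k)
  show ?case
    using corner_potentialD[OF assms(1) nx_pow_tri[OF assms(2), of k] nx_pow_tri[OF assms(2), of "Suc k"]] Suc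
    by (simp add: algebra_simps)
qed simp

text \<open>Turning from the corner that starts at \<open>b\<close> to the corner that ends at
  \<open>c\<close> crosses exactly the edges strictly between them. This is how jumps along a curve
  become sums of \<open>z\<close> over one side of a strand.\<close>

lemma potential_between:
  assumes z: "corner_potential T z G" and t: "(x, b, b') \<in> T" "(x, e, c) \<in> T" and "b \<noteq> c"
  shows "G x e c - G x b b' = (\<Sum>d\<in>between T x b c. z x d)"
proof -
  have b: "b \<in> link_verts T x" and c: "c \<in> link_verts T x" using t tri_link by blast+
  obtain j where j: "j < card (link_verts T x)" "c = (nx x ^^ j) b" using nx_pow_ex b c by blast
  have "j \<noteq> 0" using j \<open>b \<noteq> c\<close> by (metis funpow_0)
  then obtain k where k: "j = Suc k" using not0_implies_Suc by blast
  have e: "e = (nx x ^^ k) b" using nx_pow_tri[OF b, of k] j k t tri_unique2 by metis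
  have bt: "between T x b c = (\<lambda>i. (nx x ^^ i) b) ` {1..k}"
  proof
    show "between T x b c \<subseteq> (\<lambda>i. (nx x ^^ i) b) ` {1..k}"
    proof
      fix d assume "d \<in> between T x b c"
      then obtain i' j' where *: "0 < i'" "i' < j'" "j' < card (link_verts T x)"
        "d = (nx x ^^ i') b" "c = (nx x ^^ j') b" by (rule betweenE)
      then have "j' = j" using nx_pow_inj[OF b] j by metis
      then show "d \<in> (\<lambda>i. (nx x ^^ i) b) ` {1..k}" using * k by auto
    qed
    show "(\<lambda>i. (nx x ^^ i) b) ` {1..k} \<subseteq> between T x b c"
    proof clarify
      fix i assume "i \<in> {1..k}"
      then have "0 < i \<and> i < j \<and> j < card (link_verts T x) \<and> (nx x ^^ i) b = (nx x ^^ i) b \<and> c = (nx x ^^ j) b"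
        using j k by simp
      then show "(nx x ^^ i) b \<in> between T x b c" unfolding between_def by blast
    qed
  qed
  have "inj_on (\<lambda>i. (nx x ^^ i) b) {1..k}"
    using nx_pow_inj[OF b] j k by (intro inj_onI) auto
  then have "(\<Sum>d\<in>between T x b c. z x d) = (\<Sum>i=1..k. z x ((nx x ^^ i) b))"
    unfolding bt by (simp add: sum.reindex)
  then show ?thesis using potential_sum[OF z b, of k] e j k nx_eq[OF t(1)] by simp
qed

text \<open>Start at an arbitrary corner of each vertex and add \<open>z\<close> along the link. The
  only obstruction is that the sum once around must vanish, and this sum is, up to sign, the
  boundary of \<open>z\<close> at the vertex.\<close>

lemma potential_exists:
  assumes z: "z \<in> cycles T"
  obtains G where "corner_potential T z G"
proof -
  define base where "base x = (SOME b. b \<in> link_verts T x)" for x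
  define ix where "ix x d = (THE k. k < card (link_verts T x) \<and> (nx x ^^ k) (base x) = d)" for x d
  define G where "G x a b = (\<Sum>j=1..ix x a. z x ((nx x ^^ j) (base x)))" for x a b :: nat
  have "corner_potential T z G" unfolding corner_potential_def
  proof (intro allI impI)
    fix x a b c assume t: "(x, a, b) \<in> T \<and> (x, b, c) \<in> T"
    let ?N = "card (link_verts T x)" and ?b = "base x"
    have a: "a \<in> link_verts T x" using t tri_link by blast
    then have base: "?b \<in> link_verts T x" unfolding base_def by (metis someI)
    have ix: "ix x ((nx x ^^ k) ?b) = k" if "k < ?N" for k
      unfolding ix_def using that nx_pow_inj[OF base] by blast
    obtain k where k: "k < ?N" "a = (nx x ^^ k) ?b" using nx_pow_ex base a by blast
    have b: "b = (nx x ^^ Suc k) ?b" using t k nx_eq by auto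
    show "z x b = G x b c - G x a b"
    proof (cases "Suc k < ?N")
      case True
      then show ?thesis using ix[OF True] ix[OF k(1)] k b by (simp add: G_def)
    next
      case False
      then have Nk: "?N = Suc k" using k by simp
      then have b0: "b = (nx x ^^ 0) ?b" using b link_orbit(2)[OF base] by simp
      have "(\<Sum>d\<in>link_verts T x. z x d) = 0"
      proof -
        have "(\<Sum>d\<in>link_verts T x. z x d) = (\<Sum>d\<in>link_verts T x. - z d x)"
          by (rule sum.cong[OF refl], rule cycles_antisym[OF z])
        then show ?thesis using boundary1_link[of z x] z
          by (simp add: sum_negf cycles_def)
      qed
      moreover have "(\<Sum>d\<in>link_verts T x. z x d) = (\<Sum>j<Suc k. z x ((nx x ^^ j) ?b))"
        using sum.reindex_bij_betw[OF link_orbit(1)[OF base], of "z x"] Nk by simp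
      moreover have "(\<Sum>j<Suc k. z x ((nx x ^^ j) ?b)) = z x b + (\<Sum>j=1..k. z x ((nx x ^^ j) ?b))"
        unfolding sum.lessThan_Suc_shift using b0
        by (simp add: sum.atLeast1_atMost_eq del: funpow.simps)
      ultimately show ?thesis using ix[OF k(1)] ix[of 0] k b0 by (simp add: G_def)
    qed
  qed
  then show thesis by (rule that)
qed

lemma triangles_iff: "{a, b, c} \<in> triangles T \<longleftrightarrow> (a, b, c) \<in> T \<or> (b, a, c) \<in> T"
proof
  assume "{a, b, c} \<in> triangles T"
  then obtain p q r where *: "{a, b, c} = {p, q, r}" "(p, q, r) \<in> T"
    unfolding triangles_def by auto
  have ne: "p \<noteq> q" "q \<noteq> r" "p \<noteq> r" using tri_distinct[OF *(2)] by auto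
  then have "card {a, b, c} = 3" using * by simp
  then have "a \<noteq> b" "b \<noteq> c" "a \<noteq> c" by (auto simp: insert_commute card_insert_if split: if_splits)
  moreover have "a \<in> {p, q, r}" "b \<in> {p, q, r}" "c \<in> {p, q, r}" using * by auto
  ultimately show "(a, b, c) \<in> T \<or> (b, a, c) \<in> T"
    using *(2) rot[OF *(2)] rot2[OF *(2)] by auto
next
  assume "(a, b, c) \<in> T \<or> (b, a, c) \<in> T"
  moreover have "{a, b, c} = {b, a, c}" by auto
  ultimately show "{a, b, c} \<in> triangles T" unfolding triangles_def by blast
qed

lemma boundary2_at:
  assumes g: "g \<in> chains2 T" and t: "(a, b, c) \<in> T" "(b, a, d) \<in> T"
  shows "boundary2 T g a b = g a b c - g b a d"
proof -
  have cd: "c \<noteq> d" using t no_mirror by blast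
  have zero: "g x a b = 0" if "x \<notin> {c, d}" for x
  proof -
    have "{x, a, b} \<notin> triangles T"
      using triangles_iff[of x a b] that t tri_unique rot rot2 by blast
    then show ?thesis using g unfolding chains2_def by blast
  qed
  have "boundary2 T g a b = (\<Sum>x\<in>{c, d}. g x a b)"
    unfolding boundary2_def
    by (rule sum.mono_neutral_right) (use finite_verts tri_verts_mem t zero in auto)
  also have "\<dots> = g c a b + g d a b" using cd by simp
  also have "\<dots> = g a b c - g b a d"
  proof -
    have "g c a b = g a b c" "g d a b = g a b d" using chains2_cyclic[OF g] by metis+
    then show ?thesis using chains2_swap[OF g, of a b d] by simp
  qed
  finally show ?thesis .
qed

text \<open>A 2-chain, read on corners, takes one value on all three corners of a triangle; at an
  edge its boundary subtracts the value on the right from the one on the left, which is the defining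
  equation of a potential.\<close>

lemma boundary2_potential:
  assumes g: "g \<in> chains2 T"
  shows "corner_potential T (boundary2 T g) g"
  unfolding corner_potential_def
proof (intro allI impI)
  fix x a b c assume t: "(x, a, b) \<in> T \<and> (x, b, c) \<in> T"
  then have "boundary2 T g x b = g x b c - g b x a" using boundary2_at g rot rot2 by blast
  moreover have "g b x a = g x a b" using chains2_cyclic[OF g] by metis
  ultimately show "boundary2 T g x b = g x b c - g x a b" by simp
qed

lemma boundary_chain:
  assumes g: "g \<in> chains2 T" shows "boundary2 T g \<in> chains1 T"
  unfolding chains1_def
proof (intro CollectI conjI allI impI)
  fix a b
  have "g x b a = - g x a b" for x using chains2_swap[OF g] by blast
  then show "boundary2 T g b a = - boundary2 T g a b" unfolding boundary2_def by (simp add: sum_negf)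
next
  fix a b assume ne: "{a, b} \<notin> edges T"
  have "g x a b = 0" for x
  proof -
    have "{x, a, b} \<notin> triangles T \<or> a = b"
      using triangles_iff[of x a b] ne edges_iff tri_link rot link_sym by blast
    moreover have "g x a a = 0" using chains2_swap(2)[OF g, of x a a] by simp
    moreover have "{x, a, b} \<notin> triangles T \<Longrightarrow> g x a b = 0" using g unfolding chains2_def by blast
    ultimately show ?thesis by blast
  qed
  then show "boundary2 T g a b = 0" unfolding boundary2_def by simp
qed

text \<open>Converse of \<open>potential_exists\<close>: the sum around the link telescopes. It
  yields cycles on subdivided surfaces as soon as a potential has been lifted, without computing
  boundaries there.\<close>

lemma cycle_if_potential:
  assumes anti: "\<And>a b. z b a = - z a b" and edge: "\<And>a b. {a, b} \<notin> edges T \<Longrightarrow> z a b = 0"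
    and G: "corner_potential T z G"
  shows "z \<in> cycles T"
proof -
  have c1: "z \<in> chains1 T" unfolding chains1_def using anti edge by blast
  have "boundary1 T z x = 0" for x
  proof (cases "link_verts T x = {}")
    case False
    then obtain b where b: "b \<in> link_verts T x" by blast
    let ?N = "card (link_verts T x)"
    have "?N > 0" using b finite_link card_gt_0_iff by blast
    then obtain k where k: "?N = Suc k" using not0_implies_Suc by blast
    define F where "F j = z x ((nx x ^^ j) b)" for j
    define K where "K j = G x ((nx x ^^ j) b) ((nx x ^^ Suc j) b)" for j
    have per: "(nx x ^^ Suc k) b = b" using link_orbit(2)[OF b] k by simp
    have FK: "F (Suc j) = K (Suc j) - K j" for j
      unfolding F_def K_def by (rule corner_potentialD[OF G nx_pow_tri[OF b] nx_pow_tri[OF b]])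
    have "(\<Sum>d\<in>link_verts T x. z x d) = (\<Sum>j<Suc k. F j)"
      using sum.reindex_bij_betw[OF link_orbit(1)[OF b], of "z x"] k by (simp only: F_def)
    also have "\<dots> = F 0 + (\<Sum>j<k. F (Suc j))" by (rule sum.lessThan_Suc_shift)
    also have "\<dots> = (\<Sum>j<Suc k. F (Suc j))" using per unfolding F_def by simp
    also have "\<dots> = K (Suc k) - K 0" unfolding FK by (rule sum_lessThan_telescope)
    also have "\<dots> = 0" using per unfolding K_def by simp
    finally have "(\<Sum>d\<in>link_verts T x. z x d) = 0" .
    moreover have "(\<Sum>d\<in>link_verts T x. z d x) = (\<Sum>d\<in>link_verts T x. - z x d)"
      by (rule sum.cong[OF refl], rule anti)
    ultimately show ?thesis using boundary1_link[OF c1] by (simp add: sum_negf)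
  qed (use boundary1_link[OF c1] in simp)
  then show ?thesis unfolding cycles_def using c1 by blast
qed

lemma boundary_cycle:
  assumes g: "g \<in> chains2 T" shows "boundary2 T g \<in> cycles T"
  by (rule cycle_if_potential[OF _ _ boundary2_potential[OF g]])
    (use boundary_chain[OF g] in \<open>unfold chains1_def, blast+\<close>)

lemma boundaries_cycles: "boundaries T \<subseteq> cycles T"
  unfolding boundaries_def using boundary_cycle by blast

lemma flux_boundary_left:
  assumes "g \<in> chains2 T" shows "flux T g f = 0"
proof -
  have "g b c a - g a b c = 0" for a b c using chains2_cyclic[OF assms, of b c a] by simp
  then show ?thesis unfolding flux_def by simp
qed

end

section \<open>The intersection pairing on cycles\<close>

text \<open>The chosen potential is unique only up to a constant at each vertex; against a cycle
  these constants cancel, see \<open>pairing_eq\<close>. Like \<open>flux\<close>, the value is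
  twice the intersection number.\<close>

definition pairing :: "surface \<Rightarrow> chain \<Rightarrow> chain \<Rightarrow> int" where
  "pairing T z f = flux T (SOME G. corner_potential T z G) f"

definition edge_chain :: "nat \<Rightarrow> nat \<Rightarrow> chain" where
  "edge_chain a b p q = (if (p, q) = (a, b) then 1 else if (p, q) = (b, a) then - 1 else 0)"

lemma cyclesI:
  "(\<And>a b. f b a = - f a b) \<Longrightarrow> (\<And>a b. {a, b} \<notin> edges T \<Longrightarrow> f a b = 0) \<Longrightarrow>
   (\<And>x. boundary1 T f x = 0) \<Longrightarrow> f \<in> cycles T"
  unfolding cycles_def chains1_def by blast

lemma boundary1_add: "boundary1 T (\<lambda>a b. f a b + g a b) x = boundary1 T f x + boundary1 T g x"
  unfolding boundary1_def by (rule sum.distrib)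

lemma boundary1_scale: "boundary1 T (\<lambda>a b. k * f a b) x = k * boundary1 T f x"
  unfolding boundary1_def by (simp add: sum_distrib_left)

lemma chains1I:
  "(\<And>a b. f b a = - f a b) \<Longrightarrow> (\<And>a b. {a, b} \<notin> edges T \<Longrightarrow> f a b = 0) \<Longrightarrow> f \<in> chains1 T"
  unfolding chains1_def by blast

lemma chains1_antisym: "f \<in> chains1 T \<Longrightarrow> f b a = - f a b"
  unfolding chains1_def by blast

lemma chains1_edge: "f \<in> chains1 T \<Longrightarrow> {a, b} \<notin> edges T \<Longrightarrow> f a b = 0"
  unfolding chains1_def by blast

lemma chains1_add:
  assumes "f \<in> chains1 T" "g \<in> chains1 T" shows "(\<lambda>a b. f a b + g a b) \<in> chains1 T"
proof (rule chains1I)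
  show "f b a + g b a = - (f a b + g a b)" for a b
    using assms[THEN chains1_antisym, of b a] by simp
  show "f a b + g a b = 0" if "{a, b} \<notin> edges T" for a b
    using assms[THEN chains1_edge, OF that] by simp
qed

lemma chains1_scale:
  assumes "f \<in> chains1 T" shows "(\<lambda>a b. k * f a b) \<in> chains1 T"
proof (rule chains1I)
  show "k * f b a = - (k * f a b)" for a b
    using assms[THEN chains1_antisym, of b a] by simp
  show "k * f a b = 0" if "{a, b} \<notin> edges T" for a b
    using assms[THEN chains1_edge, OF that] by simp
qed

lemma cycles_add: "f \<in> cycles T \<Longrightarrow> g \<in> cycles T \<Longrightarrow> (\<lambda>a b. f a b + g a b) \<in> cycles T"
  unfolding cycles_def by (auto simp: chains1_add boundary1_add)

lemma cycles_scale: "f \<in> cycles T \<Longrightarrow> (\<lambda>a b. k * f a b) \<in> cycles T"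
  unfolding cycles_def by (auto simp: chains1_scale boundary1_scale)

lemma boundary1_diff: "boundary1 T (\<lambda>a b. f a b - g a b) x = boundary1 T f x - boundary1 T g x"
  unfolding boundary1_def by (rule sum_subtractf)

lemma chains1_diff:
  "f \<in> chains1 T \<Longrightarrow> g \<in> chains1 T \<Longrightarrow> (\<lambda>a b. f a b - g a b) \<in> chains1 T"
  using chains1_add[of f T "\<lambda>a b. - 1 * g a b"] chains1_scale[of g T "- 1"] by simp

lemma flux_diff_right: "flux T G (\<lambda>a b. f a b - g a b) = flux T G f - flux T G g"
  unfolding flux_def sum_subtractf[symmetric] by (rule sum.cong) (auto simp: algebra_simps)

lemma cycles_chains1: "f \<in> cycles T \<Longrightarrow> f \<in> chains1 T"
  unfolding cycles_def by blast

lemma flux_add_right: "flux T G (\<lambda>a b. f a b + g a b) = flux T G f + flux T G g"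
  unfolding flux_def sum.distrib[symmetric] by (rule sum.cong) (auto simp: algebra_simps)

lemma flux_scale_right: "flux T G (\<lambda>a b. k * f a b) = k * flux T G f"
  unfolding flux_def sum_distrib_left by (rule sum.cong) (auto simp: algebra_simps)

text \<open>Fraction-free elimination: a pivot \<open>A e p\<close> removes one equation and one
  unknown, with cross-multiplication in place of division. It serves two counting arguments, that
  for the Euler characteristic and that for the faces of the ribbon graph.\<close>

lemma integer_kernel_nontrivial:
  fixes A :: "'e \<Rightarrow> 'u \<Rightarrow> int"
  assumes "finite E" "finite U" "card E < card U"
  shows "\<exists>x. (\<exists>u\<in>U. x u \<noteq> 0) \<and> (\<forall>e\<in>E. (\<Sum>u\<in>U. A e u * x u) = 0)"
  using assms
proof (induction E arbitrary: A U rule: finite_induct)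
  case empty
  then have "U \<noteq> {}" by auto
  then show ?case by (auto intro!: exI[of _ "\<lambda>_. 1"])
next
  case (insert e E)
  show ?case
  proof (cases "\<forall>u\<in>U. A e u = 0")
    case True
    have "card E < card U" using insert by simp
    then obtain x where "\<exists>u\<in>U. x u \<noteq> 0" "\<forall>e\<in>E. (\<Sum>u\<in>U. A e u * x u) = 0"
      using insert.IH[of U A] insert.prems by blast
    then show ?thesis using True by (intro exI[of _ x]) auto
  next
    case False
    then obtain p where p: "p \<in> U" "A e p \<noteq> 0" by blast
    define V where "V = U - {p}"
    have V: "finite V" "p \<notin> V" "U = insert p V" "card E < card V"
      using insert p by (auto simp: V_def)
    obtain y where y: "\<exists>u\<in>V. y u \<noteq> 0"
      "\<And>e'. e' \<in> E \<Longrightarrow> (\<Sum>u\<in>V. (A e p * A e' u - A e' p * A e u) * y u) = 0"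
      using insert.IH[of V "\<lambda>e' u. A e p * A e' u - A e' p * A e u"] V by blast
    \<comment> \<open>Back substitution. The other unknowns are scaled by the pivot, so that the
      value at \<open>p\<close> is an integer and the solution stays nonzero.\<close>
    define x where "x u = (if u = p then - (\<Sum>u\<in>V. A e u * y u) else A e p * y u)" for u
    have split: "(\<Sum>u\<in>U. A e' u * x u) = (\<Sum>u\<in>V. (A e p * A e' u - A e' p * A e u) * y u)" for e'
    proof -
      have "(\<Sum>u\<in>V. A e' u * x u) = (\<Sum>u\<in>V. A e' u * (A e p * y u))"
        using V(2) by (intro sum.cong) (auto simp: x_def)
      then have "(\<Sum>u\<in>U. A e' u * x u) = - A e' p * (\<Sum>u\<in>V. A e u * y u) + (\<Sum>u\<in>V. A e' u * (A e p * y u))"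
        using V(1,2) unfolding V(3) by (simp add: x_def)
      also have "\<dots> = (\<Sum>u\<in>V. (A e p * A e' u - A e' p * A e u) * y u)"
        unfolding sum_distrib_left sum.distrib[symmetric]
        by (rule sum.cong) (auto simp: algebra_simps)
      finally show ?thesis .
    qed
    have "(\<Sum>u\<in>U. A e u * x u) = 0" unfolding split by (simp add: mult.commute)
    moreover obtain u where "u \<in> V" "y u \<noteq> 0" using y(1) by blast
    then have "u \<in> U" "x u \<noteq> 0" using V p by (auto simp: x_def)
    ultimately show ?thesis using split y(2) by (intro exI[of _ x]) auto
  qed
qed

context surf
begin

lemma edge_chain_chains1: "b \<in> link_verts T a \<Longrightarrow> edge_chain a b \<in> chains1 T"
proof -
  assume b: "b \<in> link_verts T a"
  then have "{a, b} \<in> edges T" "{b, a} \<in> edges T" "a \<noteq> b" using edges_iff link_sym edge_ne by blast+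
  then show ?thesis unfolding chains1_def edge_chain_def by auto
qed

lemma boundary1_edge_chain:
  assumes "b \<in> link_verts T a"
  shows "boundary1 T (edge_chain a b) x = (if x = b then 1 else 0) - (if x = a then 1 else 0)"
proof -
  have ne: "a \<noteq> b" using edge_ne assms by blast
  have v: "a \<in> verts T" "b \<in> verts T" using assms link_subset link_sym by blast+
  have "boundary1 T (edge_chain a b) x = (\<Sum>p\<in>verts T. (if p = a then if x = b then 1 else 0 else 0)
      - (if p = b then if x = a then 1 else 0 else 0))"
    unfolding boundary1_def by (rule sum.cong) (auto simp: edge_chain_def ne)
  also have "\<dots> = (if x = b then 1 else 0) - (if x = a then 1 else 0)"
    unfolding sum_subtractf using v finite_verts by simp
  finally show ?thesis .
qed

lemma flux_edge_chain:
  assumes z: "corner_potential T z G" "z \<in> cycles T" and t: "(a, b, c) \<in> T"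
  shows "flux T G (edge_chain a b) = 2 * (G b c a - G a b c)"
proof -
  obtain d where d: "(b, a, d) \<in> T" using opposite t by blast
  have ne: "a \<noteq> b" using tri_distinct t by blast
  have "flux T G (edge_chain a b) = (\<Sum>(p, q, r)\<in>{(a, b, c), (b, a, d)}. (G q r p - G p q r) * edge_chain a b p q)"
    unfolding flux_def
  proof (rule sum.mono_neutral_right[OF finite_T])
    show "{(a, b, c), (b, a, d)} \<subseteq> T" using t d by blast
    show "\<forall>i\<in>T - {(a, b, c), (b, a, d)}. (case i of (p, q, r) \<Rightarrow> (G q r p - G p q r) * edge_chain a b p q) = 0"
    proof
      fix i assume i: "i \<in> T - {(a, b, c), (b, a, d)}"
      obtain p q r where pqr: "i = (p, q, r)" by (rule prod_cases3)
      have "(p, q) \<noteq> (a, b)" "(p, q) \<noteq> (b, a)" using i pqr t d tri_unique by blast+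
      then have "edge_chain a b p q = 0" unfolding edge_chain_def by (simp only: if_False)
      then show "(case i of (p, q, r) \<Rightarrow> (G q r p - G p q r) * edge_chain a b p q) = 0"
        unfolding pqr by simp
    qed
  qed
  also have "\<dots> = (G b c a - G a b c) - (G a d b - G b a d)"
    using ne by (simp add: edge_chain_def)
  finally show ?thesis using potential_other_end[OF z t d] by simp
qed

text \<open>By antisymmetry the value is also minus the flux of a potential of \<open>f\<close>
  through \<open>z\<close>, in which the potential chosen for \<open>z\<close> no longer
  occurs.\<close>

lemma pairing_eq:
  assumes "corner_potential T z G" "z \<in> cycles T" "f \<in> cycles T"
  shows "pairing T z f = flux T G f"
proof -
  obtain K where K: "corner_potential T f K" using potential_exists assms(3) by blast
  have "corner_potential T z (SOME G. corner_potential T z G)" using assms(1) by (metis someI)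
  then have "pairing T z f = - flux T K z"
    unfolding pairing_def using flux_antisym K assms by blast
  also have "\<dots> = flux T G f" using flux_antisym[OF assms(1,2) K assms(3)] by simp
  finally show ?thesis .
qed

lemma pairing_antisym:
  assumes "z \<in> cycles T" "f \<in> cycles T" shows "pairing T z f = - pairing T f z"
proof -
  obtain G K where "corner_potential T z G" "corner_potential T f K"
    using potential_exists assms by metis
  then show ?thesis using flux_antisym pairing_eq assms by metis
qed

lemma pairing_add_right:
  "pairing T z (\<lambda>a b. f a b + g a b) = pairing T z f + pairing T z g"
  unfolding pairing_def by (rule flux_add_right)

lemma pairing_scale_right: "pairing T z (\<lambda>a b. k * f a b) = k * pairing T z f"
  unfolding pairing_def by (rule flux_scale_right)

lemma pairing_boundary_left:
  assumes "z \<in> boundaries T" "f \<in> cycles T" shows "pairing T z f = 0"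
proof -
  obtain g where g: "g \<in> chains2 T" "z = boundary2 T g" using assms unfolding boundaries_def by blast
  have "pairing T z f = flux T g f"
    using pairing_eq boundary2_potential[OF g(1)] boundary_cycle g assms(2) by blast
  then show ?thesis using flux_boundary_left[OF g(1)] by simp
qed

lemma pairing_boundary_right:
  assumes "f \<in> boundaries T" "z \<in> cycles T" shows "pairing T z f = 0"
proof -
  have "f \<in> cycles T" using assms(1) boundaries_cycles by blast
  then show ?thesis using pairing_boundary_left[OF assms] pairing_antisym[OF assms(2)] by simp
qed

text \<open>A potential all of whose corners agree on each triangle is a 2-chain bounded by the cycle.\<close>

lemma boundary_of_flat_potential:
  assumes z: "corner_potential T z G" "z \<in> cycles T"
    and flat: "\<And>a b c. (a, b, c) \<in> T \<Longrightarrow> G b c a = G a b c"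
  shows "z \<in> boundaries T"
proof -
  define g where "g a b c = (if (a, b, c) \<in> T then G a b c else if (b, a, c) \<in> T then - G b a c else 0)"
    for a b c
  have s1: "g b a c = - g a b c" for a b c using no_mirror by (auto simp: g_def)
  have r1: "g b c a = g a b c" for a b c
  proof -
    have "(a, b, c) \<in> T \<Longrightarrow> g b c a = g a b c" using flat rot by (simp add: g_def)
    moreover have "(b, a, c) \<in> T \<Longrightarrow> g b c a = g a b c"
    proof -
      assume t: "(b, a, c) \<in> T"
      then have t': "(c, b, a) \<in> T" using rot2 by blast
      have "G b a c = G c b a" using flat[OF t'] by simp
      then show ?thesis using t t' no_mirror by (simp add: g_def)
    qed
    moreover have "(a, b, c) \<notin> T \<Longrightarrow> (b, a, c) \<notin> T \<Longrightarrow> g b c a = g a b c"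
    proof -
      assume "(a, b, c) \<notin> T" "(b, a, c) \<notin> T"
      moreover from this have "(b, c, a) \<notin> T" "(c, b, a) \<notin> T" using rot rot2 by blast+
      ultimately show ?thesis by (simp add: g_def)
    qed
    ultimately show ?thesis by blast
  qed
  have s2: "g a c b = - g a b c" for a b c using s1[of a c b] r1 by simp
  have g: "g \<in> chains2 T"
    unfolding chains2_def
    by (intro CollectI conjI allI impI; (rule s1 s2)?) (simp add: g_def triangles_iff)
  have "z a b = boundary2 T g a b" for a b
  proof (cases "b \<in> link_verts T a")
    case True
    then obtain c where t: "(a, b, c) \<in> T" using link_iff by blast
    obtain d where d: "(b, a, d) \<in> T" using opposite t by blast
    have "z a b = G a b c - G a d b" using corner_potentialD[OF z(1)] t d rot by blast
    also have "\<dots> = G a b c - G b a d" using flat[OF d] by simp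
    also have "\<dots> = boundary2 T g a b" using boundary2_at[OF g t d] t d by (simp add: g_def)
    finally show ?thesis .
  next
    case False
    then have "{a, b} \<notin> edges T" using edges_iff by blast
    then show ?thesis using chains1_edge cycles_chains1[OF z(2)] boundary_chain[OF g] by metis
  qed
  then have "z = boundary2 T g" by blast
  then show ?thesis unfolding boundaries_def using g by blast
qed

end

locale csurf = surf +
  assumes connected: "connected_surface T"
begin

lemma connected_induct:
  assumes "a \<in> verts T" "P a" and step: "\<And>u v. v \<in> link_verts T u \<Longrightarrow> P u \<Longrightarrow> P v" and "b \<in> verts T"
  shows "P b"
proof -
  have "(a, b) \<in> {(u, v). {u, v} \<in> edges T}\<^sup>*"
    using connected assms unfolding connected_surface_def by blast
  then show ?thesis
    by (induction rule: rtrancl_induct) (use assms edges_iff in auto)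
qed

text \<open>If \<open>z\<close> pairs to zero with all cycles, the jumps of its potential can be
  integrated from a base vertex. Subtracting the resulting function of the vertices makes the three
  corners of every triangle agree, and such a potential is a 2-chain bounded by
  \<open>z\<close>.\<close>

lemma pairing_nondegenerate:
  assumes z: "z \<in> cycles T" and orth: "\<And>f. f \<in> cycles T \<Longrightarrow> pairing T z f = 0"
  shows "z \<in> boundaries T"
proof -
  obtain G where G: "corner_potential T z G" using potential_exists z by blast
  obtain v0 where v0: "v0 \<in> verts T" using T_ne tri_verts_mem by fastforce
  \<comment> \<open>\<open>P v j\<close> says that some chain with boundary \<open>v - v0\<close>
    has flux \<open>2 * j\<close>. With chains in place of edge paths, the difference of two
    candidates is a cycle at once, so orthogonality makes \<open>j\<close> unique.\<close>
  define P where "P v j \<longleftrightarrow> (\<exists>f\<in>chains1 T. (\<forall>x. boundary1 T f x = (if x = v then 1 else 0) - (if x = v0 then 1 else 0))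
     \<and> flux T G f = 2 * j)" for v and j :: int
  have step: "P b (j + (G b c a - G a b c))" if "(a, b, c) \<in> T" "P a j" for a b c j
  proof -
    obtain f where f: "f \<in> chains1 T" "\<forall>x. boundary1 T f x = (if x = a then 1 else 0) - (if x = v0 then 1 else 0)"
      "flux T G f = 2 * j" using \<open>P a j\<close> unfolding P_def by blast
    have b: "b \<in> link_verts T a" using that tri_link by blast
    let ?f = "\<lambda>p q. f p q + edge_chain a b p q"
    have "?f \<in> chains1 T" using chains1_add f(1) edge_chain_chains1[OF b] by blast
    moreover have "boundary1 T ?f x = (if x = b then 1 else 0) - (if x = v0 then 1 else 0)" for x
      unfolding boundary1_add boundary1_edge_chain[OF b] using f(2) by simp
    moreover have "flux T G ?f = 2 * (j + (G b c a - G a b c))"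
      unfolding flux_add_right flux_edge_chain[OF G z that(1)] using f(3) by simp
    ultimately show ?thesis unfolding P_def by blast
  qed
  have uniq: "j = j'" if Pj: "P v j" "P v j'" for v j j'
  proof -
    obtain f where f: "f \<in> chains1 T" "\<forall>x. boundary1 T f x = (if x = v then 1 else 0) - (if x = v0 then 1 else 0)"
      "flux T G f = 2 * j" using \<open>P v j\<close> unfolding P_def by blast
    obtain f' where f': "f' \<in> chains1 T" "\<forall>x. boundary1 T f' x = (if x = v then 1 else 0) - (if x = v0 then 1 else 0)"
      "flux T G f' = 2 * j'" using \<open>P v j'\<close> unfolding P_def by blast
    let ?f = "\<lambda>p q. f p q - f' p q"
    have "?f \<in> cycles T" unfolding cycles_def
      using chains1_diff[OF f(1) f'(1)] f(2) f'(2) by (auto simp: boundary1_diff)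
    then have "flux T G ?f = 0" using orth pairing_eq[OF G z] by metis
    then show ?thesis unfolding flux_diff_right using f(3) f'(3) by simp
  qed
  have ex: "\<exists>j. P v j" if "v \<in> verts T" for v
  proof (rule connected_induct[OF v0 _ _ that])
    have "(\<lambda>p q. 0) \<in> chains1 T" unfolding chains1_def by simp
    then show "\<exists>j. P v0 j" unfolding P_def
      by (intro exI[of _ 0] bexI[of _ "\<lambda>p q. 0"]) (auto simp: boundary1_def flux_def)
    show "\<exists>j. P v j" if "v \<in> link_verts T u" "\<exists>j. P u j" for u v
      using that step link_iff by metis
  qed
  define k where "k v = (THE j. P v j)" for v
  have k: "P v (k v)" if "v \<in> verts T" for v
    unfolding k_def using ex[OF that] uniq by (metis theI)
  show ?thesis
  proof (rule boundary_of_flat_potential[OF corner_potential_shift[OF G, of k] z])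
    fix a b c assume t: "(a, b, c) \<in> T"
    then have v: "a \<in> verts T" "b \<in> verts T" using tri_verts_mem by blast+
    have "k b = k a + (G b c a - G a b c)" using uniq step[OF t k[OF v(1)]] k[OF v(2)] by blast
    then show "G b c a - k b = G a b c - k a" by simp
  qed
qed

end

section \<open>Euler characteristic\<close>

lemma card_eq_fibres:
  assumes "finite A" "finite B" "f ` A \<subseteq> B" "\<And>y. y \<in> B \<Longrightarrow> card {x \<in> A. f x = y} = k"
  shows "card A = k * card B"
proof -
  have "card A = (\<Sum>x\<in>A. 1)" by simp
  also have "\<dots> = (\<Sum>y\<in>B. \<Sum>x\<in>{x \<in> A. f x = y}. 1)" using sum.group[OF assms(1-3), of "\<lambda>_. 1::nat"] by (rule sym)
  also have "\<dots> = (\<Sum>y\<in>B. k)" using assms(4) by (intro sum.cong) auto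
  also have "\<dots> = k * card B" by simp
  finally show ?thesis .
qed

lemma sum_pick:
  fixes k :: "'a \<Rightarrow> int"
  assumes "finite A" "b \<in> A" shows "(\<Sum>v\<in>A. of_bool (v = b) * k v) = k b"
proof -
  have "(\<Sum>v\<in>A. of_bool (v = b) * k v) = (\<Sum>v\<in>A. if v = b then k v else 0)" by (rule sum.cong) auto
  then show ?thesis using assms by simp
qed

context surf
begin

lemma finite_edges: "finite (edges T)"
proof -
  have "edges T = (\<lambda>(a, b, c). {a, b}) ` T" unfolding edges_def by force
  then show ?thesis using finite_T by simp
qed

lemma finite_triangles: "finite (triangles T)"
proof -
  have "triangles T = (\<lambda>(a, b, c). {a, b, c}) ` T" unfolding triangles_def by force
  then show ?thesis using finite_T by simp
qed

lemma card_edges: "card T = 2 * card (edges T)"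
proof (rule card_eq_fibres[OF finite_T finite_edges, of "\<lambda>(a, b, c). {a, b}"])
  show "(\<lambda>(a, b, c). {a, b}) ` T \<subseteq> edges T" unfolding edges_def by auto
  fix e assume "e \<in> edges T"
  then obtain a b c where e: "e = {a, b}" "(a, b, c) \<in> T" unfolding edges_def by auto
  obtain d where d: "(b, a, d) \<in> T" using opposite e by blast
  have "{x \<in> T. (case x of (a, b, c) \<Rightarrow> {a, b}) = e} = {(a, b, c), (b, a, d)}"
    using e d tri_unique by (auto simp: doubleton_eq_iff)
  then show "card {x \<in> T. (case x of (a, b, c) \<Rightarrow> {a, b}) = e} = 2"
    using tri_distinct[OF e(2)] by simp
qed

lemma same_triangle:
  assumes t: "(a, b, c) \<in> T" and t': "(p, q, r) \<in> T" and eq: "{p, q, r} = {a, b, c}"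
  shows "(p, q, r) = (a, b, c) \<or> (p, q, r) = (b, c, a) \<or> (p, q, r) = (c, a, b)"
proof -
  have "(b, a, c) \<notin> T" "(c, b, a) \<notin> T" "(a, c, b) \<notin> T"
    using no_mirror t rot[OF t] rot2[OF t] by blast+
  moreover have "p \<in> {a, b, c}" "q \<in> {a, b, c}" "r \<in> {a, b, c}" using eq by blast+
  ultimately show ?thesis using t' tri_distinct[OF t'] by (elim insertE emptyE) simp_all
qed

lemma card_triangles: "card T = 3 * card (triangles T)"
proof (rule card_eq_fibres[OF finite_T finite_triangles, of "\<lambda>(a, b, c). {a, b, c}"])
  show "(\<lambda>(a, b, c). {a, b, c}) ` T \<subseteq> triangles T" unfolding triangles_def by auto
  fix e assume "e \<in> triangles T"
  then obtain a b c where e: "e = {a, b, c}" "(a, b, c) \<in> T" unfolding triangles_def by auto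
  have ne: "a \<noteq> b" "b \<noteq> c" "a \<noteq> c" using tri_distinct[OF e(2)] by auto
  have "{x \<in> T. (case x of (a, b, c) \<Rightarrow> {a, b, c}) = e} = {(a, b, c), (b, c, a), (c, a, b)}"
  proof (intro equalityI subsetI)
    fix x assume "x \<in> {(a, b, c), (b, c, a), (c, a, b)}"
    moreover have "{b, c, a} = e" "{c, a, b} = e" using e by auto
    ultimately show "x \<in> {x \<in> T. (case x of (a, b, c) \<Rightarrow> {a, b, c}) = e}" using e rot[OF e(2)] rot2[OF e(2)] by auto
  next
    fix x assume x: "x \<in> {x \<in> T. (case x of (a, b, c) \<Rightarrow> {a, b, c}) = e}"
    obtain p q r where "x = (p, q, r)" by (rule prod_cases3)
    then show "x \<in> {(a, b, c), (b, c, a), (c, a, b)}" using same_triangle[OF e(2), of p q r] x e by auto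
  qed
  then show "card {x \<in> T. (case x of (a, b, c) \<Rightarrow> {a, b, c}) = e} = 3" using ne by simp
qed

lemma euler_char_eq: "6 * euler_char T = 6 * int (card (verts T)) - int (card T)"
  unfolding euler_char_def using card_edges card_triangles by simp

end

section \<open>Positive Euler characteristic forces all cycles to bound\<close>

context csurf
begin

text \<open>The relation found by counting is taken apart in stages. Its cycle part vanishes because
  it is a coboundary as well; then the vertex part is constant. Pairing removes the coefficients of
  \<open>z\<close> and \<open>f\<close>, and what is left is a 2-cycle, which is constant on a
  connected surface.\<close>

lemma cycles_bound_if_euler_char_pos:
  assumes euler: "euler_char T \<ge> 1"
  shows "cycles T \<subseteq> boundaries T"
proof (rule ccontr)
  assume "\<not> ?thesis"
  then obtain z where z: "z \<in> cycles T" "z \<notin> boundaries T" by blast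
  then obtain f where f: "f \<in> cycles T" "pairing T z f \<noteq> 0" using pairing_nondegenerate by blast
  obtain a0 b0 c0 where t0: "(a0, b0, c0) \<in> T" using T_ne by auto
  \<comment> \<open>Each edge is listed once, as an increasing pair, so that the equations are as
    many as the edges.\<close>
  define Eo where "Eo = {(a, b). a < b \<and> {a, b} \<in> edges T}"
  have "bij_betw (\<lambda>(a, b). {a, b}) Eo (edges T)"
  proof (rule bij_betw_imageI)
    show "inj_on (\<lambda>(a, b). {a, b}) Eo" by (rule inj_onI) (auto simp: Eo_def doubleton_eq_iff)
    show "(\<lambda>(a, b). {a, b}) ` Eo = edges T"
    proof
      show "edges T \<subseteq> (\<lambda>(a, b). {a, b}) ` Eo"
      proof
        fix e assume "e \<in> edges T"
        then obtain a b c where e: "e = {a, b}" "(a, b, c) \<in> T" unfolding edges_def by auto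
        then have "(min a b, max a b) \<in> Eo" "e = {min a b, max a b}"
          using tri_distinct[OF e(2)] \<open>e \<in> edges T\<close>
          by (auto simp: Eo_def min_def max_def insert_commute)
        then show "e \<in> (\<lambda>(a, b). {a, b}) ` Eo" by force
      qed
    qed (auto simp: Eo_def)
  qed
  then have Eo: "finite Eo" "card Eo = card (edges T)"
    using finite_edges bij_betw_finite bij_betw_same_card by blast+
  \<comment> \<open>The unknowns are coefficients of the vertices, of the triangles and of the two
    cycles. There is one equation per edge, and two more set the coefficients of \<open>a0\<close>
    and of one triangle to zero. These exclude the trivial relations: constant functions on vertices
    and multiples of the fundamental class. The \<open>+ 2\<close> on both sides balance, so Euler
    characteristic at least \<open>1\<close> makes the unknowns outnumber the equations.\<close>
  define U :: "(nat + (nat set + bool)) set" where "U = verts T <+> (triangles T <+> UNIV)"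
  define E :: "((nat \<times> nat) + bool) set" where "E = Eo <+> UNIV"
  define A where "A = (\<lambda>(e :: (nat \<times> nat) + bool) (u :: nat + (nat set + bool)).
    case e of Inl (a, b) \<Rightarrow> (case u of Inl v \<Rightarrow> of_bool (v = b) - of_bool (v = a)
        | Inr (Inl t) \<Rightarrow> of_bool (t = {a, b, nx a b}) - of_bool (t = {b, a, nx b a})
        | Inr (Inr q) \<Rightarrow> (if q then z a b else f a b))
      | Inr q \<Rightarrow> (of_bool (u = (if q then Inl a0 else Inr (Inl {a0, b0, c0}))) :: int))"
  have fin: "finite U" "finite E" using Eo finite_verts finite_triangles by (auto simp: U_def E_def)
  have "card U = card (verts T) + card (triangles T) + 2" "card E = card (edges T) + 2"
    using Eo finite_verts finite_triangles by (auto simp: U_def E_def card_Plus)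
  moreover have "int (card (verts T)) + int (card (triangles T)) > int (card (edges T))"
    using euler unfolding euler_char_def by simp
  ultimately have "card E < card U" by simp
  then obtain x where x: "\<exists>u\<in>U. x u \<noteq> 0" "\<And>e. e \<in> E \<Longrightarrow> (\<Sum>u\<in>U. A e u * x u) = 0"
    using integer_kernel_nontrivial[OF fin(2,1), of A] by blast
  define k where "k v = x (Inl v)" for v
  define g where "g t = x (Inr (Inl t))" for t
  define s where "s = x (Inr (Inr True))"
  define t where "t = x (Inr (Inr False))"
  have sumU: "(\<Sum>u\<in>U. h u) = (\<Sum>v\<in>verts T. h (Inl v)) + ((\<Sum>t\<in>triangles T. h (Inr (Inl t))) +
      (h (Inr (Inr True)) + h (Inr (Inr False))))" for h :: "_ \<Rightarrow> int"
    unfolding U_def using finite_verts finite_triangles by (simp add: sum.Plus UNIV_bool add.commute)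
  have inE: "Inr q \<in> E" for q unfolding E_def by (rule InrI) simp
  have "k a0 = 0"
  proof -
    have "(\<Sum>u\<in>U. A (Inr True) u * x u) = (\<Sum>v\<in>verts T. of_bool (v = a0) * k v)"
      unfolding sumU by (simp add: A_def k_def)
    then show ?thesis using sum_pick[OF finite_verts tri_verts_mem(1)[OF t0], of k] x(2)[OF inE[of True]]
      by simp
  qed
  have g0: "g {a0, b0, c0} = 0"
  proof -
    have m: "{a0, b0, c0} \<in> triangles T" using t0 triangles_iff by blast
    have "(\<Sum>u\<in>U. A (Inr False) u * x u) = (\<Sum>v\<in>triangles T. of_bool (v = {a0, b0, c0}) * g v)"
      unfolding sumU by (simp add: A_def g_def)
    then show ?thesis using sum_pick[OF finite_triangles m, of g] x(2)[OF inE[of False]]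
      by simp
  qed
  define gg where "gg a b c = (if (a, b, c) \<in> T then g {a, b, c} else if (b, a, c) \<in> T then - g {a, b, c} else 0)"
    for a b c
  have gg: "gg \<in> chains2 T"
    unfolding chains2_def
  proof (intro CollectI conjI allI impI)
    fix a b c :: nat
    have "{b, a, c} = {a, b, c}" by auto
    then show "gg b a c = - gg a b c" using no_mirror[of a b c] no_mirror[of b a c]
      by (simp add: gg_def)
    have "(a, c, b) \<in> T \<longleftrightarrow> (b, a, c) \<in> T" "(c, a, b) \<in> T \<longleftrightarrow> (a, b, c) \<in> T" using rot rot2 by blast+
    moreover have "{a, c, b} = {a, b, c}" by auto
    ultimately show "gg a c b = - gg a b c" using no_mirror[of a b c] by (auto simp: gg_def)
    show "{a, b, c} \<notin> triangles T \<Longrightarrow> gg a b c = 0" using triangles_iff by (simp add: gg_def)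
  qed
  define B where "B = boundary2 T gg"
  have B: "B \<in> boundaries T" "B \<in> cycles T"
    using gg boundary_cycle unfolding B_def boundaries_def by auto
  have eq0: "k b - k a + (B a b + (s * z a b + t * f a b)) = 0" if "a < b" "b \<in> link_verts T a" for a b
  proof -
    have 1: "(a, b, nx a b) \<in> T" "(b, a, nx b a) \<in> T" using that link_iff link_sym by blast+
    have m: "{a, b, nx a b} \<in> triangles T" "{b, a, nx b a} \<in> triangles T" using 1 triangles_iff by blast+
    have v: "a \<in> verts T" "b \<in> verts T" using 1 tri_verts_mem by blast+
    have "Inl (a, b) \<in> E" using that edges_iff by (auto simp: E_def Eo_def)
    then have "0 = (\<Sum>u\<in>U. A (Inl (a, b)) u * x u)" using x(2) by simp
    also have "\<dots> = (\<Sum>v\<in>verts T. of_bool (v = b) * k v) - (\<Sum>v\<in>verts T. of_bool (v = a) * k v) +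
      (((\<Sum>v\<in>triangles T. of_bool (v = {a, b, nx a b}) * g v) - (\<Sum>v\<in>triangles T. of_bool (v = {b, a, nx b a}) * g v))
        + (s * z a b + t * f a b))"
      unfolding sumU by (simp add: A_def k_def g_def s_def t_def left_diff_distrib sum_subtractf)
    also have "\<dots> = k b - k a + ((g {a, b, nx a b} - g {b, a, nx b a}) + (s * z a b + t * f a b))"
      unfolding sum_pick[OF finite_verts v(1)] sum_pick[OF finite_verts v(2)]
        sum_pick[OF finite_triangles m(1)] sum_pick[OF finite_triangles m(2)] ..
    finally show ?thesis using boundary2_at[OF gg 1] 1 by (simp add: B_def gg_def)
  qed
  have eq: "k b - k a = - (B a b + (s * z a b + t * f a b))" if "b \<in> link_verts T a" for a b
  proof (cases "a < b")
    case False
    then have "b < a" using that edge_ne by fastforce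
    then have "k a - k b + (B b a + (s * z b a + t * f b a)) = 0" using eq0 that link_sym by blast
    then show ?thesis using cycles_antisym[OF B(2), of b a] cycles_antisym[OF z(1), of b a]
        cycles_antisym[OF f(1), of b a] by simp
  qed (use eq0[OF _ that] in simp)
  define Z where "Z a b = B a b + (s * z a b + t * f a b)" for a b
  have Z: "Z \<in> cycles T"
    using cycles_add[OF B(2) cycles_add[OF cycles_scale[OF z(1)] cycles_scale[OF f(1)]]]
    unfolding Z_def by simp
  \<comment> \<open>\<open>Z\<close> is a cycle and minus the coboundary of \<open>k\<close>.
    Summation by parts turns its sum of squares into a multiple of the sum of \<open>k\<close>
    against the boundary of \<open>Z\<close>, which is zero.\<close>
  have Z0: "Z a b = 0" if "b \<in> link_verts T a" for a b
  proof -
    have "(\<Sum>(a, b, c)\<in>T. Z a b * Z a b) = (\<Sum>(a, b, c)\<in>T. - (k b - k a) * Z a b)"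
    proof (rule sum.cong, simp, clarify)
      fix a b c assume "(a, b, c) \<in> T"
      then have "Z a b = - (k b - k a)" using eq[of b a] tri_link(1) unfolding Z_def by simp
      then show "Z a b * Z a b = - (k b - k a) * Z a b" by simp
    qed
    also have "\<dots> = (\<Sum>(a, b, c)\<in>T. k a * Z a b) + (\<Sum>(a, b, c)\<in>T. k b * Z b a)"
      unfolding sum.distrib[symmetric]
    proof (rule sum.cong, simp, clarify)
      fix a b c
      show "- (k b - k a) * Z a b = k a * Z a b + k b * Z b a"
        using cycles_antisym[OF Z, of b a] by (simp add: algebra_simps)
    qed
    also have "\<dots> = 2 * (\<Sum>(a, b, c)\<in>T. k a * Z a b)"
      using flip_sum[of "\<lambda>a b c. k a * Z a b"] by simp
    also have "(\<Sum>(a, b, c)\<in>T. k a * Z a b) = (\<Sum>a\<in>verts T. \<Sum>b\<in>link_verts T a. k a * Z a b)"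
    proof -
      have "(\<Sum>a\<in>verts T. \<Sum>b\<in>link_verts T a. k a * Z a b) = (\<Sum>(a, b)\<in>Sigma (verts T) (link_verts T). k a * Z a b)"
        by (rule sum.Sigma) (use finite_verts finite_link in auto)
      also have "\<dots> = (\<Sum>(a, b, c)\<in>T. k a * Z a b)"
        by (rule sum.reindex_bij_witness[where i = "\<lambda>(a, b, c). (a, b)" and j = "\<lambda>(a, b). (a, b, nx a b)"])
          (use link_iff tri_link tri_verts_mem nx_eq in auto)
      finally show ?thesis by simp
    qed
    also have "\<dots> = 0"
    proof (rule sum.neutral, rule ballI)
      fix a
      have "(\<Sum>b\<in>link_verts T a. k a * Z a b) = k a * (\<Sum>b\<in>link_verts T a. - Z b a)"
        unfolding sum_distrib_left
        by (rule sum.cong[OF refl]) (use cycles_antisym[OF Z] in metis)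
      also have "\<dots> = 0" using boundary1_link[OF cycles_chains1[OF Z], of a] Z
        unfolding cycles_def by (simp add: sum_negf)
      finally show "(\<Sum>b\<in>link_verts T a. k a * Z a b) = 0" .
    qed
    finally have "(\<Sum>(a, b, c)\<in>T. Z a b * Z a b) = 0" by simp
    then have "\<forall>x\<in>T. (case x of (a, b, c) \<Rightarrow> Z a b * Z a b) = 0"
      by (subst (asm) sum_nonneg_eq_0_iff) (auto simp: finite_T)
    then show ?thesis using that link_iff[of b a] by (auto dest: bspec)
  qed
  have k0: "k v = 0" if "v \<in> verts T" for v
  proof (rule connected_induct[OF tri_verts_mem(1)[OF t0] _ _ that])
    show "k v = 0" if "v \<in> link_verts T u" "k u = 0" for u v
      using eq[OF that(1)] Z0[OF that(1)] that(2) unfolding Z_def by simp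
  qed (rule \<open>k a0 = 0\<close>)
  have "Z = (\<lambda>a b. 0 * z a b)"
    using Z0 chains1_edge[OF cycles_chains1[OF Z]] edges_iff by (intro ext) (metis mult_zero_left)
  then have pZ: "pairing T y Z = 0" for y using pairing_scale_right[of y 0 z] by simp
  have expand: "pairing T y Z = pairing T y B + (s * pairing T y z + t * pairing T y f)" for y
    unfolding Z_def pairing_add_right pairing_scale_right ..
  \<comment> \<open>Pairing the relation with \<open>z\<close> isolates \<open>t\<close>, and
    pairing it with \<open>f\<close> then isolates \<open>s\<close>: boundaries pair to zero with
    cycles, and \<open>z\<close> pairs to zero with itself.\<close>
  have zz: "pairing T z z = 0" using pairing_antisym[OF z(1) z(1)] by simp
  have "t = 0"
    using expand[of z] pZ[of z] pairing_boundary_right[OF B(1) z(1)] zz f(2) by simp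
  moreover have "s = 0"
    using expand[of f] pZ[of f] pairing_boundary_right[OF B(1) f(1)] f(2) pairing_antisym[OF z(1) f(1)] \<open>t = 0\<close>
    by simp
  ultimately have ggB: "B a b = 0" if "b \<in> link_verts T a" for a b using Z0[OF that] unfolding Z_def by simp
  \<comment> \<open>The boundary of \<open>gg\<close> is zero by now, so its coefficients agree
    across every edge. Connectedness spreads the zero value from the normalised triangle.\<close>
  have gstep: "g {a, b, c} = g {b, a, d}" if "(a, b, c) \<in> T" "(b, a, d) \<in> T" for a b c d
    using ggB[OF tri_link(1)[OF that(1)]] boundary2_at[OF gg that] that by (simp add: B_def gg_def)
  have around: "g {x, c, nx x c} = g {x, b, nx x b}"
    if b: "b \<in> link_verts T x" and c: "c \<in> link_verts T x" for x b c
  proof -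
    obtain j where j: "c = (nx x ^^ j) b" using nx_pow_ex b c by blast
    have "g {x, (nx x ^^ j) b, (nx x ^^ Suc j) b} = g {x, b, nx x b}" for j
    proof (induction j)
      case (Suc j)
      let ?p = "(nx x ^^ j) b" and ?q = "(nx x ^^ Suc j) b" and ?r = "(nx x ^^ Suc (Suc j)) b"
      have 1: "(x, ?p, ?q) \<in> T" "(x, ?q, ?r) \<in> T" using nx_pow_tri[OF b] by blast+
      then have "g {x, ?q, ?r} = g {?q, x, ?p}" using gstep rot2 by blast
      moreover have "{?q, x, ?p} = {x, ?p, ?q}" by auto
      ultimately show ?case using Suc by simp
    qed simp
    from this[of j] show ?thesis using j by simp
  qed
  have gall: "\<forall>b\<in>link_verts T x. g {x, b, nx x b} = 0" if "x \<in> verts T" for x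
  proof (rule connected_induct[OF tri_verts_mem(1)[OF t0] _ _ that])
    show "\<forall>b\<in>link_verts T a0. g {a0, b, nx a0 b} = 0"
      using around tri_link[OF t0] g0 nx_eq[OF t0] by metis
    fix u v assume v: "v \<in> link_verts T u" and IH: "\<forall>b\<in>link_verts T u. g {u, b, nx u b} = 0"
    have "(u, v, nx u v) \<in> T" "(v, u, nx v u) \<in> T" using v link_iff link_sym by blast+
    then have "g {v, u, nx v u} = 0" using gstep IH v by metis
    then show "\<forall>b\<in>link_verts T v. g {v, b, nx v b} = 0" using around link_sym[OF v] by metis
  qed
  have gz: "g \<tau> = 0" if "\<tau> \<in> triangles T" for \<tau>
  proof -
    obtain a b c where "\<tau> = {a, b, c}" "(a, b, c) \<in> T" using \<open>\<tau> \<in> triangles T\<close> unfolding triangles_def by blast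
    then show ?thesis using gall tri_verts_mem tri_link nx_eq by metis
  qed
  have "x u = 0" if "u \<in> U" for u
    using that k0 gz \<open>s = 0\<close> \<open>t = 0\<close> unfolding U_def k_def g_def s_def t_def
    by (auto simp: UNIV_bool Plus_def)
  then show False using x(1) by blast
qed

end

section \<open>First homology and normal curves\<close>

lemma boundary2_add:
  "boundary2 T (\<lambda>a b c. g a b c + g' a b c) = (\<lambda>a b. boundary2 T g a b + boundary2 T g' a b)"
  unfolding boundary2_def by (simp add: sum.distrib)

lemma boundary2_neg: "boundary2 T (\<lambda>a b c. - g a b c) = (\<lambda>a b. - boundary2 T g a b)"
  unfolding boundary2_def by (simp add: sum_negf)

lemma chains2_zero: "g \<in> chains2 T \<Longrightarrow> {a, b, c} \<notin> triangles T \<Longrightarrow> g a b c = 0"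
  unfolding chains2_def by blast

lemma boundaries_zero: "(\<lambda>a b. 0) \<in> boundaries T"
proof -
  have 1: "(\<lambda>a b c. 0) \<in> chains2 T" unfolding chains2_def by simp
  have 2: "(\<lambda>a b. 0) = boundary2 T (\<lambda>a b c. 0)" unfolding boundary2_def by simp
  show ?thesis unfolding boundaries_def by (rule image_eqI[where f = "boundary2 T", OF 2 1])
qed

lemma boundaries_add:
  assumes "f \<in> boundaries T" "f' \<in> boundaries T" shows "(\<lambda>a b. f a b + f' a b) \<in> boundaries T"
proof -
  obtain g g' where g: "g \<in> chains2 T" "g' \<in> chains2 T" "f = boundary2 T g" "f' = boundary2 T g'"
    using assms unfolding boundaries_def by blast
  have "(\<lambda>a b c. g a b c + g' a b c) \<in> chains2 T"
    unfolding chains2_def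
  proof (intro CollectI conjI allI impI)
    fix a b c
    show "g b a c + g' b a c = - (g a b c + g' a b c)" using chains2_swap(1)[OF g(1), of b a c] chains2_swap(1)[OF g(2), of b a c] by simp
    show "g a c b + g' a c b = - (g a b c + g' a b c)" using chains2_swap(2)[OF g(1), of a c b] chains2_swap(2)[OF g(2), of a c b] by simp
    show "{a, b, c} \<notin> triangles T \<Longrightarrow> g a b c + g' a b c = 0" using chains2_zero[OF g(1)] chains2_zero[OF g(2)] by simp
  qed
  then show ?thesis unfolding boundaries_def g boundary2_add[symmetric] by blast
qed

lemma boundaries_neg:
  assumes "f \<in> boundaries T" shows "(\<lambda>a b. - f a b) \<in> boundaries T"
proof -
  obtain g where g: "g \<in> chains2 T" "f = boundary2 T g"
    using assms unfolding boundaries_def by blast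
  have "(\<lambda>a b c. - g a b c) \<in> chains2 T"
    unfolding chains2_def
  proof (intro CollectI conjI allI impI)
    fix a b c
    show "- g b a c = - (- g a b c)" using chains2_swap(1)[OF g(1), of b a c] by simp
    show "- g a c b = - (- g a b c)" using chains2_swap(2)[OF g(1), of a c b] by simp
    show "{a, b, c} \<notin> triangles T \<Longrightarrow> - g a b c = 0" using chains2_zero[OF g(1)] by simp
  qed
  then show ?thesis unfolding boundaries_def g boundary2_neg[symmetric] by blast
qed

lemma cycles_zero: "(\<lambda>a b. 0) \<in> cycles T"
  by (rule cyclesI) (auto simp: boundary1_def)

lemma cycle_group_simps:
  "carrier (cycle_group T) = cycles T"
  "f \<otimes>\<^bsub>cycle_group T\<^esub> g = (\<lambda>a b. f a b + g a b)"
  "\<one>\<^bsub>cycle_group T\<^esub> = (\<lambda>a b. 0)"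
  unfolding cycle_group_def cycles_def by simp_all

lemma cycle_group_comm: "comm_group (cycle_group T)"
proof (rule comm_groupI; (unfold cycle_group_simps)?)
  fix f assume f: "f \<in> cycles T"
  show "\<exists>g\<in>cycles T. (\<lambda>a b. g a b + f a b) = (\<lambda>a b. 0)"
    using cycles_scale[OF f, of "- 1"] by (intro bexI[of _ "\<lambda>a b. - 1 * f a b"]) auto
qed (auto simp: cycles_add cycles_zero ac_simps)

lemma chain_class_iff: "h \<in> chain_class T f \<longleftrightarrow> (\<exists>g\<in>boundaries T. h = (\<lambda>a b. g a b + f a b))"
  unfolding chain_class_def r_coset_def cycle_group_simps by blast

lemma chain_class_self: "f \<in> chain_class T f"
  unfolding chain_class_iff using boundaries_zero by (intro bexI[of _ "\<lambda>a b. 0"]) auto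

lemma chain_class_eqI:
  assumes g: "g \<in> boundaries T" and f: "f = (\<lambda>a b. g a b + f' a b)"
  shows "chain_class T f = chain_class T f'"
proof (intro equalityI subsetI)
  fix h assume "h \<in> chain_class T f"
  then obtain g' where g': "g' \<in> boundaries T" "h = (\<lambda>a b. g' a b + f a b)" unfolding chain_class_iff by blast
  then have "h = (\<lambda>a b. (g' a b + g a b) + f' a b)" using f by (simp add: add.assoc)
  then show "h \<in> chain_class T f'" unfolding chain_class_iff by (rule bexI[OF _ boundaries_add[OF g'(1) g]])
next
  fix h assume "h \<in> chain_class T f'"
  then obtain g' where g': "g' \<in> boundaries T" "h = (\<lambda>a b. g' a b + f' a b)"
    unfolding chain_class_iff by (rule bexE)
  then have "h = (\<lambda>a b. (g' a b + - g a b) + f a b)" using f by simp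
  then show "h \<in> chain_class T f" unfolding chain_class_iff by (rule bexI[OF _ boundaries_add[OF g'(1) boundaries_neg[OF g]]])
qed

context surf
begin

lemma boundaries_subgroup: "subgroup (boundaries T) (cycle_group T)"
proof -
  interpret comm_group "cycle_group T" by (rule cycle_group_comm)
  show ?thesis
  proof (rule subgroupI; (unfold cycle_group_simps)?)
    fix f assume f: "f \<in> boundaries T"
    then have "inv\<^bsub>cycle_group T\<^esub> f = (\<lambda>a b. - f a b)"
      using boundaries_cycles boundaries_neg[OF f]
      by (intro inv_equality) (auto simp: cycle_group_simps)
    then show "inv\<^bsub>cycle_group T\<^esub> f \<in> boundaries T" using boundaries_neg[OF f] by simp
  next
    show "boundaries T \<noteq> {}" using boundaries_zero by blast
  qed (use boundaries_cycles boundaries_add in auto)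
qed

lemma H1_trivial_iff: "trivial_group (H1 T) \<longleftrightarrow> cycles T \<subseteq> boundaries T"
proof -
  interpret G: comm_group "cycle_group T" by (rule cycle_group_comm)
  have "boundaries T \<lhd> cycle_group T" by (rule G.subgroup_imp_normal[OF boundaries_subgroup])
  then interpret N: normal "boundaries T" "cycle_group T" .
  have car: "carrier (H1 T) = (\<lambda>f. chain_class T f) ` cycles T" and one: "\<one>\<^bsub>H1 T\<^esub> = boundaries T"
    unfolding H1_def FactGroup_def RCOSETS_def chain_class_def by (auto simp: cycle_group_simps)
  have grp: "group (H1 T)" unfolding H1_def by (rule N.factorgroup_is_group)
  show ?thesis
  proof
    assume "trivial_group (H1 T)"
    then have c: "carrier (H1 T) = {boundaries T}" unfolding trivial_group_def one by simp
    show "cycles T \<subseteq> boundaries T"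
    proof
      fix f assume "f \<in> cycles T"
      then have "chain_class T f \<in> carrier (H1 T)" unfolding car by blast
      then have "chain_class T f = boundaries T" using c by simp
      then show "f \<in> boundaries T" using chain_class_self by blast
    qed
  next
    assume *: "cycles T \<subseteq> boundaries T"
    have "chain_class T f = boundaries T" if "f \<in> cycles T" for f
      unfolding chain_class_def using * that boundaries_subgroup N.rcos_const by blast
    moreover have "cycles T \<noteq> {}" using cycles_zero by blast
    ultimately have "carrier (H1 T) = {boundaries T}" unfolding car by auto
    then show "trivial_group (H1 T)" using grp unfolding trivial_group_def one by simp
  qed
qed

end

section \<open>Darts and strands of normal curves\<close>

lemma length_darts [simp]: "length (darts c) = length c"
  unfolding darts_def by simp

lemma darts_nth: "i < length c \<Longrightarrow> darts c ! i = (c ! i, c ! (Suc i mod length c))"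
  unfolding darts_def by (simp add: nth_rotate1)

lemma map_fst_darts: "map fst (darts c) = c"
  unfolding darts_def by simp

lemma set_curve_darts: "set (curve_darts \<gamma>) = (\<Union>c\<in>set \<gamma>. set (darts c))"
  unfolding curve_darts_def by simp

lemma curve_darts_append: "curve_darts (\<gamma> @ \<gamma>') = curve_darts \<gamma> @ curve_darts \<gamma>'"
  unfolding curve_darts_def by simp

lemma strands_append: "strands (\<gamma> @ \<gamma>') = strands \<gamma> \<union> strands \<gamma>'"
  unfolding strands_def by auto

text \<open>Distinct darts separate positions and components alike, as a component is the list of
  the first entries of its darts.\<close>

lemma curve_darts_inj:
  assumes d: "distinct (curve_darts \<gamma>)" and c: "c \<in> set \<gamma>" "c' \<in> set \<gamma>"
    and i: "i < length c" "j < length c'" and eq: "darts c ! i = darts c' ! j"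
  shows "c = c' \<and> i = j"
proof -
  have "darts c = darts c'"
  proof (rule ccontr)
    assume "darts c \<noteq> darts c'"
    then have "set (darts c) \<inter> set (darts c') = {}"
      using d c unfolding curve_darts_def distinct_concat_iff by auto
    then show False using i eq nth_mem[of i "darts c"] nth_mem[of j "darts c'"] by auto
  qed
  then have "c = c'" using map_fst_darts by metis
  moreover have "distinct (darts c)" using d c unfolding curve_darts_def distinct_concat_iff by auto
  ultimately show ?thesis using i eq nth_eq_iff_index_eq[of "darts c" i j] by auto
qed

lemma pred_index: "i < n \<Longrightarrow> (i + n - 1) mod n < n \<and> Suc ((i + n - 1) mod n) mod n = i" for i n :: nat
proof -
  assume "i < n"
  then have "Suc (i + n - 1) = i + n" by simp
  then have "Suc ((i + n - 1) mod n) mod n = (i + n) mod n" by (metis mod_Suc_eq)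
  then show ?thesis using \<open>i < n\<close> by simp
qed

lemma dart_of_index: "i < length c \<Longrightarrow> c \<in> set \<gamma> \<Longrightarrow> darts c ! i \<in> set (curve_darts \<gamma>)"
proof -
  assume "i < length c" "c \<in> set \<gamma>"
  then have "darts c ! i \<in> set (darts c)" by simp
  then show ?thesis unfolding set_curve_darts using \<open>c \<in> set \<gamma>\<close> by blast
qed

lemma normal_crossing:
  assumes "normal_curve T \<gamma>" "s \<in> strands \<gamma>" "s' \<in> strands \<gamma>" "s \<noteq> s'" "mid s = mid s'"
  shows "positive_wrt T s s' \<or> positive_wrt T s' s"
proof -
  have "\<forall>s\<in>strands \<gamma>. \<forall>s'\<in>strands \<gamma>. s \<noteq> s' \<and> mid s = mid s' \<longrightarrow>
    positive_wrt T s s' \<or> positive_wrt T s' s"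
    using assms(1) unfolding normal_curve_def by (elim conjE)
  then show ?thesis using assms(2-5) by simp
qed

lemma strandE:
  assumes "s \<in> strands \<gamma>"
  obtains c i where "c \<in> set \<gamma>" "i < length c" "s = strand_at c i"
  using assms unfolding strands_def by blast

lemma strand_in:
  assumes "(p, x, q) \<in> strands \<gamma>"
  shows "(p, x) \<in> set (curve_darts \<gamma>)" "(x, q) \<in> set (curve_darts \<gamma>)"
proof -
  obtain c i where c: "c \<in> set \<gamma>" "i < length c" "(p, x, q) = strand_at c i"
    by (rule strandE[OF assms])
  let ?j = "(i + length c - 1) mod length c"
  have "darts c ! i = (x, q)" using c by (simp add: darts_nth strand_at_def)
  then show "(x, q) \<in> set (curve_darts \<gamma>)" using dart_of_index[OF c(2,1)] by simp
  have j: "?j < length c" "Suc ?j mod length c = i" using pred_index[OF c(2)] by auto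
  then have "darts c ! ?j = (p, x)" using c(3) by (simp add: darts_nth strand_at_def)
  then show "(p, x) \<in> set (curve_darts \<gamma>)" using dart_of_index[OF j(1) c(1)] by simp
qed

lemma dart_out_strand:
  assumes "(x, q) \<in> set (curve_darts \<gamma>)" obtains p where "(p, x, q) \<in> strands \<gamma>"
proof -
  obtain c where c: "c \<in> set \<gamma>" "(x, q) \<in> set (darts c)" using assms unfolding set_curve_darts by blast
  then obtain i where "i < length c" "darts c ! i = (x, q)" by (metis in_set_conv_nth length_darts)
  then have "strand_at c i = (c ! ((i + length c - 1) mod length c), x, q)"
    by (simp add: darts_nth strand_at_def)
  then show thesis using that c(1) \<open>i < length c\<close> unfolding strands_def by force
qed

lemma dart_in_strand:
  assumes "(p, x) \<in> set (curve_darts \<gamma>)" obtains q where "(p, x, q) \<in> strands \<gamma>"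
proof -
  obtain c where c: "c \<in> set \<gamma>" "(p, x) \<in> set (darts c)" using assms unfolding set_curve_darts by blast
  then obtain i where i: "i < length c" "darts c ! i = (p, x)" by (metis in_set_conv_nth length_darts)
  let ?j = "Suc i mod length c"
  have j: "?j < length c" using i by (intro mod_less_divisor) auto
  have "(?j + length c - 1) mod length c = i"
  proof (cases "Suc i = length c")
    case False
    then have "Suc i < length c" using i by simp
    then show ?thesis using i by simp
  qed (use i in simp)
  then have "strand_at c ?j = (p, x, c ! (Suc ?j mod length c))"
    using i by (simp add: darts_nth strand_at_def)
  then show thesis using that c(1) j unfolding strands_def by force
qed

lemma strand_unique_out:
  assumes "distinct (curve_darts \<gamma>)" "(p, x, q) \<in> strands \<gamma>" "(p', x, q) \<in> strands \<gamma>"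
  shows "p = p'"
proof -
  obtain c i where c: "c \<in> set \<gamma>" "i < length c" "(p, x, q) = strand_at c i"
    by (rule strandE[OF assms(2)])
  obtain c' i' where c': "c' \<in> set \<gamma>" "i' < length c'" "(p', x, q) = strand_at c' i'"
    by (rule strandE[OF assms(3)])
  have "darts c ! i = darts c' ! i'" using c c' by (simp add: darts_nth strand_at_def)
  then have "c = c' \<and> i = i'" using curve_darts_inj[OF assms(1)] c c' by blast
  then show ?thesis using c c' by (metis prod.inject)
qed

lemma strand_unique_in:
  assumes "distinct (curve_darts \<gamma>)" "(p, x, q) \<in> strands \<gamma>" "(p, x, q') \<in> strands \<gamma>"
  shows "q = q'"
proof -
  obtain c i where c: "c \<in> set \<gamma>" "i < length c" "(p, x, q) = strand_at c i"
    by (rule strandE[OF assms(2)])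
  obtain c' i' where c': "c' \<in> set \<gamma>" "i' < length c'" "(p, x, q') = strand_at c' i'"
    by (rule strandE[OF assms(3)])
  let ?j = "(i + length c - 1) mod length c" and ?j' = "(i' + length c' - 1) mod length c'"
  have j: "?j < length c" "Suc ?j mod length c = i" "?j' < length c'" "Suc ?j' mod length c' = i'"
    using pred_index[OF c(2)] pred_index[OF c'(2)] by auto
  then have "darts c ! ?j = darts c' ! ?j'" using c c' by (simp add: darts_nth strand_at_def)
  then have "c = c' \<and> ?j = ?j'" using curve_darts_inj[OF assms(1) c(1) c'(1) j(1,3)] by blast
  then have "c = c' \<and> i = i'" using j by metis
  then show ?thesis using c c' by (metis prod.inject)
qed

lemma finite_strands: "finite (strands \<gamma>)"
proof -
  have "strands \<gamma> = (\<Union>c\<in>set \<gamma>. strand_at c ` {..<length c})" unfolding strands_def by blast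
  then show ?thesis by simp
qed

lemma curve_chain_eq:
  assumes "distinct (curve_darts \<gamma>)"
  shows "curve_chain \<gamma> a b = of_bool ((a, b) \<in> set (curve_darts \<gamma>)) - of_bool ((b, a) \<in> set (curve_darts \<gamma>))"
proof -
  have "count_list xs x = of_bool (x \<in> set xs)" if "distinct xs" for xs :: "(nat \<times> nat) list" and x
    using that by (induction xs) auto
  then show ?thesis unfolding curve_chain_def using assms by simp
qed

context surf
begin

lemma normal_darts:
  assumes "normal_curve T \<gamma>"
  shows "distinct (curve_darts \<gamma>)"
    and "(a, b) \<in> set (curve_darts \<gamma>) \<Longrightarrow> b \<in> link_verts T a"
    and "(a, b) \<in> set (curve_darts \<gamma>) \<Longrightarrow> (b, a) \<notin> set (curve_darts \<gamma>)"
proof -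
  have inj: "distinct (map (\<lambda>(a, b). {a, b}) (curve_darts \<gamma>))" using assms unfolding normal_curve_def by blast
  then show "distinct (curve_darts \<gamma>)" by (simp add: distinct_map)
  show l: "b \<in> link_verts T a" if "(a, b) \<in> set (curve_darts \<gamma>)" for a b
    using assms that edges_iff unfolding normal_curve_def by blast
  show "(b, a) \<notin> set (curve_darts \<gamma>)" if ab: "(a, b) \<in> set (curve_darts \<gamma>)"
  proof
    assume "(b, a) \<in> set (curve_darts \<gamma>)"
    moreover have "inj_on (\<lambda>(a, b). {a, b}) (set (curve_darts \<gamma>))" using inj by (simp add: distinct_map)
    moreover have "(case (a, b) of (a, b) \<Rightarrow> {a, b}) = (case (b, a) of (a, b) \<Rightarrow> {a, b})" by auto
    ultimately have "(a, b) = (b, a)" using ab by (meson inj_onD)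
    then show False using edge_ne[OF l[OF ab]] by simp
  qed
qed

lemma strand_link:
  assumes "normal_curve T \<gamma>" "(p, x, q) \<in> strands \<gamma>"
  shows "p \<in> link_verts T x" "q \<in> link_verts T x" "p \<noteq> q"
proof -
  note d = strand_in[OF assms(2)]
  show "p \<in> link_verts T x" "q \<in> link_verts T x" using normal_darts(2)[OF assms(1)] d link_sym by blast+
  show "p \<noteq> q" using normal_darts(3)[OF assms(1) d(1)] d(2) by blast
qed

text \<open>Every dart is the exit of exactly one strand and the entry of exactly one. Reading the
  same sum in both ways regroups it by passages through vertices.\<close>

lemma finite_dart_sum:
  assumes n: "normal_curve T \<gamma>"
  shows "(\<Sum>(a, b)\<in>set (curve_darts \<gamma>). h a b) = (\<Sum>(p, x, q)\<in>strands \<gamma>. h x q)"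
    and "(\<Sum>(a, b)\<in>set (curve_darts \<gamma>). h a b) = (\<Sum>(p, x, q)\<in>strands \<gamma>. h p x)"
proof -
  note d = normal_darts(1)[OF n]
  have "bij_betw (\<lambda>(p, x, q). (x, q)) (strands \<gamma>) (set (curve_darts \<gamma>))"
  proof (rule bij_betw_imageI)
    show "inj_on (\<lambda>(p, x, q). (x, q)) (strands \<gamma>)" using strand_unique_out[OF d] by (auto intro!: inj_onI)
    show "(\<lambda>(p, x, q). (x, q)) ` strands \<gamma> = set (curve_darts \<gamma>)"
    proof (intro equalityI subsetI)
      fix e assume e: "e \<in> set (curve_darts \<gamma>)"
      obtain a b where ab: "e = (a, b)" by fastforce
      then obtain p where "(p, a, b) \<in> strands \<gamma>" using dart_out_strand e by blast
      then show "e \<in> (\<lambda>(p, x, q). (x, q)) ` strands \<gamma>" using ab by force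
    qed (use strand_in in auto)
  qed
  from sum.reindex_bij_betw[OF this, of "\<lambda>(a, b). h a b"]
  show "(\<Sum>(a, b)\<in>set (curve_darts \<gamma>). h a b) = (\<Sum>(p, x, q)\<in>strands \<gamma>. h x q)"
    by (simp add: case_prod_beta)
  have "bij_betw (\<lambda>(p, x, q). (p, x)) (strands \<gamma>) (set (curve_darts \<gamma>))"
  proof (rule bij_betw_imageI)
    show "inj_on (\<lambda>(p, x, q). (p, x)) (strands \<gamma>)" using strand_unique_in[OF d] by (auto intro!: inj_onI)
    show "(\<lambda>(p, x, q). (p, x)) ` strands \<gamma> = set (curve_darts \<gamma>)"
    proof (intro equalityI subsetI)
      fix e assume e: "e \<in> set (curve_darts \<gamma>)"
      obtain a b where ab: "e = (a, b)" by fastforce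
      then obtain q where "(a, b, q) \<in> strands \<gamma>" using dart_in_strand e by blast
      then show "e \<in> (\<lambda>(p, x, q). (p, x)) ` strands \<gamma>" using ab by force
    qed (use strand_in in auto)
  qed
  from sum.reindex_bij_betw[OF this, of "\<lambda>(a, b). h a b"]
  show "(\<Sum>(a, b)\<in>set (curve_darts \<gamma>). h a b) = (\<Sum>(p, x, q)\<in>strands \<gamma>. h p x)"
    by (simp add: case_prod_beta)
qed

lemma curve_chain_cycle:
  assumes n: "normal_curve T \<gamma>" shows "curve_chain \<gamma> \<in> cycles T"
proof (rule cyclesI)
  let ?D = "set (curve_darts \<gamma>)"
  note d = normal_darts[OF n]
  show "curve_chain \<gamma> b a = - curve_chain \<gamma> a b" for a b unfolding curve_chain_def by simp
  show "curve_chain \<gamma> a b = 0" if "{a, b} \<notin> edges T" for a b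
    using that d(2) edges_iff link_sym unfolding curve_chain_eq[OF d(1)] by auto
  show "boundary1 T (curve_chain \<gamma>) y = 0" for y
  proof -
    have v: "a \<in> verts T" "b \<in> verts T" if "(a, b) \<in> ?D" for a b using d(2)[OF that] link_subset link_sym by blast+
    have inn: "(\<Sum>a\<in>verts T. of_bool ((a, y) \<in> ?D)) = (\<Sum>(a, b)\<in>?D. of_bool (b = y) :: int)"
    proof -
      have "(\<Sum>a\<in>verts T. of_bool ((a, y) \<in> ?D) :: int) = (\<Sum>a\<in>{a. (a, y) \<in> ?D}. 1)"
        using v finite_verts by (intro sum.mono_neutral_cong_right) auto
      also have "\<dots> = (\<Sum>e\<in>{e \<in> ?D. snd e = y}. 1)"
        by (rule sum.reindex_bij_witness[where i = fst and j = "\<lambda>a. (a, y)"]) auto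
      also have "\<dots> = (\<Sum>(a, b)\<in>?D. of_bool (b = y) :: int)"
        by (rule sum.mono_neutral_cong_left) auto
      finally show ?thesis .
    qed
    have out: "(\<Sum>a\<in>verts T. of_bool ((y, a) \<in> ?D)) = (\<Sum>(a, b)\<in>?D. of_bool (a = y) :: int)"
    proof -
      have "(\<Sum>a\<in>verts T. of_bool ((y, a) \<in> ?D) :: int) = (\<Sum>a\<in>{a. (y, a) \<in> ?D}. 1)"
        using v finite_verts by (intro sum.mono_neutral_cong_right) auto
      also have "\<dots> = (\<Sum>e\<in>{e \<in> ?D. fst e = y}. 1)"
        by (rule sum.reindex_bij_witness[where i = snd and j = "\<lambda>a. (y, a)"]) auto
      also have "\<dots> = (\<Sum>(a, b)\<in>?D. of_bool (a = y) :: int)"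
        by (rule sum.mono_neutral_cong_left) auto
      finally show ?thesis .
    qed
    have "boundary1 T (curve_chain \<gamma>) y = (\<Sum>(a, b)\<in>?D. of_bool (b = y)) - (\<Sum>(a, b)\<in>?D. of_bool (a = y))"
      unfolding boundary1_def curve_chain_eq[OF d(1)] sum_subtractf inn out ..
    also have "\<dots> = 0" unfolding finite_dart_sum(2)[OF n, of "\<lambda>a b. of_bool (b = y)"]
        finite_dart_sum(1)[OF n, of "\<lambda>a b. of_bool (a = y)"] by simp
    finally show ?thesis .
  qed
qed

text \<open>\<open>positive_wrt\<close> looks at the sides of the strand travelled positively. The
  cyclic order translates this into which end of \<open>(p1, x, q1)\<close> lies to the left of
  \<open>(p, x, q)\<close>, and that is what a sum over \<open>between T x q p\<close>
  detects.\<close>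

lemma positive_wrt_sides:
  assumes l: "p1 \<in> link_verts T x" "q1 \<in> link_verts T x" "p \<in> link_verts T x" "q \<in> link_verts T x"
  shows "positive_wrt T (p1, x, q1) (p, x, q) \<Longrightarrow> q1 \<in> between T x q p \<and> p1 \<notin> between T x q p"
    and "positive_wrt T (p, x, q) (p1, x, q1) \<Longrightarrow> p1 \<in> between T x q p \<and> q1 \<notin> between T x q p"
proof -
  assume "positive_wrt T (p1, x, q1) (p, x, q)"
  then have b: "p \<in> between T x q1 p1" "q \<in> between T x p1 q1" unfolding positive_wrt_def by auto
  have "q1 \<in> between T x p1 p" using between_rotate[OF l(3) between_rotate[OF l(2) b(1)]] .
  then have "q \<in> between T x p1 p" using between_trans[OF l(1) b(2)] by blast
  then have 1: "p \<in> between T x q p1" using between_rotate l by blast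
  have "p1 \<in> between T x q1 q" using between_rotate[OF l(4) between_rotate[OF l(1) b(2)]] .
  then have "p \<in> between T x q1 q" using between_trans[OF l(2) b(1)] by blast
  then have "q1 \<in> between T x q p" using between_rotate l by blast
  then show "q1 \<in> between T x q p \<and> p1 \<notin> between T x q p" using between_asym[OF l(4) 1] by blast
next
  assume "positive_wrt T (p, x, q) (p1, x, q1)"
  then have b: "p1 \<in> between T x q p" "q1 \<in> between T x p q" unfolding positive_wrt_def by auto
  have "p \<in> between T x q q1" using between_rotate[OF l(2) between_rotate[OF l(3) b(2)]] .
  then show "p1 \<in> between T x q p \<and> q1 \<notin> between T x q p" using b(1) between_asym[OF l(4)] by blast
qed

text \<open>The change of a potential across the edge from \<open>a\<close> to \<open>b\<close>.\<close>

definition jump :: "(nat \<Rightarrow> nat \<Rightarrow> nat \<Rightarrow> int) \<Rightarrow> chain" where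
  "jump G a b = G b (nx a b) a - G a b (nx a b)"

lemma jump_eq: "(a, b, c) \<in> T \<Longrightarrow> G b c a - G a b c = jump G a b"
  using nx_eq by (simp add: jump_def)

lemma jump_antisym:
  assumes z: "corner_potential T z G" "z \<in> cycles T" and t: "(a, b, c) \<in> T"
  shows "jump G b a = - jump G a b"
proof -
  have "(b, a, nx b a) \<in> T" using t link_iff link_sym tri_link by blast
  from potential_other_end[OF z t this] show ?thesis using nx_eq[OF t] by (simp add: jump_def)
qed

lemma flux_jump:
  assumes n: "normal_curve T \<gamma>" and z: "corner_potential T z G" "z \<in> cycles T"
  shows "flux T G (curve_chain \<gamma>) = 2 * (\<Sum>(a, b)\<in>set (curve_darts \<gamma>). jump G a b)"
proof -
  let ?D = "set (curve_darts \<gamma>)"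
  note d = normal_darts[OF n]
  have pos: "(\<Sum>(a, b, c)\<in>T. jump G a b * of_bool ((a, b) \<in> ?D)) = (\<Sum>(a, b)\<in>?D. jump G a b)"
  proof -
    have "(\<Sum>(a, b, c)\<in>T. jump G a b * of_bool ((a, b) \<in> ?D)) = (\<Sum>(a, b, c)\<in>{(a, b, c) \<in> T. (a, b) \<in> ?D}. jump G a b)"
      by (rule sum.mono_neutral_cong_right) (auto simp: finite_T)
    also have "\<dots> = (\<Sum>(a, b)\<in>?D. jump G a b)"
      by (rule sum.reindex_bij_witness[where i = "\<lambda>(a, b). (a, b, nx a b)" and j = "\<lambda>(a, b, c). (a, b)"])
        (use nx_eq link_iff d(2) in auto)
    finally show ?thesis .
  qed
  have "flux T G (curve_chain \<gamma>) = (\<Sum>(a, b, c)\<in>T. jump G a b * of_bool ((a, b) \<in> ?D)) +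
      (\<Sum>(a, b, c)\<in>T. jump G b a * of_bool ((b, a) \<in> ?D))"
    unfolding flux_def sum.distrib[symmetric]
  proof (rule sum.cong, simp, clarify)
    fix a b c assume t: "(a, b, c) \<in> T"
    show "(G b c a - G a b c) * curve_chain \<gamma> a b = jump G a b * of_bool ((a, b) \<in> ?D) + jump G b a * of_bool ((b, a) \<in> ?D)"
      unfolding curve_chain_eq[OF d(1)] jump_eq[OF t] jump_antisym[OF z t] by (simp add: right_diff_distrib)
  qed
  also have "\<dots> = 2 * (\<Sum>(a, b)\<in>?D. jump G a b)"
    using flip_sum[of "\<lambda>a b c. jump G a b * of_bool ((a, b) \<in> ?D)"] pos by simp
  finally show ?thesis .
qed

text \<open>Push the curve slightly to its left: it then crosses exactly the edges that leave each
  passage on the left. Formally, the jumps are regrouped by vertices, and each passage contributes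
  the change of potential from its outgoing to its incoming edge.\<close>

lemma flux_curve_chain:
  assumes n: "normal_curve T \<gamma>" and z: "corner_potential T z G" "z \<in> cycles T"
  shows "flux T G (curve_chain \<gamma>) = 2 * (\<Sum>(p, x, q)\<in>strands \<gamma>. \<Sum>d\<in>between T x q p. z x d)"
proof -
  let ?D = "set (curve_darts \<gamma>)"
  have "flux T G (curve_chain \<gamma>) = 2 * (\<Sum>(a, b)\<in>?D. jump G a b)" by (rule flux_jump[OF n z])
  also have "(\<Sum>(a, b)\<in>?D. jump G a b) = (\<Sum>(a, b)\<in>?D. G b (nx a b) a) - (\<Sum>(a, b)\<in>?D. G a b (nx a b))"
    unfolding jump_def sum_subtractf[symmetric] by (rule sum.cong) auto
  also have "\<dots> = (\<Sum>(p, x, q)\<in>strands \<gamma>. G x (nx p x) p) - (\<Sum>(p, x, q)\<in>strands \<gamma>. G x q (nx x q))"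
    unfolding finite_dart_sum(2)[OF n, of "\<lambda>a b. G b (nx a b) a"]
      finite_dart_sum(1)[OF n, of "\<lambda>a b. G a b (nx a b)"] ..
  also have "\<dots> = (\<Sum>(p, x, q)\<in>strands \<gamma>. \<Sum>d\<in>between T x q p. z x d)"
    unfolding sum_subtractf[symmetric]
  proof (rule sum.cong, simp, clarify)
    fix p x q assume s: "(p, x, q) \<in> strands \<gamma>"
    note l = strand_link[OF n s]
    have "(x, q, nx x q) \<in> T" "(x, nx p x, p) \<in> T" using l link_iff link_sym rot by blast+
    then show "G x (nx p x) p - G x q (nx x q) = (\<Sum>d\<in>between T x q p. z x d)"
      using potential_between[OF z(1)] l(3) by metis
  qed
  finally show ?thesis .
qed

lemma finite_between: "b \<in> link_verts T x \<Longrightarrow> finite (between T x b c)"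
  by (rule finite_subset[OF _ finite_link]) (use between_link(2) in blast)

text \<open>Only common vertices contribute. There the first curve has one incoming and one outgoing
  edge, exactly one of them lies to the left of the second curve, and the sign of the crossing tells
  which.\<close>

lemma curve_intersection_eq_pairing:
  assumes tr: "transverse T \<gamma>1 \<gamma>2"
  shows "normal_curve T \<gamma>1" "normal_curve T \<gamma>2"
    and "pairing T (curve_chain \<gamma>1) (curve_chain \<gamma>2) = 2 * curve_intersection T \<gamma>1 \<gamma>2"
proof -
  have n: "normal_curve T (\<gamma>1 @ \<gamma>2)" using tr unfolding transverse_def .
  have sub: "card {s \<in> strands \<gamma>. mid s = x} \<le> 2"
    if "strands \<gamma> \<subseteq> strands (\<gamma>1 @ \<gamma>2)" for \<gamma> x
  proof -
    have "card {s \<in> strands \<gamma>. mid s = x} \<le> card {s \<in> strands (\<gamma>1 @ \<gamma>2). mid s = x}"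
      using that by (intro card_mono) (auto intro: finite_subset[OF _ finite_strands[of "\<gamma>1 @ \<gamma>2"]])
    also have "\<dots> \<le> 2" using n unfolding normal_curve_def by blast
    finally show ?thesis .
  qed
  have s12: "strands (\<gamma>1 @ \<gamma>2) = strands \<gamma>1 \<union> strands \<gamma>2" by (rule strands_append)
  show n1: "normal_curve T \<gamma>1" "normal_curve T \<gamma>2"
    using n sub[of \<gamma>1] sub[of \<gamma>2] s12 unfolding normal_curve_def curve_darts_append
    by (auto simp: distinct_map inj_on_Un)
  let ?z = "curve_chain \<gamma>1"
  let ?D1 = "set (curve_darts \<gamma>1)" and ?D2 = "set (curve_darts \<gamma>2)"
  have disj: "?D1 \<inter> ?D2 = {}" using normal_darts(1)[OF n] unfolding curve_darts_append by simp
  have z: "?z \<in> cycles T" and f: "curve_chain \<gamma>2 \<in> cycles T" using curve_chain_cycle n1 by blast+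
  obtain G where G: "corner_potential T ?z G" using potential_exists z by blast
  let ?X = "mid ` strands \<gamma>1 \<inter> mid ` strands \<gamma>2"
  let ?sg = "\<lambda>x. if \<exists>s\<in>strands \<gamma>1. \<exists>s'\<in>strands \<gamma>2. mid s = x \<and> positive_wrt T s s' then 1 else - 1 :: int"
  have ne: "s \<noteq> s'" if "s \<in> strands \<gamma>1" "s' \<in> strands \<gamma>2" for s s'
  proof
    assume "s = s'"
    obtain p x q where "s = (p, x, q)" by (rule prod_cases3)
    then show False using that \<open>s = s'\<close> strand_in(1) disj by blast
  qed
  \<comment> \<open>At most two strands meet at a vertex, and the two curves share none. So at a
    common vertex each curve has a single strand, and \<open>curve_chain \<gamma>1\<close> at
    \<open>x\<close> sees only its two ends.\<close>
  have uniq: "s1 = t1 \<and> s2 = t2"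
    if "s1 \<in> strands \<gamma>1" "t1 \<in> strands \<gamma>1" "s2 \<in> strands \<gamma>2" "t2 \<in> strands \<gamma>2"
      "mid s1 = x" "mid t1 = x" "mid s2 = x" "mid t2 = x" for s1 t1 s2 t2 x
  proof (rule ccontr)
    assume contr: "\<not> ?thesis"
    have "card {s1, t1, s2, t2} \<le> card {s \<in> strands (\<gamma>1 @ \<gamma>2). mid s = x}"
      using that s12 by (intro card_mono) (auto intro: finite_subset[OF _ finite_strands[of "\<gamma>1 @ \<gamma>2"]])
    also have "\<dots> \<le> 2" using n unfolding normal_curve_def by blast
    finally have "card {s1, t1, s2, t2} \<le> 2" .
    then show False using contr ne that by (auto simp: card_insert_if split: if_splits)
  qed
  have zval: "?z x d = of_bool (d = q1) - of_bool (d = p1)"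
    if s: "(p1, x, q1) \<in> strands \<gamma>1" and s': "(p, x, q) \<in> strands \<gamma>2" for p1 x q1 p q d
  proof -
    have m: "mid (p1, x, q1) = x" "mid (p, x, q) = x" by (auto simp: mid_def)
    have "(x, d) \<in> ?D1 \<longleftrightarrow> d = q1"
    proof
      assume "(x, d) \<in> ?D1"
      then obtain p' where "(p', x, d) \<in> strands \<gamma>1" using dart_out_strand by blast
      then show "d = q1" using uniq[OF s _ s' s'] m by (auto simp: mid_def)
    qed (use strand_in[OF s] in simp)
    moreover have "(d, x) \<in> ?D1 \<longleftrightarrow> d = p1"
    proof
      assume "(d, x) \<in> ?D1"
      then obtain p' where "(d, x, p') \<in> strands \<gamma>1" using dart_in_strand by blast
      then show "d = p1" using uniq[OF s _ s' s'] m by (auto simp: mid_def)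
    qed (use strand_in[OF s] in simp)
    ultimately show ?thesis unfolding curve_chain_eq[OF normal_darts(1)[OF n1(1)]] by simp
  qed
  \<comment> \<open>The value is \<open>1\<close> when the first curve leaves to the left of the
    second, which means that it travels the crossing positively, and \<open>- 1\<close> when it
    arrives from there.\<close>
  have W: "(\<Sum>d\<in>between T x q p. ?z x d) = ?sg x"
    if s: "(p1, x, q1) \<in> strands \<gamma>1" and s': "(p, x, q) \<in> strands \<gamma>2" for p1 x q1 p q
  proof -
    have m: "mid (p1, x, q1) = x" "mid (p, x, q) = x" by (auto simp: mid_def)
    note l = strand_link[OF n1(1) s] strand_link[OF n1(2) s']
    have fin: "finite (between T x q p)" using finite_between l by blast
    have "(\<Sum>d\<in>between T x q p. ?z x d) = (\<Sum>d\<in>between T x q p. of_bool (d = q1)) - (\<Sum>d\<in>between T x q p. of_bool (d = p1))"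
      unfolding zval[OF s s'] sum_subtractf ..
    also have "\<dots> = of_bool (q1 \<in> between T x q p) - of_bool (p1 \<in> between T x q p)"
      using fin by (simp add: of_bool_def)
    finally have eq: "(\<Sum>d\<in>between T x q p. ?z x d) = of_bool (q1 \<in> between T x q p) - of_bool (p1 \<in> between T x q p)" .
    have "positive_wrt T (p1, x, q1) (p, x, q) \<or> positive_wrt T (p, x, q) (p1, x, q1)"
      using normal_crossing[OF n _ _ ne[OF s s']] s s' s12 m by simp
    then show ?thesis
    proof
      assume pos: "positive_wrt T (p1, x, q1) (p, x, q)"
      then have "?sg x = 1" using s s' m by auto
      then show ?thesis using eq positive_wrt_sides(1)[OF l(1,2,4,5) pos] by simp
    next
      assume neg: "positive_wrt T (p, x, q) (p1, x, q1)"
      note sides = positive_wrt_sides(2)[OF l(1,2,4,5) neg]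
      have "\<not> positive_wrt T s s2" if "s \<in> strands \<gamma>1" "s2 \<in> strands \<gamma>2" "mid s = x" for s s2
      proof
        assume pw: "positive_wrt T s s2"
        then have "mid s2 = x" using that unfolding positive_wrt_def by simp
        then have "s = (p1, x, q1) \<and> s2 = (p, x, q)" using uniq[OF that(1) s that(2) s'] that m by simp
        then show False using positive_wrt_sides(1)[OF l(1,2,4,5)] pw sides by blast
      qed
      then have "?sg x = - 1" by auto
      then show ?thesis using eq sides by simp
    qed
  qed
  have "pairing T ?z (curve_chain \<gamma>2) = flux T G (curve_chain \<gamma>2)" by (rule pairing_eq[OF G z f])
  also have "\<dots> = 2 * (\<Sum>(p, x, q)\<in>strands \<gamma>2. \<Sum>d\<in>between T x q p. ?z x d)"
    by (rule flux_curve_chain[OF n1(2) G z])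
  also have "(\<Sum>(p, x, q)\<in>strands \<gamma>2. \<Sum>d\<in>between T x q p. ?z x d) =
      (\<Sum>(p, x, q)\<in>{s \<in> strands \<gamma>2. mid s \<in> mid ` strands \<gamma>1}. \<Sum>d\<in>between T x q p. ?z x d)"
  proof (rule sum.mono_neutral_right[OF finite_strands])
    show "\<forall>i\<in>strands \<gamma>2 - {s \<in> strands \<gamma>2. mid s \<in> mid ` strands \<gamma>1}.
        (case i of (p, x, q) \<Rightarrow> \<Sum>d\<in>between T x q p. ?z x d) = 0"
    proof
      fix i assume i: "i \<in> strands \<gamma>2 - {s \<in> strands \<gamma>2. mid s \<in> mid ` strands \<gamma>1}"
      obtain p x q where pxq: "i = (p, x, q)" by (rule prod_cases3)
      have "x \<notin> mid ` strands \<gamma>1" using i pxq by (auto simp: mid_def)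
      then have no: "(p', x, q') \<notin> strands \<gamma>1" for p' q' by (force simp: mid_def)
      have "(x, d) \<notin> ?D1" "(d, x) \<notin> ?D1" for d using no dart_out_strand dart_in_strand by metis+
      then have "?z x d = 0" for d unfolding curve_chain_eq[OF normal_darts(1)[OF n1(1)]] by simp
      then show "(case i of (p, x, q) \<Rightarrow> \<Sum>d\<in>between T x q p. ?z x d) = 0" unfolding pxq by simp
    qed
  qed auto
  also have "\<dots> = (\<Sum>s\<in>{s \<in> strands \<gamma>2. mid s \<in> mid ` strands \<gamma>1}. ?sg (mid s))"
  proof (rule sum.cong, simp)
    fix s' assume s': "s' \<in> {s \<in> strands \<gamma>2. mid s \<in> mid ` strands \<gamma>1}"
    obtain p x q where pxq: "s' = (p, x, q)" by (rule prod_cases3)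
    obtain s where "s \<in> strands \<gamma>1" "mid s = x" using s' pxq by (auto simp: mid_def)
    then obtain p1 q1 where "(p1, x, q1) \<in> strands \<gamma>1" by (cases s) (auto simp: mid_def)
    then show "(case s' of (p, x, q) \<Rightarrow> \<Sum>d\<in>between T x q p. ?z x d) = ?sg (mid s')"
      using W s' unfolding pxq by (simp add: mid_def)
  qed
  also have "\<dots> = (\<Sum>x\<in>?X. ?sg x)"
  proof (rule sum.reindex_bij_betw, rule bij_betw_imageI)
    show "inj_on mid {s \<in> strands \<gamma>2. mid s \<in> mid ` strands \<gamma>1}"
    proof (rule inj_onI)
      fix s t assume st: "s \<in> {s \<in> strands \<gamma>2. mid s \<in> mid ` strands \<gamma>1}"
        "t \<in> {s \<in> strands \<gamma>2. mid s \<in> mid ` strands \<gamma>1}" "mid s = mid t"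
      then obtain r where r: "r \<in> strands \<gamma>1" "mid r = mid s" by force
      have "s \<in> strands \<gamma>2" "t \<in> strands \<gamma>2" using st by blast+
      then show "s = t" using uniq[OF r(1) r(1) _ _ r(2) r(2) refl st(3)[symmetric]] by blast
    qed
    have "mid ` {s \<in> A. mid s \<in> B} = B \<inter> mid ` A" for A B by blast
    then show "mid ` {s \<in> strands \<gamma>2. mid s \<in> mid ` strands \<gamma>1} = ?X" .
  qed
  finally show "pairing T ?z (curve_chain \<gamma>2) = 2 * curve_intersection T \<gamma>1 \<gamma>2"
    unfolding curve_intersection_def .
qed

end

section \<open>Stellar moves\<close>

text \<open>The link condition is weakened to connectedness under adjacency in both directions. This
  suffices because the forward orbit is finite and the successor is injective on it, hence
  surjective, so the orbit is closed under predecessors too.\<close>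

lemma closed_oriented_surfaceI:
  assumes fin: "finite T" and ne: "T \<noteq> {}"
    and rot: "\<And>a b c. (a, b, c) \<in> T \<Longrightarrow> (b, c, a) \<in> T"
    and dist: "\<And>a b c. (a, b, c) \<in> T \<Longrightarrow> a \<noteq> b"
    and mirror: "\<And>a b c. (a, b, c) \<in> T \<Longrightarrow> (b, a, c) \<notin> T"
    and uniq: "\<And>a b c d. (a, b, c) \<in> T \<Longrightarrow> (a, b, d) \<in> T \<Longrightarrow> c = d"
    and opp: "\<And>a b c. (a, b, c) \<in> T \<Longrightarrow> \<exists>d. (b, a, d) \<in> T"
    and link: "\<And>x A b c. A \<subseteq> link_verts T x \<Longrightarrow> b \<in> A \<Longrightarrow>
      (\<And>b c. (x, b, c) \<in> T \<Longrightarrow> b \<in> A \<longleftrightarrow> c \<in> A) \<Longrightarrow> c \<in> link_verts T x \<Longrightarrow> c \<in> A"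
  shows "closed_oriented_surface T"
proof -
  have nx: "ccw_next T x b = c" if "(x, b, c) \<in> T" for x b c
    unfolding ccw_next_def using that uniq by blast
  have lk: "b \<in> link_verts T x" "c \<in> link_verts T x" if "(x, b, c) \<in> T" for x b c
    using that rot opp unfolding link_verts_def by blast+
  have fl: "finite (link_verts T x)" for x
    by (rule finite_subset[of _ "(\<lambda>(a, b, c). b) ` T"]) (use fin in \<open>force simp: link_verts_def\<close>)+
  have orbit: "\<exists>k. c = (ccw_next T x ^^ k) b" if b: "b \<in> link_verts T x" and c: "c \<in> link_verts T x" for x b c
  proof -
    let ?n = "ccw_next T x"
    define A where "A = {d. \<exists>k. d = (?n ^^ k) b}"
    have step: "?n d \<in> A" if dA: "d \<in> A" for d
    proof -
      obtain k where "d = (?n ^^ k) b" using dA unfolding A_def by blast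
      then have "?n d = (?n ^^ Suc k) b" by simp
      then show ?thesis unfolding A_def by blast
    qed
    have sub: "A \<subseteq> link_verts T x"
    proof
      fix d assume "d \<in> A"
      then obtain k where "d = (?n ^^ k) b" unfolding A_def by blast
      moreover have "(?n ^^ k) b \<in> link_verts T x"
      proof (induction k)
        case (Suc k)
        then obtain e where "(x, (?n ^^ k) b, e) \<in> T" unfolding link_verts_def by blast
        then show ?case using nx lk(2) by auto
      qed (use b in simp)
      ultimately show "d \<in> link_verts T x" by simp
    qed
    have nxT: "(x, d, ?n d) \<in> T" if dA: "d \<in> A" for d
    proof -
      obtain e where "(x, d, e) \<in> T" using sub dA unfolding link_verts_def by blast
      then show ?thesis using nx by simp
    qed
    have "inj_on ?n A"
    proof (rule inj_onI)
      fix d e assume "d \<in> A" "e \<in> A" "?n d = ?n e"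
      then have "(?n d, x, d) \<in> T" "(?n d, x, e) \<in> T" using nxT rot by metis+
      then show "d = e" using uniq by blast
    qed
    then have surj: "?n ` A = A"
      using step finite_subset[OF sub fl] by (intro endo_inj_surj) auto
    have "c \<in> A"
    proof (rule link[OF sub _ _ c])
      have "b = (?n ^^ 0) b" by simp
      then show "b \<in> A" unfolding A_def by blast
      fix d e assume de: "(x, d, e) \<in> T"
      show "d \<in> A \<longleftrightarrow> e \<in> A"
      proof
        assume "d \<in> A" then show "e \<in> A" using step nx[OF de] by blast
      next
        assume "e \<in> A"
        then obtain d' where "d' \<in> A" "e = ?n d'" using surj by blast
        then have "(e, x, d') \<in> T" using nxT rot by metis
        moreover have "(e, x, d) \<in> T" using de rot by blast
        ultimately show "d \<in> A" using uniq \<open>d' \<in> A\<close> by blast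
      qed
    qed
    then show ?thesis unfolding A_def by blast
  qed
  show ?thesis unfolding closed_oriented_surface_def
  proof (intro conjI allI impI ballI)
    fix a b c assume t: "(a, b, c) \<in> T"
    show "a \<noteq> b" "b \<noteq> c" using dist t rot by blast+
    show "a \<noteq> c" using dist[OF rot[OF rot[OF t]]] by blast
    show "(b, c, a) \<in> T" "(b, a, c) \<notin> T" "\<exists>d. (b, a, d) \<in> T" using t rot mirror opp by blast+
  next
    fix a b c d assume "(a, b, c) \<in> T \<and> (a, b, d) \<in> T"
    then show "c = d" using uniq by blast
  next
    fix x b c assume "b \<in> link_verts T x" "c \<in> link_verts T x"
    then show "\<exists>k. c = (ccw_next T x ^^ k) b" by (rule orbit)
  qed (use fin ne in auto)
qed

lemma (in surf) link_connected:
  assumes A: "b \<in> A" and b: "b \<in> link_verts T x" and c: "c \<in> link_verts T x"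
    and step: "\<And>b c. (x, b, c) \<in> T \<Longrightarrow> b \<in> A \<Longrightarrow> c \<in> A"
  shows "c \<in> A"
proof -
  obtain k where k: "c = (nx x ^^ k) b" using nx_pow_ex b c by blast
  have "(nx x ^^ k) b \<in> A" for k
    by (induction k) (use A step nx_pow_tri[OF b] in auto)
  then show ?thesis using k by simp
qed

section \<open>Replacing a disc by a cone\<close>

definition cone :: "nat \<Rightarrow> (nat \<times> nat) set \<Rightarrow> surface" where
  "cone x B = {(a, b, c). (a = x \<and> (b, c) \<in> B) \<or> (b = x \<and> (c, a) \<in> B) \<or> (c = x \<and> (a, b) \<in> B)}"

text \<open>Both stellar moves replace a disc, with set of triangles \<open>R\<close> and boundary circle \<open>B\<close>, by the cone
  from the new vertex over \<open>B\<close>.\<close>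

locale disc_in_surface = surf +
  fixes R :: surface and B :: "(nat \<times> nat) set" and x :: nat
  assumes R_sub: "R \<subseteq> T" and R_rot: "\<And>a b c. (a, b, c) \<in> R \<Longrightarrow> (b, c, a) \<in> R"
    and x_new: "x \<notin> verts T"
    and B_in: "\<And>p q. (p, q) \<in> B \<Longrightarrow> \<exists>c. (p, q, c) \<in> R"
    and B_out: "\<And>p q d. (p, q) \<in> B \<Longrightarrow> (q, p, d) \<notin> R"
    and B_all: "\<And>p q c. (p, q, c) \<in> R \<Longrightarrow> (p, q) \<in> B \<or> (\<exists>d. (q, p, d) \<in> R)"
    and B_ex: "\<And>y b c. (y, b, c) \<in> R \<Longrightarrow> (\<exists>p. (p, y) \<in> B) \<and> (\<exists>q. (y, q) \<in> B)"
    and B_uni: "\<And>p p' y. (p, y) \<in> B \<Longrightarrow> (p', y) \<in> B \<Longrightarrow> p = p'" "\<And>q q' y. (y, q) \<in> B \<Longrightarrow> (y, q') \<in> B \<Longrightarrow> q = q'"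
    and B_conn: "\<And>A p q p' q'. (\<And>p q. (p, q) \<in> B \<Longrightarrow> p \<in> A \<longleftrightarrow> q \<in> A) \<Longrightarrow> (p, q) \<in> B \<Longrightarrow> (p', q') \<in> B \<Longrightarrow>
       p \<in> A \<Longrightarrow> p' \<in> A"
    and B_ne: "B \<noteq> {}"
begin

definition T' :: surface where "T' = (T - R) \<union> cone x B"

lemma B_T: "(p, q) \<in> B \<Longrightarrow> \<exists>c. (p, q, c) \<in> T" using B_in R_sub by blast

lemma B_x: assumes "(p, q) \<in> B" shows "p \<noteq> x" "q \<noteq> x" "x \<noteq> p" "x \<noteq> q" "p \<noteq> q"
proof -
  obtain c where c: "(p, q, c) \<in> T" using B_T assms by blast
  then show "p \<noteq> x" "q \<noteq> x" "x \<noteq> p" "x \<noteq> q" "p \<noteq> q" using tri_verts_mem[OF c] x_new tri_distinct[OF c] by auto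
qed

lemma T_x: assumes "(a, b, c) \<in> T" shows "a \<noteq> x" "b \<noteq> x" "c \<noteq> x"
  using tri_verts_mem[OF assms] x_new by auto

lemma R_rot2: "(a, b, c) \<in> R \<Longrightarrow> (c, a, b) \<in> R" using R_rot by blast

lemma B_old: "(p, q) \<in> B \<Longrightarrow> (p, q, c) \<in> T \<Longrightarrow> (p, q, c) \<in> R"
  using B_in R_sub tri_unique by blast

lemma B_mirror: "(p, q) \<in> B \<Longrightarrow> (q, p) \<notin> B"
  using B_in B_out by blast

lemma B_new: "(q, p) \<in> B \<Longrightarrow> \<exists>c. (p, q, c) \<in> T - R"
  using B_T opposite B_out by blast

lemma old_new: "(p, q, c) \<in> T - R \<Longrightarrow> (q, p, d) \<in> R \<Longrightarrow> (q, p) \<in> B"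
  using B_all R_sub tri_unique by blast

lemma T'_old: "a \<noteq> x \<Longrightarrow> b \<noteq> x \<Longrightarrow> c \<noteq> x \<Longrightarrow> (a, b, c) \<in> T' \<longleftrightarrow> (a, b, c) \<in> T - R"
  unfolding T'_def cone_def by auto

lemma T'_fst: "(x, b, c) \<in> T' \<longleftrightarrow> (b, c) \<in> B"
  unfolding T'_def cone_def by (auto dest: T_x B_x)

lemma T'_snd: "(a, x, c) \<in> T' \<longleftrightarrow> (c, a) \<in> B"
  unfolding T'_def cone_def by (auto dest: T_x B_x)

lemma T'_trd: "(a, b, x) \<in> T' \<longleftrightarrow> (a, b) \<in> B"
  unfolding T'_def cone_def by (auto dest: T_x B_x)

lemmas T'_simps = T'_fst T'_snd T'_trd

lemma T'_rot: assumes "(a, b, c) \<in> T'" shows "(b, c, a) \<in> T'"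
proof -
  consider "a = x" | "b = x" | "c = x" | "a \<noteq> x" "b \<noteq> x" "c \<noteq> x" by blast
  then show ?thesis
  proof cases
    case 4
    then have "(a, b, c) \<in> T - R" using assms T'_old by simp
    then have "(b, c, a) \<in> T - R" using rot R_rot2 by blast
    then show ?thesis using 4 T'_old by simp
  qed (use assms in \<open>simp_all add: T'_simps\<close>)
qed

lemma T'_uniq: assumes "(a, b, c) \<in> T'" "(a, b, d) \<in> T'" shows "c = d"
proof -
  consider "a = x" | "b = x" | "a \<noteq> x" "b \<noteq> x" "c = x" "d = x" | "a \<noteq> x" "b \<noteq> x" "c = x" "d \<noteq> x"
    | "a \<noteq> x" "b \<noteq> x" "c \<noteq> x" "d = x" | "a \<noteq> x" "b \<noteq> x" "c \<noteq> x" "d \<noteq> x" by blast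
  then show ?thesis
  proof cases
    case 1
    then show ?thesis using assms B_uni(2) by (simp add: T'_simps)
  next
    case 2
    then show ?thesis using assms B_uni(1) by (simp add: T'_simps)
  next
    case 4
    then have "(a, b) \<in> B" "(a, b, d) \<in> T - R" using assms T'_old[of a b d] by (simp_all add: T'_simps)
    then show ?thesis using B_old by blast
  next
    case 5
    then have "(a, b) \<in> B" "(a, b, c) \<in> T - R" using assms T'_old[of a b c] by (simp_all add: T'_simps)
    then show ?thesis using B_old by blast
  next
    case 6
    then show ?thesis using assms T'_old[of a b] tri_unique[of a b] by simp
  qed simp
qed

lemma T'_opp: assumes "(a, b, c) \<in> T'" shows "\<exists>d. (b, a, d) \<in> T'"
proof -
  consider "a = x" | "b = x" "a \<noteq> x" | "c = x" "a \<noteq> x" "b \<noteq> x" | "a \<noteq> x" "b \<noteq> x" "c \<noteq> x" by blast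
  then show ?thesis
  proof cases
    case 1
    then have "(b, c) \<in> B" using assms T'_fst by simp
    then obtain p where "(p, b) \<in> B" using B_in B_ex by blast
    then show ?thesis using 1 T'_snd by auto
  next
    case 2
    then have "(c, a) \<in> B" using assms T'_snd by simp
    then obtain p where "(a, p) \<in> B" using B_in B_ex R_rot by blast
    then show ?thesis using 2 T'_fst by auto
  next
    case 3
    then have "(a, b) \<in> B" using assms T'_trd by simp
    then show ?thesis using B_new unfolding T'_def by blast
  next
    case 4
    then have t: "(a, b, c) \<in> T - R" using assms T'_old by blast
    then obtain d where d: "(b, a, d) \<in> T" using opposite by blast
    show ?thesis
    proof (cases "(b, a, d) \<in> R")
      case True
      then have "(b, a) \<in> B" using old_new t by blast
      then show ?thesis using T'_trd by blast
    qed (use d T'_def in blast)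
  qed
qed

lemma link_T': "y \<noteq> x \<Longrightarrow> d \<noteq> x \<Longrightarrow> d \<in> link_verts T' y \<Longrightarrow> d \<in> link_verts T y"
proof -
  assume "y \<noteq> x" "d \<noteq> x" "d \<in> link_verts T' y"
  then obtain r where r: "(y, d, r) \<in> T'" unfolding link_verts_def by blast
  have "\<exists>r. (y, d, r) \<in> T"
  proof (cases "r = x")
    case True
    then show ?thesis using r T'_trd B_T by blast
  next
    case False
    then show ?thesis using r T'_old \<open>y \<noteq> x\<close> \<open>d \<noteq> x\<close> by blast
  qed
  then show ?thesis unfolding link_verts_def by blast
qed

text \<open>Apart from bookkeeping on triangles only the links need an argument. The link of the new
  vertex is the circle \<open>B\<close>; in the link of an old vertex on \<open>B\<close>, the
  interior of the arc through \<open>R\<close> is replaced by the single vertex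
  \<open>x\<close>.\<close>

lemma surface_T': "closed_oriented_surface T'"
proof (rule closed_oriented_surfaceI)
  have "B \<subseteq> (\<lambda>(a, b, c). (a, b)) ` T" using B_T by force
  then have finB: "finite B" using finite_T finite_subset by blast
  have "cone x B = (\<lambda>(p, q). (x, p, q)) ` B \<union> (\<lambda>(p, q). (p, q, x)) ` B \<union> (\<lambda>(p, q). (q, x, p)) ` B"
    unfolding cone_def by (auto simp: image_iff split: prod.splits)
  then show "finite T'" using finB finite_T unfolding T'_def by simp
  obtain p q where "(p, q) \<in> B" using B_ne by auto
  then show "T' \<noteq> {}" using T'_fst by blast
  show "(b, c, a) \<in> T'" if "(a, b, c) \<in> T'" for a b c using T'_rot that .
  show "c = d" if "(a, b, c) \<in> T'" "(a, b, d) \<in> T'" for a b c d using T'_uniq that .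
  show "\<exists>d. (b, a, d) \<in> T'" if "(a, b, c) \<in> T'" for a b c using T'_opp that .
  show "a \<noteq> b" if "(a, b, c) \<in> T'" for a b c
  proof -
    consider "a = x" | "b = x" | "c = x" | "a \<noteq> x" "b \<noteq> x" "c \<noteq> x" by blast
    then show ?thesis
    proof cases
      case 4
      then show ?thesis using that T'_old[of a b c] tri_distinct[of a b c] by simp
    qed (use that in \<open>auto simp: T'_simps dest: B_x\<close>)
  qed
  show "(b, a, c) \<notin> T'" if "(a, b, c) \<in> T'" for a b c
  proof
    assume m: "(b, a, c) \<in> T'"
    consider "a = x" | "b = x" | "c = x" | "a \<noteq> x" "b \<noteq> x" "c \<noteq> x" by blast
    then show False
    proof cases
      case 4
      then show ?thesis using m that T'_old[of a b c] T'_old[of b a c] no_mirror[of a b c] by simp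
    qed (use m that in \<open>auto simp: T'_simps dest: B_mirror\<close>)
  qed
  fix y A b c
  assume A: "A \<subseteq> link_verts T' y" "b \<in> A" and cl: "\<And>b c. (y, b, c) \<in> T' \<Longrightarrow> b \<in> A \<longleftrightarrow> c \<in> A"
    and c: "c \<in> link_verts T' y"
  show "c \<in> A"
  proof (cases "y = x")
    case True
    have lx: "\<exists>q. (d, q) \<in> B" if "d \<in> link_verts T' y" for d
      using that True unfolding link_verts_def by (simp add: T'_simps)
    have clx: "p \<in> A \<longleftrightarrow> q \<in> A" if "(p, q) \<in> B" for p q
      using cl[of p q] that True by (simp add: T'_simps)
    obtain q where q: "(b, q) \<in> B" using lx A by blast
    obtain q' where q': "(c, q') \<in> B" using lx[OF c] by blast
    show ?thesis using B_conn[of A, OF clx q q' A(2)] .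
  next
    case False
    \<comment> \<open>\<open>A0\<close> pulls the set \<open>A\<close> back to the old link of
      \<open>y\<close>: if \<open>x\<close> lies in \<open>A\<close>, the whole closed arc through
      \<open>R\<close> is added, and otherwise no vertex of that arc turns out to be in
      \<open>A\<close>.\<close>
    define A0 where "A0 = (A - {x}) \<union> (if x \<in> A then {d. \<exists>e. (y, d, e) \<in> R \<or> (y, e, d) \<in> R} else {})"
    have bd: "(d \<in> A) \<longleftrightarrow> x \<in> A" if "(y, d) \<in> B \<or> (d, y) \<in> B" for d
      using that cl[of d x] cl[of x d] by (auto simp: T'_simps)
    \<comment> \<open>A link vertex that belongs to a triangle of \<open>R\<close> and to one
      outside \<open>R\<close> is an end of the arc, hence adjacent to \<open>x\<close> in the new
      link.\<close>
    have inR: "(y, d) \<in> B \<or> (d, y) \<in> B"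
      if "(y, d, e) \<in> R \<or> (y, e, d) \<in> R" "(y, d, e') \<in> T - R \<or> (y, e', d) \<in> T - R" for d e e'
    proof -
      have 1: "(y, d, e) \<in> R \<or> (d, y, e) \<in> R" using that(1) R_rot2 by blast
      have 2: "(y, d, e') \<in> T - R \<or> (d, y, e') \<in> T - R" using that(2) R_rot rot2 by blast
      from 1 2 show ?thesis using old_new R_sub tri_unique by blast
    qed
    have closed: "d \<in> A0 \<longleftrightarrow> e \<in> A0" if t: "(y, d, e) \<in> T" for d e
    proof (cases "(y, d, e) \<in> R")
      case True
      show ?thesis
      proof (cases "x \<in> A")
        case True
        then show ?thesis using \<open>(y, d, e) \<in> R\<close> unfolding A0_def by auto
      next
        case xA: False
        have "d \<notin> A"
        proof
          assume "d \<in> A"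
          then obtain r where r: "(y, d, r) \<in> T'" using A unfolding link_verts_def by blast
          show False
          proof (cases "r = x")
            case True
            then show False using r bd[of d] \<open>d \<in> A\<close> xA by (simp add: T'_simps)
          next
            case False
            then have "(y, d, r) \<in> T - R" using r T'_old[of y d r] \<open>y \<noteq> x\<close> T_x(2)[OF t] by simp
            then show False using True R_sub tri_unique by blast
          qed
        qed
        moreover have "e \<notin> A"
        proof
          assume "e \<in> A"
          then obtain r where "(y, e, r) \<in> T'" using A unfolding link_verts_def by blast
          then obtain r where r: "(y, r, e) \<in> T'" using T'_opp T'_rot by blast
          show False
          proof (cases "r = x")
            case True
            then show False using r bd[of e] \<open>e \<in> A\<close> xA by (simp add: T'_simps)
          next
            case False
            then have "(y, r, e) \<in> T - R" using r T'_old[of y r e] \<open>y \<noteq> x\<close> T_x(3)[OF t] by simp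
            then show False using True R_sub tri_unique2 by blast
          qed
        qed
        ultimately show ?thesis using xA unfolding A0_def by simp
      qed
    next
      case old: False
      have xs: "d \<noteq> x" "e \<noteq> x" using T_x[OF t] by auto
      have "(d \<in> A) = (e \<in> A)" by (rule cl) (use t old in \<open>simp add: T'_def\<close>)
      moreover have "x \<in> A \<Longrightarrow> (y, d, f) \<in> R \<or> (y, f, d) \<in> R \<Longrightarrow> d \<in> A" for f
        using inR[of d f e] bd t old by blast
      moreover have "x \<in> A \<Longrightarrow> (y, e, f) \<in> R \<or> (y, f, e) \<in> R \<Longrightarrow> e \<in> A" for f
        using inR[of e f d] bd t old by blast
      ultimately show ?thesis using xs unfolding A0_def by auto
    qed
    have xB: "\<exists>q. (y, q) \<in> B" if "x \<in> link_verts T' y"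
    proof -
      have "\<exists>q. (q, y) \<in> B" using that unfolding link_verts_def by (simp add: T'_simps)
      then show ?thesis using B_in B_ex R_rot by blast
    qed
    obtain b0 where b0: "b0 \<in> A0" "b0 \<in> link_verts T y"
    proof (cases "b = x")
      case True
      then obtain q where q: "(y, q) \<in> B" using xB A by blast
      then have "q \<in> A" using bd A(2) True by blast
      moreover have "q \<noteq> x" using B_x q by blast
      ultimately show thesis using that[of q] link_T' A(1) \<open>y \<noteq> x\<close> unfolding A0_def by blast
    next
      case False
      then show thesis using that[of b] link_T' A \<open>y \<noteq> x\<close> unfolding A0_def by blast
    qed
    have all: "d \<in> A0" if "d \<in> link_verts T y" for d
      by (rule link_connected[OF b0 that]) (use closed in blast)
    show "c \<in> A"
    proof (cases "c = x")
      case True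
      then obtain q where q: "(y, q) \<in> B" using xB c by blast
      then have "q \<in> link_verts T y" using B_T tri_link by blast
      then have "q \<in> A0" using all by blast
      then show ?thesis using bd[of q] q True unfolding A0_def by (auto split: if_splits)
    next
      case cx: False
      then have "c \<in> A0" using all c link_T' False by blast
      then consider "c \<in> A" | e where "x \<in> A" "(y, c, e) \<in> R \<or> (y, e, c) \<in> R"
        unfolding A0_def by (auto split: if_splits)
      then show ?thesis
      proof cases
        case 2
        obtain r where r: "(y, c, r) \<in> T'" using c unfolding link_verts_def by blast
        have "(y, c) \<in> B \<or> (c, y) \<in> B"
        proof (cases "r = x")
          case True
          then show ?thesis using r by (simp add: T'_simps)
        next
          case False
          then have "(y, c, r) \<in> T - R" using r T'_old[of y c r] \<open>y \<noteq> x\<close> cx by simp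
          then show ?thesis using inR 2(2) by blast
        qed
        then show ?thesis using bd 2 by blast
      qed
    qed
  qed
qed

end

lemma subdivide_edge_antisym:
  assumes f: "\<And>a b. f b a = - f a b" and d: "u \<noteq> v" "u \<noteq> x" "v \<noteq> x"
  shows "subdivide_edge u v x f q p = - subdivide_edge u v x f p q"
proof -
  consider (1) "(p, q) \<in> {(u, x), (x, v)}" | (2) "(p, q) \<in> {(v, x), (x, u)}"
    | (3) "(p, q) \<notin> {(u, x), (x, v)}" "(p, q) \<notin> {(v, x), (x, u)}" "{p, q} = {u, v}"
    | (4) "(p, q) \<notin> {(u, x), (x, v)}" "(p, q) \<notin> {(v, x), (x, u)}" "{p, q} \<noteq> {u, v}" by blast
  then show ?thesis
  proof cases
    case 1
    then show ?thesis using d f[of v u] unfolding subdivide_edge_def by auto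
  next
    case 2
    then show ?thesis using d f[of u v] unfolding subdivide_edge_def by auto
  next
    case 3
    have "{q, p} = {u, v}" using 3(3) by (simp add: insert_commute)
    moreover have "(q, p) \<notin> {(u, x), (x, v)}" "(q, p) \<notin> {(v, x), (x, u)}" using 3 by auto
    ultimately show ?thesis using 3 unfolding subdivide_edge_def by (simp only: if_False if_True minus_zero refl)
  next
    case 4
    have "{q, p} \<noteq> {u, v}" using 4(3) by (simp add: insert_commute)
    moreover have "(q, p) \<notin> {(u, x), (x, v)}" "(q, p) \<notin> {(v, x), (x, u)}" using 4 by auto
    ultimately show ?thesis using 4 unfolding subdivide_edge_def by (simp only: if_False f[of q p] minus_minus)
  qed
qed

lemma stellar_by_star:
  assumes m: "\<And>s. s \<in> T \<Longrightarrow> \<sigma> \<subseteq> tri_verts s \<longleftrightarrow> s \<in> R" and R: "R \<subseteq> T"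
  shows "stellar T \<sigma> x = (T - R) \<union> (\<Union>y\<in>\<sigma>. subst_vertex y x ` R)"
proof -
  have "{s \<in> T. \<not> \<sigma> \<subseteq> tri_verts s} = T - R" using m by blast
  moreover have "{subst_vertex y x s | y s. s \<in> T \<and> \<sigma> \<subseteq> tri_verts s \<and> y \<in> \<sigma>} = (\<Union>y\<in>\<sigma>. subst_vertex y x ` R)"
    using m R by blast
  ultimately show ?thesis unfolding stellar_def by simp
qed

section \<open>The two stellar moves as replacements of discs\<close>

context surf
begin

lemma cycle_outside: "z \<in> cycles T \<Longrightarrow> x \<notin> verts T \<Longrightarrow> z x b = 0" "z \<in> cycles T \<Longrightarrow> x \<notin> verts T \<Longrightarrow> z b x = 0"
  using cycles_edge edges_iff link_subset link_sym by blast+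

lemma edge_star_triangles:
  assumes t: "(u, v, a) \<in> T" "(v, u, b) \<in> T" and s: "(p, q, r) \<in> T" and uv: "u \<in> {p, q, r}" "v \<in> {p, q, r}"
  shows "(p, q, r) \<in> {(u, v, a), (v, a, u), (a, u, v), (v, u, b), (u, b, v), (b, v, u)}"
proof -
  have third: "(u, v, c) \<in> T \<longleftrightarrow> c = a" "(v, u, c) \<in> T \<longleftrightarrow> c = b" for c
    using t tri_unique by blast+
  have "u \<noteq> v" using tri_distinct t by blast
  then have "(p = u \<and> q = v) \<or> (q = u \<and> r = v) \<or> (r = u \<and> p = v) \<or> (p = v \<and> q = u) \<or> (q = v \<and> r = u) \<or> (r = v \<and> p = u)"
    using uv by auto
  then show ?thesis using s rot[OF s] rot2[OF s] by (elim disjE conjE) (simp_all add: third)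
qed

lemma edge_star_distinct:
  assumes t: "(u, v, a) \<in> T" "(v, u, b) \<in> T"
  shows "u \<noteq> v" "u \<noteq> a" "u \<noteq> b" "v \<noteq> a" "v \<noteq> b" "a \<noteq> b" "v \<noteq> u" "a \<noteq> u" "b \<noteq> u" "a \<noteq> v" "b \<noteq> v" "b \<noteq> a"
  using tri_distinct[OF t(1)] tri_distinct[OF t(2)] no_mirror[OF t(1)] t by auto

lemma edge_star_disc:
  assumes t: "(u, v, a) \<in> T" "(v, u, b) \<in> T" and x: "x \<notin> verts T"
  shows "disc_in_surface T {(u, v, a), (v, a, u), (a, u, v), (v, u, b), (u, b, v), (b, v, u)}
    {(v, a), (a, u), (u, b), (b, v)} x"
proof (unfold_locales, goal_cases)
  case 1
  then show ?case using t rot rot2 by blast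
next
  case 3
  then show ?case by (rule x)
qed (use edge_star_distinct[OF t] in auto)

lemma stellar_edge_eq:
  assumes t: "(u, v, a) \<in> T" "(v, u, b) \<in> T" and x: "x \<notin> verts T"
  shows "stellar T {u, v} x = (T - {(u, v, a), (v, a, u), (a, u, v), (v, u, b), (u, b, v), (b, v, u)}) \<union>
    cone x {(v, a), (a, u), (u, b), (b, v)}" (is "_ = (T - ?R) \<union> cone x ?B")
proof -
  note d = edge_star_distinct[OF t]
  have R: "?R \<subseteq> T" using t rot rot2 by blast
  have m: "{u, v} \<subseteq> tri_verts s \<longleftrightarrow> s \<in> ?R" if "s \<in> T" for s
  proof -
    obtain p q r where s: "s = (p, q, r)" by (rule prod_cases3)
    show ?thesis
    proof
      assume "{u, v} \<subseteq> tri_verts s"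
      then show "s \<in> ?R" using edge_star_triangles[OF t, of p q r] that unfolding s by simp
    qed auto
  qed
  have eq: "(\<Union>y\<in>{u, v}. subst_vertex y x ` ?R) = cone x ?B"
    using d unfolding cone_def by auto
  have "stellar T {u, v} x = (T - ?R) \<union> (\<Union>y\<in>{u, v}. subst_vertex y x ` ?R)"
    by (rule stellar_by_star[OF _ R]) (rule m)
  then show ?thesis unfolding eq .
qed

lemma triangle_star_disc:
  assumes t: "(a, b, c) \<in> T" and x: "x \<notin> verts T"
  shows "disc_in_surface T {(a, b, c), (b, c, a), (c, a, b)} {(a, b), (b, c), (c, a)} x"
proof (unfold_locales, goal_cases)
  case 1
  then show ?case using t rot rot2 by blast
next
  case 3
  then show ?case by (rule x)
qed (use tri_distinct[OF t] in auto)

lemma stellar_triangle_eq: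
  assumes t: "(a, b, c) \<in> T" and x: "x \<notin> verts T"
  shows "stellar T {a, b, c} x = (T - {(a, b, c), (b, c, a), (c, a, b)}) \<union> cone x {(a, b), (b, c), (c, a)}"
    (is "_ = (T - ?R) \<union> cone x ?B")
proof -
  note d = tri_distinct[OF t]
  have R: "?R \<subseteq> T" using t rot rot2 by blast
  have m: "{a, b, c} \<subseteq> tri_verts s \<longleftrightarrow> s \<in> ?R" if "s \<in> T" for s
  proof -
    obtain p q r where s: "s = (p, q, r)" by (rule prod_cases3)
    show ?thesis
    proof
      assume sub: "{a, b, c} \<subseteq> tri_verts s"
      have "card {p, q, r} \<le> card {a, b, c}" using d by (simp add: card_insert_if)
      then have "{p, q, r} = {a, b, c}" using sub unfolding s by (metis card_seteq finite.emptyI finite.insertI tri_verts.simps)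
      then show "s \<in> ?R" using same_triangle[OF t, of p q r] that unfolding s by simp
    qed auto
  qed
  have eq: "(\<Union>y\<in>{a, b, c}. subst_vertex y x ` ?R) = cone x ?B"
    using d unfolding cone_def by auto
  have "stellar T {a, b, c} x = (T - ?R) \<union> (\<Union>y\<in>{a, b, c}. subst_vertex y x ` ?R)"
    by (rule stellar_by_star[OF _ R]) (rule m)
  then show ?thesis unfolding eq .
qed

end

section \<open>Lifting potentials through a replacement of a disc\<close>

context disc_in_surface
begin

text \<open>A new corner at an old vertex inherits the value from the triangle of \<open>R\<close>
  on the same edge of \<open>B\<close>. The corners at \<open>x\<close> are free: \<open>g\<close>
  is chosen in each move so that its differences are the values of the subdivided cycle on the edges
  at \<open>x\<close>.\<close>

definition lift_potential :: "(nat \<Rightarrow> nat \<Rightarrow> nat \<Rightarrow> int) \<Rightarrow> (nat \<Rightarrow> int) \<Rightarrow> nat \<Rightarrow> nat \<Rightarrow> nat \<Rightarrow> int" where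
  "lift_potential G g y p q = (if y = x then g p else if p = x then G y (nx q y) q
     else if q = x then G y p (nx y p) else G y p q)"

lemma lift_potential:
  assumes z: "corner_potential T z G"
    and old: "\<And>y p q. y \<noteq> x \<Longrightarrow> q \<noteq> x \<Longrightarrow> (y, p, q) \<in> T - R \<or> (y, q, p) \<in> T - R \<Longrightarrow> z' y q = z y q"
    and to_x: "\<And>y p r. (y, p) \<in> B \<Longrightarrow> (r, y) \<in> B \<Longrightarrow> z' y x = G y (nx r y) r - G y p (nx y p)"
    and from_x: "\<And>p q r. (p, q) \<in> B \<Longrightarrow> (q, r) \<in> B \<Longrightarrow> z' x q = g q - g p"
  shows "corner_potential T' z' (lift_potential G g)"
  unfolding corner_potential_def
proof (intro allI impI, elim conjE)
  fix y p q r assume t: "(y, p, q) \<in> T'" "(y, q, r) \<in> T'"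
  consider (center) "y = x" | (thru) "y \<noteq> x" "q = x" | (in_out) "y \<noteq> x" "q \<noteq> x" "p = x" "r = x"
    | (left) "y \<noteq> x" "q \<noteq> x" "p = x" "r \<noteq> x" | (right) "y \<noteq> x" "q \<noteq> x" "p \<noteq> x" "r = x"
    | (out) "y \<noteq> x" "q \<noteq> x" "p \<noteq> x" "r \<noteq> x" by blast
  then show "z' y q = lift_potential G g y q r - lift_potential G g y p q"
  proof cases
    case center
    then have "(p, q) \<in> B" "(q, r) \<in> B" using t by (simp_all add: T'_simps)
    then show ?thesis using center from_x unfolding lift_potential_def by simp
  next
    case thru
    then have b: "(y, p) \<in> B" "(r, y) \<in> B" using t by (simp_all add: T'_simps)
    then have "p \<noteq> x" using B_x by blast
    then show ?thesis using thru to_x[OF b] unfolding lift_potential_def by simp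
  next
    case in_out
    then have "(q, y) \<in> B" "(y, q) \<in> B" using t by (simp_all add: T'_simps)
    then show ?thesis using B_mirror by blast
  next
    case left
    then have b: "(q, y) \<in> B" and o: "(y, q, r) \<in> T - R" using t T'_old[of y q r] by (simp_all add: T'_simps)
    have "(y, nx q y, q) \<in> T" using b B_T nx_eq rot2 rot by blast
    then have "z y q = G y q r - G y (nx q y) q" using corner_potentialD[OF z] o by blast
    then show ?thesis using left old[of y q r] o unfolding lift_potential_def by simp
  next
    case right
    then have b: "(y, q) \<in> B" and o: "(y, p, q) \<in> T - R" using t T'_old[of y p q] by (simp_all add: T'_simps)
    have "(y, q, nx y q) \<in> T" using b B_T link_iff tri_link by blast
    then have "z y q = G y q (nx y q) - G y p q" using corner_potentialD[OF z] o by blast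
    then show ?thesis using right old[of y q p] o unfolding lift_potential_def by simp
  next
    case out
    then have o: "(y, p, q) \<in> T - R" "(y, q, r) \<in> T - R" using t T'_old[of y p q] T'_old[of y q r] by simp_all
    then have "z y q = G y q r - G y p q" using corner_potentialD[OF z] by blast
    then show ?thesis using out old[of y q p] o unfolding lift_potential_def by simp
  qed
qed

lemma finite_B: "finite B"
proof -
  have "B \<subseteq> (\<lambda>(a, b, c). (a, b)) ` T" using B_T by force
  then show ?thesis using finite_T finite_subset by blast
qed

lemma cone_sum:
  fixes h :: "nat \<Rightarrow> nat \<Rightarrow> nat \<Rightarrow> int"
  shows "(\<Sum>(p, q, r)\<in>cone x B. h p q r) = (\<Sum>(p, q)\<in>B. h x p q + (h p q x + h q x p))"
proof -
  let ?C1 = "(\<lambda>(p, q). (x, p, q)) ` B" and ?C2 = "(\<lambda>(p, q). (p, q, x)) ` B" and ?C3 = "(\<lambda>(p, q). (q, x, p)) ` B"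
  have c: "cone x B = ?C1 \<union> (?C2 \<union> ?C3)"
    unfolding cone_def by (auto simp: image_iff split: prod.splits)
  have "(\<Sum>(p, q, r)\<in>cone x B. h p q r) = (\<Sum>(p, q, r)\<in>?C1. h p q r) + ((\<Sum>(p, q, r)\<in>?C2. h p q r) + (\<Sum>(p, q, r)\<in>?C3. h p q r))"
  proof -
    have f: "finite ?C1" "finite ?C2" "finite ?C3" using finite_B by auto
    have d: "?C1 \<inter> (?C2 \<union> ?C3) = {}" "?C2 \<inter> ?C3 = {}" by (auto dest: B_x)
    show ?thesis
      unfolding c sum.union_disjoint[OF f(1) finite_UnI[OF f(2,3)] d(1)] sum.union_disjoint[OF f(2,3) d(2)] ..
  qed
  also have "(\<Sum>(p, q, r)\<in>?C1. h p q r) = (\<Sum>(p, q)\<in>B. h x p q)"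
    by (subst sum.reindex) (auto intro!: inj_onI sum.cong)
  also have "(\<Sum>(p, q, r)\<in>?C2. h p q r) = (\<Sum>(p, q)\<in>B. h p q x)"
    by (subst sum.reindex) (auto intro!: inj_onI sum.cong)
  also have "(\<Sum>(p, q, r)\<in>?C3. h p q r) = (\<Sum>(p, q)\<in>B. h q x p)"
    by (subst sum.reindex) (auto intro!: inj_onI sum.cong)
  finally show ?thesis by (simp add: sum.distrib[symmetric] case_prod_beta)
qed

text \<open>The triangles outside \<open>R\<close> contribute as before. Together with
  \<open>flux_split\<close> this reduces the invariance of the flux under a move to an identity
  between sums over the few elements of \<open>B\<close> and \<open>R\<close>.\<close>

lemma flux_lift:
  assumes old: "\<And>p q c. (p, q, c) \<in> T - R \<or> (p, q) \<in> B \<Longrightarrow> f' p q = f p q"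
  shows "flux T' (lift_potential G g) f' = (\<Sum>(p, q, r)\<in>T - R. (G q r p - G p q r) * f p q) +
     (\<Sum>(p, q)\<in>B. (G p q (nx p q) - g p) * f' x p +
        ((G q (nx p q) p - G p q (nx p q)) * f p q + (g p - G q (nx p q) p) * f' q x))"
proof -
  let ?G = "lift_potential G g"
  have disj: "(T - R) \<inter> cone x B = {}"
    unfolding cone_def by (auto dest: T_x)
  have fin: "finite (T - R)" "finite (cone x B)"
    using finite_T surf.finite_T[OF surf.intro[OF surface_T']] unfolding T'_def by auto
  have "flux T' ?G f' = (\<Sum>(p, q, r)\<in>T - R. (?G q r p - ?G p q r) * f' p q) +
     (\<Sum>(p, q, r)\<in>cone x B. (?G q r p - ?G p q r) * f' p q)"
    unfolding flux_def T'_def by (rule sum.union_disjoint[OF fin disj])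
  also have "(\<Sum>(p, q, r)\<in>T - R. (?G q r p - ?G p q r) * f' p q) = (\<Sum>(p, q, r)\<in>T - R. (G q r p - G p q r) * f p q)"
  proof (rule sum.cong, simp, clarify)
    fix p q r assume t: "(p, q, r) \<in> T" "(p, q, r) \<notin> R"
    then show "(?G q r p - ?G p q r) * f' p q = (G q r p - G p q r) * f p q"
      using old[of p q r] T_x[OF t(1)] unfolding lift_potential_def by simp
  qed
  also have "(\<Sum>(p, q, r)\<in>cone x B. (?G q r p - ?G p q r) * f' p q) =
    (\<Sum>(p, q)\<in>B. (?G p q x - ?G x p q) * f' x p + ((?G q x p - ?G p q x) * f' p q + (?G x p q - ?G q x p) * f' q x))"
    by (rule cone_sum)
  also have "\<dots> = (\<Sum>(p, q)\<in>B. (G p q (nx p q) - g p) * f' x p +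
        ((G q (nx p q) p - G p q (nx p q)) * f p q + (g p - G q (nx p q) p) * f' q x))"
  proof (rule sum.cong, simp, clarify)
    fix p q assume b: "(p, q) \<in> B"
    show "(?G p q x - ?G x p q) * f' x p + ((?G q x p - ?G p q x) * f' p q + (?G x p q - ?G q x p) * f' q x) =
      (G p q (nx p q) - g p) * f' x p + ((G q (nx p q) p - G p q (nx p q)) * f p q + (g p - G q (nx p q) p) * f' q x)"
      using old[of p q] b B_x[OF b] unfolding lift_potential_def by simp
  qed
  finally show ?thesis .
qed

lemma flux_split:
  "flux T G f = (\<Sum>(p, q, r)\<in>T - R. (G q r p - G p q r) * f p q) + (\<Sum>(p, q, r)\<in>R. (G q r p - G p q r) * f p q)"
  unfolding flux_def by (rule sum.subset_diff[OF R_sub finite_T])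

lemma edge_T':
  assumes "{p, q} \<in> edges T" "(p, q) \<in> B \<or> (q, p) \<in> B \<or> (\<exists>c. (p, q, c) \<in> T - R)"
  shows "{p, q} \<in> edges T'"
proof -
  have "(\<exists>c. (p, q, c) \<in> T') \<or> (\<exists>c. (q, p, c) \<in> T')"
    using assms(2) T'_trd unfolding T'_def by blast
  then show ?thesis unfolding edges_def by (auto simp: insert_commute)
qed

lemma edge_x: "(p, q) \<in> B \<Longrightarrow> {x, p} \<in> edges T'" "(p, q) \<in> B \<Longrightarrow> {x, q} \<in> edges T'"
proof -
  assume "(p, q) \<in> B"
  then have "(x, p, q) \<in> T'" "(q, x, p) \<in> T'" by (simp_all add: T'_simps)
  then show "{x, p} \<in> edges T'" "{x, q} \<in> edges T'" unfolding edges_def by (auto simp: insert_commute)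
qed

end

section \<open>Invariance of the pairing under stellar moves\<close>

context surf
begin

lemma star_edge_step:
  assumes e: "{u, v} \<in> edges T" and x: "x \<notin> verts T"
  shows "closed_oriented_surface (stellar T {u, v} x)"
    and "f \<in> cycles T \<Longrightarrow> subdivide_edge u v x f \<in> cycles (stellar T {u, v} x)"
    and "z \<in> cycles T \<Longrightarrow> f \<in> cycles T \<Longrightarrow>
      pairing (stellar T {u, v} x) (subdivide_edge u v x z) (subdivide_edge u v x f) = pairing T z f"
proof -
  obtain a b where t: "(u, v, a) \<in> T" "(v, u, b) \<in> T"
    using e edges_iff link_iff opposite by blast
  note d = edge_star_distinct[OF t]
  define R where "R = {(u, v, a), (v, a, u), (a, u, v), (v, u, b), (u, b, v), (b, v, u)}"
  define B where "B = {(v, a), (a, u), (u, b), (b, v)}"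
  let ?F = "subdivide_edge u v x"
  interpret D: disc_in_surface T R B x unfolding R_def B_def by (rule edge_star_disc[OF t x])
  have T1: "stellar T {u, v} x = D.T'" unfolding stellar_edge_eq[OF t x] D.T'_def unfolding R_def B_def ..
  interpret S: surf D.T' by unfold_locales (rule D.surface_T')
  show "closed_oriented_surface (stellar T {u, v} x)" unfolding T1 by (rule D.surface_T')
  have xn: "u \<noteq> x" "v \<noteq> x" "a \<noteq> x" "b \<noteq> x" "x \<noteq> u" "x \<noteq> v" "x \<noteq> a" "x \<noteq> b"
    using D.T_x[OF t(1)] D.T_x[OF t(2)] by auto
  have nxs: "nx v a = u" "nx a u = v" "nx u b = v" "nx b v = u"
    using t rot rot2 nx_eq by blast+
  have F_old: "?F f p q = f p q" if "p \<noteq> x" "q \<noteq> x" "{p, q} \<noteq> {u, v}" for f p q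
    using that xn unfolding subdivide_edge_def by auto
  have F_x: "?F f u x = f u v" "?F f x v = f u v" "?F f v x = f v u" "?F f x u = f v u"
    "?F f a x = f a x" "?F f x a = f x a" "?F f b x = f b x" "?F f x b = f x b" for f
    using d xn unfolding subdivide_edge_def by (auto simp: doubleton_eq_iff)
  have Rt: "(y, p, q) \<in> R" if "(y, p, q) \<in> T" "{u, v} \<subseteq> {y, p, q}" for y p q
    using edge_star_triangles[OF t that(1)] that(2) unfolding R_def by simp
  have F_T: "?F f p q = f p q" if c: "(p, q, c) \<in> T - R \<or> (p, q) \<in> B" for f p q c
  proof -
    have "p \<noteq> x \<and> q \<noteq> x \<and> {p, q} \<noteq> {u, v}" using c
    proof
      assume tr: "(p, q, c) \<in> T - R"
      then have "\<not> {u, v} \<subseteq> {p, q, c}" using Rt[of p q c] by blast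
      then have "{p, q} \<noteq> {u, v}" by blast
      then show ?thesis using D.T_x[of p q c] tr by blast
    qed (use d xn in \<open>auto simp: doubleton_eq_iff B_def\<close>)
    then show ?thesis using F_old by blast
  qed
  \<comment> \<open>The corners at \<open>x\<close> lie on the two sides of the starred edge. On
    either side they copy the corner at \<open>u\<close> of the former triangle there, so the two
    values differ by \<open>z u v\<close>, the value of the lifted cycle on the halves of the
    edge.\<close>
  define g where "g G p = (if p \<in> {v, a} then G u v a else G u b v)" for G :: "nat \<Rightarrow> nat \<Rightarrow> nat \<Rightarrow> int" and p
  have pot: "corner_potential D.T' (?F z) (D.lift_potential G (g G))"
    if z: "z \<in> cycles T" and G: "corner_potential T z G" for z G
  proof (rule D.lift_potential[OF G])
    fix y p q assume "y \<noteq> x" "q \<noteq> x" "(y, p, q) \<in> T - R \<or> (y, q, p) \<in> T - R"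
    moreover from this have "\<not> {u, v} \<subseteq> {y, p, q} \<or> \<not> {u, v} \<subseteq> {y, q, p}" using Rt[of y p q] Rt[of y q p] by blast
    then have "{y, q} \<noteq> {u, v}" by blast
    ultimately show "?F z y q = z y q" using F_old by blast
  next
    have zu: "z u v = G u v a - G u b v" "z v u = G v u b - G v a u"
      using corner_potentialD[OF G rot[OF t(2)] t(1)] corner_potentialD[OF G rot[OF t(1)] t(2)] .
    have z0: "z a x = 0" "z b x = 0" "z x a = 0" "z x b = 0" using cycle_outside[OF z x] by auto
    have anti: "z v u = - z u v" by (rule cycles_antisym[OF z])
    show "?F z y x = G y (nx r y) r - G y p (nx y p)" if "(y, p) \<in> B" "(r, y) \<in> B" for y p r
      using that d nxs F_x[of z] zu z0 unfolding B_def by auto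
    have zx: "?F z x a = 0" "?F z x b = 0" "?F z x u = G u b v - G u v a" "?F z x v = G u v a - G u b v"
      using F_x[of z] z0 zu(1) anti by simp_all
    have gs: "g G v = G u v a" "g G a = G u v a" "g G u = G u b v" "g G b = G u b v"
      using d unfolding g_def by simp_all
    show "?F z x q = g G q - g G p" if "(p, q) \<in> B" for p q
      using that unfolding B_def by (auto simp: zx gs)
  qed
  have cyc: "?F f \<in> cycles D.T'" if f: "f \<in> cycles T" for f
  proof -
    obtain G where G: "corner_potential T f G" using potential_exists f by blast
    show ?thesis
    proof (rule S.cycle_if_potential[OF _ _ pot[OF f G]])
      fix p q
      show "?F f q p = - ?F f p q"
        by (rule subdivide_edge_antisym[OF cycles_antisym[OF f]]) (use d xn in auto)
      show "?F f p q = 0" if ne: "{p, q} \<notin> edges D.T'"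
      proof -
        have "{x, u} \<in> edges D.T'" "{x, v} \<in> edges D.T'" using D.edge_x(1)[of u b] D.edge_x(1)[of v a] unfolding B_def by auto
        then have 1: "(p, q) \<notin> {(u, x), (x, v), (v, x), (x, u)}" using ne by (auto simp: insert_commute)
        have "f p q = 0" if n: "{p, q} \<noteq> {u, v}"
        proof (rule ccontr)
          assume "f p q \<noteq> 0"
          then have pq: "{p, q} \<in> edges T" using cycles_edge f by blast
          then obtain c where c: "(p, q, c) \<in> T" using edges_iff link_iff by blast
          have "(p, q, c) \<in> R \<Longrightarrow> (p, q) \<in> B" using n unfolding R_def B_def by auto
          then show False using D.edge_T'[OF pq] c ne by blast
        qed
        moreover have "(p, q) \<notin> {(u, x), (x, v)}" "(p, q) \<notin> {(v, x), (x, u)}" using 1 by auto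
        ultimately show ?thesis unfolding subdivide_edge_def by (cases "{p, q} = {u, v}") (simp_all only: if_False if_True simp_thms)
      qed
    qed
  qed
  then show "f \<in> cycles T \<Longrightarrow> ?F f \<in> cycles (stellar T {u, v} x)" unfolding T1 .
  assume z: "z \<in> cycles T" and f: "f \<in> cycles T"
  obtain G where G: "corner_potential T z G" using potential_exists z by blast
  have f0: "f a x = 0" "f b x = 0" "f x a = 0" "f x b = 0" using cycle_outside[OF f x] by auto
  have "pairing D.T' (?F z) (?F f) = flux D.T' (D.lift_potential G (g G)) (?F f)"
    by (rule S.pairing_eq[OF pot[OF z G] cyc[OF z] cyc[OF f]])
  also have "\<dots> = flux T G f"
  proof -
    have "(\<Sum>(p, q)\<in>B. (G p q (nx p q) - g G p) * ?F f x p +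
        ((G q (nx p q) p - G p q (nx p q)) * f p q + (g G p - G q (nx p q) p) * ?F f q x)) =
      (\<Sum>(p, q, r)\<in>R. (G q r p - G p q r) * f p q)"
      using d nxs F_x[of f] f0 unfolding B_def R_def by (simp add: g_def algebra_simps)
    then show ?thesis using D.flux_lift[where f = f and f' = "?F f", OF F_T] D.flux_split[of G f] by simp
  qed
  also have "\<dots> = pairing T z f" using pairing_eq[OF G z f] by simp
  finally show "pairing (stellar T {u, v} x) (?F z) (?F f) = pairing T z f" unfolding T1 .
qed

lemma star_triangle_step:
  assumes e: "\<sigma> \<in> triangles T" and x: "x \<notin> verts T"
  shows "closed_oriented_surface (stellar T \<sigma> x)"
    and "f \<in> cycles T \<Longrightarrow> f \<in> cycles (stellar T \<sigma> x)"
    and "z \<in> cycles T \<Longrightarrow> f \<in> cycles T \<Longrightarrow> pairing (stellar T \<sigma> x) z f = pairing T z f"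
proof -
  obtain a b c where \<sigma>: "\<sigma> = {a, b, c}" and t: "(a, b, c) \<in> T" using e unfolding triangles_def by blast
  note d = tri_distinct[OF t]
  define R where "R = {(a, b, c), (b, c, a), (c, a, b)}"
  define B where "B = {(a, b), (b, c), (c, a)}"
  interpret D: disc_in_surface T R B x unfolding R_def B_def by (rule triangle_star_disc[OF t x])
  have T1: "stellar T \<sigma> x = D.T'" unfolding \<sigma> stellar_triangle_eq[OF t x] D.T'_def unfolding R_def B_def ..
  interpret S: surf D.T' by unfold_locales (rule D.surface_T')
  show "closed_oriented_surface (stellar T \<sigma> x)" unfolding T1 by (rule D.surface_T')
  have nxs: "nx a b = c" "nx b c = a" "nx c a = b"
    using t rot rot2 nx_eq by blast+
  \<comment> \<open>No cycle of the old surface runs through \<open>x\<close>, so the corners at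
    \<open>x\<close> may take any common value; \<open>0\<close> is used.\<close>
  have pot: "corner_potential D.T' z (D.lift_potential G (\<lambda>_. 0))"
    if z: "z \<in> cycles T" and G: "corner_potential T z G" for z G
  proof (rule D.lift_potential[OF G])
    show "z y x = G y (nx r y) r - G y p (nx y p)" if "(y, p) \<in> B" "(r, y) \<in> B" for y p r
      using that d nxs cycle_outside[OF z x] unfolding B_def by auto
  qed (use cycle_outside[OF z x] in auto)
  have cyc: "f \<in> cycles D.T'" if f: "f \<in> cycles T" for f
  proof -
    obtain G where G: "corner_potential T f G" using potential_exists f by blast
    show ?thesis
    proof (rule S.cycle_if_potential[OF _ _ pot[OF f G]])
      fix p q
      show "f q p = - f p q" by (rule cycles_antisym[OF f])
      show "f p q = 0" if ne: "{p, q} \<notin> edges D.T'"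
      proof (rule ccontr)
        assume "f p q \<noteq> 0"
        then have pq: "{p, q} \<in> edges T" using cycles_edge f by blast
        then obtain r where r: "(p, q, r) \<in> T" using edges_iff link_iff by blast
        have "(p, q, r) \<in> R \<Longrightarrow> (p, q) \<in> B" unfolding R_def B_def by auto
        then show False using D.edge_T'[OF pq] r ne by blast
      qed
    qed
  qed
  then show "f \<in> cycles T \<Longrightarrow> f \<in> cycles (stellar T \<sigma> x)" unfolding T1 .
  assume z: "z \<in> cycles T" and f: "f \<in> cycles T"
  obtain G where G: "corner_potential T z G" using potential_exists z by blast
  have f0: "f p x = 0" "f x p = 0" for p using cycle_outside[OF f x] by auto
  have "pairing D.T' z f = flux D.T' (D.lift_potential G (\<lambda>_. 0)) f"
    by (rule S.pairing_eq[OF pot[OF z G] cyc[OF z] cyc[OF f]])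
  also have "\<dots> = flux T G f"
  proof -
    have "(\<Sum>(p, q)\<in>B. (G p q (nx p q) - 0) * f x p +
        ((G q (nx p q) p - G p q (nx p q)) * f p q + (0 - G q (nx p q) p) * f q x)) =
      (\<Sum>(p, q, r)\<in>R. (G q r p - G p q r) * f p q)"
      using d nxs f0 unfolding B_def R_def by (simp add: algebra_simps)
    then show ?thesis using D.flux_lift[where f = f and f' = f, OF refl, of G "\<lambda>_. 0"] D.flux_split[of G f] by simp
  qed
  also have "\<dots> = pairing T z f" using pairing_eq[OF G z f] by simp
  finally show "pairing (stellar T \<sigma> x) z f = pairing T z f" unfolding T1 .
qed

text \<open>The value of the pairing can be computed in any subdivision. This is the source of
  uniqueness in \<open>intersection_number\<close>.\<close>

lemma subdivision_pairing:
  assumes "subdivision T T1 F"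
  shows "closed_oriented_surface T1 \<and> (\<forall>f\<in>cycles T. F f \<in> cycles T1) \<and>
    (\<forall>z\<in>cycles T. \<forall>f\<in>cycles T. pairing T1 (F z) (F f) = pairing T z f)"
  using assms
proof (induction rule: subdivision.induct)
  case trivial
  show ?case using surface by simp
next
  case (star_edge T1 F u v x)
  then interpret S: surf T1 by unfold_locales blast
  show ?case using S.star_edge_step[OF star_edge.hyps(2,3)] star_edge.IH by simp
next
  case (star_triangle T1 F \<sigma> x)
  then interpret S: surf T1 by unfold_locales blast
  show ?case using S.star_triangle_step[OF star_triangle.hyps(2,3)] star_triangle.IH by simp
qed

end

section \<open>Barycentric subdivision\<close>

definition edge_bd :: "surface \<Rightarrow> nat set \<Rightarrow> (nat \<times> nat) set" where
  "edge_bd T \<sigma> = {(p, q). \<exists>r. (p, q, r) \<in> T \<and> {p, q, r} = \<sigma>}"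

context surf
begin

text \<open>Fresh vertices, serving as barycentres of the simplices \<open>\<sigma>\<close>.\<close>

definition nm :: "nat set \<Rightarrow> nat" where "nm \<sigma> = Suc (Max (verts T)) + set_encode \<sigma>"

lemma nm_new: "nm \<sigma> \<notin> verts T"
  unfolding nm_def using Max_ge[OF finite_verts, of "Suc (Max (verts T)) + set_encode \<sigma>"] by auto

lemma nm_eq: "finite \<sigma> \<Longrightarrow> finite \<tau> \<Longrightarrow> nm \<sigma> = nm \<tau> \<longleftrightarrow> \<sigma> = \<tau>"
  unfolding nm_def using set_encode_inverse by (metis add_left_cancel)

lemma nm_vert: "v \<in> verts T \<Longrightarrow> nm \<sigma> \<noteq> v" "v \<in> verts T \<Longrightarrow> v \<noteq> nm \<sigma>"
  using nm_new by blast+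

lemma nm_tri: assumes "(a, b, c) \<in> T" shows "nm \<sigma> \<noteq> a" "nm \<sigma> \<noteq> b" "nm \<sigma> \<noteq> c" "a \<noteq> nm \<sigma>" "b \<noteq> nm \<sigma>" "c \<noteq> nm \<sigma>"
  using tri_verts_mem[OF assms] nm_vert by blast+

lemma edge_bd_triangle:
  assumes "(a, b, c) \<in> T" shows "edge_bd T {a, b, c} = {(a, b), (b, c), (c, a)}"
proof -
  have "{b, c, a} = {a, b, c}" "{c, a, b} = {a, b, c}" by auto
  then have "(p, q) \<in> edge_bd T {a, b, c}" if "(p, q) \<in> {(a, b), (b, c), (c, a)}" for p q
    using that assms rot[OF assms] rot2[OF assms] unfolding edge_bd_def by blast
  moreover have "(p, q) \<in> {(a, b), (b, c), (c, a)}" if "(p, q) \<in> edge_bd T {a, b, c}" for p q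
    using that same_triangle[OF assms] unfolding edge_bd_def by blast
  ultimately show ?thesis by (intro equalityI subrelI)
qed

lemma edge_bd_vert: "(p, q) \<in> edge_bd T \<sigma> \<Longrightarrow> p \<in> verts T \<and> q \<in> verts T"
  unfolding edge_bd_def using tri_verts_mem by blast

text \<open>The barycentric subdivision is reached by starring all triangles and then all edges, one
  at a time. This is a closed form of the surface after the triangles in \<open>S\<close>,
  independent of their order, for the induction over single moves.\<close>

definition star_triangles :: "nat set set \<Rightarrow> surface" where
  "star_triangles S = {(p, q, r) \<in> T. {p, q, r} \<notin> S} \<union> (\<Union>\<sigma>\<in>S. cone (nm \<sigma>) (edge_bd T \<sigma>))"

lemma star_triangles_old: "p \<in> verts T \<Longrightarrow> q \<in> verts T \<Longrightarrow> r \<in> verts T \<Longrightarrow>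
  (p, q, r) \<in> star_triangles S \<longleftrightarrow> (p, q, r) \<in> T \<and> {p, q, r} \<notin> S"
  unfolding star_triangles_def cone_def using nm_vert by auto

lemma star_triangles_verts: "verts (star_triangles S) \<subseteq> verts T \<union> nm ` S"
proof
  fix v assume "v \<in> verts (star_triangles S)"
  then obtain b c where "(v, b, c) \<in> star_triangles S" unfolding verts_def by blast
  then consider "(v, b, c) \<in> T" | \<sigma> where "\<sigma> \<in> S" "(v, b, c) \<in> cone (nm \<sigma>) (edge_bd T \<sigma>)"
    unfolding star_triangles_def by blast
  then show "v \<in> verts T \<union> nm ` S"
  proof cases
    case 1
    then show ?thesis using tri_verts_mem by blast
  next
    case 2
    then show ?thesis using edge_bd_vert unfolding cone_def by blast
  qed
qed

lemma star_triangles_subdivision: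
  assumes "finite S" "S \<subseteq> triangles T" shows "subdivision T (star_triangles S) id"
  using assms
proof (induction S rule: finite_induct)
  case empty
  have "star_triangles {} = T" unfolding star_triangles_def by auto
  then show ?case using subdivision.trivial[of T] by (simp only:)
next
  case (insert \<sigma> S)
  then have IH: "subdivision T (star_triangles S) id" by blast
  interpret S: surf "star_triangles S" by unfold_locales (use subdivision_pairing[OF IH] in blast)
  obtain a b c where \<sigma>: "\<sigma> = {a, b, c}" and t: "(a, b, c) \<in> T"
    using insert.prems unfolding triangles_def by blast
  note v = tri_verts_mem[OF t]
  have tS: "(a, b, c) \<in> star_triangles S" using star_triangles_old v t insert.hyps(2) \<sigma> by blast
  have fin: "finite \<tau>" if "\<tau> \<in> S" for \<tau> using that insert.prems unfolding triangles_def by auto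
  have new: "nm \<sigma> \<notin> verts (star_triangles S)"
  proof
    assume "nm \<sigma> \<in> verts (star_triangles S)"
    then obtain \<tau> where "\<tau> \<in> S" "nm \<sigma> = nm \<tau>" using star_triangles_verts nm_new by blast
    moreover have "finite \<sigma>" using \<sigma> by simp
    ultimately show False using nm_eq fin insert.hyps(2) by blast
  qed
  let ?R = "{(a, b, c), (b, c, a), (c, a, b)}"
  have R: "?R = {(p, q, r) \<in> T. {p, q, r} = \<sigma>}"
  proof -
    have "{b, c, a} = {a, b, c}" "{c, a, b} = {a, b, c}" by auto
    then have "s \<in> {(p, q, r) \<in> T. {p, q, r} = \<sigma>}" if "s \<in> ?R" for s
      using that t rot[OF t] rot2[OF t] unfolding \<sigma> by blast
    moreover have "s \<in> ?R" if "s \<in> {(p, q, r) \<in> T. {p, q, r} = \<sigma>}" for s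
    proof -
      obtain p q r where pqr: "s = (p, q, r)" by (rule prod_cases3)
      show ?thesis using that same_triangle[OF t, of p q r] unfolding \<sigma> pqr by simp
    qed
    ultimately show ?thesis by (intro equalityI subsetI)
  qed
  have c0: "cone (nm \<tau>) (edge_bd T \<tau>) \<inter> T = {}" for \<tau>
    unfolding cone_def using nm_tri by blast
  have alg: "P' \<union> (K \<union> C) = ((P \<union> C) - Q) \<union> K" if "P' = P - Q" "C \<inter> Q = {}" for P P' Q C K :: surface
    using that by blast
  have "{(p, q, r) \<in> T. {p, q, r} \<notin> insert \<sigma> S} = {(p, q, r) \<in> T. {p, q, r} \<notin> S} - ?R"
    unfolding R by blast
  moreover have "(\<Union>\<sigma>\<in>S. cone (nm \<sigma>) (edge_bd T \<sigma>)) \<inter> ?R = {}"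
  proof -
    have "?R \<subseteq> T" unfolding R by blast
    then show ?thesis using c0 by blast
  qed
  ultimately have "star_triangles (insert \<sigma> S) = (star_triangles S - ?R) \<union> cone (nm \<sigma>) (edge_bd T \<sigma>)"
    unfolding star_triangles_def UN_insert by (rule alg)
  also have "\<dots> = stellar (star_triangles S) \<sigma> (nm \<sigma>)"
    using S.stellar_triangle_eq[OF tS, of "nm \<sigma>"] new unfolding edge_bd_triangle[OF t] \<sigma> by simp
  finally have eq: "star_triangles (insert \<sigma> S) = stellar (star_triangles S) \<sigma> (nm \<sigma>)" .
  have "\<sigma> \<in> triangles (star_triangles S)" using S.triangles_iff tS unfolding \<sigma> by blast
  from subdivision.star_triangle[OF IH this new] show ?case unfolding eq .
qed

text \<open>The boundary of the star of an edge once all triangles have been starred.\<close>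

definition star_bd :: "nat set \<Rightarrow> (nat \<times> nat) set" where
  "star_bd e = {(x, y). \<exists>p q r. (p, q, r) \<in> T \<and> {p, q} = e \<and>
     ((x, y) = (q, nm {p, q, r}) \<or> (x, y) = (nm {p, q, r}, p))}"

text \<open>Closed form of the second phase: each triangle over an edge outside \<open>E\<close>,
  with the barycentre as apex, is still whole; over the edges in \<open>E\<close> these triangles
  have been cut at the midpoint.\<close>

definition star_edges :: "nat set set \<Rightarrow> surface" where
  "star_edges E = (\<Union>(p, q, r)\<in>{(p, q, r) \<in> T. {p, q} \<notin> E}. cone (nm {p, q, r}) {(p, q)}) \<union>
     (\<Union>e\<in>E. cone (nm e) (star_bd e))"

lemma star_edges_empty: "star_edges {} = star_triangles (triangles T)"
proof -
  have t: "{p, q, r} \<in> triangles T" if "(p, q, r) \<in> T" for p q r using that triangles_iff by blast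
  have "star_triangles (triangles T) = (\<Union>\<sigma>\<in>triangles T. cone (nm \<sigma>) (edge_bd T \<sigma>))"
    unfolding star_triangles_def using t by auto
  also have "\<dots> = (\<Union>(p, q, r)\<in>T. cone (nm {p, q, r}) {(p, q)})"
    unfolding cone_def edge_bd_def using t by fastforce
  finally show ?thesis unfolding star_edges_def by simp
qed

lemma star_bd_edge:
  assumes t: "(u, v, a) \<in> T" "(v, u, b) \<in> T"
  shows "star_bd {u, v} = {(v, nm {u, v, a}), (nm {u, v, a}, u), (u, nm {v, u, b}), (nm {v, u, b}, v)}"
proof -
  have "(p, q, r) = (u, v, a) \<or> (p, q, r) = (v, u, b)" if "(p, q, r) \<in> T" "{p, q} = {u, v}" for p q r
    using that t tri_unique by (metis doubleton_eq_iff)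
  moreover have "{v, u} = {u, v}" by auto
  ultimately show ?thesis using t unfolding star_bd_def by blast
qed

lemma edge_cases: assumes "e \<in> edges T" obtains u v a b where "e = {u, v}" "(u, v, a) \<in> T" "(v, u, b) \<in> T"
  using assms opposite unfolding edges_def by blast

lemma star_edges_verts:
  assumes "E \<subseteq> edges T" shows "verts (star_edges E) \<subseteq> verts T \<union> nm ` (triangles T \<union> E)"
proof
  fix v assume "v \<in> verts (star_edges E)"
  then obtain b c where "(v, b, c) \<in> star_edges E" unfolding verts_def by blast
  then consider p q r where "(p, q, r) \<in> T" "(v, b, c) \<in> cone (nm {p, q, r}) {(p, q)}"
    | e where "e \<in> E" "(v, b, c) \<in> cone (nm e) (star_bd e)"
    unfolding star_edges_def by blast
  then show "v \<in> verts T \<union> nm ` (triangles T \<union> E)"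
  proof cases
    case 1
    then have "v = nm {p, q, r} \<or> v = p \<or> v = q" "{p, q, r} \<in> triangles T"
      using triangles_iff unfolding cone_def by auto
    then show ?thesis using tri_verts_mem[OF 1(1)] by blast
  next
    case 2
    then have "v = nm e \<or> (\<exists>y. (v, y) \<in> star_bd e \<or> (y, v) \<in> star_bd e)" unfolding cone_def by blast
    moreover have "v \<in> verts T \<union> nm ` triangles T" if "(v, y) \<in> star_bd e \<or> (y, v) \<in> star_bd e" for y
      using that tri_verts_mem triangles_iff unfolding star_bd_def by auto
    ultimately show ?thesis using 2(1) by blast
  qed
qed

text \<open>Pins down the subdivided chain by its values: both halves of a starred edge carry the
  old value, other old edges are unchanged, and all else is zero. No trace of the order of the moves
  remains.\<close>

definition edges_lift :: "nat set set \<Rightarrow> chain \<Rightarrow> chain \<Rightarrow> bool" where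
  "edges_lift E f f' \<longleftrightarrow>
     (\<forall>a b. {a, b} \<in> E \<longrightarrow> f' a (nm {a, b}) = f a b \<and> f' (nm {a, b}) b = f a b) \<and>
     (\<forall>a b. {a, b} \<in> edges T - E \<longrightarrow> f' a b = f a b) \<and>
     (\<forall>x y. f' x y \<noteq> 0 \<longrightarrow> {x, y} \<in> edges T - E \<or>
        (\<exists>a b. {a, b} \<in> E \<and> ((x, y) = (a, nm {a, b}) \<or> (x, y) = (nm {a, b}, b))))"

lemma edges_lift_step:
  assumes lift: "edges_lift E f f'" and E: "E \<subseteq> edges T" and e: "{u, v} \<in> edges T" "{u, v} \<notin> E"
    and anti: "\<And>a b. f b a = - f a b"
  shows "edges_lift (insert {u, v} E) f (subdivide_edge u v (nm {u, v}) f')"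
proof -
  let ?m = "nm {u, v}" and ?f = "subdivide_edge u v (nm {u, v}) f'"
  have L1: "f' a (nm {a, b}) = f a b" "f' (nm {a, b}) b = f a b" if "{a, b} \<in> E" for a b
    using lift that unfolding edges_lift_def by blast+
  have L2: "f' a b = f a b" if "{a, b} \<in> edges T" "{a, b} \<notin> E" for a b
    using lift that unfolding edges_lift_def by blast
  have L3: "{x, y} \<in> edges T - E \<or>
        (\<exists>a b. {a, b} \<in> E \<and> ((x, y) = (a, nm {a, b}) \<or> (x, y) = (nm {a, b}, b)))" if "f' x y \<noteq> 0" for x y
    using lift that unfolding edges_lift_def by blast
  have ev: "a \<in> verts T" "b \<in> verts T" if "{a, b} \<in> edges T" for a b
    using that edges_iff link_subset link_sym by blast+
  have uv: "u \<noteq> v" using e edges_iff edge_ne by blast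
  have m: "?m \<noteq> a" "a \<noteq> ?m" if "{a, b} \<in> edges T" for a b using ev[OF that] nm_vert by blast+
  have muv: "?m \<noteq> u" "?m \<noteq> v" "u \<noteq> ?m" "v \<noteq> ?m" using ev[OF e(1)] nm_vert by blast+
  have fuv: "f' u v = f u v" "f' v u = f v u" using L2 e by (auto simp: insert_commute)
  have at: "?f u ?m = f u v" "?f ?m v = f u v" "?f v ?m = f v u" "?f ?m u = f v u"
    using uv muv fuv unfolding subdivide_edge_def by auto
  have other: "?f x y = f' x y" if "x \<noteq> ?m" "y \<noteq> ?m" "{x, y} \<noteq> {u, v}" for x y
    using that unfolding subdivide_edge_def by auto
  have nmE: "nm e' \<noteq> ?m" "e' \<noteq> {u, v}" if "e' \<in> E" for e'
  proof -
    show ne: "e' \<noteq> {u, v}" using that e by blast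
    have "finite e'" using that E unfolding edges_def by auto
    then show "nm e' \<noteq> ?m" using nm_eq[of e' "{u, v}"] ne by simp
  qed
  have nmv: "{x, nm e'} \<noteq> {u, v}" "{nm e', x} \<noteq> {u, v}" for x e'
  proof -
    have "nm e' \<noteq> u" "nm e' \<noteq> v" using ev[OF e(1)] nm_vert by blast+
    then show "{x, nm e'} \<noteq> {u, v}" "{nm e', x} \<noteq> {u, v}" by auto
  qed
  show ?thesis unfolding edges_lift_def
  proof (intro conjI allI impI)
    fix a b assume ab: "{a, b} \<in> insert {u, v} E"
    show "?f a (nm {a, b}) = f a b" "?f (nm {a, b}) b = f a b"
    proof (atomize (full), cases "{a, b} = {u, v}")
      case True
      then have "(a = u \<and> b = v) \<or> (a = v \<and> b = u)" by (simp add: doubleton_eq_iff)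
      then show "?f a (nm {a, b}) = f a b \<and> ?f (nm {a, b}) b = f a b" using at True by auto
    next
      case False
      then have ab: "{a, b} \<in> E" "{a, b} \<in> edges T" using ab E by auto
      have "?f a (nm {a, b}) = f' a (nm {a, b})" "?f (nm {a, b}) b = f' (nm {a, b}) b"
      proof -
        have "a \<noteq> ?m" "b \<noteq> ?m" using ev[OF ab(2)] nm_vert by blast+
        then show "?f a (nm {a, b}) = f' a (nm {a, b})" "?f (nm {a, b}) b = f' (nm {a, b}) b"
          using other[OF _ nmE(1)[OF ab(1)] nmv(1)] other[OF nmE(1)[OF ab(1)] _ nmv(2)] by blast+
      qed
      then show "?f a (nm {a, b}) = f a b \<and> ?f (nm {a, b}) b = f a b" using L1[OF ab(1)] by simp
    qed
  next
    fix a b assume ab: "{a, b} \<in> edges T - insert {u, v} E"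
    then have "a \<noteq> ?m" "b \<noteq> ?m" "{a, b} \<noteq> {u, v}" using ev[of a b] nm_vert by blast+
    then have "?f a b = f' a b" by (rule other)
    then show "?f a b = f a b" using L2 ab by simp
  next
    fix x y assume nz: "?f x y \<noteq> 0"
    show "{x, y} \<in> edges T - insert {u, v} E \<or>
        (\<exists>a b. {a, b} \<in> insert {u, v} E \<and> ((x, y) = (a, nm {a, b}) \<or> (x, y) = (nm {a, b}, b)))"
    proof (cases "(x, y) \<in> {(u, ?m), (?m, v), (v, ?m), (?m, u)}")
      case True
      moreover have "{v, u} = {u, v}" by auto
      ultimately have "(x, y) = (u, nm {u, v}) \<or> (x, y) = (nm {u, v}, v) \<or> (x, y) = (v, nm {v, u}) \<or> (x, y) = (nm {v, u}, u)"
        by simp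
      then show ?thesis using insertI1[of "{u, v}" E] \<open>{v, u} = {u, v}\<close> by (elim disjE) (rule disjI2, metis)+
    next
      case False
      then have "(x, y) \<notin> {(u, ?m), (?m, v)}" "(x, y) \<notin> {(v, ?m), (?m, u)}" by auto
      then have "?f x y = (if {x, y} = {u, v} then 0 else f' x y)" unfolding subdivide_edge_def by (simp only: if_False)
      then have ne: "{x, y} \<noteq> {u, v}" "f' x y \<noteq> 0" using nz by (metis, metis)
      from L3[OF ne(2)] ne(1) show ?thesis by blast
    qed
  qed
qed

lemma star_edges_subdivision:
  assumes "finite E" "E \<subseteq> edges T"
  shows "\<exists>F. subdivision T (star_edges E) F \<and> (\<forall>f\<in>cycles T. edges_lift E f (F f))"
  using assms
proof (induction E rule: finite_induct)
  case empty
  have "subdivision T (star_edges {}) id"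
    unfolding star_edges_empty by (rule star_triangles_subdivision[OF finite_triangles]) simp
  moreover have "edges_lift {} f (id f)" if "f \<in> cycles T" for f
    using cycles_edge[OF that] unfolding edges_lift_def by auto
  ultimately show ?case by blast
next
  case (insert e E)
  then obtain F where F: "subdivision T (star_edges E) F" "\<And>f. f \<in> cycles T \<Longrightarrow> edges_lift E f (F f)" by auto
  interpret S: surf "star_edges E" by unfold_locales (use subdivision_pairing[OF F(1)] in blast)
  obtain u v a b where e: "e = {u, v}" and t: "(u, v, a) \<in> T" "(v, u, b) \<in> T"
    using edge_cases insert.prems by blast
  note d = edge_star_distinct[OF t]
  let ?ta = "nm {u, v, a}" and ?tb = "nm {v, u, b}"
  have eE: "{u, v} \<notin> E" "{v, u} \<notin> E" using insert.hyps(2) e by (auto simp: insert_commute)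
  have "(u, v, ?ta) \<in> cone ?ta {(u, v)}" "(v, u, ?tb) \<in> cone ?tb {(v, u)}" unfolding cone_def by auto
  then have tS: "(u, v, ?ta) \<in> star_edges E" "(v, u, ?tb) \<in> star_edges E"
    using t eE unfolding star_edges_def by blast+
  have fin: "finite \<tau>" if "\<tau> \<in> triangles T \<union> E" for \<tau>
    using that insert.prems unfolding triangles_def edges_def by auto
  have new: "nm e \<notin> verts (star_edges E)"
  proof
    assume "nm e \<in> verts (star_edges E)"
    then obtain \<tau> where \<tau>: "\<tau> \<in> triangles T \<union> E" "nm e = nm \<tau>"
      using star_edges_verts[of E] insert.prems nm_new by blast
    moreover have "finite e" using e by simp
    ultimately have "e = \<tau>" using nm_eq fin by blast
    then have "e \<in> triangles T" using \<tau>(1) insert.hyps(2) by blast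
    then obtain p q r where pqr: "e = {p, q, r}" "(p, q, r) \<in> T" unfolding triangles_def by blast
    have "card e = 3" unfolding pqr using tri_distinct[OF pqr(2)] by simp
    moreover have "card e = 2" unfolding e using d by simp
    ultimately show False by simp
  qed
  let ?R = "{(u, v, ?ta), (v, ?ta, u), (?ta, u, v), (v, u, ?tb), (u, ?tb, v), (?tb, v, u)}"
  let ?P = "\<lambda>E. (\<Union>(p, q, r)\<in>{(p, q, r) \<in> T. {p, q} \<notin> E}. cone (nm {p, q, r}) {(p, q)})"
  have R: "?R = cone ?ta {(u, v)} \<union> cone ?tb {(v, u)}" unfolding cone_def by auto
  have uvT: "(p, q, r) = (u, v, a) \<or> (p, q, r) = (v, u, b)" if "(p, q, r) \<in> T" "{p, q} = e" for p q r
    using that t tri_unique unfolding e by (metis doubleton_eq_iff)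
  have dis: "cone (nm {p, q, r}) {(p, q)} \<inter> ?R = {}" if pqr: "(p, q, r) \<in> T" "{p, q} \<noteq> e" for p q r
  proof -
    have "(p, q) \<noteq> (u, v)" "(p, q) \<noteq> (v, u)" using pqr(2) e by auto
    then show ?thesis unfolding R cone_def using nm_tri[OF pqr(1)] nm_tri[OF t(1)] nm_tri[OF t(2)] by blast
  qed
  have dis2: "cone (nm e') (star_bd e') \<inter> ?R = {}" if e': "e' \<in> E" for e'
  proof -
    obtain u' v' a' b' where e2: "e' = {u', v'}" and t': "(u', v', a') \<in> T" "(v', u', b') \<in> T"
      using edge_cases insert.prems e' by blast
    have "nm e' \<noteq> ?ta" "nm e' \<noteq> ?tb"
    proof -
      have "card e' = 2" using e2 edge_star_distinct[OF t'] by simp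
      moreover have "card {u, v, a} = 3" "card {v, u, b} = 3" using d by auto
      ultimately have "e' \<noteq> {u, v, a}" "e' \<noteq> {v, u, b}" by force+
      then show "nm e' \<noteq> ?ta" "nm e' \<noteq> ?tb" using nm_eq e2 by auto
    qed
    then show ?thesis unfolding R cone_def using nm_tri[OF t(1)] nm_tri[OF t(2)] by blast
  qed
  have P1: "?P (insert e E) \<subseteq> ?P E - ?R" using dis by fastforce
  have P2: "?P E \<subseteq> ?P (insert e E) \<union> ?R"
  proof
    fix s assume "s \<in> ?P E"
    then obtain p q r where pqr: "(p, q, r) \<in> T" "{p, q} \<notin> E" "s \<in> cone (nm {p, q, r}) {(p, q)}" by blast
    show "s \<in> ?P (insert e E) \<union> ?R"
    proof (cases "{p, q} = e")
      case True
      then show ?thesis using uvT[OF pqr(1)] pqr(3) unfolding R by blast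
    next
      case False
      then show ?thesis using pqr by blast
    qed
  qed
  have alg: "P' \<union> (K \<union> C) = ((P \<union> C) - Q) \<union> K"
    if "P' \<subseteq> P - Q" "P \<subseteq> P' \<union> Q" "C \<inter> Q = {}" for P P' Q C K :: surface
    using that by blast
  have "(\<Union>e\<in>E. cone (nm e) (star_bd e)) \<inter> ?R = {}" using dis2 by blast
  then have "star_edges (insert e E) = (star_edges E - ?R) \<union> cone (nm e) (star_bd e)"
    unfolding star_edges_def UN_insert by (rule alg[OF P1 P2])
  also have "\<dots> = stellar (star_edges E) e (nm e)"
    using S.stellar_edge_eq[OF tS, of "nm e"] new unfolding star_bd_edge[OF t] e by simp
  finally have eq: "star_edges (insert e E) = stellar (star_edges E) {u, v} (nm e)" unfolding e .
  have "{u, v} \<in> edges (star_edges E)" using tS unfolding edges_def by blast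
  then have "subdivision T (star_edges (insert e E)) (subdivide_edge u v (nm e) \<circ> F)"
    unfolding eq using subdivision.star_edge[OF F(1) _ new] by blast
  moreover have "edges_lift (insert e E) f ((subdivide_edge u v (nm e) \<circ> F) f)" if f: "f \<in> cycles T" for f
    using edges_lift_step[OF F(2)[OF f] _ _ eE(1) cycles_antisym[OF f]] insert.prems e by simp
  ultimately show ?case by blast
qed

definition bary :: surface where "bary = star_edges (edges T)"

lemma bary_subdivision:
  obtains F where "subdivision T bary F" "\<And>f. f \<in> cycles T \<Longrightarrow> edges_lift (edges T) f (F f)"
  using star_edges_subdivision[OF finite_edges order_refl] unfolding bary_def by blast

lemma bary_eq: "bary = (\<Union>(p, q, r)\<in>T. cone (nm {p, q}) {(q, nm {p, q, r}), (nm {p, q, r}, p)})"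
proof -
  let ?ed = "\<lambda>(p, q, r). {p, q}" and ?b = "\<lambda>(p, q, r). {(q, nm {p, q, r}), (nm {p, q, r}, p)}"
  have e: "?ed t \<in> edges T" if "t \<in> T" for t using that unfolding edges_def by (cases t) auto
  have none: "(\<Union>(p, q, r)\<in>{(p, q, r) \<in> T. {p, q} \<notin> edges T}. cone (nm {p, q, r}) {(p, q)}) = {}"
    using e by force
  have bd: "star_bd \<epsilon> = (\<Union>t\<in>{t \<in> T. ?ed t = \<epsilon>}. ?b t)" for \<epsilon>
    unfolding star_bd_def by force
  have cone_UN: "cone x (\<Union>i\<in>I. B i) = (\<Union>i\<in>I. cone x (B i))" for x I and B :: "nat \<times> nat \<times> nat \<Rightarrow> _"
    unfolding cone_def by blast
  have "bary = (\<Union>\<epsilon>\<in>edges T. \<Union>t\<in>{t \<in> T. ?ed t = \<epsilon>}. cone (nm \<epsilon>) (?b t))"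
    unfolding bary_def star_edges_def none bd cone_UN by simp
  also have "\<dots> = (\<Union>t\<in>T. cone (nm (?ed t)) (?b t))" using e by blast
  also have "\<dots> = (\<Union>(p, q, r)\<in>T. cone (nm {p, q}) {(q, nm {p, q, r}), (nm {p, q, r}, p)})"
    by (rule SUP_cong) auto
  finally show ?thesis .
qed

end

section \<open>Averaging potentials over the barycentric subdivision\<close>

definition mean :: "int set \<Rightarrow> int" where "mean S = (Min S + Max S) div 2"

lemma mean_bounds:
  assumes "finite S" "S \<noteq> {}" shows "Min S \<le> mean S" "mean S \<le> Max S"
proof -
  have "Min S \<le> Max S" using assms by simp
  then show "Min S \<le> mean S" "mean S \<le> Max S" unfolding mean_def by presburger+
qed

text \<open>The midpoint of the range of \<open>S'\<close>, rounded to an integer, has distance at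
  most \<open>(M + 1) div 2\<close> from everything within that range, in particular from the
  midpoint of \<open>S\<close>. Midpoints of ranges also commute with integer shifts, as lifting a
  potential requires.\<close>

lemma mean_nested:
  assumes S: "finite S'" "S \<noteq> {}" "S \<subseteq> S'" and M: "\<And>x y. x \<in> S' \<Longrightarrow> y \<in> S' \<Longrightarrow> x - y \<le> M"
  shows "\<bar>mean S - mean S'\<bar> \<le> (M + 1) div 2"
proof -
  have S': "S' \<noteq> {}" using S by blast
  have fS: "finite S" using S finite_subset by blast
  have "Min S' \<le> Min S" "Max S \<le> Max S'" using S S' by (simp_all add: Min_antimono Max_mono)
  then have "Min S' \<le> mean S" "mean S \<le> Max S'" using mean_bounds[OF fS S(2)] by linarith+
  moreover have "Max S' - Min S' \<le> M" using M S(1) S' by simp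
  ultimately show ?thesis unfolding mean_def[of S'] by presburger
qed

lemma mean_shift:
  assumes "finite S" "S \<noteq> {}" shows "mean ((\<lambda>x. x + k) ` S) = mean S + k"
proof -
  have m: "mono (\<lambda>x. x + k)" by (simp add: mono_def)
  have "Min ((\<lambda>x. x + k) ` S) = Min S + k" "Max ((\<lambda>x. x + k) ` S) = Max S + k"
    using mono_Min_commute[OF m assms] mono_Max_commute[OF m assms] by simp_all
  then show ?thesis unfolding mean_def by presburger
qed

context surf
begin

lemma bary_surface: "closed_oriented_surface bary"
  using bary_subdivision subdivision_pairing by metis

lemma bary_mem:
  assumes "(p, q, r) \<in> T"
  shows "(nm {p, q}, q, nm {p, q, r}) \<in> bary" "(q, nm {p, q, r}, nm {p, q}) \<in> bary" "(nm {p, q, r}, nm {p, q}, q) \<in> bary"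
    "(nm {p, q}, nm {p, q, r}, p) \<in> bary" "(nm {p, q, r}, p, nm {p, q}) \<in> bary" "(p, nm {p, q}, nm {p, q, r}) \<in> bary"
proof -
  have "cone (nm {p, q}) {(q, nm {p, q, r}), (nm {p, q, r}, p)} \<subseteq> bary" unfolding bary_eq using assms by blast
  then show "(nm {p, q}, q, nm {p, q, r}) \<in> bary" "(q, nm {p, q, r}, nm {p, q}) \<in> bary" "(nm {p, q, r}, nm {p, q}, q) \<in> bary"
    "(nm {p, q}, nm {p, q, r}, p) \<in> bary" "(nm {p, q, r}, p, nm {p, q}) \<in> bary" "(p, nm {p, q}, nm {p, q, r}) \<in> bary"
    unfolding cone_def by auto
qed

lemma bary_cases:
  assumes "(x, y, w) \<in> bary"
  obtains p q r where "(p, q, r) \<in> T" "(x, y, w) = (nm {p, q}, q, nm {p, q, r})"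
  | p q r where "(p, q, r) \<in> T" "(x, y, w) = (q, nm {p, q, r}, nm {p, q})"
  | p q r where "(p, q, r) \<in> T" "(x, y, w) = (nm {p, q, r}, nm {p, q}, q)"
  | p q r where "(p, q, r) \<in> T" "(x, y, w) = (nm {p, q}, nm {p, q, r}, p)"
  | p q r where "(p, q, r) \<in> T" "(x, y, w) = (nm {p, q, r}, p, nm {p, q})"
  | p q r where "(p, q, r) \<in> T" "(x, y, w) = (p, nm {p, q}, nm {p, q, r})"
proof -
  obtain p q r where t: "(p, q, r) \<in> T" and c: "(x, y, w) \<in> cone (nm {p, q}) {(q, nm {p, q, r}), (nm {p, q, r}, p)}"
    using assms unfolding bary_eq by blast
  from c have "(x, y, w) \<in> {(nm {p, q}, q, nm {p, q, r}), (q, nm {p, q, r}, nm {p, q}), (nm {p, q, r}, nm {p, q}, q),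
    (nm {p, q}, nm {p, q, r}, p), (nm {p, q, r}, p, nm {p, q}), (p, nm {p, q}, nm {p, q, r})}"
    unfolding cone_def by auto
  then show thesis using t that by blast
qed

lemma tri_rot_sets: "{q, r, p} = {p, q, r}" "{r, p, q} = {p, q, r}" "{q, p} = {p, q}" for p q r :: nat
  by auto

text \<open>The directed edges of \<open>bary\<close> fall into six kinds, according to whether they
  join a vertex, a midpoint or a barycentre to one of another type. For each kind the two adjacent
  corners are explicit, and each hypothesis treats one kind.\<close>

lemma bary_potentialI:
  assumes
    1: "\<And>p q r s. (p, q, r) \<in> T \<Longrightarrow> (q, p, s) \<in> T \<Longrightarrow>
      f (nm {p, q}) q = K (nm {p, q}) q (nm {p, q, r}) - K (nm {p, q}) (nm {q, p, s}) q" and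
    2: "\<And>p q r. (p, q, r) \<in> T \<Longrightarrow>
      f q (nm {p, q, r}) = K q (nm {p, q, r}) (nm {p, q}) - K q (nm {q, r}) (nm {p, q, r})" and
    3: "\<And>p q r. (p, q, r) \<in> T \<Longrightarrow>
      f (nm {p, q, r}) (nm {p, q}) = K (nm {p, q, r}) (nm {p, q}) q - K (nm {p, q, r}) p (nm {p, q})" and
    4: "\<And>p q r. (p, q, r) \<in> T \<Longrightarrow>
      f (nm {p, q}) (nm {p, q, r}) = K (nm {p, q}) (nm {p, q, r}) p - K (nm {p, q}) q (nm {p, q, r})" and
    5: "\<And>p q r. (p, q, r) \<in> T \<Longrightarrow>
      f (nm {p, q, r}) p = K (nm {p, q, r}) p (nm {p, q}) - K (nm {p, q, r}) (nm {r, p}) p" and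
    6: "\<And>p q r s. (p, q, r) \<in> T \<Longrightarrow> (q, p, s) \<in> T \<Longrightarrow>
      f p (nm {p, q}) = K p (nm {p, q}) (nm {p, q, r}) - K p (nm {q, p, s}) (nm {p, q})"
  shows "corner_potential bary f K"
  unfolding corner_potential_def
proof (intro allI impI, elim conjE)
  interpret B: surf bary by unfold_locales (rule bary_surface)
  fix x a b c assume l: "(x, a, b) \<in> bary" and r: "(x, b, c) \<in> bary"
  from r show "f x b = K x b c - K x a b"
  proof (cases rule: bary_cases)
    case (1 p q r)
    obtain s where s: "(q, p, s) \<in> T" using opposite 1 by blast
    have "(x, nm {q, p, s}, b) \<in> bary" using bary_mem(4)[OF s] 1(2) by (simp add: insert_commute)
    then have "a = nm {q, p, s}" using l B.tri_unique2 by blast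
    then show ?thesis using assms(1)[OF 1(1) s] 1(2) by simp
  next
    case (2 p q r)
    have "(x, nm {q, r}, b) \<in> bary" using bary_mem(6)[OF rot[OF 2(1)]] 2(2) tri_rot_sets by simp
    then have "a = nm {q, r}" using l B.tri_unique2 by blast
    then show ?thesis using assms(2)[OF 2(1)] 2(2) by simp
  next
    case (3 p q r)
    have "(x, p, b) \<in> bary" using bary_mem(5)[OF 3(1)] 3(2) by simp
    then have "a = p" using l B.tri_unique2 by blast
    then show ?thesis using assms(3)[OF 3(1)] 3(2) by simp
  next
    case (4 p q r)
    have "(x, q, b) \<in> bary" using bary_mem(1)[OF 4(1)] 4(2) by simp
    then have "a = q" using l B.tri_unique2 by blast
    then show ?thesis using assms(4)[OF 4(1)] 4(2) by simp
  next
    case (5 p q r)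
    have "(x, nm {r, p}, b) \<in> bary" using bary_mem(3)[OF rot2[OF 5(1)]] 5(2) tri_rot_sets by simp
    then have "a = nm {r, p}" using l B.tri_unique2 by blast
    then show ?thesis using assms(5)[OF 5(1)] 5(2) by simp
  next
    case (6 p q r)
    obtain s where s: "(q, p, s) \<in> T" using opposite 6 by blast
    have "(x, nm {q, p, s}, b) \<in> bary" using bary_mem(2)[OF s] 6(2) by (simp add: insert_commute)
    then have "a = nm {q, p, s}" using l B.tri_unique2 by blast
    then show ?thesis using assms(6)[OF 6(1) s] 6(2) by simp
  qed
qed

text \<open>Undoes the naming of barycentres: the simplex of \<open>T\<close> whose barycentre a
  vertex of \<open>bary\<close> is.\<close>

definition dec :: "nat \<Rightarrow> nat set" where
  "dec v = (if v \<in> verts T then {v} else set_decode (v - Suc (Max (verts T))))"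

lemma dec_vert: "v \<in> verts T \<Longrightarrow> dec v = {v}" unfolding dec_def by simp

lemma dec_nm: "finite \<sigma> \<Longrightarrow> dec (nm \<sigma>) = \<sigma>"
  unfolding dec_def using nm_new by (simp add: nm_def set_encode_inverse)

definition corner_val :: "(nat \<Rightarrow> nat \<Rightarrow> nat \<Rightarrow> int) \<Rightarrow> nat set \<Rightarrow> nat \<Rightarrow> int" where
  "corner_val G \<sigma> a = (THE k. \<exists>b c. (a, b, c) \<in> T \<and> {a, b, c} = \<sigma> \<and> k = G a b c)"

lemma corner_val:
  assumes t: "(a, b, c) \<in> T"
  shows "corner_val G {a, b, c} a = G a b c" "corner_val G {a, b, c} b = G b c a" "corner_val G {a, b, c} c = G c a b"
proof -
  have *: "corner_val G {a, b, c} a = G a b c" if t: "(a, b, c) \<in> T" for a b c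
    unfolding corner_val_def
  proof (rule the_equality)
    show "\<exists>b' c'. (a, b', c') \<in> T \<and> {a, b', c'} = {a, b, c} \<and> G a b c = G a b' c'" using t by blast
    fix k assume "\<exists>b' c'. (a, b', c') \<in> T \<and> {a, b', c'} = {a, b, c} \<and> k = G a b' c'"
    then obtain b' c' where *: "(a, b', c') \<in> T" "{a, b', c'} = {a, b, c}" "k = G a b' c'" by blast
    then show "k = G a b c" using same_triangle[OF t *(1,2)] tri_distinct[OF t] by auto
  qed
  show "corner_val G {a, b, c} a = G a b c" by (rule *[OF t])
  show "corner_val G {a, b, c} b = G b c a" using *[OF rot[OF t]] tri_rot_sets by metis
  show "corner_val G {a, b, c} c = G c a b" using *[OF rot2[OF t]] tri_rot_sets by metis
qed

lemma dec_sets: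
  assumes "(p, q, r) \<in> T"
  shows "dec p = {p}" "dec q = {q}" "dec (nm {p, q}) = {p, q}" "dec (nm {p, q, r}) = {p, q, r}"
  using dec_vert tri_verts_mem[OF assms] dec_nm by auto

lemma lift_values:
  assumes f: "edges_lift (edges T) z f"
  shows "{p, q} \<in> edges T \<Longrightarrow> f p (nm {p, q}) = z p q" "{p, q} \<in> edges T \<Longrightarrow> f (nm {p, q}) q = z p q"
    "(p, q, r) \<in> T \<Longrightarrow> f y (nm {p, q, r}) = 0" "(p, q, r) \<in> T \<Longrightarrow> f (nm {p, q, r}) y = 0"
proof -
  show "{p, q} \<in> edges T \<Longrightarrow> f p (nm {p, q}) = z p q" "{p, q} \<in> edges T \<Longrightarrow> f (nm {p, q}) q = z p q"
    using f unfolding edges_lift_def by blast+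
  assume t: "(p, q, r) \<in> T"
  have nz: "\<exists>a b. {a, b} \<in> edges T \<and> ((x, y) = (a, nm {a, b}) \<or> (x, y) = (nm {a, b}, b))" if "f x y \<noteq> 0" for x y
    using f that unfolding edges_lift_def by (metis DiffE)
  have ne: "nm {p, q, r} \<noteq> nm {a, b}" for a b
  proof
    assume "nm {p, q, r} = nm {a, b}"
    then have "card {p, q, r} = card {a, b}" using nm_eq by simp
    moreover have "card {a, b} \<le> 2" by (simp add: card_insert_if)
    ultimately show False using tri_distinct[OF t] by simp
  qed
  have ev: "nm {p, q, r} \<noteq> a" "nm {p, q, r} \<noteq> b" if "{a, b} \<in> edges T" for a b
    using that edges_iff link_subset link_sym nm_vert by blast+
  show "f y (nm {p, q, r}) = 0" using nz[of y "nm {p, q, r}"] ne ev by force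
  show "f (nm {p, q, r}) y = 0" using nz[of "nm {p, q, r}" y] ne ev by force
qed

text \<open>Integer counterpart of affine interpolation within one triangle: the corner at the
  barycentre of a face averages the old corners at the vertices of that face.\<close>

definition mean_potential :: "(nat \<Rightarrow> nat \<Rightarrow> nat \<Rightarrow> int) \<Rightarrow> nat \<Rightarrow> nat \<Rightarrow> nat \<Rightarrow> int" where
  "mean_potential G x y w = mean (corner_val G (dec x \<union> (dec y \<union> dec w)) ` dec x)"

lemma bary_union:
  assumes t: "(p, q, r) \<in> T" and m: "{x, y, w} \<subseteq> {p, q, nm {p, q}, nm {p, q, r}}" "nm {p, q, r} \<in> {x, y, w}"
  shows "dec x \<union> (dec y \<union> dec w) = {p, q, r}"
proof -
  have "dec v \<subseteq> {p, q, r}" if "v \<in> {p, q, nm {p, q}, nm {p, q, r}}" for v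
    using that dec_sets[OF t] by auto
  then have "dec x \<subseteq> {p, q, r}" "dec y \<subseteq> {p, q, r}" "dec w \<subseteq> {p, q, r}" using m(1) by auto
  moreover have "{p, q, r} \<subseteq> dec x \<union> (dec y \<union> dec w)" using m(2) dec_sets(4)[OF t] by auto
  ultimately show ?thesis by blast
qed

text \<open>Across either half of an old edge, both old corners along that edge shift by the same
  \<open>z p q\<close>, and so does their midpoint. Across an edge inside an old triangle the same
  set of corners is averaged on both sides, which fits the zero value of the lifted chain
  there.\<close>

lemma mean_potential:
  assumes z: "corner_potential T z G" "z \<in> cycles T" and f: "edges_lift (edges T) z f"
  shows "corner_potential bary f (mean_potential G)"
proof -
  have U: "mean_potential G x y w = mean (corner_val G {p, q, r} ` dec x)"
    if "(p, q, r) \<in> T" "{x, y, w} \<subseteq> {p, q, nm {p, q}, nm {p, q, r}}" "nm {p, q, r} \<in> {x, y, w}" for p q r x y w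
    unfolding mean_potential_def bary_union[OF that] ..
  have e: "{p, q} \<in> edges T" if "(p, q, r) \<in> T" for p q r using that unfolding edges_def by blast
  have one: "mean {k} = k" for k unfolding mean_def by simp
  have zz: "z p q = G p q r - G p s q" "z p q = G q r p - G q p s" if t: "(p, q, r) \<in> T" "(q, p, s) \<in> T" for p q r s
  proof -
    show "z p q = G p q r - G p s q" using corner_potentialD[OF z(1)] t rot by blast
    then show "z p q = G q r p - G q p s" using potential_other_end[OF z t] by simp
  qed
  show ?thesis
  proof (rule bary_potentialI)
    fix p q r s assume t: "(p, q, r) \<in> T" "(q, p, s) \<in> T"
    note zpq = zz[OF t]
    let ?S = "{G p s q, G q p s}"
    have a: "corner_val G {p, q, r} ` {p, q} = (\<lambda>x. x + z p q) ` ?S"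
    proof -
      have g: "G p q r = G p s q + z p q" "G q r p = G q p s + z p q" using zpq by simp_all
      show ?thesis using corner_val[OF t(1), of G] g by simp
    qed
    have b: "corner_val G {q, p, s} ` {p, q} = ?S"
      using corner_val[OF t(2), of G] by auto
    have "mean_potential G (nm {p, q}) q (nm {p, q, r}) = mean ?S + z p q"
      using U[OF t(1), of "nm {p, q}" q "nm {p, q, r}"] dec_sets[OF t(1)] a mean_shift[of ?S] by simp
    moreover have "mean_potential G (nm {p, q}) (nm {q, p, s}) q = mean ?S"
      using U[OF t(2), of "nm {p, q}" "nm {q, p, s}" q] dec_sets[OF t(1)] b tri_rot_sets by simp
    ultimately show "f (nm {p, q}) q = mean_potential G (nm {p, q}) q (nm {p, q, r}) - mean_potential G (nm {p, q}) (nm {q, p, s}) q"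
      using lift_values(2)[OF f e[OF t(1)]] by simp
    have "mean_potential G p (nm {p, q}) (nm {p, q, r}) = G p q r"
      using U[OF t(1), of p "nm {p, q}" "nm {p, q, r}"] dec_sets[OF t(1)] corner_val[OF t(1), of G] one by simp
    moreover have "mean_potential G p (nm {q, p, s}) (nm {p, q}) = G p s q"
      using U[OF t(2), of p "nm {q, p, s}" "nm {p, q}"] dec_sets[OF t(1)] corner_val[OF t(2), of G] one tri_rot_sets by simp
    ultimately show "f p (nm {p, q}) = mean_potential G p (nm {p, q}) (nm {p, q, r}) - mean_potential G p (nm {q, p, s}) (nm {p, q})"
      using lift_values(1)[OF f e[OF t(1)]] zpq by simp
  next
    fix p q r assume t: "(p, q, r) \<in> T"
    note l0 = lift_values(3,4)[OF f t]
    have "mean_potential G q (nm {p, q, r}) (nm {p, q}) = mean (corner_val G {p, q, r} ` dec q)"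
      using U[OF t, of q "nm {p, q, r}" "nm {p, q}"] by simp
    moreover have "mean_potential G q (nm {q, r}) (nm {p, q, r}) = mean (corner_val G {p, q, r} ` dec q)"
      using U[OF rot[OF t], of q "nm {q, r}" "nm {p, q, r}"] tri_rot_sets by simp
    ultimately show "f q (nm {p, q, r}) = mean_potential G q (nm {p, q, r}) (nm {p, q}) - mean_potential G q (nm {q, r}) (nm {p, q, r})"
      using l0 by simp
    show "f (nm {p, q, r}) (nm {p, q}) = mean_potential G (nm {p, q, r}) (nm {p, q}) q - mean_potential G (nm {p, q, r}) p (nm {p, q})"
      using l0 U[OF t, of "nm {p, q, r}" "nm {p, q}" q] U[OF t, of "nm {p, q, r}" p "nm {p, q}"] by simp
    show "f (nm {p, q}) (nm {p, q, r}) = mean_potential G (nm {p, q}) (nm {p, q, r}) p - mean_potential G (nm {p, q}) q (nm {p, q, r})"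
      using l0 U[OF t, of "nm {p, q}" "nm {p, q, r}" p] U[OF t, of "nm {p, q}" q "nm {p, q, r}"] by simp
    have "mean_potential G (nm {p, q, r}) (nm {r, p}) p = mean (corner_val G {p, q, r} ` dec (nm {p, q, r}))"
      using U[OF rot2[OF t], of "nm {p, q, r}" "nm {r, p}" p] tri_rot_sets by simp
    then show "f (nm {p, q, r}) p = mean_potential G (nm {p, q, r}) p (nm {p, q}) - mean_potential G (nm {p, q, r}) (nm {r, p}) p"
      using l0 U[OF t, of "nm {p, q, r}" p "nm {p, q}"] by simp
  qed
qed

definition spread :: "(nat \<Rightarrow> nat \<Rightarrow> nat \<Rightarrow> int) \<Rightarrow> int \<Rightarrow> bool" where
  "spread G M \<longleftrightarrow> (\<forall>a b c. (a, b, c) \<in> T \<longrightarrow> \<bar>G b c a - G a b c\<bar> \<le> M)"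

text \<open>The simplices at two corners of a small triangle are nested, being parts of a flag, so
  \<open>mean_nested\<close> applies. The bound \<open>(M + 1) div 2\<close> is below
  \<open>M\<close> as soon as \<open>M > 1\<close>, hence iterating reaches spread
  \<open>1\<close>.\<close>

lemma mean_potential_spread:
  assumes M: "spread G M" and xyw: "(x, y, w) \<in> bary"
  shows "\<bar>mean_potential G y w x - mean_potential G x y w\<bar> \<le> (M + 1) div 2"
proof -
  have main: "\<bar>mean_potential G y w x - mean_potential G x y w\<bar> \<le> (M + 1) div 2"
    if t: "(p, q, r) \<in> T" and s: "{x, y, w} \<subseteq> {p, q, nm {p, q}, nm {p, q, r}}" "nm {p, q, r} \<in> {x, y, w}"
      and n: "dec x \<subseteq> dec y \<or> dec y \<subseteq> dec x" for p q r
  proof -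
    let ?g = "corner_val G {p, q, r}"
    have ne: "dec x \<noteq> {}" "dec y \<noteq> {}" "dec x \<subseteq> {p, q, r}" "dec y \<subseteq> {p, q, r}"
      using s(1) dec_sets[OF t] by auto
    have d: "i - j \<le> M" if "i \<in> ?g ` {p, q, r}" "j \<in> ?g ` {p, q, r}" for i j
    proof -
      have "\<bar>G q r p - G p q r\<bar> \<le> M" "\<bar>G r p q - G q r p\<bar> \<le> M" "\<bar>G p q r - G r p q\<bar> \<le> M"
        using M t rot rot2 unfolding spread_def by blast+
      then show ?thesis using that corner_val[OF t, of G] by auto
    qed
    have fin: "finite (dec x)" "finite (dec y)" using ne finite_subset by blast+
    have "mean_potential G x y w = mean (?g ` dec x)"
      unfolding mean_potential_def bary_union[OF t s] ..
    moreover have "mean_potential G y w x = mean (?g ` dec y)"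
    proof -
      have "dec y \<union> (dec w \<union> dec x) = {p, q, r}" using bary_union[OF t s] by blast
      then show ?thesis unfolding mean_potential_def by simp
    qed
    moreover have "\<bar>mean (?g ` dec y) - mean (?g ` dec x)\<bar> \<le> (M + 1) div 2"
      using n
    proof
      assume "dec x \<subseteq> dec y"
      have "i - j \<le> M" if "i \<in> ?g ` dec y" "j \<in> ?g ` dec y" for i j
        by (rule d) (use that image_mono[OF ne(4), of ?g] in blast)+
      then have "\<bar>mean (?g ` dec x) - mean (?g ` dec y)\<bar> \<le> (M + 1) div 2"
        using ne(1) fin \<open>dec x \<subseteq> dec y\<close> by (intro mean_nested) auto
      then show ?thesis by (simp add: abs_minus_commute)
    next
      assume "dec y \<subseteq> dec x"
      have "i - j \<le> M" if "i \<in> ?g ` dec x" "j \<in> ?g ` dec x" for i j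
        by (rule d) (use that image_mono[OF ne(3), of ?g] in blast)+
      then show ?thesis using ne(2) fin \<open>dec y \<subseteq> dec x\<close> by (intro mean_nested) auto
    qed
    ultimately show ?thesis by simp
  qed
  from xyw show ?thesis
  proof (cases rule: bary_cases)
    case (1 p q r)
    then show ?thesis using dec_sets[OF 1(1)] by (intro main[OF 1(1)]) auto
  next
    case (2 p q r)
    then show ?thesis using dec_sets[OF 2(1)] by (intro main[OF 2(1)]) auto
  next
    case (3 p q r)
    then show ?thesis using dec_sets[OF 3(1)] by (intro main[OF 3(1)]) auto
  next
    case (4 p q r)
    then show ?thesis using dec_sets[OF 4(1)] by (intro main[OF 4(1)]) auto
  next
    case (5 p q r)
    then show ?thesis using dec_sets[OF 5(1)] by (intro main[OF 5(1)]) auto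
  next
    case (6 p q r)
    then show ?thesis using dec_sets[OF 6(1)] by (intro main[OF 6(1)]) auto
  qed
qed

text \<open>The three simplices of a flag intersect in its vertex, so the value is constant on a
  small triangle: it is that of the old corner in which the triangle lies.\<close>

definition near_potential :: "(nat \<Rightarrow> nat \<Rightarrow> nat \<Rightarrow> int) \<Rightarrow> nat \<Rightarrow> nat \<Rightarrow> nat \<Rightarrow> int" where
  "near_potential G x y w = corner_val G (dec x \<union> (dec y \<union> dec w)) (the_elem (dec x \<inter> (dec y \<inter> dec w)))"

lemma near_potential_rot: "near_potential G y w x = near_potential G x y w"
proof -
  have "dec y \<union> (dec w \<union> dec x) = dec x \<union> (dec y \<union> dec w)" "dec y \<inter> (dec w \<inter> dec x) = dec x \<inter> (dec y \<inter> dec w)" by blast+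
  then show ?thesis unfolding near_potential_def by simp
qed

lemma near_potential_eq:
  assumes t: "(p, q, r) \<in> T"
  shows "near_potential G (nm {p, q}) q (nm {p, q, r}) = G q r p" "near_potential G (nm {p, q}) (nm {p, q, r}) p = G p q r"
proof -
  have "dec (nm {p, q}) \<inter> (dec q \<inter> dec (nm {p, q, r})) = {q}" "dec (nm {p, q}) \<inter> (dec (nm {p, q, r}) \<inter> dec p) = {p}"
    using dec_sets[OF t] by auto
  moreover have "dec (nm {p, q}) \<union> (dec q \<union> dec (nm {p, q, r})) = {p, q, r}" "dec (nm {p, q}) \<union> (dec (nm {p, q, r}) \<union> dec p) = {p, q, r}"
    using dec_sets[OF t] by auto
  ultimately show "near_potential G (nm {p, q}) q (nm {p, q, r}) = G q r p" "near_potential G (nm {p, q}) (nm {p, q, r}) p = G p q r"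
    unfolding near_potential_def using corner_val[OF t, of G] by simp_all
qed

text \<open>A cycle is homologous, in the barycentric subdivision, to the cycle of dual edges weighted by its
  dual cocycle: the 2-chain bounding the difference takes the corner value of the original potential on the
  two small triangles at that corner.\<close>

lemma dual_cycle_homologous:
  assumes z: "corner_potential T z G" "z \<in> cycles T" and f: "edges_lift (edges T) z f" "f \<in> cycles bary"
    and y: "y \<in> cycles bary" and y_eq: "\<And>p q r. (p, q, r) \<in> T \<Longrightarrow> y (nm {p, q}) (nm {p, q, r}) = G q r p - G p q r"
    and y_old: "\<And>v x. v \<in> verts T \<Longrightarrow> y v x = 0"
  shows "(\<lambda>a b. f a b - y a b) \<in> boundaries bary"
proof -
  interpret B: surf bary by unfold_locales (rule bary_surface)
  let ?K = "near_potential G"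
  have y_old': "y x v = 0" if "v \<in> verts T" for v x using cycles_antisym[OF y, of x v] y_old[OF that] by simp
  have e: "{p, q} \<in> edges T" if "(p, q, r) \<in> T" for p q r using that unfolding edges_def by blast
  have zz: "z p q = G p q r - G p s q" "z p q = G q r p - G q p s" if t: "(p, q, r) \<in> T" "(q, p, s) \<in> T" for p q r s
  proof -
    show "z p q = G p q r - G p s q" using corner_potentialD[OF z(1)] t rot by blast
    then show "z p q = G q r p - G q p s" using potential_other_end[OF z t] by simp
  qed
  have nr: "?K q (nm {p, q, r}) (nm {p, q}) = G q r p" "?K (nm {p, q, r}) (nm {p, q}) q = G q r p"
    "?K (nm {p, q, r}) p (nm {p, q}) = G p q r" "?K p (nm {p, q}) (nm {p, q, r}) = G p q r" if "(p, q, r) \<in> T" for p q r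
    using near_potential_eq[OF that, of G] near_potential_rot[of G] by metis+
  have "corner_potential bary (\<lambda>a b. f a b - y a b) ?K"
  proof (rule bary_potentialI)
    fix p q r s assume t: "(p, q, r) \<in> T" "(q, p, s) \<in> T"
    have v: "p \<in> verts T" "q \<in> verts T" using t tri_verts_mem by blast+
    have "?K (nm {p, q}) (nm {q, p, s}) q = G q p s" using near_potential_eq(2)[OF t(2)] tri_rot_sets by metis
    then show "f (nm {p, q}) q - y (nm {p, q}) q = ?K (nm {p, q}) q (nm {p, q, r}) - ?K (nm {p, q}) (nm {q, p, s}) q"
      using lift_values(2)[OF f(1) e[OF t(1)]] zz[OF t] near_potential_eq(1)[OF t(1)] y_old'[OF v(2)] by simp
    have "?K p (nm {q, p, s}) (nm {p, q}) = G p s q" using nr(1)[OF t(2)] tri_rot_sets by metis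
    then show "f p (nm {p, q}) - y p (nm {p, q}) = ?K p (nm {p, q}) (nm {p, q, r}) - ?K p (nm {q, p, s}) (nm {p, q})"
      using lift_values(1)[OF f(1) e[OF t(1)]] zz[OF t] nr(4)[OF t(1)] y_old[OF v(1)] by simp
  next
    fix p q r assume t: "(p, q, r) \<in> T"
    have v: "p \<in> verts T" "q \<in> verts T" using t tri_verts_mem by blast+
    note l0 = lift_values(3,4)[OF f(1) t]
    have "?K q (nm {q, r}) (nm {p, q, r}) = G q r p" using nr(4)[OF rot[OF t]] tri_rot_sets by metis
    then show "f q (nm {p, q, r}) - y q (nm {p, q, r}) = ?K q (nm {p, q, r}) (nm {p, q}) - ?K q (nm {q, r}) (nm {p, q, r})"
      using l0 nr(1)[OF t] y_old[OF v(2)] by simp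
    show "f (nm {p, q, r}) (nm {p, q}) - y (nm {p, q, r}) (nm {p, q}) =
       ?K (nm {p, q, r}) (nm {p, q}) q - ?K (nm {p, q, r}) p (nm {p, q})"
      using l0 nr[OF t] y_eq[OF t] cycles_antisym[OF y, of "nm {p, q, r}" "nm {p, q}"] by simp
    show "f (nm {p, q}) (nm {p, q, r}) - y (nm {p, q}) (nm {p, q, r}) =
       ?K (nm {p, q}) (nm {p, q, r}) p - ?K (nm {p, q}) q (nm {p, q, r})"
      using l0 near_potential_eq[OF t, of G] y_eq[OF t] by simp
    have "?K (nm {p, q, r}) (nm {r, p}) p = G p q r" using nr(2)[OF rot2[OF t]] tri_rot_sets by metis
    then show "f (nm {p, q, r}) p - y (nm {p, q, r}) p = ?K (nm {p, q, r}) p (nm {p, q}) - ?K (nm {p, q, r}) (nm {r, p}) p"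
      using l0 nr(3)[OF t] y_old'[OF v(1)] by simp
  qed
  moreover have "(\<lambda>a b. f a b - y a b) \<in> cycles bary"
    using cycles_add[OF f(2) cycles_scale[OF y, of "- 1"]] by simp
  ultimately show ?thesis by (rule B.boundary_of_flat_potential) (rule near_potential_rot)
qed

end

section \<open>Transverse representatives\<close>

lemma subdivision_trans:
  assumes "subdivision T' T'' F'" "subdivision T T' F" shows "subdivision T T'' (F' \<circ> F)"
  using assms
proof (induction rule: subdivision.induct)
  case trivial
  then show ?case by simp
next
  case (star_edge T1 F1 u v x)
  then have "subdivision T T1 (F1 \<circ> F)" by blast
  from subdivision.star_edge[OF this star_edge.hyps(2,3)] show ?case by (simp only: o_assoc)
next
  case (star_triangle T1 F1 \<sigma> x)
  then have "subdivision T T1 (F1 \<circ> F)" by blast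
  from subdivision.star_triangle[OF this star_triangle.hyps(2,3)] show ?case .
qed

text \<open>With unique successors and predecessors, and each edge continued, the edges are the
  graph of a permutation of finitely many vertices. Its orbits are the closed curves; one orbit is
  split off at a time.\<close>

lemma flow_decomposition:
  assumes "finite A" and out: "\<And>x y y'. (x, y) \<in> A \<Longrightarrow> (x, y') \<in> A \<Longrightarrow> y = y'"
    and inn: "\<And>x x' y. (x, y) \<in> A \<Longrightarrow> (x', y) \<in> A \<Longrightarrow> x = x'"
    and cont: "\<And>x y. (x, y) \<in> A \<Longrightarrow> \<exists>w. (y, w) \<in> A"
  shows "\<exists>\<gamma>. [] \<notin> set \<gamma> \<and> set (curve_darts \<gamma>) = A \<and> distinct (curve_darts \<gamma>)"
  using assms
proof (induction "card A" arbitrary: A rule: less_induct)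
  case less
  show ?case
  proof (cases "A = {}")
    case True
    then show ?thesis by (intro exI[of _ "[]"]) (simp add: curve_darts_def)
  next
    case False
    then obtain x y where xy: "(x, y) \<in> A" by auto
    define f where "f u = (THE w. (u, w) \<in> A)" for u
    have f: "f u = w" if "(u, w) \<in> A" for u w
      unfolding f_def using that less.prems(2) by (intro the_equality) blast+
    define O1 where "O1 = {u. \<exists>k. u = (f ^^ k) x}"
    have stepA: "(u, f u) \<in> A" if u: "u \<in> O1" for u
    proof -
      obtain k where k: "u = (f ^^ k) x" using u unfolding O1_def by blast
      have "((f ^^ k) x, f ((f ^^ k) x)) \<in> A"
      proof (induction k)
        case 0
        then show ?case using xy f by simp
      next
        case (Suc k)
        then obtain w where "(f ((f ^^ k) x), w) \<in> A" using less.prems(4) by blast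
        then show ?case using f by simp
      qed
      then show ?thesis using k by simp
    qed
    have O1step: "f u \<in> O1" if u: "u \<in> O1" for u
    proof -
      obtain k where k: "u = (f ^^ k) x" using u unfolding O1_def by blast
      then have "f u = (f ^^ Suc k) x" by simp
      then show ?thesis unfolding O1_def by blast
    qed
    have "x = (f ^^ 0) x" by simp
    then have xO: "x \<in> O1" unfolding O1_def by blast
    have "O1 \<subseteq> fst ` A" using stepA by force
    then have fO: "finite O1" using less.prems(1) finite_subset by blast
    have injO: "inj_on f O1"
      by (rule inj_onI) (use stepA less.prems(3) in metis)
    let ?n = "card O1"
    have orb: "bij_betw (\<lambda>k. (f ^^ k) x) {..<?n} O1" "(f ^^ ?n) x = x"
      using cyclic_orbit[OF fO _ injO xO] O1step unfolding O1_def by blast+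
    have n0: "0 < ?n" using xO fO card_gt_0_iff by blast
    define c where "c = map (\<lambda>k. (f ^^ k) x) [0..<?n]"
    have len: "length c = ?n" by (simp add: c_def)
    have distc: "distinct c" unfolding c_def using orb(1) by (simp add: distinct_map bij_betw_def lessThan_atLeast0)
    have setc: "set c = O1" unfolding c_def using orb(1) by (simp add: bij_betw_def lessThan_atLeast0)
    have dn: "darts c ! i = (c ! i, f (c ! i))" if i: "i < ?n" for i
    proof (cases "Suc i = ?n")
      case True
      then have "f ((f ^^ i) x) = x" using orb(2) by (metis funpow.simps(2) o_apply)
      then show ?thesis using i True n0 by (simp add: darts_nth len c_def)
    next
      case False
      then show ?thesis using i by (simp add: darts_nth len c_def)
    qed
    have setd: "set (darts c) = (\<lambda>u. (u, f u)) ` O1"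
    proof -
      have "set (darts c) = {darts c ! i | i. i < ?n}" unfolding set_conv_nth using len by simp
      also have "\<dots> = {(c ! i, f (c ! i)) | i. i < ?n}" using dn by metis
      also have "\<dots> = (\<lambda>u. (u, f u)) ` {c ! i | i. i < ?n}" by blast
      also have "{c ! i | i. i < ?n} = set c" by (simp only: set_conv_nth len)
      also have "\<dots> = O1" by (rule setc)
      finally show ?thesis .
    qed
    have distd: "distinct (darts c)"
      using distc map_fst_darts[of c] distinct_map by metis
    define A' where "A' = A - set (darts c)"
    have dA: "set (darts c) \<subseteq> A" unfolding setd using stepA by blast
    have "(x, f x) \<in> set (darts c)" unfolding setd using xO by blast
    then have "A' \<subset> A" unfolding A'_def using dA by blast
    then have cl: "card A' < card A" using less.prems(1) psubset_card_mono by blast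
    \<comment> \<open>The successor map permutes the orbit, and predecessors are unique, so no edge
      enters the orbit from outside. Removing the orbit thus leaves a set with the same
      properties.\<close>
    have backO: "u \<in> O1" if uv: "(u, v) \<in> A" and v: "v \<in> O1" for u v
    proof -
      have "f ` O1 = O1" using O1step injO fO by (intro endo_inj_surj) auto
      then have "v \<in> f ` O1" using v by (simp only:)
      then obtain u' where "u' \<in> O1" "f u' = v" by blast
      then have "(u', v) \<in> A" using stepA by blast
      then show ?thesis using less.prems(3) uv \<open>u' \<in> O1\<close> by blast
    qed
    have A'iff: "(u, v) \<in> A' \<longleftrightarrow> (u, v) \<in> A \<and> u \<notin> O1" for u v
      unfolding A'_def setd using f stepA by blast
    have "\<exists>\<gamma>. [] \<notin> set \<gamma> \<and> set (curve_darts \<gamma>) = A' \<and> distinct (curve_darts \<gamma>)"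
    proof (rule less.hyps[OF cl])
      show "finite A'" using less.prems(1) unfolding A'_def by simp
      show "y = y'" if "(x, y) \<in> A'" "(x, y') \<in> A'" for x y y' using that less.prems(2) A'iff by blast
      show "x = x'" if "(x, y) \<in> A'" "(x', y) \<in> A'" for x x' y using that less.prems(3) A'iff by blast
      show "\<exists>w. (y, w) \<in> A'" if a: "(x, y) \<in> A'" for x y
      proof -
        obtain w where "(y, w) \<in> A" using a A'iff less.prems(4) by blast
        moreover have "y \<notin> O1" using a A'iff backO by blast
        ultimately show ?thesis using A'iff by blast
      qed
    qed
    then obtain \<gamma> where \<gamma>: "[] \<notin> set \<gamma>" "set (curve_darts \<gamma>) = A'" "distinct (curve_darts \<gamma>)" by blast
    have "curve_darts (c # \<gamma>) = darts c @ curve_darts \<gamma>" unfolding curve_darts_def by simp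
    moreover have "set (darts c) \<inter> A' = {}" "set (darts c) \<union> A' = A" unfolding A'_def using dA by auto
    moreover have "c \<noteq> []" using len n0 by auto
    ultimately show ?thesis using \<gamma> distd by (intro exI[of _ "c # \<gamma>"]) simp
  qed
qed

lemma card_le_one: "(\<And>s s'. s \<in> A \<Longrightarrow> s' \<in> A \<Longrightarrow> s = s') \<Longrightarrow> card A \<le> 1"
  by (cases "finite A") (auto simp: card_le_Suc0_iff_eq)

context surf
begin

lemma between_step:
  assumes "(x, b, d) \<in> T" "c \<in> link_verts T x" "d \<noteq> c" "b \<noteq> c"
  shows "d \<in> between T x b c"
proof -
  have "b \<in> link_verts T x" "d \<noteq> b" using assms tri_link tri_distinct by blast+
  then show ?thesis using between_iff_trancl[of b x c d] assms by blast
qed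

definition refine :: "nat list \<Rightarrow> nat list" where
  "refine c = map (\<lambda>k. if even k then c ! (k div 2) else nm {c ! (k div 2), c ! (Suc (k div 2) mod length c)})
     [0..<2 * length c]"

lemma length_refine: "length (refine c) = 2 * length c" unfolding refine_def by simp

lemma refine_nth:
  assumes "i < length c"
  shows "refine c ! (2 * i) = c ! i" "refine c ! Suc (2 * i) = nm {c ! i, c ! (Suc i mod length c)}"
  using assms unfolding refine_def by simp_all

lemma refine_darts:
  assumes i: "i < length c"
  shows "darts (refine c) ! (2 * i) = (c ! i, nm {c ! i, c ! (Suc i mod length c)})"
    and "darts (refine c) ! Suc (2 * i) = (nm {c ! i, c ! (Suc i mod length c)}, c ! (Suc i mod length c))"
proof -
  show "darts (refine c) ! (2 * i) = (c ! i, nm {c ! i, c ! (Suc i mod length c)})"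
    using i by (simp add: darts_nth length_refine refine_nth)
  have "Suc (Suc (2 * i)) mod (2 * length c) = 2 * (Suc i mod length c)"
    using mult_mod_right[of 2 "Suc i" "length c"] by simp
  moreover have "Suc i mod length c < length c" using i by (intro mod_less_divisor) auto
  ultimately show "darts (refine c) ! Suc (2 * i) = (nm {c ! i, c ! (Suc i mod length c)}, c ! (Suc i mod length c))"
    using i by (simp add: darts_nth length_refine refine_nth)
qed

lemma less_double_cases:
  assumes "k < 2 * (n::nat)" obtains i where "i < n" "k = 2 * i" | i where "i < n" "k = Suc (2 * i)"
proof (cases "even k")
  case True
  then obtain i where "k = 2 * i" by (rule evenE)
  then show thesis using that(1)[of i] assms by simp
next
  case False
  then obtain i where "k = 2 * i + 1" by (rule oddE)
  then show thesis using that(2)[of i] assms by simp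
qed

lemma refine_dart_iff:
  "e \<in> set (darts (refine c)) \<longleftrightarrow>
     (\<exists>p q. (p, q) \<in> set (darts c) \<and> (e = (p, nm {p, q}) \<or> e = (nm {p, q}, q)))"
proof
  assume "e \<in> set (darts (refine c))"
  then obtain k where k: "k < 2 * length c" "e = darts (refine c) ! k"
    by (metis in_set_conv_nth length_darts length_refine)
  have m: "(c ! i, c ! (Suc i mod length c)) \<in> set (darts c)" if "i < length c" for i
    using that darts_nth nth_mem[of i "darts c"] by (metis length_darts)
  from k(1) show "\<exists>p q. (p, q) \<in> set (darts c) \<and> (e = (p, nm {p, q}) \<or> e = (nm {p, q}, q))"
  proof (cases rule: less_double_cases)
    case (1 i)
    then show ?thesis using refine_darts(1)[OF 1(1)] m[OF 1(1)] k(2) by metis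
  next
    case (2 i)
    then show ?thesis using refine_darts(2)[OF 2(1)] m[OF 2(1)] k(2) by metis
  qed
next
  assume "\<exists>p q. (p, q) \<in> set (darts c) \<and> (e = (p, nm {p, q}) \<or> e = (nm {p, q}, q))"
  then obtain p q where pq: "(p, q) \<in> set (darts c)" "e = (p, nm {p, q}) \<or> e = (nm {p, q}, q)" by blast
  then obtain i where i: "i < length c" "darts c ! i = (p, q)" by (metis in_set_conv_nth length_darts)
  then have ci: "c ! i = p" "c ! (Suc i mod length c) = q" using darts_nth by auto
  have "darts (refine c) ! k \<in> set (darts (refine c))" if "k < 2 * length c" for k
    using that by (simp add: length_refine)
  from this[of "2 * i"] this[of "Suc (2 * i)"] show "e \<in> set (darts (refine c))"
    using pq(2) refine_darts[OF i(1)] ci i(1) by auto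
qed

lemma refine_strand:
  assumes "s \<in> strands [refine c]"
  shows "(\<exists>p x q. (p, x, q) \<in> strands [c] \<and> s = (nm {p, x}, x, nm {x, q})) \<or>
    (\<exists>p q. (p, q) \<in> set (darts c) \<and> s = (p, nm {p, q}, q))"
proof -
  obtain k where k: "k < 2 * length c" "s = strand_at (refine c) k"
    using assms unfolding strands_def by (auto simp: length_refine)
  from k(1) show ?thesis
  proof (cases rule: less_double_cases)
    case (1 i)
    let ?j = "(i + length c - 1) mod length c"
    have j: "?j < length c" "Suc ?j mod length c = i" using pred_index[OF 1(1)] by auto
    have "(2 * i + 2 * length c - 1) mod (2 * length c) = Suc (2 * ?j)"
    proof (cases i)
      case 0
      then show ?thesis using 1(1) by (cases "length c") simp_all
    next
      case (Suc i')
      then have "i + length c - 1 = i' + length c" "2 * i + 2 * length c - 1 = Suc (2 * i') + 2 * length c" by simp_all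
      then show ?thesis using 1(1) Suc mod_add_self2[of "Suc (2 * i')" "2 * length c"] by simp
    qed
    then have "strand_at (refine c) (2 * i) = (nm {c ! ?j, c ! i}, c ! i, nm {c ! i, c ! (Suc i mod length c)})"
      using 1(1) refine_nth(2)[OF j(1)] j(2) unfolding strand_at_def by (simp add: length_refine refine_nth)
    moreover have "strand_at c i \<in> strands [c]" unfolding strands_def using 1(1) by auto
    ultimately show ?thesis using k(2) 1(2) unfolding strand_at_def by blast
  next
    case (2 i)
    have "(Suc (2 * i) + 2 * length c - 1) mod (2 * length c) = 2 * i" using 2(1) by simp
    moreover have "Suc (Suc (2 * i)) mod (2 * length c) = 2 * (Suc i mod length c)"
      using mult_mod_right[of 2 "Suc i" "length c"] by simp
    moreover have "Suc i mod length c < length c" using 2(1) by (intro mod_less_divisor) auto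
    ultimately have "strand_at (refine c) (Suc (2 * i)) = (c ! i, nm {c ! i, c ! (Suc i mod length c)}, c ! (Suc i mod length c))"
      using 2(1) unfolding strand_at_def by (simp add: length_refine refine_nth)
    moreover have "(c ! i, c ! (Suc i mod length c)) \<in> set (darts c)"
      using 2(1) darts_nth nth_mem[of i "darts c"] by (metis length_darts)
    ultimately show ?thesis using k(2) 2(2) by metis
  qed
qed

text \<open>Each step of a path in the old link becomes two steps in the new one, from midpoint to
  midpoint by way of a barycentre. Barycentres of triangles differ from all midpoints, so the two
  excluded ends are still avoided.\<close>

lemma between_bary:
  assumes "d \<in> between T x b c" and b: "b \<in> link_verts T x"
  shows "nm {x, d} \<in> between bary x (nm {x, b}) (nm {x, c})"
proof -
  interpret B: surf bary by unfold_locales (rule bary_surface)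
  let ?\<phi> = "\<lambda>e. nm {x, e}"
  note bl = between_link[OF b assms(1)]
  have inj: "?\<phi> e = ?\<phi> f \<longleftrightarrow> e = f" for e f using nm_eq[of "{x, e}" "{x, f}"] by (auto simp: doubleton_eq_iff)
  have fwd: "(x, ?\<phi> e, nm {x, e, f}) \<in> bary" "(x, nm {x, e, f}, ?\<phi> f) \<in> bary" if "(x, e, f) \<in> T" for e f
  proof -
    show "(x, ?\<phi> e, nm {x, e, f}) \<in> bary" using bary_mem(6)[OF that] .
    show "(x, nm {x, e, f}, ?\<phi> f) \<in> bary" using bary_mem(2)[OF rot2[OF that]] tri_rot_sets by metis
  qed
  have card3: "nm {x, e, f} \<noteq> ?\<phi> g" if "(x, e, f) \<in> T" for e f g
  proof
    assume "nm {x, e, f} = ?\<phi> g"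
    then have "card {x, e, f} = card {x, g}" using nm_eq by simp
    moreover have "card {x, g} \<le> 2" by (simp add: card_insert_if)
    ultimately show False using tri_distinct[OF that] by simp
  qed
  let ?R = "{(e, f). (x, e, f) \<in> bary \<and> f \<notin> {?\<phi> b, ?\<phi> c}}"
  have "(b, d) \<in> {(e, f). (x, e, f) \<in> T \<and> f \<notin> {b, c}}\<^sup>+" using between_iff_trancl[OF b bl(1,3)] assms(1) by blast
  then have "(?\<phi> b, ?\<phi> d) \<in> ?R\<^sup>+"
  proof (induction rule: trancl_induct)
    case (base y)
    then have "(?\<phi> b, nm {x, b, y}) \<in> ?R" "(nm {x, b, y}, ?\<phi> y) \<in> ?R" using fwd card3 inj by auto
    then show ?case by (meson trancl.simps)
  next
    case (step y z)
    then have "(?\<phi> y, nm {x, y, z}) \<in> ?R" "(nm {x, y, z}, ?\<phi> z) \<in> ?R" using fwd card3 inj by auto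
    then show ?case using step.IH by (meson trancl_into_trancl)
  qed
  moreover have "?\<phi> b \<in> link_verts bary x" "?\<phi> c \<in> link_verts bary x"
  proof -
    have "(x, b, nx x b) \<in> T" "(x, c, nx x c) \<in> T" using b bl(1) link_iff by blast+
    then show "?\<phi> b \<in> link_verts bary x" "?\<phi> c \<in> link_verts bary x" using fwd(1) unfolding link_verts_def by blast+
  qed
  ultimately show ?thesis using B.between_iff_trancl[of "?\<phi> b" x "?\<phi> c" "?\<phi> d"] inj bl(3) by blast
qed

text \<open>An equality of chains and not merely of classes: both sides carry the old values on
  half-edges and vanish elsewhere. Hence it can be composed with the chain maps of further
  subdivisions.\<close>

lemma refine_chain:
  assumes n: "normal_curve T [c]" and n2: "distinct (curve_darts [refine c])"
    and f: "edges_lift (edges T) (curve_chain [c]) f"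
  shows "curve_chain [refine c] = f"
proof (intro ext)
  fix x y
  let ?D = "set (curve_darts [c])" and ?D2 = "set (curve_darts [refine c])"
  note d = normal_darts[OF n]
  have D: "?D = set (darts c)" "?D2 = set (darts (refine c))" unfolding set_curve_darts by simp_all
  have v: "p \<in> verts T" "q \<in> verts T" if "(p, q) \<in> ?D" for p q using d(2)[OF that] link_subset link_sym by blast+
  have dbl: "{p, q} = {p, q'} \<longleftrightarrow> q = q'" "{p, q} = {p', q} \<longleftrightarrow> p = p'" for p q p' q' :: nat
    by (auto simp: doubleton_eq_iff)
  have outD: "(p, nm {p, q}) \<in> ?D2 \<longleftrightarrow> (p, q) \<in> ?D" if "p \<in> verts T" for p q
    unfolding D refine_dart_iff using nm_vert[OF that] nm_eq dbl by auto
  have inD: "(nm {p, q}, q) \<in> ?D2 \<longleftrightarrow> (p, q) \<in> ?D" if "q \<in> verts T" for p q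
    unfolding D refine_dart_iff using nm_vert[OF that] nm_eq dbl by auto
  have ev: "a \<in> verts T" "b \<in> verts T" if "{a, b} \<in> edges T" for a b
    using that edges_iff link_subset link_sym by blast+
  have val: "curve_chain [refine c] a (nm {a, b}) = curve_chain [c] a b"
    "curve_chain [refine c] (nm {a, b}) b = curve_chain [c] a b" if e: "{a, b} \<in> edges T" for a b
  proof -
    have s: "{b, a} = {a, b}" by auto
    note v = ev[OF e]
    show "curve_chain [refine c] a (nm {a, b}) = curve_chain [c] a b"
      using outD[OF v(1), of b] inD[OF v(1), of b] unfolding curve_chain_eq[OF n2] curve_chain_eq[OF d(1)] s by simp
    show "curve_chain [refine c] (nm {a, b}) b = curve_chain [c] a b"
      using outD[OF v(2), of a] inD[OF v(2), of a] unfolding curve_chain_eq[OF n2] curve_chain_eq[OF d(1)] s by simp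
  qed
  show "curve_chain [refine c] x y = f x y"
  proof (cases "\<exists>a b. {a, b} \<in> edges T \<and> ((x, y) = (a, nm {a, b}) \<or> (x, y) = (nm {a, b}, b))")
    case True
    then obtain a b where ab: "{a, b} \<in> edges T" "(x, y) = (a, nm {a, b}) \<or> (x, y) = (nm {a, b}, b)" by blast
    then show ?thesis using val[OF ab(1)] lift_values(1,2)[OF f ab(1)] by auto
  next
    case False
    have "f x y = 0" using f False unfolding edges_lift_def by (metis DiffE)
    moreover have "(x, y) \<notin> ?D2" "(y, x) \<notin> ?D2"
    proof -
      have e: "{p, q} \<in> edges T" "{q, p} \<in> edges T" if "(p, q) \<in> set (darts c)" for p q
        using d(2) that edges_iff link_sym unfolding D by blast+
      have s: "{q, p} = {p, q}" for p q :: nat by auto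
      show "(x, y) \<notin> ?D2" using False e unfolding D refine_dart_iff by blast
      show "(y, x) \<notin> ?D2"
      proof
        assume "(y, x) \<in> ?D2"
        then obtain p q where "(p, q) \<in> set (darts c)" "(y, x) = (p, nm {p, q}) \<or> (y, x) = (nm {p, q}, q)"
          unfolding D refine_dart_iff by blast
        then show False using False e[of p q] s[of p q] by (metis prod.inject)
      qed
    qed
    ultimately show ?thesis unfolding curve_chain_eq[OF n2] by simp
  qed
qed

end

section \<open>Curves along dual edges\<close>

lemma normal_card: "normal_curve T \<gamma> \<Longrightarrow> card {s \<in> strands \<gamma>. mid s = x} \<le> 2"
  unfolding normal_curve_def by blast

lemma normal_undirected: "normal_curve T \<gamma> \<Longrightarrow> distinct (map (\<lambda>(a, b). {a, b}) (curve_darts \<gamma>))"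
  unfolding normal_curve_def by blast

context surf
begin

lemma nm_edge_eq: "nm {a, b} = nm {a', b'} \<longleftrightarrow> {a, b} = {a', b'}"
  using nm_eq by simp

lemma nm_tri_edge: assumes "(p, q, r) \<in> T" shows "nm {p, q, r} \<noteq> nm {a, b}" "nm {a, b} \<noteq> nm {p, q, r}"
proof -
  have "card {a, b} \<le> 2" by (simp add: card_insert_if)
  moreover have "card {p, q, r} = 3" using tri_distinct[OF assms] by simp
  ultimately have "{p, q, r} \<noteq> {a, b}" by (metis numeral_le_iff semiring_norm(70,72) le_refl numeral_3_eq_3 Suc_n_not_le_n numeral_2_eq_2)
  then show "nm {p, q, r} \<noteq> nm {a, b}" "nm {a, b} \<noteq> nm {p, q, r}" using nm_eq by auto
qed

text \<open>For a dual cocycle with values in \<open>{-1, 0, 1}\<close>, the dual cycle is a disjoint union of simple closed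
  curves in the barycentric subdivision.\<close>

definition dual_darts :: "(nat \<Rightarrow> nat \<Rightarrow> nat \<Rightarrow> int) \<Rightarrow> (nat \<times> nat) set" where
  "dual_darts G = {(nm {p, q}, nm {p, q, r}) | p q r. (p, q, r) \<in> T \<and> G q r p - G p q r = 1} \<union>
     {(nm {p, q, r}, nm {p, q}) | p q r. (p, q, r) \<in> T \<and> G q r p - G p q r = - 1}"

lemma dual_dartE:
  assumes "(x, y) \<in> dual_darts G"
  obtains p q r where "(p, q, r) \<in> T" "G q r p - G p q r = 1" "x = nm {p, q}" "y = nm {p, q, r}"
  | p q r where "(p, q, r) \<in> T" "G q r p - G p q r = - 1" "x = nm {p, q, r}" "y = nm {p, q}"
  using assms unfolding dual_darts_def by blast

lemma dual_dartI:
  "(p, q, r) \<in> T \<Longrightarrow> G q r p - G p q r = 1 \<Longrightarrow> (nm {p, q}, nm {p, q, r}) \<in> dual_darts G"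
  "(p, q, r) \<in> T \<Longrightarrow> G q r p - G p q r = - 1 \<Longrightarrow> (nm {p, q, r}, nm {p, q}) \<in> dual_darts G"
  unfolding dual_darts_def by blast+

lemma same_edge:
  assumes "(p, q, r) \<in> T" "(p', q', r') \<in> T" "{p', q'} = {p, q}"
  shows "(p' = p \<and> q' = q \<and> r' = r) \<or> (p' = q \<and> q' = p)"
  using assms tri_unique by (metis doubleton_eq_iff)

lemma same_flag:
  assumes t: "(p, q, r) \<in> T" "(p', q', r') \<in> T" and eq: "nm {p', q'} = nm {p, q}" "nm {p', q', r'} = nm {p, q, r}"
  shows "p' = p \<and> q' = q \<and> r' = r"
proof -
  have "{p', q'} = {p, q}" "{p', q', r'} = {p, q, r}" using eq nm_eq by simp_all
  then show ?thesis using same_triangle[OF t] tri_distinct[OF t(1)] by (auto simp: doubleton_eq_iff)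
qed

lemma flip_value:
  assumes z: "corner_potential T z G" "z \<in> cycles T" and "(p, q, r) \<in> T" "(q, p, s) \<in> T"
  shows "G p s q - G q p s = - (G q r p - G p q r)"
  using potential_other_end[OF z assms(3,4)] by simp

text \<open>Negating the potential reverses all dual edges, so facts about predecessors follow from
  facts about successors.\<close>

lemma dual_darts_neg: "(x, y) \<in> dual_darts G \<longleftrightarrow> (y, x) \<in> dual_darts (\<lambda>a b c. - G a b c)"
proof -
  have "(y, x) \<in> dual_darts (\<lambda>a b c. - G a b c)" if "(x, y) \<in> dual_darts G" for x y and G :: "nat \<Rightarrow> nat \<Rightarrow> nat \<Rightarrow> int"
    using that
  proof (cases rule: dual_dartE)
    case (1 p q r)
    then show ?thesis using dual_dartI(2)[OF 1(1), of "\<lambda>a b c. - G a b c"] by simp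
  next
    case (2 p q r)
    then show ?thesis using dual_dartI(1)[OF 2(1), of "\<lambda>a b c. - G a b c"] by simp
  qed
  from this[of x y G] this[of y x "\<lambda>a b c. - G a b c"] show ?thesis by auto
qed

lemma dual_darts_asym:
  assumes "(x, y) \<in> dual_darts G" shows "(y, x) \<notin> dual_darts G"
proof
  assume yx: "(y, x) \<in> dual_darts G"
  from assms show False
  proof (cases rule: dual_dartE)
    case (1 p q r)
    note xy = 1
    from yx show False
    proof (cases rule: dual_dartE)
      case (1 p' q' r')
      then show False using xy(4) nm_tri_edge(1)[OF xy(1), of p' q'] by simp
    next
      case (2 p' q' r')
      have "p' = p \<and> q' = q \<and> r' = r"
        by (rule same_flag[OF xy(1) 2(1) trans[OF 2(4)[symmetric] xy(3)] trans[OF 2(3)[symmetric] xy(4)]])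
      then show False using 2(2) xy(2) by simp
    qed
  next
    case (2 p q r)
    note xy = 2
    from yx show False
    proof (cases rule: dual_dartE)
      case (1 p' q' r')
      have "p' = p \<and> q' = q \<and> r' = r"
        by (rule same_flag[OF xy(1) 1(1) trans[OF 1(3)[symmetric] xy(4)] trans[OF 1(4)[symmetric] xy(3)]])
      then show False using 1(2) xy(2) by simp
    next
      case (2 p' q' r')
      then show False using xy(3) nm_tri_edge(1)[OF xy(1), of p' q'] by simp
    qed
  qed
qed

lemma spread_one:
  assumes "spread G 1" "(p, q, r) \<in> T"
  shows "\<bar>G q r p - G p q r\<bar> \<le> 1" "\<bar>G r p q - G q r p\<bar> \<le> 1" "\<bar>G p q r - G r p q\<bar> \<le> 1"
  using assms rot rot2 unfolding spread_def by blast+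

text \<open>At a midpoint the jump changes sign with the side from which it is read, so only one of
  the two dual edges there can leave it. At a barycentre the three jumps lie in
  \<open>{-1, 0, 1}\<close> and sum to zero, so at most one is \<open>- 1\<close>.\<close>

lemma dual_darts_out:
  assumes z: "corner_potential T z G" "z \<in> cycles T" and sp: "spread G 1"
    and xy: "(x, y) \<in> dual_darts G" and xy': "(x, y') \<in> dual_darts G" shows "y = y'"
  using xy
proof (cases rule: dual_dartE)
  case (1 p q r)
  note A = 1
  from xy' show ?thesis
  proof (cases rule: dual_dartE)
    case (1 p' q' r')
    then have "{p', q'} = {p, q}" using A(3) nm_edge_eq by simp
    from same_edge[OF A(1) 1(1) this] show ?thesis
    proof
      assume "p' = p \<and> q' = q \<and> r' = r"
      then show ?thesis using 1(4) A(4) by simp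
    next
      assume "p' = q \<and> q' = p"
      then show ?thesis using flip_value[OF z A(1), of r'] 1(1,2) A(2) by simp
    qed
  next
    case (2 p' q' r')
    then show ?thesis using A(3) nm_tri_edge(1)[OF 2(1)] by metis
  qed
next
  case (2 p q r)
  note A = 2
  from xy' show ?thesis
  proof (cases rule: dual_dartE)
    case (1 p' q' r')
    then show ?thesis using A(3) nm_tri_edge(1)[OF A(1)] by metis
  next
    case (2 p' q' r')
    then have "{p', q', r'} = {p, q, r}" using A(3) nm_eq by simp
    then have c: "(p', q', r') = (p, q, r) \<or> (p', q', r') = (q, r, p) \<or> (p', q', r') = (r, p, q)"
      using same_triangle[OF A(1) 2(1)] by blast
    have "\<not> (G r p q - G q r p = - 1)" "\<not> (G p q r - G r p q = - 1)"
      using spread_one[OF sp A(1)] A(2) by linarith+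
    then have "(p', q', r') = (p, q, r)" using c 2(2) by auto
    then show ?thesis using 2(4) A(4) by simp
  qed
qed

lemma dual_darts_in:
  assumes z: "corner_potential T z G" "z \<in> cycles T" and sp: "spread G 1"
    and xy: "(x, y) \<in> dual_darts G" and xy': "(x', y) \<in> dual_darts G" shows "x = x'"
proof (rule dual_darts_out)
  show "corner_potential T (\<lambda>a b. - 1 * z a b) (\<lambda>a b c. - G a b c)" using corner_potential_scale[OF z(1), of "- 1"] by simp
  show "(\<lambda>a b. - 1 * z a b) \<in> cycles T" by (rule cycles_scale[OF z(2)])
  have "\<bar>- G q r p - - G p q r\<bar> \<le> 1" if "(p, q, r) \<in> T" for p q r
    using spread_one(1)[OF sp that] by linarith
  then show "spread (\<lambda>a b c. - G a b c) 1" unfolding spread_def by blast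
  show "(y, x) \<in> dual_darts (\<lambda>a b c. - G a b c)" using xy dual_darts_neg by blast
  show "(y, x') \<in> dual_darts (\<lambda>a b c. - G a b c)" using xy' dual_darts_neg by blast
qed

text \<open>The same zero sum around a triangle forces a jump \<open>- 1\<close> wherever there is a
  jump \<open>1\<close>; at a midpoint the continuation lies in the other triangle, where the sign
  is opposite.\<close>

lemma dual_darts_cont:
  assumes z: "corner_potential T z G" "z \<in> cycles T" and sp: "spread G 1"
    and xy: "(x, y) \<in> dual_darts G" shows "\<exists>w. (y, w) \<in> dual_darts G"
  using xy
proof (cases rule: dual_dartE)
  case (1 p q r)
  have "G r p q - G q r p = - 1 \<or> G p q r - G r p q = - 1"
    using spread_one[OF sp 1(1)] 1(2) by linarith
  then show ?thesis
  proof
    assume "G r p q - G q r p = - 1"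
    from dual_dartI(2)[where G = G, OF rot[OF 1(1)] this] show ?thesis using 1(4) tri_rot_sets by metis
  next
    assume "G p q r - G r p q = - 1"
    from dual_dartI(2)[where G = G, OF rot2[OF 1(1)] this] show ?thesis using 1(4) tri_rot_sets by metis
  qed
next
  case (2 p q r)
  obtain s where s: "(q, p, s) \<in> T" using opposite 2(1) by blast
  have "G p s q - G q p s = 1" using flip_value[OF z 2(1) s] 2(2) by simp
  from dual_dartI(1)[where G = G, OF s this] show ?thesis using 2(4) tri_rot_sets by metis
qed

lemma dual_darts_new: "(x, y) \<in> dual_darts G \<Longrightarrow> x \<notin> verts T \<and> y \<notin> verts T"
  by (erule dual_dartE) (simp_all add: nm_new)

lemma finite_dual_darts: "finite (dual_darts G)"
proof -
  have "dual_darts G \<subseteq> (\<lambda>(p, q, r). (nm {p, q}, nm {p, q, r})) ` T \<union> (\<lambda>(p, q, r). (nm {p, q, r}, nm {p, q})) ` T"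
    unfolding dual_darts_def by force
  then show ?thesis using finite_T finite_subset by blast
qed

lemma refine_undirected:
  assumes n: "normal_curve T [c]"
  shows "distinct (map (\<lambda>(a, b). {a, b}) (darts (refine c)))"
proof -
  let ?u = "\<lambda>(a, b). {a, b}"
  have D: "curve_darts [c] = darts c" unfolding curve_darts_def by simp
  have dc: "distinct (map ?u (darts c))" using normal_undirected[OF n] unfolding D .
  have sep: "a = b \<and> nm \<sigma> = nm \<tau>" if "{a, nm \<sigma>} = {b, nm \<tau>}" "a \<in> verts T" "b \<in> verts T" for a b \<sigma> \<tau>
    using that nm_vert by (metis doubleton_eq_iff)
  let ?m = "\<lambda>i. nm {c ! i, c ! (Suc i mod length c)}"
  have dart: "(c ! i, c ! (Suc i mod length c)) \<in> set (darts c)" if "i < length c" for i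
    using that darts_nth nth_mem[of i "darts c"] by (metis length_darts)
  have v: "c ! i \<in> verts T" "c ! (Suc i mod length c) \<in> verts T" "c ! i \<noteq> c ! (Suc i mod length c)" if "i < length c" for i
    using normal_darts(2)[OF n] dart[OF that] link_subset link_sym edge_ne unfolding D by blast+
  have form: "\<exists>i e. i < length c \<and> ?u (darts (refine c) ! k) = {e, ?m i} \<and> e \<in> verts T \<and>
      ((k = 2 * i \<and> e = c ! i) \<or> (k = Suc (2 * i) \<and> e = c ! (Suc i mod length c)))" if "k < 2 * length c" for k
    using that
  proof (cases rule: less_double_cases)
    case (1 i)
    then show ?thesis using refine_darts(1)[OF 1(1)] v[OF 1(1)] by (intro exI[of _ i] exI[of _ "c ! i"]) simp
  next
    case (2 i)
    then show ?thesis using refine_darts(2)[OF 2(1)] v[OF 2(1)]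
      by (intro exI[of _ i] exI[of _ "c ! (Suc i mod length c)"]) (auto simp: insert_commute)
  qed
  show ?thesis unfolding distinct_conv_nth
  proof (intro allI impI)
    fix k k' assume k: "k < length (map ?u (darts (refine c)))" "k' < length (map ?u (darts (refine c)))" "k \<noteq> k'"
    then have kk: "k < 2 * length c" "k' < 2 * length c" by (simp_all add: length_refine)
    obtain i e where i: "i < length c" "?u (darts (refine c) ! k) = {e, ?m i}" "e \<in> verts T"
      "(k = 2 * i \<and> e = c ! i) \<or> (k = Suc (2 * i) \<and> e = c ! (Suc i mod length c))" using form[OF kk(1)] by blast
    obtain j d where j: "j < length c" "?u (darts (refine c) ! k') = {d, ?m j}" "d \<in> verts T"
      "(k' = 2 * j \<and> d = c ! j) \<or> (k' = Suc (2 * j) \<and> d = c ! (Suc j mod length c))" using form[OF kk(2)] by blast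
    have "{e, ?m i} \<noteq> {d, ?m j}"
    proof
      assume "{e, ?m i} = {d, ?m j}"
      then have ed: "e = d" "?m i = ?m j" using sep i(3) j(3) by blast+
      then have "map ?u (darts c) ! i = map ?u (darts c) ! j" using i(1) j(1) nm_edge_eq by (simp add: darts_nth)
      then have "i = j" using nth_eq_iff_index_eq[OF dc, of i j] i(1) j(1) by (simp del: nth_map)
      then show False using i(4) j(4) ed(1) k(3) v(3)[OF i(1)] by auto
    qed
    then show "map ?u (darts (refine c)) ! k \<noteq> map ?u (darts (refine c)) ! k'"
      using k i(2) j(2) by simp
  qed
qed

text \<open>Around a midpoint the two ends of the edge alternate with the two barycentres, so the
  old edge and the dual edge cross there. The two claims cover the two directions of the dual
  edge.\<close>

lemma bary_edge_cross:
  assumes t: "(p, q, r) \<in> T" "(q, p, s) \<in> T"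
  shows "positive_wrt bary (p, nm {p, q}, q) (nm {p, q, r}, nm {p, q}, nm {q, p, s})"
    and "positive_wrt bary (nm {q, p, s}, nm {p, q}, nm {p, q, r}) (p, nm {p, q}, q)"
proof -
  interpret B: surf bary by unfold_locales (rule bary_surface)
  let ?m = "nm {p, q}" and ?t = "nm {p, q, r}" and ?t' = "nm {q, p, s}"
  have b: "(?m, q, ?t) \<in> bary" "(?m, ?t, p) \<in> bary" "(?m, p, ?t') \<in> bary" "(?m, ?t', q) \<in> bary"
    using bary_mem[OF t(1)] bary_mem[OF t(2)] tri_rot_sets(3)[of q p] by simp_all
  have l: "q \<in> link_verts bary ?m" "p \<in> link_verts bary ?m" "?t \<in> link_verts bary ?m" "?t' \<in> link_verts bary ?m"
    using b B.tri_link by blast+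
  have "r \<noteq> s" using t no_mirror by blast
  then have tt: "?t \<noteq> ?t'" using nm_eq[of "{p, q, r}" "{q, p, s}"] tri_distinct[OF t(1)] tri_distinct[OF t(2)]
    by (auto simp: set_eq_iff)
  have pq: "p \<noteq> q" using tri_distinct t by blast
  note n = nm_tri[OF t(1)] nm_tri[OF t(2)]
  have "?t \<in> between bary ?m q p" by (rule B.between_step[OF b(1) l(2)]) (use n pq in auto)
  moreover have "?t' \<in> between bary ?m p q" by (rule B.between_step[OF b(3) l(1)]) (use n pq in auto)
  ultimately show "positive_wrt bary (p, ?m, q) (?t, ?m, ?t')" unfolding positive_wrt_def mid_def by simp
  have "p \<in> between bary ?m ?t ?t'" by (rule B.between_step[OF b(2) l(4)]) (use n tt in auto)
  moreover have "q \<in> between bary ?m ?t' ?t" by (rule B.between_step[OF b(4) l(3)]) (use n tt in auto)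
  ultimately show "positive_wrt bary (?t', ?m, ?t) (p, ?m, q)" unfolding positive_wrt_def mid_def by simp
qed

lemma positive_wrt_bary:
  assumes n: "normal_curve T [c]" and s: "(p, x, q) \<in> strands [c]" "(p', x, q') \<in> strands [c]"
    and pos: "positive_wrt T (p, x, q) (p', x, q')"
  shows "positive_wrt bary (nm {p, x}, x, nm {x, q}) (nm {p', x}, x, nm {x, q'})"
proof -
  have "p' \<in> between T x q p" "q' \<in> between T x p q" using pos unfolding positive_wrt_def by simp_all
  then have "nm {x, p'} \<in> between bary x (nm {x, q}) (nm {x, p})" "nm {x, q'} \<in> between bary x (nm {x, p}) (nm {x, q})"
    using between_bary strand_link[OF n s(1)] by blast+
  moreover have "{x, p'} = {p', x}" "{x, p} = {p, x}" by auto
  ultimately show ?thesis unfolding positive_wrt_def mid_def by simp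
qed

text \<open>The dual curve avoids all vertices of \<open>T\<close>, and the refined curve passes
  only through those and through midpoints. So the two meet at midpoints only, where each has a
  single strand, and the crossings of the refined curve with itself stay at old vertices.\<close>

lemma dual_curve_transverse:
  assumes z: "corner_potential T z G" "z \<in> cycles T" and sp: "spread G 1"
    and n: "normal_curve T [c]" and \<gamma>: "[] \<notin> set \<gamma>" "set (curve_darts \<gamma>) = dual_darts G" "distinct (curve_darts \<gamma>)"
  shows "transverse bary [refine c] \<gamma>"
  unfolding transverse_def normal_curve_def
proof (intro conjI)
  interpret B: surf bary by unfold_locales (rule bary_surface)
  let ?u = "\<lambda>(a, b). {a, b}"
  have D: "curve_darts [c] = darts c" "curve_darts [refine c] = darts (refine c)" unfolding curve_darts_def by simp_all
  have cd: "curve_darts ([refine c] @ \<gamma>) = darts (refine c) @ curve_darts \<gamma>" unfolding curve_darts_append D ..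
  have "c \<noteq> []" using n unfolding normal_curve_def by auto
  then have "refine c \<noteq> []" using length_refine[of c] by auto
  then show "[] \<notin> set ([refine c] @ \<gamma>)" using \<gamma>(1) by auto
  have dT: "\<exists>r. (p, q, r) \<in> T" if "(p, q) \<in> set (darts c)" for p q
    using normal_darts(2)[OF n] that link_iff unfolding D by blast
  have e1: "{a, b} \<in> edges bary" if ab: "(a, b) \<in> set (darts (refine c))" for a b
  proof -
    obtain p q where pq: "(p, q) \<in> set (darts c)" "(a, b) = (p, nm {p, q}) \<or> (a, b) = (nm {p, q}, q)"
      using ab refine_dart_iff by blast
    obtain r where "(p, q, r) \<in> T" using dT pq(1) by blast
    then show ?thesis using bary_mem(1,6)[of p q r] pq(2) unfolding edges_def by auto
  qed
  have e2: "{a, b} \<in> edges bary" if "(a, b) \<in> dual_darts G" for a b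
    using that
  proof (cases rule: dual_dartE)
    case (1 p q r)
    then show ?thesis using bary_mem(4)[OF 1(1)] unfolding edges_def by auto
  next
    case (2 p q r)
    then show ?thesis using bary_mem(3)[OF 2(1)] unfolding edges_def by auto
  qed
  show "\<forall>(a, b)\<in>set (curve_darts ([refine c] @ \<gamma>)). {a, b} \<in> edges bary"
    using e1 e2 \<gamma>(2) unfolding cd by auto
  show "distinct (map ?u (curve_darts ([refine c] @ \<gamma>)))"
  proof -
    have "inj_on ?u (dual_darts G)"
    proof (rule inj_onI)
      fix d d' assume d: "d \<in> dual_darts G" "d' \<in> dual_darts G" "?u d = ?u d'"
      obtain a b a' b' where "d = (a, b)" "d' = (a', b')" by fastforce
      then show "d = d'" using d dual_darts_asym by (auto simp: doubleton_eq_iff)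
    qed
    then have "distinct (map ?u (curve_darts \<gamma>))" using \<gamma>(2,3) by (simp add: distinct_map)
    moreover have "?u d \<noteq> ?u d'" if d: "d \<in> set (darts (refine c))" and d': "d' \<in> dual_darts G" for d d'
    proof -
      obtain a b where ab: "d' = (a, b)" by fastforce
      obtain p q where pq: "(p, q) \<in> set (darts c)" "d = (p, nm {p, q}) \<or> d = (nm {p, q}, q)"
        using d refine_dart_iff by blast
      have "p \<in> verts T" "q \<in> verts T" using dT[OF pq(1)] tri_verts_mem by blast+
      then show ?thesis using pq(2) dual_darts_new[of a b G] d' ab by (auto simp: doubleton_eq_iff)
    qed
    ultimately show ?thesis unfolding cd using refine_undirected[OF n] \<gamma>(2) by (auto simp: image_iff)
  qed
  have S: "strands ([refine c] @ \<gamma>) = strands [refine c] \<union> strands \<gamma>" by (rule strands_append)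
  have g1: "s = s'" if "s \<in> strands \<gamma>" "s' \<in> strands \<gamma>" "mid s = mid s'" for s s'
  proof -
    obtain a x b a' x' b' where s: "s = (a, x, b)" "s' = (a', x', b')" by (metis prod_cases3)
    have "x' = x" using that(3) s by (simp add: mid_def)
    then have "(a, x) \<in> dual_darts G" "(x, b) \<in> dual_darts G" "(a', x) \<in> dual_darts G" "(x, b') \<in> dual_darts G"
      using strand_in that(1,2) unfolding s \<gamma>(2)[symmetric] by blast+
    then show ?thesis using dual_darts_out[OF z sp] dual_darts_in[OF z sp] s \<open>x' = x\<close> by blast
  qed
  have g0: "mid s \<notin> verts T" if sg: "s \<in> strands \<gamma>" for s
  proof -
    obtain a x b where s: "s = (a, x, b)" by (rule prod_cases3)
    have "(a, x) \<in> dual_darts G" using strand_in(1) sg unfolding s \<gamma>(2)[symmetric] by blast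
    then show ?thesis using dual_darts_new s by (simp add: mid_def)
  qed
  have r0: "\<exists>p x q. (p, x, q) \<in> strands [c] \<and> s = (nm {p, x}, x, nm {x, q})"
    if s: "s \<in> strands [refine c]" "mid s \<in> verts T" for s
    using refine_strand[OF s(1)] s(2) nm_new by (auto simp: mid_def)
  have r1: "\<exists>p q. (p, q) \<in> set (darts c) \<and> s = (p, nm {p, q}, q)"
    if s: "s \<in> strands [refine c]" "mid s \<notin> verts T" for s
  proof -
    have "x \<in> verts T" if "(p, x, q) \<in> strands [c]" for p x q
      using strand_link(1)[OF n that] link_sym link_subset by blast
    then show ?thesis using refine_strand[OF s(1)] s(2) by (auto simp: mid_def)
  qed
  have r2: "s = s'" if s: "s \<in> strands [refine c]" "s' \<in> strands [refine c]" "mid s = mid s'" "mid s \<notin> verts T" for s s'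
  proof -
    obtain p q where pq: "(p, q) \<in> set (darts c)" "s = (p, nm {p, q}, q)" using r1 s by blast
    obtain p' q' where pq': "(p', q') \<in> set (darts c)" "s' = (p', nm {p', q'}, q')" using r1[of s'] s by auto
    have "{p, q} = {p', q'}" using s(3) pq pq' nm_edge_eq by (simp add: mid_def)
    moreover have "\<not> (p' = q \<and> q' = p)" using normal_darts(3)[OF n] pq(1) pq'(1) unfolding D by blast
    ultimately show ?thesis using pq pq' by (auto simp: doubleton_eq_iff)
  qed
  show "\<forall>x. card {s \<in> strands ([refine c] @ \<gamma>). mid s = x} \<le> 2"
  proof
    fix x
    show "card {s \<in> strands ([refine c] @ \<gamma>). mid s = x} \<le> 2"
    proof (cases "x \<in> verts T")
      case True
      have "{s \<in> strands ([refine c] @ \<gamma>). mid s = x} \<subseteq> (\<lambda>(p, x, q). (nm {p, x}, x, nm {x, q})) ` {s \<in> strands [c]. mid s = x}"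
      proof
        fix s assume "s \<in> {s \<in> strands ([refine c] @ \<gamma>). mid s = x}"
        then have "mid s = x" "s \<in> strands [refine c] \<or> s \<in> strands \<gamma>" using S by blast+
        then have "s \<in> strands [refine c]" "mid s = x" using g0 True by blast+
        then obtain p x' q where px: "(p, x', q) \<in> strands [c]" "s = (nm {p, x'}, x', nm {x', q})"
          using r0 True by blast
        moreover have "x' = x" using px \<open>mid s = x\<close> by (simp add: mid_def)
        ultimately show "s \<in> (\<lambda>(p, x, q). (nm {p, x}, x, nm {x, q})) ` {s \<in> strands [c]. mid s = x}"
          by (intro image_eqI[of _ _ "(p, x, q)"]) (simp_all add: mid_def)
      qed
      then have "card {s \<in> strands ([refine c] @ \<gamma>). mid s = x} \<le> card {s \<in> strands [c]. mid s = x}"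
        using finite_strands by (intro surj_card_le) auto
      then show ?thesis using normal_card[OF n, of x] by linarith
    next
      case False
      have "{s \<in> strands ([refine c] @ \<gamma>). mid s = x} = {s \<in> strands [refine c]. mid s = x} \<union> {s \<in> strands \<gamma>. mid s = x}"
        using S by blast
      moreover have "card {s \<in> strands [refine c]. mid s = x} \<le> 1" using r2 False by (intro card_le_one) auto
      moreover have "card {s \<in> strands \<gamma>. mid s = x} \<le> 1" using g1 by (intro card_le_one) auto
      ultimately show ?thesis using card_Un_le[of "{s \<in> strands [refine c]. mid s = x}" "{s \<in> strands \<gamma>. mid s = x}"] by simp
    qed
  qed
  have mixed: "positive_wrt bary s s' \<or> positive_wrt bary s' s"
    if s: "s \<in> strands [refine c]" "s' \<in> strands \<gamma>" "mid s = mid s'" for s s'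
  proof -
    have "mid s \<notin> verts T" using g0 s by simp
    then obtain p q where pq: "(p, q) \<in> set (darts c)" "s = (p, nm {p, q}, q)" using r1 s by blast
    obtain r where t: "(p, q, r) \<in> T" using dT pq(1) by blast
    obtain r' where t': "(q, p, r') \<in> T" using opposite t by blast
    obtain a x b where s': "s' = (a, x, b)" by (rule prod_cases3)
    have x: "x = nm {p, q}" using s(3) pq s' by (simp add: mid_def)
    have dd: "(a, nm {p, q}) \<in> dual_darts G" "(nm {p, q}, b) \<in> dual_darts G"
      using strand_in s(2) unfolding s' x \<gamma>(2)[symmetric] by blast+
    have tri: "y = nm {p, q, r} \<or> y = nm {q, p, r'}" if "(p0, q0, r0) \<in> T" "nm {p, q} = nm {p0, q0}" "y = nm {p0, q0, r0}" for y p0 q0 r0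
    proof -
      have "{p0, q0} = {p, q}" using that(2) nm_edge_eq by simp
      then show ?thesis using same_edge[OF t that(1)] that t' tri_unique by blast
    qed
    have a: "a = nm {p, q, r} \<or> a = nm {q, p, r'}"
      using dd(1)
    proof (cases rule: dual_dartE)
      case (1 p0 q0 r0)
      then show ?thesis using nm_tri_edge[OF 1(1)] by metis
    qed (rule tri)
    have b: "b = nm {p, q, r} \<or> b = nm {q, p, r'}"
      using dd(2)
    proof (cases rule: dual_dartE)
      case (2 p0 q0 r0)
      then show ?thesis using nm_tri_edge[OF 2(1)] by metis
    qed (rule tri)
    have "a \<noteq> b" using dual_darts_asym dd by blast
    then show ?thesis using a b bary_edge_cross[OF t t'] unfolding s' x pq(2) by blast
  qed
  show "\<forall>s\<in>strands ([refine c] @ \<gamma>). \<forall>s'\<in>strands ([refine c] @ \<gamma>). s \<noteq> s' \<and> mid s = mid s' \<longrightarrow>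
     positive_wrt bary s s' \<or> positive_wrt bary s' s"
  proof (intro ballI impI, elim conjE)
    fix s s' assume s: "s \<in> strands ([refine c] @ \<gamma>)" "s' \<in> strands ([refine c] @ \<gamma>)" and ne: "s \<noteq> s'" and m: "mid s = mid s'"
    consider "s \<in> strands [refine c]" "s' \<in> strands [refine c]" | "s \<in> strands [refine c]" "s' \<in> strands \<gamma>"
      | "s \<in> strands \<gamma>" "s' \<in> strands [refine c]" | "s \<in> strands \<gamma>" "s' \<in> strands \<gamma>" using s S by blast
    then show "positive_wrt bary s s' \<or> positive_wrt bary s' s"
    proof cases
      case 1
      have v: "mid s \<in> verts T" using r2[OF 1 m] ne by blast
      obtain p x q where a: "(p, x, q) \<in> strands [c]" "s = (nm {p, x}, x, nm {x, q})" using r0[OF 1(1) v] by blast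
      obtain p' x' q' where b: "(p', x', q') \<in> strands [c]" "s' = (nm {p', x'}, x', nm {x', q'})" using r0[OF 1(2)] v m by auto
      have x: "x' = x" using m a b by (simp add: mid_def)
      have "(p, x, q) \<noteq> (p', x', q')" using ne a b by auto
      then have "positive_wrt T (p, x, q) (p', x', q') \<or> positive_wrt T (p', x', q') (p, x, q)"
        using normal_crossing[OF n a(1) b(1)] x by (simp add: mid_def)
      then show ?thesis using positive_wrt_bary[OF n] a b unfolding x by blast
    next
      case 2
      then show ?thesis using mixed m by blast
    next
      case 3
      then show ?thesis using mixed[of s' s] m by auto
    next
      case 4
      then show ?thesis using g1 ne m by blast
    qed
  qed
qed

text \<open>The zero potential has an empty dual curve, which makes this a special case of
  transversality.\<close>

lemma normal_refine:
  assumes n: "normal_curve T [c]" shows "normal_curve bary [refine c]"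
proof -
  have "corner_potential T (\<lambda>a b. 0) (\<lambda>a b c. 0)" unfolding corner_potential_def by simp
  moreover have "dual_darts (\<lambda>a b c. 0) = {}" unfolding dual_darts_def by simp
  moreover have "spread (\<lambda>a b c. 0) 1" unfolding spread_def by simp
  ultimately have "transverse bary [refine c] []"
    using dual_curve_transverse[OF _ cycles_zero _ n] by (simp add: curve_darts_def)
  then show ?thesis unfolding transverse_def by simp
qed

lemma dual_curve_exists:
  assumes n: "normal_curve T [c]" and z: "corner_potential T z G" "z \<in> cycles T" and sp: "spread G 1"
  shows "\<exists>T' F \<gamma>1 \<gamma>2. subdivision T T' F \<and> transverse T' \<gamma>1 \<gamma>2 \<and> curve_chain \<gamma>1 = F (curve_chain [c]) \<and>
    (\<lambda>a b. F z a b - curve_chain \<gamma>2 a b) \<in> boundaries T'"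
proof -
  interpret B: surf bary by unfold_locales (rule bary_surface)
  obtain F where F: "subdivision T bary F" "\<And>f. f \<in> cycles T \<Longrightarrow> edges_lift (edges T) f (F f)"
    using bary_subdivision by blast
  obtain \<gamma> where \<gamma>: "[] \<notin> set \<gamma>" "set (curve_darts \<gamma>) = dual_darts G" "distinct (curve_darts \<gamma>)"
    using flow_decomposition[OF finite_dual_darts, of G] dual_darts_out[OF z sp] dual_darts_in[OF z sp]
      dual_darts_cont[OF z sp] by blast
  have tr: "transverse bary [refine c] \<gamma>" by (rule dual_curve_transverse[OF z sp n \<gamma>])
  note nn = B.curve_intersection_eq_pairing(1,2)[OF tr]
  have "curve_chain [refine c] = F (curve_chain [c])"
    by (rule refine_chain[OF n B.normal_darts(1)[OF nn(1)] F(2)[OF curve_chain_cycle[OF n]]])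
  moreover have "(\<lambda>a b. F z a b - curve_chain \<gamma> a b) \<in> boundaries bary"
  proof (rule dual_cycle_homologous[OF z F(2)[OF z(2)]])
    show "F z \<in> cycles bary" using subdivision_pairing[OF F(1)] z(2) by blast
    show "curve_chain \<gamma> \<in> cycles bary" by (rule B.curve_chain_cycle[OF nn(2)])
    fix p q r assume t: "(p, q, r) \<in> T"
    have "(nm {p, q}, nm {p, q, r}) \<in> dual_darts G \<longleftrightarrow> G q r p - G p q r = 1"
    proof
      assume "(nm {p, q}, nm {p, q, r}) \<in> dual_darts G"
      then show "G q r p - G p q r = 1"
      proof (cases rule: dual_dartE)
        case (1 p' q' r')
        then show ?thesis using same_flag[OF t 1(1)] by metis
      next
        case (2 p' q' r')
        then show ?thesis using nm_tri_edge(1)[OF t, of p' q'] by simp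
      qed
    qed (rule dual_dartI(1)[OF t])
    moreover have "(nm {p, q, r}, nm {p, q}) \<in> dual_darts G \<longleftrightarrow> G q r p - G p q r = - 1"
    proof
      assume "(nm {p, q, r}, nm {p, q}) \<in> dual_darts G"
      then show "G q r p - G p q r = - 1"
      proof (cases rule: dual_dartE)
        case (1 p' q' r')
        then show ?thesis using nm_tri_edge(1)[OF t, of p' q'] by simp
      next
        case (2 p' q' r')
        then show ?thesis using same_flag[OF t 2(1)] by metis
      qed
    qed (rule dual_dartI(2)[OF t])
    moreover have "\<bar>G q r p - G p q r\<bar> \<le> 1" by (rule spread_one(1)[OF sp t])
    ultimately show "curve_chain \<gamma> (nm {p, q}) (nm {p, q, r}) = G q r p - G p q r"
      unfolding curve_chain_eq[OF \<gamma>(3)] \<gamma>(2) by auto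
  next
    fix v x assume "v \<in> verts T"
    then have "(v, x) \<notin> dual_darts G" "(x, v) \<notin> dual_darts G" using dual_darts_new by blast+
    then show "curve_chain \<gamma> v x = 0" unfolding curve_chain_eq[OF \<gamma>(3)] \<gamma>(2) by simp
  qed
  ultimately show ?thesis using F(1) tr by blast
qed

end

text \<open>Induction on the bound \<open>M\<close>: while it exceeds \<open>1\<close>, subdividing
  brings it down to \<open>(M + 1) div 2\<close>, with \<open>c\<close> refined alongside; at
  \<open>1\<close> the dual curve exists. The surface varies in the induction, hence the statement
  outside of the locale.\<close>

lemma transverse_representatives_aux:
  fixes M :: nat
  assumes "surf T" "normal_curve T [c]" "corner_potential T z G" "z \<in> cycles T" "surf.spread T G (int M)"
  shows "\<exists>T' F \<gamma>1 \<gamma>2. subdivision T T' F \<and> transverse T' \<gamma>1 \<gamma>2 \<and> curve_chain \<gamma>1 = F (curve_chain [c]) \<and>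
    (\<lambda>a b. F z a b - curve_chain \<gamma>2 a b) \<in> boundaries T'"
  using assms
proof (induction M arbitrary: T c z G rule: less_induct)
  case (less M)
  interpret surf T by (rule less.prems(1))
  interpret B: surf bary by unfold_locales (rule bary_surface)
  show ?case
  proof (cases "M \<le> 1")
    case True
    have "spread G 1" unfolding spread_def
    proof (intro allI impI)
      fix a b c assume "(a, b, c) \<in> T"
      then have "\<bar>G b c a - G a b c\<bar> \<le> int M" using less.prems(5) unfolding spread_def by blast
      then show "\<bar>G b c a - G a b c\<bar> \<le> 1" using True by linarith
    qed
    then show ?thesis by (rule dual_curve_exists[OF less.prems(2,3,4)])
  next
    case False
    obtain F where F: "subdivision T bary F" "\<And>f. f \<in> cycles T \<Longrightarrow> edges_lift (edges T) f (F f)"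
      using bary_subdivision by blast
    have lt: "(M + 1) div 2 < M" using False by linarith
    have n: "normal_curve bary [refine c]" by (rule normal_refine[OF less.prems(2)])
    have chain: "curve_chain [refine c] = F (curve_chain [c])"
      by (rule refine_chain[OF less.prems(2) B.normal_darts(1)[OF n] F(2)[OF curve_chain_cycle[OF less.prems(2)]]])
    have "int ((M + 1) div 2) = (int M + 1) div 2" by (simp add: zdiv_int)
    then have "B.spread (mean_potential G) (int ((M + 1) div 2))"
      unfolding B.spread_def using mean_potential_spread[OF less.prems(5)] by simp
    then have "\<exists>T' F' \<gamma>1 \<gamma>2. subdivision bary T' F' \<and> transverse T' \<gamma>1 \<gamma>2 \<and> curve_chain \<gamma>1 = F' (curve_chain [refine c]) \<and>
      (\<lambda>a b. F' (F z) a b - curve_chain \<gamma>2 a b) \<in> boundaries T'"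
      using less.IH[OF lt B.surf_axioms n mean_potential[OF less.prems(3,4) F(2)[OF less.prems(4)]]]
        subdivision_pairing[OF F(1)] less.prems(4) by blast
    then obtain T' F' \<gamma>1 \<gamma>2 where *: "subdivision bary T' F'" "transverse T' \<gamma>1 \<gamma>2"
      "curve_chain \<gamma>1 = F' (curve_chain [refine c])" "(\<lambda>a b. F' (F z) a b - curve_chain \<gamma>2 a b) \<in> boundaries T'"
      by blast
    show ?thesis
    proof (intro exI conjI)
      show "subdivision T T' (F' \<circ> F)" by (rule subdivision_trans[OF *(1) F(1)])
      show "transverse T' \<gamma>1 \<gamma>2" by (rule *(2))
      show "curve_chain \<gamma>1 = (F' \<circ> F) (curve_chain [c])" using *(3) chain by simp
      show "(\<lambda>a b. (F' \<circ> F) z a b - curve_chain \<gamma>2 a b) \<in> boundaries T'" using *(4) by simp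
    qed
  qed
qed

section \<open>Intersection numbers computed by the pairing\<close>

context surf
begin

lemma transverse_representatives:
  assumes "normal_curve T [c]" "z \<in> cycles T"
  obtains T' F \<gamma>1 \<gamma>2 where "subdivision T T' F" "transverse T' \<gamma>1 \<gamma>2" "curve_chain \<gamma>1 = F (curve_chain [c])"
    "(\<lambda>a b. F z a b - curve_chain \<gamma>2 a b) \<in> boundaries T'"
proof -
  obtain G where G: "corner_potential T z G" using potential_exists assms(2) by blast
  \<comment> \<open>Any bound on the jumps will do to start the induction; the sum of their absolute
    values is one.\<close>
  define h where "h = (\<lambda>(a, b, c). \<bar>G b c a - G a b c\<bar>)"
  define M where "M = nat (\<Sum>t\<in>T. h t)"
  have nn: "0 \<le> h t" for t unfolding h_def by (cases t) simp
  have "\<bar>G b c a - G a b c\<bar> \<le> int M" if "(a, b, c) \<in> T" for a b c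
  proof -
    have "h (a, b, c) \<le> (\<Sum>t\<in>T. h t)" by (rule member_le_sum[OF that]) (use nn finite_T in auto)
    moreover have "0 \<le> (\<Sum>t\<in>T. h t)" by (rule sum_nonneg) (rule nn)
    ultimately show ?thesis unfolding M_def h_def by simp
  qed
  then have "spread G (int M)" unfolding spread_def by blast
  from transverse_representatives_aux[OF surf_axioms assms(1) G assms(2) this] show thesis using that by blast
qed

lemma pairing_add_left:
  assumes "f \<in> cycles T" "g \<in> cycles T" "h \<in> cycles T"
  shows "pairing T (\<lambda>a b. f a b + g a b) h = pairing T f h + pairing T g h"
  using pairing_antisym[OF cycles_add[OF assms(1,2)] assms(3)] pairing_antisym[OF assms(1,3)] pairing_antisym[OF assms(2,3)]
    pairing_add_right[of h f g] by simp

lemma pairing_class: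
  assumes "z1 \<in> cycles T" "z2 \<in> cycles T" "f1 \<in> chain_class T z1" "f2 \<in> chain_class T z2"
  shows "f1 \<in> cycles T" "f2 \<in> cycles T" "pairing T f1 f2 = pairing T z1 z2"
proof -
  obtain g1 where g1: "g1 \<in> boundaries T" "f1 = (\<lambda>a b. g1 a b + z1 a b)" using assms(3) unfolding chain_class_iff by (rule bexE)
  obtain g2 where g2: "g2 \<in> boundaries T" "f2 = (\<lambda>a b. g2 a b + z2 a b)" using assms(4) unfolding chain_class_iff by (rule bexE)
  have c: "g1 \<in> cycles T" "g2 \<in> cycles T" using g1 g2 boundaries_cycles by blast+
  show f: "f1 \<in> cycles T" "f2 \<in> cycles T" unfolding g1(2) g2(2) using cycles_add c assms by blast+
  have "pairing T f1 f2 = pairing T z1 f2"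
    unfolding g1(2) pairing_add_left[OF c(1) assms(1) f(2)] pairing_boundary_left[OF g1(1) f(2)] by simp
  also have "\<dots> = pairing T z1 z2"
    unfolding g2(2) pairing_add_right pairing_boundary_right[OF g2(1) assms(1)] by simp
  finally show "pairing T f1 f2 = pairing T z1 z2" .
qed

text \<open>The pairing depends only on homology classes and is kept by subdivision, so every
  admissible choice of representatives gives the same number. To evaluate the definite description
  it then suffices to exhibit one choice.\<close>

lemma intersection_of_representatives:
  assumes z: "z1 \<in> cycles T" "z2 \<in> cycles T" and sub: "subdivision T T' F" and tr: "transverse T' \<gamma>1 \<gamma>2"
    and r: "represents T' F \<gamma>1 (chain_class T z1)" "represents T' F \<gamma>2 (chain_class T z2)"
  shows "2 * curve_intersection T' \<gamma>1 \<gamma>2 = pairing T z1 z2"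
proof -
  interpret S: surf T' by unfold_locales (use subdivision_pairing[OF sub] in blast)
  obtain f1 where f1: "f1 \<in> chain_class T z1" "curve_class T' \<gamma>1 = chain_class T' (F f1)"
    using r(1) unfolding represents_def by blast
  obtain f2 where f2: "f2 \<in> chain_class T z2" "curve_class T' \<gamma>2 = chain_class T' (F f2)"
    using r(2) unfolding represents_def by blast
  note f = pairing_class[OF z f1(1) f2(1)]
  have F: "F f1 \<in> cycles T'" "F f2 \<in> cycles T'" "pairing T' (F f1) (F f2) = pairing T f1 f2"
    using subdivision_pairing[OF sub] f by blast+
  have "curve_chain \<gamma>1 \<in> chain_class T' (F f1)" "curve_chain \<gamma>2 \<in> chain_class T' (F f2)"
    using f1(2) f2(2) chain_class_self unfolding curve_class_def by blast+
  then have "pairing T' (curve_chain \<gamma>1) (curve_chain \<gamma>2) = pairing T' (F f1) (F f2)"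
    using S.pairing_class(3)[OF F(1,2)] by blast
  then show ?thesis using S.curve_intersection_eq_pairing(3)[OF tr] F(3) f(3) by simp
qed

lemma intersection_number_eqI:
  assumes z: "z1 \<in> cycles T" "z2 \<in> cycles T" and sub: "subdivision T T' F" and tr: "transverse T' \<gamma>1 \<gamma>2"
    and r: "represents T' F \<gamma>1 (chain_class T z1)" "represents T' F \<gamma>2 (chain_class T z2)"
  shows "2 * intersection_number T (chain_class T z1) (chain_class T z2) = pairing T z1 z2"
proof -
  have "intersection_number T (chain_class T z1) (chain_class T z2) = curve_intersection T' \<gamma>1 \<gamma>2"
    unfolding intersection_number_def
  proof (rule the_equality)
    show "\<exists>T'' F \<gamma>1' \<gamma>2'. subdivision T T'' F \<and> transverse T'' \<gamma>1' \<gamma>2' \<and>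
        represents T'' F \<gamma>1' (chain_class T z1) \<and> represents T'' F \<gamma>2' (chain_class T z2) \<and>
        curve_intersection T' \<gamma>1 \<gamma>2 = curve_intersection T'' \<gamma>1' \<gamma>2'"
      using sub tr r by blast
    fix k assume "\<exists>T'' F \<gamma>1' \<gamma>2'. subdivision T T'' F \<and> transverse T'' \<gamma>1' \<gamma>2' \<and>
        represents T'' F \<gamma>1' (chain_class T z1) \<and> represents T'' F \<gamma>2' (chain_class T z2) \<and>
        k = curve_intersection T'' \<gamma>1' \<gamma>2'"
    then obtain T'' F' \<gamma>1' \<gamma>2' where *: "subdivision T T'' F'" "transverse T'' \<gamma>1' \<gamma>2'"
      "represents T'' F' \<gamma>1' (chain_class T z1)" "represents T'' F' \<gamma>2' (chain_class T z2)"
      "k = curve_intersection T'' \<gamma>1' \<gamma>2'" by (elim exE conjE)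
    then show "k = curve_intersection T' \<gamma>1 \<gamma>2"
      using intersection_of_representatives[OF z *(1-4)] intersection_of_representatives[OF z sub tr r] by simp
  qed
  then show ?thesis using intersection_of_representatives[OF z sub tr r] by simp
qed

text \<open>The first class has to come from a normal curve, because that curve is refined; the
  second may be the class of any cycle, since it is replaced by its dual curve.\<close>

lemma intersection_number_normal:
  assumes n: "normal_curve T [c]" and z: "z \<in> cycles T"
  shows "2 * intersection_number T (curve_class T [c]) (chain_class T z) = pairing T (curve_chain [c]) z"
proof -
  obtain T' F \<gamma>1 \<gamma>2 where *: "subdivision T T' F" "transverse T' \<gamma>1 \<gamma>2" "curve_chain \<gamma>1 = F (curve_chain [c])"
    "(\<lambda>a b. F z a b - curve_chain \<gamma>2 a b) \<in> boundaries T'"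
    using transverse_representatives[OF assms] by blast
  have 1: "represents T' F \<gamma>1 (chain_class T (curve_chain [c]))"
    unfolding represents_def curve_class_def *(3) by (rule bexI[OF refl chain_class_self])
  have "chain_class T' (F z) = chain_class T' (curve_chain \<gamma>2)"
    by (rule chain_class_eqI[OF *(4)]) simp
  then have 2: "represents T' F \<gamma>2 (chain_class T z)"
    unfolding represents_def curve_class_def by (intro bexI[OF _ chain_class_self]) simp
  show ?thesis unfolding curve_class_def
    by (rule intersection_number_eqI[OF curve_chain_cycle[OF n] z *(1,2) 1 2])
qed

text \<open>Both classes are zero and are represented by the empty curve on the surface
  itself.\<close>

lemma intersection_number_boundary:
  assumes z: "z1 \<in> boundaries T" "z2 \<in> boundaries T"
  shows "intersection_number T (chain_class T z1) (chain_class T z2) = 0"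
proof -
  have c: "z1 \<in> cycles T" "z2 \<in> cycles T" using z boundaries_cycles by blast+
  have "represents T id [] (chain_class T z)" if "z \<in> boundaries T" for z
  proof -
    have "curve_chain [] = (\<lambda>a b. 0)" unfolding curve_chain_def curve_darts_def by (intro ext) simp
    moreover have "(\<lambda>a b. 0) \<in> chain_class T z"
      unfolding chain_class_iff using boundaries_neg[OF that] by (intro bexI[of _ "\<lambda>a b. - z a b"]) auto
    ultimately show ?thesis unfolding represents_def curve_class_def
      by (intro bexI[of _ "\<lambda>a b. 0"]) simp_all
  qed
  note r = this[OF z(1)] this[OF z(2)]
  have "transverse T [] []" unfolding transverse_def normal_curve_def curve_darts_def strands_def by simp
  from intersection_number_eqI[OF c subdivision.trivial this r] show ?thesis
    using pairing_boundary_left[OF z(1) c(2)] by simp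
qed

end

section \<open>Capping the ribbon graph of a curve\<close>

text \<open>The surface obtained from a neighbourhood of a graph on a surface by capping its boundary
  circles with discs. A dart \<open>(x, b)\<close> of the graph contributes one vertex \<open>side (x, b)\<close> on the left of the
  edge from \<open>x\<close> to \<open>b\<close>.\<close>

locale ribbon = surf +
  fixes D :: "(nat \<times> nat) set"
  assumes D_link: "(x, b) \<in> D \<Longrightarrow> b \<in> link_verts T x"
    and D_sym: "(x, b) \<in> D \<Longrightarrow> (b, x) \<in> D"
    and D_deg: "(x, b) \<in> D \<Longrightarrow> \<exists>b'. b' \<noteq> b \<and> (x, b') \<in> D"
    and D_ne: "D \<noteq> {}"
begin

text \<open>Number of counterclockwise steps in the link from \<open>b\<close> to the next dart of
  the graph at \<open>x\<close>; \<open>nc\<close> is the end of that dart. By \<open>D_deg\<close>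
  it is met before a full turn.\<close>

definition nk :: "nat \<Rightarrow> nat \<Rightarrow> nat" where
  "nk x b = (LEAST k. 0 < k \<and> (x, (nx x ^^ k) b) \<in> D)"

definition nc :: "nat \<Rightarrow> nat \<Rightarrow> nat" where "nc x b = (nx x ^^ nk x b) b"

lemma nk_prop:
  assumes "(x, b) \<in> D" shows "0 < nk x b" "(x, (nx x ^^ nk x b) b) \<in> D" "nk x b < card (link_verts T x)"
    and "\<And>k. 0 < k \<Longrightarrow> k < nk x b \<Longrightarrow> (x, (nx x ^^ k) b) \<notin> D"
proof -
  obtain b' where b': "b' \<noteq> b" "(x, b') \<in> D" using D_deg assms by blast
  obtain j where j: "j < card (link_verts T x)" "b' = (nx x ^^ j) b" using nx_pow_ex D_link assms b'(2) by metis
  have "0 < j" using b'(1) j(2) by (cases j) auto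
  then have P: "0 < j \<and> (x, (nx x ^^ j) b) \<in> D" using b' j by simp
  show "0 < nk x b" "(x, (nx x ^^ nk x b) b) \<in> D" using LeastI[of "\<lambda>k. 0 < k \<and> (x, (nx x ^^ k) b) \<in> D", OF P] unfolding nk_def by auto
  show "nk x b < card (link_verts T x)"
    using Least_le[of "\<lambda>k. 0 < k \<and> (x, (nx x ^^ k) b) \<in> D", OF P] j(1) unfolding nk_def by linarith
  show "(x, (nx x ^^ k) b) \<notin> D" if "0 < k" "k < nk x b" for k
    using not_less_Least[of k "\<lambda>k. 0 < k \<and> (x, (nx x ^^ k) b) \<in> D"] that unfolding nk_def by blast
qed

lemma nc_D: "(x, b) \<in> D \<Longrightarrow> (x, nc x b) \<in> D" unfolding nc_def by (rule nk_prop(2))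

lemma nc_ne: assumes "(x, b) \<in> D" shows "nc x b \<noteq> b"
proof
  assume "nc x b = b"
  then have "(nx x ^^ nk x b) b = (nx x ^^ 0) b" by (simp add: nc_def)
  then have "nk x b = 0"
    by (rule nx_pow_inj[OF D_link[OF assms]]) (use nk_prop(1,3)[OF assms] in auto)
  then show False using nk_prop(1)[OF assms] by simp
qed

lemma nc_between: assumes "(x, b) \<in> D" "d \<in> between T x b (nc x b)" shows "(x, d) \<notin> D"
proof -
  obtain i j where *: "0 < i" "i < j" "j < card (link_verts T x)" "d = (nx x ^^ i) b" "nc x b = (nx x ^^ j) b"
    using assms(2) by (rule betweenE)
  have "nk x b = j"
    by (rule nx_pow_inj[OF D_link[OF assms(1)]]) (use * nk_prop(3)[OF assms(1)] in \<open>auto simp: nc_def\<close>)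
  then show ?thesis using nk_prop(4)[OF assms(1) *(1)] * by simp
qed

text \<open>If two darts had the same successor, neither could lie in the gap before it, so as seen
  from each of them the successor would come before the other dart. A cyclic order forbids
  this.\<close>

lemma nc_inj: assumes b: "(x, b) \<in> D" "(x, b') \<in> D" and eq: "nc x b = nc x b'" shows "b = b'"
proof (rule ccontr)
  assume ne: "b \<noteq> b'"
  let ?c = "nc x b"
  note l = D_link[OF b(1)] D_link[OF b(2)] D_link[OF nc_D[OF b(1)]]
  have cn: "?c \<noteq> b" "?c \<noteq> b'" using nc_ne[OF b(1)] nc_ne[OF b(2)] eq by auto
  have "b' \<notin> between T x b ?c" "b \<notin> between T x b' ?c" using nc_between b eq by auto
  then have 1: "?c \<in> between T x b b'" and 2: "?c \<in> between T x b' b"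
    using between_total[OF l(1,3,2)] between_total[OF l(2,3,1)] cn ne by simp_all
  have "b \<in> between T x b' ?c" by (rule between_rotate[OF l(3) between_rotate[OF l(1) 1]])
  then show False using 2 between_asym[OF l(2)] by blast
qed

text \<open>A run of link steps from one dart to another splits into \<open>nc\<close> steps, by
  strong induction on its length; all darts at a vertex thus form one
  \<open>nc\<close>-cycle.\<close>

lemma nc_cycle:
  assumes A: "b \<in> A" and b: "(x, b) \<in> D" and c: "(x, c) \<in> D"
    and step: "\<And>e. (x, e) \<in> D \<Longrightarrow> e \<in> A \<Longrightarrow> nc x e \<in> A"
  shows "c \<in> A"
proof -
  have "(nx x ^^ k) b \<in> A" if "b \<in> A" "(x, b) \<in> D" "(x, (nx x ^^ k) b) \<in> D" for k b
    using that
  proof (induction k arbitrary: b rule: less_induct)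
    case (less k)
    show ?case
    proof (cases "k = 0")
      case False
      have le: "nk x b \<le> k"
      proof (rule ccontr)
        assume "\<not> nk x b \<le> k"
        then show False using nk_prop(4)[OF less.prems(2), of k] less.prems(3) False by simp
      qed
      then have eq: "(nx x ^^ k) b = (nx x ^^ (k - nk x b)) (nc x b)"
        unfolding nc_def by (metis funpow_add le_add_diff_inverse2 o_apply)
      have "(nx x ^^ (k - nk x b)) (nc x b) \<in> A"
        by (rule less.IH) (use nk_prop(1)[OF less.prems(2)] False step less.prems nc_D eq in auto)
      then show ?thesis using eq by simp
    qed (use less.prems in simp)
  qed
  moreover obtain k where "c = (nx x ^^ k) b" using nx_pow_ex D_link b c by metis
  ultimately show ?thesis using A b c by blast
qed

lemma finite_D: "finite D"
proof -
  have "D \<subseteq> verts T \<times> verts T"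
  proof (rule subrelI)
    fix x b assume "(x, b) \<in> D"
    then show "(x, b) \<in> verts T \<times> verts T" using D_link link_subset link_sym by blast
  qed
  then show ?thesis using finite_verts finite_subset by blast
qed

lemma D_vert: "(x, b) \<in> D \<Longrightarrow> x \<in> verts T" "(x, b) \<in> D \<Longrightarrow> b \<in> verts T" "(x, b) \<in> D \<Longrightarrow> x \<noteq> b"
  using D_link link_subset link_sym edge_ne by blast+

text \<open>The dart preceding \<open>h\<close> on the boundary of the face to its left.\<close>

definition pf :: "nat \<times> nat \<Rightarrow> nat \<times> nat" where "pf h = (nc (fst h) (snd h), fst h)"

lemma pf_D: "h \<in> D \<Longrightarrow> pf h \<in> D"
  unfolding pf_def using nc_D D_sym by (cases h) auto

lemma snd_pf: "snd (pf h) = fst h" unfolding pf_def by simp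

lemma pf_inj: "inj_on pf D"
proof (rule inj_onI)
  fix h h' assume h: "h \<in> D" "h' \<in> D" "pf h = pf h'"
  then show "h = h'" using nc_inj by (cases h; cases h') (auto simp: pf_def)
qed

lemma pf_surj: assumes "h \<in> D" obtains h' where "h' \<in> D" "pf h' = h"
proof -
  have "pf ` D = D" using pf_D pf_inj finite_D by (intro endo_inj_surj) auto
  then have "h \<in> pf ` D" using assms by simp
  then show thesis using that by blast
qed

lemma pf_pf_ne: assumes "h \<in> D" shows "pf (pf h) \<noteq> h"
proof
  assume "pf (pf h) = h"
  then have "snd (pf (pf h)) = snd h" by simp
  then have "nc (fst h) (snd h) = snd h" by (simp add: pf_def)
  then show False using nc_ne[of "fst h" "snd h"] assms by simp
qed

lemma pf_ne: assumes "h \<in> D" shows "pf h \<noteq> h"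
proof
  assume "pf h = h"
  then have "snd (pf h) = snd h" by simp
  then show False using D_vert(3)[of "fst h" "snd h"] assms by (simp add: pf_def)
qed

definition face_orbit :: "nat \<times> nat \<Rightarrow> (nat \<times> nat) set" where "face_orbit h = {e. \<exists>k. e = (pf ^^ k) h}"

lemma face_orbit_self: "h \<in> face_orbit h"
proof -
  have "h = (pf ^^ 0) h" by simp
  then show ?thesis unfolding face_orbit_def by blast
qed

lemma pf_pow_D: "h \<in> D \<Longrightarrow> (pf ^^ k) h \<in> D"
  by (induction k) (auto intro: pf_D)

lemma face_orbit_pf: assumes "h \<in> D" shows "face_orbit (pf h) = face_orbit h"
proof
  have sh: "(pf ^^ k) (pf h) = (pf ^^ Suc k) h" for k by (simp add: funpow_swap1)
  show "face_orbit (pf h) \<subseteq> face_orbit h" unfolding face_orbit_def sh by blast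
  have sub: "face_orbit h \<subseteq> D" unfolding face_orbit_def using pf_pow_D assms by blast
  then have fin: "finite (face_orbit h)" using finite_D finite_subset by blast
  have maps: "pf ` face_orbit h \<subseteq> face_orbit h"
  proof (rule image_subsetI)
    fix e assume "e \<in> face_orbit h"
    then obtain k where "e = (pf ^^ k) h" unfolding face_orbit_def by blast
    then have "pf e = (pf ^^ Suc k) h" by simp
    then show "pf e \<in> face_orbit h" unfolding face_orbit_def by blast
  qed
  have "(pf ^^ card (face_orbit h)) h = h"
    by (rule cyclic_orbit(2)[OF fin maps inj_on_subset[OF pf_inj sub] face_orbit_self])
      (simp add: face_orbit_def)
  moreover have "0 < card (face_orbit h)" using fin face_orbit_self card_gt_0_iff by blast
  ultimately obtain p where p: "(pf ^^ Suc p) h = h" using gr0_implies_Suc by metis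
  show "face_orbit h \<subseteq> face_orbit (pf h)"
  proof
    fix e assume "e \<in> face_orbit h"
    then obtain k where "e = (pf ^^ k) h" unfolding face_orbit_def by blast
    also have "\<dots> = (pf ^^ k) ((pf ^^ Suc p) h)" using p by simp
    also have "\<dots> = (pf ^^ (k + p)) (pf h)" by (simp add: funpow_swap1 funpow_add)
    finally show "e \<in> face_orbit (pf h)" unfolding face_orbit_def by blast
  qed
qed

lemma face_orbit_eq: assumes "h \<in> D" "e \<in> face_orbit h" shows "face_orbit e = face_orbit h"
proof -
  obtain k where k: "e = (pf ^^ k) h" using assms(2) unfolding face_orbit_def by blast
  have "face_orbit ((pf ^^ k) h) = face_orbit h"
    by (induction k) (use face_orbit_pf pf_pow_D[OF assms(1)] in auto)
  then show ?thesis using k by simp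
qed

text \<open>A canonical number of the face, needed because the centres of the capping discs have to
  be vertices in \<open>nat\<close>.\<close>

definition face :: "nat \<times> nat \<Rightarrow> nat" where "face h = (LEAST n. n \<in> prod_encode ` face_orbit h)"

lemma face_eq_iff: assumes "h \<in> D" "h' \<in> D" shows "face h = face h' \<longleftrightarrow> face_orbit h = face_orbit h'"
proof
  assume eq: "face h = face h'"
  have m: "face g \<in> prod_encode ` face_orbit g" for g
    unfolding face_def by (rule LeastI[of _ "prod_encode g"]) (use face_orbit_self in blast)
  obtain e where e: "e \<in> face_orbit h" "face h = prod_encode e" using m by blast
  obtain e' where e': "e' \<in> face_orbit h'" "face h' = prod_encode e'" using m by blast
  have "e = e'" using eq e(2) e'(2) by (simp add: prod_encode_eq)
  then show "face_orbit h = face_orbit h'" using face_orbit_eq assms e(1) e'(1) by metis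
qed (simp add: face_def)

lemma face_pf: "h \<in> D \<Longrightarrow> face (pf h) = face h"
  using face_eq_iff pf_D face_orbit_pf by blast

text \<open>Even offsets beyond the old vertices are used for sides and odd ones for face centres,
  so the three kinds of vertices never collide.\<close>

definition side :: "nat \<times> nat \<Rightarrow> nat" where "side h = Suc (Max (verts T)) + 2 * prod_encode h"

definition face_vert :: "nat \<times> nat \<Rightarrow> nat" where "face_vert h = Suc (Suc (Max (verts T)) + 2 * face h)"

lemma side_eq: "side h = side h' \<longleftrightarrow> h = h'"
  unfolding side_def by (simp add: prod_encode_eq)

lemma face_vert_eq: "face_vert h = face_vert h' \<longleftrightarrow> face h = face h'"
  unfolding face_vert_def by simp

lemma side_face: "side h \<noteq> face_vert h'" "face_vert h' \<noteq> side h"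
  unfolding side_def face_vert_def by presburger+

lemma side_vert: "x \<in> verts T \<Longrightarrow> side h \<noteq> x" "x \<in> verts T \<Longrightarrow> face_vert h \<noteq> x"
  "x \<in> verts T \<Longrightarrow> x \<noteq> side h" "x \<in> verts T \<Longrightarrow> x \<noteq> face_vert h"
  "side h \<notin> verts T" "face_vert h \<notin> verts T"
proof -
  have *: "x \<in> verts T \<Longrightarrow> x \<le> Max (verts T)" for x using finite_verts by simp
  show "x \<in> verts T \<Longrightarrow> side h \<noteq> x" "x \<in> verts T \<Longrightarrow> face_vert h \<noteq> x"
    "x \<in> verts T \<Longrightarrow> x \<noteq> side h" "x \<in> verts T \<Longrightarrow> x \<noteq> face_vert h"
    using *[of x] unfolding side_def face_vert_def by auto
  show "side h \<notin> verts T" "face_vert h \<notin> verts T"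
    using *[of "side h"] *[of "face_vert h"] unfolding side_def face_vert_def by auto
qed

text \<open>Three triangles per dart \<open>h\<close>, with their rotations: one between its edge
  and \<open>side h\<close>, one filling the corner at \<open>fst h\<close> up to the next edge of
  the graph, and one joining the two sides at that corner to the centre of the face. Thanks to the
  layer of sides the result is a simplicial complex even if a face meets the same vertex or edge
  twice.\<close>

definition capped :: surface where
  "capped = (\<Union>h\<in>D. {(fst h, snd h, side h), (snd h, side h, fst h), (side h, fst h, snd h),
     (fst h, side h, side (pf h)), (side h, side (pf h), fst h), (side (pf h), fst h, side h),
     (side (pf h), side h, face_vert h), (side h, face_vert h, side (pf h)), (face_vert h, side (pf h), side h)})"

lemma capped_mem:
  assumes "h \<in> D"
  shows "(fst h, snd h, side h) \<in> capped" "(snd h, side h, fst h) \<in> capped" "(side h, fst h, snd h) \<in> capped"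
    "(fst h, side h, side (pf h)) \<in> capped" "(side h, side (pf h), fst h) \<in> capped" "(side (pf h), fst h, side h) \<in> capped"
    "(side (pf h), side h, face_vert h) \<in> capped" "(side h, face_vert h, side (pf h)) \<in> capped"
    "(face_vert h, side (pf h), side h) \<in> capped"
  unfolding capped_def using assms by blast+

lemma capped_cases:
  assumes "(u, v, w) \<in> capped"
  obtains h where "h \<in> D" "u = fst h" "v = snd h" "w = side h"
  | h where "h \<in> D" "u = snd h" "v = side h" "w = fst h"
  | h where "h \<in> D" "u = side h" "v = fst h" "w = snd h"
  | h where "h \<in> D" "u = fst h" "v = side h" "w = side (pf h)"
  | h where "h \<in> D" "u = side h" "v = side (pf h)" "w = fst h"
  | h where "h \<in> D" "u = side (pf h)" "v = fst h" "w = side h"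
  | h where "h \<in> D" "u = side (pf h)" "v = side h" "w = face_vert h"
  | h where "h \<in> D" "u = side h" "v = face_vert h" "w = side (pf h)"
  | h where "h \<in> D" "u = face_vert h" "v = side (pf h)" "w = side h"
  using assms unfolding capped_def by auto

text \<open>Computes the last vertex of a triangle from the other two by decoding sides. Uniqueness
  of the triangle on a directed edge is then one equation per shape, instead of a comparison of all
  pairs of the nine shapes.\<close>

definition third :: "nat \<Rightarrow> nat \<Rightarrow> nat" where
  "third u v = (if u \<in> verts T then
       if v \<in> verts T then side (u, v) else
         (let h = inv_into UNIV side v in if u = snd h then fst h else side (pf h))
     else if v \<in> verts T then
       (let h = inv_into UNIV side u in if v = fst h then snd h else side (inv_into D pf h))
     else if u \<in> range side \<and> v \<in> range side then
       (let h = inv_into UNIV side u; h' = inv_into UNIV side v in if h' = pf h then fst h else face_vert h')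
     else if u \<in> range side then side (pf (inv_into UNIV side u)) else side (inv_into D pf (inv_into UNIV side v)))"

lemma inv_side: "inv_into UNIV side (side h) = h"
  by (rule inv_f_f) (simp add: inj_def side_eq)

lemma inv_pf: "h \<in> D \<Longrightarrow> inv_into D pf (pf h) = h"
  by (rule inv_into_f_f[OF pf_inj])

lemma face_range: "face_vert h \<notin> range side" using side_face by blast

lemma fst_snd_vert: assumes "h \<in> D" shows "fst h \<in> verts T" "snd h \<in> verts T" "fst h \<noteq> snd h" "snd h \<noteq> fst h"
  using D_vert[of "fst h" "snd h"] assms by auto

lemma capped_third: assumes "(u, v, w) \<in> capped" shows "w = third u v"
  using assms
proof (cases rule: capped_cases)
  case (1 h)
  then show ?thesis using fst_snd_vert[OF 1(1)] by (simp add: third_def)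
next
  case (2 h)
  then show ?thesis using fst_snd_vert[OF 2(1)] by (simp add: third_def side_vert inv_side Let_def)
next
  case (3 h)
  then show ?thesis using fst_snd_vert[OF 3(1)] by (simp add: third_def side_vert inv_side Let_def)
next
  case (4 h)
  then show ?thesis using fst_snd_vert[OF 4(1)] by (simp add: third_def side_vert inv_side Let_def)
next
  case (5 h)
  then show ?thesis by (simp add: third_def side_vert inv_side Let_def)
next
  case (6 h)
  have "fst (pf h) \<noteq> fst h" using fst_snd_vert(3)[OF pf_D[OF 6(1)]] snd_pf by simp
  then show ?thesis using 6 fst_snd_vert[OF 6(1)] by (simp add: third_def side_vert inv_side inv_pf Let_def)
next
  case (7 h)
  have "h \<noteq> pf (pf h)" using pf_pf_ne[OF 7(1)] by simp
  then show ?thesis using 7 by (simp add: third_def side_vert inv_side Let_def)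
next
  case (8 h)
  then show ?thesis using face_range by (simp add: third_def side_vert inv_side Let_def)
next
  case (9 h)
  then show ?thesis using face_range by (simp add: third_def side_vert inv_side inv_pf Let_def)
qed

lemma capped_rot: assumes "(u, v, w) \<in> capped" shows "(v, w, u) \<in> capped"
  using assms by (cases rule: capped_cases) (use capped_mem in auto)

lemma capped_opposite: assumes "(u, v, w) \<in> capped" shows "\<exists>t. (v, u, t) \<in> capped"
  using assms
proof (cases rule: capped_cases)
  case (1 h)
  have "(snd h, fst h) \<in> D" using D_sym 1(1) by simp
  from capped_mem(1)[OF this] show ?thesis using 1 by auto
next
  case (2 h)
  obtain h' where "h' \<in> D" "pf h' = h" using pf_surj 2(1) by blast
  then show ?thesis using capped_mem(6)[of h'] snd_pf[of h'] 2 by auto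
next
  case (3 h)
  then show ?thesis using capped_mem(4) by blast
next
  case (4 h)
  then show ?thesis using capped_mem(3) by blast
next
  case (5 h)
  then show ?thesis using capped_mem(7) by blast
next
  case (6 h)
  then show ?thesis using capped_mem(2)[OF pf_D[OF 6(1)]] snd_pf[of h] by auto
next
  case (7 h)
  then show ?thesis using capped_mem(5) by blast
next
  case (8 h)
  obtain h' where h': "h' \<in> D" "pf h' = h" using pf_surj 8(1) by blast
  then have "face_vert h' = face_vert h" using face_pf face_vert_eq by metis
  then show ?thesis using capped_mem(9)[OF h'(1)] h'(2) 8 by auto
next
  case (9 h)
  have "face_vert (pf h) = face_vert h" using face_pf 9(1) face_vert_eq by metis
  then show ?thesis using capped_mem(8)[OF pf_D[OF 9(1)]] 9 by auto
qed

lemma capped_mirror: assumes m: "(u, v, w) \<in> capped" shows "(v, u, w) \<notin> capped"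
proof
  assume m': "(v, u, w) \<in> capped"
  from m show False
  proof (cases rule: capped_cases)
    case (1 h)
    have "(snd h, fst h) \<in> D" using D_sym 1(1) by simp
    then have "w = side (snd h, fst h)" using capped_third[OF m'] capped_third[OF capped_mem(1)] 1 by auto
    then show False using 1 side_eq fst_snd_vert(3)[OF 1(1)] by (metis fst_conv)
  next
    case (2 h)
    obtain h' where h': "h' \<in> D" "pf h' = h" using pf_surj 2(1) by blast
    have "w = side h'" using capped_third[OF m'] capped_third[OF capped_mem(6)[OF h'(1)]] h'(2) snd_pf[of h'] 2 by simp
    then show False using 2 fst_snd_vert(1)[OF 2(1)] side_vert by metis
  next
    case (3 h)
    then have "w = side (pf h)" using capped_third[OF m'] capped_third[OF capped_mem(4)[OF 3(1)]] by simp
    then show False using 3 fst_snd_vert(2)[OF 3(1)] side_vert by metis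
  next
    case (4 h)
    then have "w = snd h" using capped_third[OF m'] capped_third[OF capped_mem(3)[OF 4(1)]] by simp
    then show False using 4 fst_snd_vert(2)[OF 4(1)] side_vert by metis
  next
    case (5 h)
    then have "w = face_vert h" using capped_third[OF m'] capped_third[OF capped_mem(7)[OF 5(1)]] by simp
    then show False using 5 fst_snd_vert(1)[OF 5(1)] side_vert by metis
  next
    case (6 h)
    then have "w = fst (pf h)" using capped_third[OF m'] capped_third[OF capped_mem(2)[OF pf_D[OF 6(1)]]] snd_pf[of h] by simp
    then show False using 6 fst_snd_vert(1)[OF pf_D[OF 6(1)]] side_vert by metis
  next
    case (7 h)
    then have "w = fst h" using capped_third[OF m'] capped_third[OF capped_mem(5)[OF 7(1)]] by simp
    then show False using 7 fst_snd_vert(1)[OF 7(1)] side_vert by metis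
  next
    case (8 h)
    obtain h' where h': "h' \<in> D" "pf h' = h" using pf_surj 8(1) by blast
    have "face_vert h' = face_vert h" using h' face_pf face_vert_eq by metis
    then have "w = side h'" using capped_third[OF m'] capped_third[OF capped_mem(9)[OF h'(1)]] h'(2) 8 by simp
    then have "pf h = h'" using 8 side_eq by simp
    then show False using pf_pf_ne[OF h'(1)] h'(2) by simp
  next
    case (9 h)
    have "face_vert (pf h) = face_vert h" using face_pf 9(1) face_vert_eq by metis
    then have "w = side (pf (pf h))" using capped_third[OF m'] capped_third[OF capped_mem(8)[OF pf_D[OF 9(1)]]] 9 by simp
    then show False using 9 side_eq pf_pf_ne[OF 9(1)] by simp
  qed
qed

lemma capped_ne: assumes "(u, v, w) \<in> capped" shows "u \<noteq> v"
  using assms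
proof (cases rule: capped_cases)
  case (5 h)
  then show ?thesis using pf_ne[OF 5(1)] side_eq by metis
next
  case (7 h)
  then show ?thesis using pf_ne[OF 7(1)] side_eq by metis
qed (use fst_snd_vert side_vert side_face in \<open>auto\<close>)

text \<open>The link of an old vertex \<open>x\<close> passes from each dart \<open>b\<close>
  through \<open>side (x, b)\<close> and \<open>side (nc x b, x)\<close> to \<open>nc x b\<close>,
  so its connectedness comes from the cycle of darts at \<open>x\<close>.\<close>

lemma capped_link_vert:
  assumes x: "x \<in> verts T" and A: "b \<in> A" "b \<in> link_verts capped x" and c: "c \<in> link_verts capped x"
    and cl: "\<And>u v. (x, u, v) \<in> capped \<Longrightarrow> u \<in> A \<longleftrightarrow> v \<in> A"
  shows "c \<in> A"
proof -
  have s1: "b \<in> A \<longleftrightarrow> side (x, b) \<in> A" if "(x, b) \<in> D" for b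
    using cl[of b "side (x, b)"] capped_mem(1)[OF that] by simp
  have s2: "side (b, x) \<in> A \<longleftrightarrow> b \<in> A" if "(b, x) \<in> D" for b
    using cl[of "side (b, x)" b] capped_mem(2)[OF that] by simp
  have s3: "side (x, b) \<in> A \<longleftrightarrow> side (nc x b, x) \<in> A" if "(x, b) \<in> D" for b
    using cl[of "side (x, b)" "side (nc x b, x)"] capped_mem(4)[OF that] by (simp add: pf_def)
  have step: "b \<in> A \<longleftrightarrow> nc x b \<in> A" if "(x, b) \<in> D" for b
    using s1[OF that] s3[OF that] s2[OF D_sym[OF nc_D[OF that]]] by simp
  have rep: "\<exists>d. (x, d) \<in> D \<and> (u \<in> A \<longleftrightarrow> d \<in> A)" if u: "u \<in> link_verts capped x" for u
  proof -
    obtain v where "(x, u, v) \<in> capped" using u unfolding link_verts_def by blast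
    then show ?thesis
    proof (cases rule: capped_cases)
      case (1 h)
      then show ?thesis by (intro exI[of _ "snd h"]) simp
    next
      case (2 h)
      then have h: "h = (fst h, x)" by simp
      then have "(fst h, x) \<in> D" using 2(1) by simp
      then show ?thesis using s2 D_sym 2(3) h by metis
    next
      case (4 h)
      then have h: "h = (x, snd h)" by simp
      then have "(x, snd h) \<in> D" using 4(1) by simp
      then show ?thesis using s1 4(3) h by metis
    qed (use x side_vert in auto)
  qed
  obtain b0 where b0: "(x, b0) \<in> D" "b0 \<in> A" using rep[OF A(2)] A(1) by blast
  obtain c0 where c0: "(x, c0) \<in> D" "c \<in> A \<longleftrightarrow> c0 \<in> A" using rep[OF c] by blast
  have "c0 \<in> A" by (rule nc_cycle[OF b0(2,1) c0(1)]) (use step in blast)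
  then show ?thesis using c0(2) by blast
qed

text \<open>The link is the 5-cycle \<open>fst h\<close>, \<open>snd h\<close>,
  \<open>side h'\<close>, \<open>face_vert h\<close>, \<open>side (pf h)\<close>, where
  \<open>pf h' = h\<close>.\<close>

lemma capped_link_side:
  assumes A: "b \<in> A" "b \<in> link_verts capped (side h)" and c: "c \<in> link_verts capped (side h)"
    and cl: "\<And>u v. (side h, u, v) \<in> capped \<Longrightarrow> u \<in> A \<longleftrightarrow> v \<in> A"
  shows "c \<in> A"
proof -
  have all: "h \<in> D \<and> (u \<in> A \<longleftrightarrow> fst h \<in> A)" if u: "u \<in> link_verts capped (side h)" for u
  proof -
    obtain v where v: "(side h, u, v) \<in> capped" using u unfolding link_verts_def by blast
    have h: "h \<in> D" using v
      by (cases rule: capped_cases) (use fst_snd_vert side_vert side_eq side_face pf_D in auto)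
    obtain h' where h': "h' \<in> D" "pf h' = h" using pf_surj h by blast
    have f: "face_vert h' = face_vert h" using h' face_pf face_vert_eq by metis
    have 1: "fst h \<in> A \<longleftrightarrow> snd h \<in> A" by (rule cl[OF capped_mem(3)[OF h]])
    have 2: "side (pf h) \<in> A \<longleftrightarrow> fst h \<in> A" by (rule cl[OF capped_mem(5)[OF h]])
    have 3: "snd h \<in> A \<longleftrightarrow> side h' \<in> A" using cl[of "snd h" "side h'"] capped_mem(6)[OF h'(1)] h'(2) snd_pf[of h'] by simp
    have 4: "face_vert h \<in> A \<longleftrightarrow> side (pf h) \<in> A" by (rule cl[OF capped_mem(8)[OF h]])
    from v have "u \<in> {fst h, snd h, side (pf h), side h', face_vert h}"
    proof (cases rule: capped_cases)
      case (6 g)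
      then have "pf g = h" using side_eq by simp
      then show ?thesis using 6 snd_pf[of g] by auto
    next
      case (7 g)
      then have "pf g = pf h'" using side_eq h'(2) by simp
      then have "g = h'" using pf_inj 7(1) h'(1) by (auto dest: inj_onD)
      then show ?thesis using 7 by simp
    qed (use fst_snd_vert side_vert side_eq side_face in auto)
    then show ?thesis using h 1 2 3 4 by auto
  qed
  then show ?thesis using A c by blast
qed

lemma capped_link_face:
  assumes A: "b \<in> A" "b \<in> link_verts capped (face_vert h)" and c: "c \<in> link_verts capped (face_vert h)"
    and cl: "\<And>u v. (face_vert h, u, v) \<in> capped \<Longrightarrow> u \<in> A \<longleftrightarrow> v \<in> A"
  shows "c \<in> A"
proof -
  have form: "\<exists>g\<in>D. u = side g \<and> face_vert g = face_vert h" if u: "u \<in> link_verts capped (face_vert h)" for u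
  proof -
    obtain v where "(face_vert h, u, v) \<in> capped" using u unfolding link_verts_def by blast
    then show ?thesis
    proof (cases rule: capped_cases)
      case (9 g)
      have "face_vert (pf g) = face_vert g" using face_pf 9(1) face_vert_eq by metis
      then show ?thesis using 9 pf_D by (intro bexI[of _ "pf g"]) auto
    qed (use fst_snd_vert side_vert side_face in auto)
  qed
  have step: "side (pf g) \<in> A \<longleftrightarrow> side g \<in> A" if "g \<in> D" "face_vert g = face_vert h" for g
    using cl[of "side (pf g)" "side g"] capped_mem(9)[OF that(1)] that(2) by simp
  obtain g where g: "g \<in> D" "b = side g" "face_vert g = face_vert h" using form A(2) by blast
  obtain g' where g': "g' \<in> D" "c = side g'" "face_vert g' = face_vert h" using form c by blast
  have "face_orbit g' = face_orbit g" using face_eq_iff g g' face_vert_eq by metis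
  then have "g' \<in> face_orbit g" using face_orbit_self by blast
  then obtain k where k: "g' = (pf ^^ k) g" unfolding face_orbit_def by blast
  have "side ((pf ^^ k) g) \<in> A \<and> face_vert ((pf ^^ k) g) = face_vert h" for k
  proof (induction k)
    case (Suc k)
    have D: "(pf ^^ k) g \<in> D" by (rule pf_pow_D[OF g(1)])
    have "face_vert (pf ((pf ^^ k) g)) = face_vert h" using face_pf[OF D] Suc face_vert_eq by metis
    then show ?case using step[OF D] Suc by simp
  qed (use g A in simp)
  then show ?thesis using g'(2) k by simp
qed

lemma capped_surface: "closed_oriented_surface capped"
proof (rule closed_oriented_surfaceI)
  show "finite capped" unfolding capped_def using finite_D by simp
  obtain h where "h \<in> D" using D_ne by blast
  then show "capped \<noteq> {}" using capped_mem(1) by blast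
  show "(b, c, a) \<in> capped" if "(a, b, c) \<in> capped" for a b c by (rule capped_rot[OF that])
  show "a \<noteq> b" if "(a, b, c) \<in> capped" for a b c by (rule capped_ne[OF that])
  show "(b, a, c) \<notin> capped" if "(a, b, c) \<in> capped" for a b c by (rule capped_mirror[OF that])
  show "c = d" if "(a, b, c) \<in> capped" "(a, b, d) \<in> capped" for a b c d
    using capped_third[OF that(1)] capped_third[OF that(2)] by simp
  show "\<exists>d. (b, a, d) \<in> capped" if "(a, b, c) \<in> capped" for a b c by (rule capped_opposite[OF that])
  fix x A b c
  assume A: "A \<subseteq> link_verts capped x" "b \<in> A" and cl: "\<And>b c. (x, b, c) \<in> capped \<Longrightarrow> b \<in> A \<longleftrightarrow> c \<in> A"
    and c: "c \<in> link_verts capped x"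
  have b: "b \<in> link_verts capped x" using A by blast
  then obtain v where "(x, b, v) \<in> capped" unfolding link_verts_def by blast
  then have "x \<in> verts T \<or> (\<exists>h. x = side h) \<or> (\<exists>h. x = face_vert h)"
    by (cases rule: capped_cases) (use fst_snd_vert in blast)+
  then show "c \<in> A"
  proof (elim disjE exE)
    assume "x \<in> verts T"
    then show ?thesis by (rule capped_link_vert[OF _ A(2) b c cl])
  next
    fix h assume x: "x = side h"
    show ?thesis by (rule capped_link_side[OF A(2) b[unfolded x] c[unfolded x] cl[unfolded x]])
  next
    fix h assume x: "x = face_vert h"
    show ?thesis by (rule capped_link_face[OF A(2) b[unfolded x] c[unfolded x] cl[unfolded x]])
  qed
qed

end

lemma card_insert_nine: "card {a, b, c, d, e, f, g, h, i} \<le> 9"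
  using card_length[of "[a, b, c, d, e, f, g, h, i]"] by (simp del: card_insert_disjoint)

context ribbon
begin

lemma capped_link: "(x, b) \<in> D \<Longrightarrow> b \<in> link_verts capped x"
  using capped_mem(1)[of "(x, b)"] unfolding link_verts_def by auto

text \<open>\<open>nc\<close> steps are common to both surfaces: one of them is a stretch of the old
  link without darts and becomes three steps in the new link through two sides. So the darts at a
  vertex keep their cyclic order.\<close>

lemma between_capped:
  assumes b: "(x, b) \<in> D" and c: "(x, c) \<in> D" and d: "(x, d) \<in> D" and btw: "d \<in> between T x b c"
  shows "d \<in> between capped x b c"
proof -
  interpret C: surf capped by unfold_locales (rule capped_surface)
  let ?R = "{(e, f). (x, e, f) \<in> capped \<and> f \<notin> {b, c}}"
  note bl = D_link[OF b] and cl = D_link[OF c]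
  have bc: "b \<noteq> c" by (rule between_link(3)[OF bl btw])
  have iff: "f \<in> between capped x b c \<longleftrightarrow> (b, f) \<in> ?R\<^sup>+" for f
    by (rule C.between_iff_trancl[OF capped_link[OF b] capped_link[OF c] bc])
  have vert: "b \<in> verts T" "c \<in> verts T" using D_vert(2) b c by blast+
  have walk: "(e, nc x e) \<in> ?R\<^sup>+" if e: "(x, e) \<in> D" "nc x e \<notin> {b, c}" for e
  proof -
    have n: "(nc x e, x) \<in> D" using D_sym nc_D e(1) by blast
    have "(e, side (x, e)) \<in> ?R" using capped_mem(1)[OF e(1)] side_vert vert by auto
    moreover have "(side (x, e), side (nc x e, x)) \<in> ?R"
      using capped_mem(4)[OF e(1)] side_vert vert by (auto simp: pf_def)
    moreover have "(side (nc x e, x), nc x e) \<in> ?R" using capped_mem(2)[OF n] e(2) by simp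
    ultimately show ?thesis by (meson trancl.simps)
  qed
  \<comment> \<open>An implication in place of membership: it holds trivially at \<open>b\<close>
    and at darts outside the arc, so it can be carried around the whole vertex by
    \<open>nc_cycle\<close>.\<close>
  define A where "A = {e. e \<in> between T x b c \<longrightarrow> e \<in> between capped x b c}"
  have "d \<in> A"
  proof (rule nc_cycle[OF _ b d])
    show "b \<in> A" unfolding A_def using between_link(4)[OF bl, of b] by blast
    fix e assume e: "(x, e) \<in> D" "e \<in> A"
    let ?f = "nc x e"
    note el = D_link[OF e(1)] and f = nc_D[OF e(1)]
    show "?f \<in> A"
    proof (cases "?f \<in> between T x b c")
      case True
      have fne: "?f \<notin> {b, c}" using between_link(4,5)[OF bl True] by blast
      have bn: "b \<notin> between T x e ?f" using nc_between[OF e(1)] b by blast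
      have "e = b \<or> e \<in> between T x b c"
      proof (rule ccontr)
        assume no: "\<not> (e = b \<or> e \<in> between T x b c)"
        have "?f \<in> between T x b e"
        proof (cases "e = c")
          case False
          then have "c \<in> between T x b e" using between_total[OF bl cl el] no bc by blast
          then show ?thesis by (rule between_trans[OF bl True])
        qed (use True in simp)
        then have "b \<in> between T x e ?f"
          using between_rotate[OF D_link[OF f]] between_rotate[OF bl] by blast
        then show False using bn by simp
      qed
      then have "e = b \<or> (b, e) \<in> ?R\<^sup>+" using e(2) iff unfolding A_def by blast
      then have "(b, ?f) \<in> ?R\<^sup>+" using walk[OF e(1) fne] by (meson trancl_trans)
      then show ?thesis unfolding A_def using iff by blast
    qed (simp add: A_def)
  qed
  then show ?thesis using btw unfolding A_def by blast
qed

lemma positive_wrt_capped: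
  assumes D: "(p, x) \<in> D" "(x, q) \<in> D" "(p', x) \<in> D" "(x, q') \<in> D"
    and pos: "positive_wrt T (p, x, q) (p', x, q')"
  shows "positive_wrt capped (p, x, q) (p', x, q')"
proof -
  have "p' \<in> between T x q p" "q' \<in> between T x p q" using pos unfolding positive_wrt_def by simp_all
  then have "p' \<in> between capped x q p" "q' \<in> between capped x p q"
    using between_capped D D_sym by blast+
  then show ?thesis unfolding positive_wrt_def mid_def by simp
qed

lemma capped_adjacent:
  assumes "h \<in> D"
  shows "{fst h, snd h} \<in> edges capped" "{side h, fst h} \<in> edges capped" "{face_vert h, side h} \<in> edges capped"
proof -
  show "{fst h, snd h} \<in> edges capped" "{side h, fst h} \<in> edges capped"
    using capped_mem(1,3)[OF assms] unfolding edges_def by blast+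
  have "{side h, face_vert h} \<in> edges capped" using capped_mem(8)[OF assms] unfolding edges_def by blast
  then show "{face_vert h, side h} \<in> edges capped" by (simp add: insert_commute)
qed

lemma capped_connected:
  assumes con: "\<And>u v. u \<in> fst ` D \<Longrightarrow> v \<in> fst ` D \<Longrightarrow> (u, v) \<in> D\<^sup>*"
  shows "connected_surface capped"
  unfolding connected_surface_def
proof (intro ballI)
  let ?E = "{(u, v). {u, v} \<in> edges capped}"
  fix a b assume ab: "a \<in> verts capped" "b \<in> verts capped"
  have sym: "(u, v) \<in> ?E\<^sup>* \<Longrightarrow> (v, u) \<in> ?E\<^sup>*" for u v
    by (rule symD[OF sym_rtrancl]) (auto simp: sym_def insert_commute)
  have DE: "D \<subseteq> ?E" using capped_adjacent(1) by auto
  have s: "(side h, fst h) \<in> ?E\<^sup>*" if "h \<in> D" for h using capped_adjacent(2)[OF that] by blast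
  have f: "(face_vert h, fst h) \<in> ?E\<^sup>*" if "h \<in> D" for h
    using capped_adjacent(3)[OF that] s[OF that] by (blast intro: converse_rtrancl_into_rtrancl)
  have near: "\<exists>u\<in>fst ` D. (a, u) \<in> ?E\<^sup>*" if a: "a \<in> verts capped" for a
  proof -
    obtain v w where "(a, v, w) \<in> capped" using a unfolding verts_def by blast
    then show ?thesis
    proof (cases rule: capped_cases)
      case (2 h)
      have "snd h \<in> fst ` D" using D_sym[of "fst h" "snd h"] 2(1) by force
      then show ?thesis using 2 by blast
    next
      case (6 h)
      then show ?thesis using s[OF pf_D[OF 6(1)]] pf_D by blast
    next
      case (7 h)
      then show ?thesis using s[OF pf_D[OF 7(1)]] pf_D by blast
    qed (use s f in blast)+
  qed
  obtain u where u: "u \<in> fst ` D" "(a, u) \<in> ?E\<^sup>*" using near ab by blast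
  obtain v where v: "v \<in> fst ` D" "(b, v) \<in> ?E\<^sup>*" using near ab by blast
  have "(u, v) \<in> ?E\<^sup>*" using con[OF u(1) v(1)] rtrancl_mono[OF DE] by blast
  then show "(a, b) \<in> ?E\<^sup>*" using u(2) sym[OF v(2)] by (meson rtrancl_trans)
qed

text \<open>In \<open>euler_char_eq\<close>, each dart brings one side vertex and at most nine
  oriented triangles, that is \<open>6 - 9 = - 3\<close>. Every edge of the graph has two darts, so
  this is six times vertices minus edges plus faces.\<close>

lemma capped_euler_char:
  "6 * euler_char capped \<ge> 6 * int (card (fst ` D)) + 6 * int (card (face ` D)) - 3 * int (card D)"
proof -
  interpret C: surf capped by unfold_locales (rule capped_surface)
  have "card capped \<le> (\<Sum>h\<in>D. card {(fst h, snd h, side h), (snd h, side h, fst h), (side h, fst h, snd h),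
     (fst h, side h, side (pf h)), (side h, side (pf h), fst h), (side (pf h), fst h, side h),
     (side (pf h), side h, face_vert h), (side h, face_vert h, side (pf h)), (face_vert h, side (pf h), side h)})"
    unfolding capped_def by (rule card_UN_le[OF finite_D])
  also have "\<dots> \<le> (\<Sum>h\<in>D. 9)"
    by (rule sum_mono) (rule card_insert_nine)
  also have "\<dots> = 9 * card D" by simp
  finally have 9: "card capped \<le> 9 * card D" .
  have "fst ` D \<union> side ` D \<union> face_vert ` D \<subseteq> verts capped"
    unfolding verts_def using capped_mem(1,3,9) by blast
  then have "card (fst ` D \<union> side ` D \<union> face_vert ` D) \<le> card (verts capped)"
    by (rule card_mono[OF C.finite_verts])
  moreover have "card (fst ` D \<union> side ` D \<union> face_vert ` D) = card (fst ` D) + card (side ` D) + card (face_vert ` D)"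
  proof -
    have "side ` D \<inter> face_vert ` D = {}" using side_face by blast
    moreover have "fst ` D \<inter> side ` D = {}" "fst ` D \<inter> face_vert ` D = {}"
      using fst_snd_vert(1) side_vert(5,6) by force+
    ultimately show ?thesis using finite_D by (simp add: card_Un_disjoint Int_Un_distrib2)
  qed
  moreover have "card (side ` D) = card D" by (rule card_image) (simp add: inj_on_def side_eq)
  moreover have "card (face_vert ` D) = card (face ` D)"
  proof -
    have "face_vert ` D = (\<lambda>m. Suc (Suc (Max (verts T)) + 2 * m)) ` face ` D"
      unfolding image_image face_vert_def by simp
    then show ?thesis by (simp add: card_image inj_on_def)
  qed
  ultimately show ?thesis using C.euler_char_eq 9 by linarith
qed

end

section \<open>The ribbon graph of a closed curve\<close>

definition sym_darts :: "nat list \<Rightarrow> (nat \<times> nat) set" where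
  "sym_darts c = set (darts c) \<union> (set (darts c))\<inverse>"

lemma sym_darts_connected:
  assumes "u \<in> set c" "v \<in> set c" shows "(u, v) \<in> (sym_darts c)\<^sup>*"
proof -
  have "(c ! 0, c ! i) \<in> (set (darts c))\<^sup>*" if "i < length c" for i
    using that
  proof (induction i)
    case (Suc i)
    have "darts c ! i \<in> set (darts c)" using Suc by simp
    then have "(c ! i, c ! Suc i) \<in> set (darts c)" using Suc.prems by (simp add: darts_nth)
    then show ?case using Suc by (simp add: rtrancl_into_rtrancl)
  qed simp
  moreover have "(set (darts c))\<^sup>* \<subseteq> (sym_darts c)\<^sup>*" by (rule rtrancl_mono) (simp add: sym_darts_def)
  ultimately have *: "(c ! 0, y) \<in> (sym_darts c)\<^sup>*" if "y \<in> set c" for y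
    using that by (metis in_set_conv_nth subsetD)
  have "sym (sym_darts c)" unfolding sym_darts_def sym_def by auto
  then have "sym ((sym_darts c)\<^sup>*)" by (rule sym_rtrancl)
  then show ?thesis using *[OF assms(1)] *[OF assms(2)] by (meson rtrancl_trans symD)
qed

lemma fst_sym_darts: "fst ` sym_darts c = set c"
proof -
  have "fst ` set (darts c) = set c" by (metis map_fst_darts set_map)
  moreover have "snd ` set (darts c) = set c"
    unfolding darts_def by (metis length_rotate1 map_snd_zip set_map set_rotate1)
  moreover have "fst ` (set (darts c))\<inverse> = snd ` set (darts c)" by force
  ultimately show ?thesis unfolding sym_darts_def by (simp add: image_Un)
qed

context surf
begin

context
  fixes c assumes n: "normal_curve T [c]"
begin

lemma single_darts: "set (curve_darts [c]) = set (darts c)" "curve_darts [c] = darts c"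
  unfolding curve_darts_def by simp_all

lemma card_sym_darts: "card (sym_darts c) = 2 * length c"
proof -
  note d = normal_darts[OF n, unfolded single_darts]
  have "set (darts c) \<inter> (set (darts c))\<inverse> = {}" using d(3) by auto
  then have "card (sym_darts c) = card (set (darts c)) + card ((set (darts c))\<inverse>)"
    unfolding sym_darts_def by (simp add: card_Un_disjoint)
  moreover have "card (set (darts c)) = length c" using distinct_card[OF d(1)] by simp
  ultimately show ?thesis by simp
qed

text \<open>A strand enters and leaves a vertex along different edges, so each dart has a second one
  at its origin.\<close>

lemma ribbon_sym_darts: "ribbon T (sym_darts c)"
proof
  note d = normal_darts[OF n, unfolded single_darts]
  show sym: "(x, b) \<in> sym_darts c \<Longrightarrow> (b, x) \<in> sym_darts c" for x b unfolding sym_darts_def by auto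
  show "(x, b) \<in> sym_darts c \<Longrightarrow> b \<in> link_verts T x" for x b
    unfolding sym_darts_def using d(2) link_sym by blast
  have "c \<noteq> []" using n unfolding normal_curve_def by auto
  then have "set (darts c) \<noteq> {}" by (metis length_darts length_0_conv set_empty)
  then show "sym_darts c \<noteq> {}" unfolding sym_darts_def by simp
  have st: "(x, p) \<in> sym_darts c \<and> (x, q) \<in> sym_darts c \<and> p \<noteq> q" if "(p, x, q) \<in> strands [c]" for p x q
    using strand_in[OF that] strand_link(3)[OF n that] unfolding single_darts sym_darts_def by blast
  show "\<exists>b'. b' \<noteq> b \<and> (x, b') \<in> sym_darts c" if "(x, b) \<in> sym_darts c" for x b
  proof -
    have "(x, b) \<in> set (curve_darts [c]) \<or> (b, x) \<in> set (curve_darts [c])"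
      using that unfolding sym_darts_def single_darts by blast
    then show ?thesis
    proof
      assume "(x, b) \<in> set (curve_darts [c])"
      then obtain p where "(p, x, b) \<in> strands [c]" by (rule dart_out_strand)
      then show ?thesis using st by blast
    next
      assume "(b, x) \<in> set (curve_darts [c])"
      then obtain q where "(b, x, q) \<in> strands [c]" by (rule dart_in_strand)
      then have "b \<noteq> q" "(x, q) \<in> sym_darts c" using st by blast+
      then show ?thesis by (intro exI[of _ q]) simp
    qed
  qed
qed

text \<open>Capping preserves positive crossings. Conversely, two different strands of a normal
  curve cross one way or the other in \<open>T\<close>; the wrong way would persist in the capped
  surface, where a crossing cannot be positive for both strands.\<close>

lemma positive_wrt_capped_iff:
  assumes s: "s \<in> strands [c]" "s' \<in> strands [c]"
  shows "positive_wrt (ribbon.capped T (sym_darts c)) s s' \<longleftrightarrow> positive_wrt T s s'"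
proof -
  interpret R: ribbon T "sym_darts c" by (rule ribbon_sym_darts)
  interpret C: surf R.capped by unfold_locales (rule R.capped_surface)
  have dd: "(p, x) \<in> sym_darts c \<and> (x, q) \<in> sym_darts c" if "(p, x, q) \<in> strands [c]" for p x q
    using strand_in[OF that] unfolding single_darts sym_darts_def by blast
  have mono: "positive_wrt R.capped s s'" if s: "s \<in> strands [c]" "s' \<in> strands [c]" and "positive_wrt T s s'" for s s'
  proof -
    obtain p x q p' x' q' where e: "s = (p, x, q)" "s' = (p', x', q')" using prod_cases3 by metis
    have "x' = x" using \<open>positive_wrt T s s'\<close> unfolding e positive_wrt_def mid_def by simp
    then show ?thesis using that dd R.positive_wrt_capped unfolding e by blast
  qed
  show ?thesis
  proof
    assume pos: "positive_wrt R.capped s s'"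
    obtain p x q p' x' q' where e: "s = (p, x, q)" "s' = (p', x', q')" using prod_cases3 by metis
    have x: "x' = x" using pos unfolding e positive_wrt_def mid_def by simp
    have d: "(p, x) \<in> sym_darts c" "(x, q) \<in> sym_darts c" "(p', x) \<in> sym_darts c" "(x, q') \<in> sym_darts c"
      using dd s unfolding e x by blast+
    then have l: "p \<in> link_verts R.capped x" "q \<in> link_verts R.capped x"
      "p' \<in> link_verts R.capped x" "q' \<in> link_verts R.capped x"
      using R.capped_link R.D_sym by blast+
    have ne: "s \<noteq> s'"
    proof
      assume "s = s'"
      then have "p \<in> between R.capped x q p" using pos unfolding e positive_wrt_def by simp
      then show False using C.between_link(5)[OF l(2)] by blast
    qed
    have "\<not> positive_wrt T s' s"
    proof
      assume "positive_wrt T s' s"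
      then have "positive_wrt R.capped s' s" by (rule mono[OF s(2,1)])
      then show False
        using C.positive_wrt_sides(1)[OF l] C.positive_wrt_sides(2)[OF l] pos unfolding e x by blast
    qed
    then show "positive_wrt T s s'" using normal_crossing[OF n s ne] x unfolding e mid_def by auto
  qed (rule mono[OF s])
qed

lemma capped_normal: "normal_curve (ribbon.capped T (sym_darts c)) [c]"
proof -
  interpret R: ribbon T "sym_darts c" by (rule ribbon_sym_darts)
  have e: "{a, b} \<in> edges R.capped" if "(a, b) \<in> set (curve_darts [c])" for a b
    using R.capped_adjacent(1)[of "(a, b)"] that unfolding single_darts sym_darts_def by simp
  show ?thesis
    unfolding normal_curve_def
  proof (intro conjI)
    show "[] \<notin> set [c]" using n unfolding normal_curve_def by blast
    show "\<forall>(a, b)\<in>set (curve_darts [c]). {a, b} \<in> edges R.capped" using e by blast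
    show "distinct (map (\<lambda>(a, b). {a, b}) (curve_darts [c]))" by (rule normal_undirected[OF n])
    show "\<forall>x. card {s \<in> strands [c]. mid s = x} \<le> 2" using normal_card[OF n] by blast
    show "\<forall>s\<in>strands [c]. \<forall>s'\<in>strands [c]. s \<noteq> s' \<and> mid s = mid s' \<longrightarrow>
        positive_wrt R.capped s s' \<or> positive_wrt R.capped s' s"
      using normal_crossing[OF n] positive_wrt_capped_iff by blast
  qed
qed

lemma capped_read_word: "read_word (ribbon.capped T (sym_darts c)) c lab = read_word T c lab"
proof -
  have "travels_positively (ribbon.capped T (sym_darts c)) [c] (strand_at c i) = travels_positively T [c] (strand_at c i)"
    if "i < length c" for i
  proof -
    have "strand_at c i \<in> strands [c]" unfolding strands_def using that by auto
    then show ?thesis unfolding travels_positively_def using positive_wrt_capped_iff by blast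
  qed
  then show ?thesis unfolding read_word_def read_symbol_def by auto
qed

text \<open>The curve keeps its list of vertices, so its strands, crossings and labels are literally
  the same; only signs, normality and connectedness refer to the surface.\<close>

lemma capped_realization:
  assumes "realization m w T c lab" shows "realization m w (ribbon.capped T (sym_darts c)) c lab"
proof -
  interpret R: ribbon T "sym_darts c" by (rule ribbon_sym_darts)
  have "connected_surface R.capped"
    by (rule R.capped_connected) (simp add: fst_sym_darts sym_darts_connected)
  then show ?thesis
    using assms R.capped_surface capped_normal capped_read_word unfolding realization_def by simp
qed

end

end

section \<open>Split curves\<close>

lemma mod_back: "l < L \<Longrightarrow> q < L \<Longrightarrow> (l + L - q) mod L = (if q \<le> l then l - q else l + L - q)" for l L q :: nat
  by (simp add: le_mod_geq)

text \<open>The closing dart of the segment leads back to \<open>c ! i\<close>, which is also the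
  next vertex \<open>c ! j\<close> on the curve. So the segment consists of darts of
  \<open>c\<close> only.\<close>

lemma darts_segment:
  assumes i: "i < length c" "j < length c" "i \<noteq> j" "c ! i = c ! j"
  shows "darts (segment c i j) = take ((j + length c - i) mod length c) (rotate i (darts c))"
proof -
  let ?L = "length c" and ?m = "(j + length c - i) mod length c"
  have L0: "0 < ?L" using i(1) by (rule le_less_trans[OF le0])
  have m: "0 < ?m" "?m < ?L" "(i + ?m) mod ?L = j"
    using i unfolding mod_back[OF i(2,1)] by (auto simp: le_mod_geq)
  have len: "length (segment c i j) = ?m" unfolding segment_def using m by simp
  have el: "segment c i j ! k = c ! ((i + k) mod ?L)" if "k < ?m" for k
    unfolding segment_def using that m by (simp add: nth_rotate)
  show ?thesis
  proof (rule nth_equalityI)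
    show "length (darts (segment c i j)) = length (take ?m (rotate i (darts c)))" using len m by simp
    fix k assume "k < length (darts (segment c i j))"
    then have k: "k < ?m" using len by simp
    have L: "(i + k) mod ?L < ?L" by (rule mod_less_divisor[OF L0])
    have r: "take ?m (rotate i (darts c)) ! k = (c ! ((i + k) mod ?L), c ! ((i + Suc k) mod ?L))"
      using k m L by (simp add: nth_rotate darts_nth mod_Suc_eq)
    have "segment c i j ! (Suc k mod ?m) = c ! ((i + Suc k) mod ?L)"
    proof (cases "Suc k = ?m")
      case True
      then show ?thesis using el[of 0] m i by simp
    next
      case False
      then show ?thesis using el[of "Suc k"] k by simp
    qed
    then show "darts (segment c i j) ! k = take ?m (rotate i (darts c)) ! k"
      unfolding r using k len el[OF k] by (simp add: darts_nth)
  qed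
qed

lemma set_darts_segment:
  assumes i: "i < length c" "j < length c" "i \<noteq> j" "c ! i = c ! j"
  shows "set (darts (segment c i j)) =
    (!) (darts c) ` {l. l < length c \<and> (l + length c - i) mod length c < (j + length c - i) mod length c}"
proof -
  let ?L = "length c" and ?m = "(j + length c - i) mod length c"
  have L0: "0 < ?L" using i(1) by (rule le_less_trans[OF le0])
  then have m: "?m < ?L" by (rule mod_less_divisor)
  have "set (take ?m (rotate i (darts c))) = (!) (rotate i (darts c)) ` {..<?m}"
    using m by (simp add: nth_image[symmetric] lessThan_atLeast0)
  also have "\<dots> = (\<lambda>k. darts c ! ((i + k) mod ?L)) ` {..<?m}"
    by (rule image_cong) (use m in \<open>simp_all add: nth_rotate\<close>)
  also have "\<dots> = (!) (darts c) ` (\<lambda>k. (i + k) mod ?L) ` {..<?m}" by (simp add: image_image)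
  also have "(\<lambda>k. (i + k) mod ?L) ` {..<?m} = {l. l < ?L \<and> (l + ?L - i) mod ?L < ?m}"
  proof (intro equalityI subsetI)
    fix l assume "l \<in> (\<lambda>k. (i + k) mod ?L) ` {..<?m}"
    then obtain k where k: "k < ?m" "l = (i + k) mod ?L" by blast
    have l: "l < ?L" unfolding k(2) by (rule mod_less_divisor[OF L0])
    have "l = (if i + k < ?L then i + k else i + k - ?L)" using k m i by (simp add: le_mod_geq)
    then have "(l + ?L - i) mod ?L = k" unfolding mod_back[OF l i(1)] using k m i by (auto split: if_splits)
    then show "l \<in> {l. l < ?L \<and> (l + ?L - i) mod ?L < ?m}" using k l by simp
  next
    fix l assume l: "l \<in> {l. l < ?L \<and> (l + ?L - i) mod ?L < ?m}"
    then have "l < ?L" by simp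
    then have "l = (i + (l + ?L - i) mod ?L) mod ?L"
      using i unfolding mod_back[OF \<open>l < ?L\<close> i(1)] by (auto simp: le_mod_geq)
    then show "l \<in> (\<lambda>k. (i + k) mod ?L) ` {..<?m}" using l by blast
  qed
  finally show ?thesis unfolding darts_segment[OF i] .
qed

lemma (in surf) strand_at_inj:
  assumes n: "normal_curve T [c]" and eq: "strand_at c i = strand_at c j" and ij: "i < length c" "j < length c"
  shows "i = j"
proof -
  have "darts c ! i = darts c ! j" using eq ij by (simp add: strand_at_def darts_nth)
  then show ?thesis using curve_darts_inj[OF normal_darts(1)[OF n], of c c i j] ij by simp
qed

lemma (in surf) normal_visits:
  assumes n: "normal_curve T [c]" and ijk: "i < length c" "j < length c" "k < length c"
    "c ! i = x" "c ! j = x" "c ! k = x"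
  shows "i = j \<or> j = k \<or> i = k"
proof (rule ccontr)
  assume ne: "\<not> ?thesis"
  let ?S = "{s \<in> strands [c]. mid s = x}"
  have "strand_at c l \<in> ?S" if "l < length c" "c ! l = x" for l
    unfolding strands_def using that by (auto simp: strand_at_def mid_def)
  then have sub: "{strand_at c i, strand_at c j, strand_at c k} \<subseteq> ?S" using ijk by simp
  have "card {strand_at c i, strand_at c j, strand_at c k} \<le> card ?S"
    by (rule card_mono[OF _ sub]) (simp add: finite_strands)
  moreover have "card ?S \<le> 2" by (rule normal_card[OF n])
  moreover have "strand_at c i \<noteq> strand_at c j" "strand_at c j \<noteq> strand_at c k" "strand_at c i \<noteq> strand_at c k"
    using ne strand_at_inj[OF n] ijk(1-3) by blast+
  ultimately show False by simp
qed

text \<open>Away from the split vertex its strands are strands of \<open>c\<close>. At the split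
  vertex the curve passes only at the positions \<open>i\<close> and \<open>j\<close>, so there is
  just the new strand at position \<open>0\<close>, and nothing is left for it to cross.\<close>

lemma (in surf) normal_segment:
  assumes n: "normal_curve T [c]" and i: "i < length c" "j < length c" "i \<noteq> j" "c ! i = c ! j"
  shows "normal_curve T [segment c i j]"
proof -
  let ?L = "length c" and ?m = "(j + length c - i) mod length c" and ?s = "segment c i j"
  have L0: "0 < ?L" using i(1) by (rule le_less_trans[OF le0])
  have m: "0 < ?m" "?m < ?L" "(i + ?m) mod ?L = j"
    using i unfolding mod_back[OF i(2,1)] by (auto simp: le_mod_geq)
  have len: "length ?s = ?m" unfolding segment_def using m by simp
  have el: "?s ! k = c ! ((i + k) mod ?L)" if "k < ?m" for k
    unfolding segment_def using that m by (simp add: nth_rotate)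
  have d: "curve_darts [?s] = take ?m (rotate i (curve_darts [c]))"
    unfolding curve_darts_def using darts_segment[OF i] by simp
  have sub: "set (curve_darts [?s]) \<subseteq> set (curve_darts [c])"
    unfolding d using set_take_subset[of ?m "rotate i (curve_darts [c])"] by simp
  have st: "strand_at ?s k = strand_at c ((i + k) mod ?L)" if k: "0 < k" "k < ?m" for k
  proof -
    let ?l = "(i + k) mod ?L"
    have l: "?l < ?L" by (rule mod_less_divisor[OF L0])
    have p: "(?l + ?L - 1) mod ?L = (i + (k - 1)) mod ?L"
    proof -
      have "(?l + ?L - 1) mod ?L = (?l + (?L - 1)) mod ?L" using m by simp
      also have "\<dots> = (i + k + (?L - 1)) mod ?L" by (simp add: mod_add_left_eq)
      also have "i + k + (?L - 1) = (i + (k - 1)) + ?L" using k m by simp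
      finally show ?thesis by simp
    qed
    have k1: "k - 1 < ?m" using k by simp
    have "(k + ?m - 1) mod ?m = k - 1" using k by (simp add: le_mod_geq)
    moreover have "darts ?s ! k = darts c ! ?l"
      unfolding darts_segment[OF i] using k m by (simp add: nth_rotate)
    ultimately show ?thesis
      using el[OF k1] k p l len m unfolding strand_at_def by (simp add: darts_nth)
  qed
  have mids: "k = 0" if k: "k < ?m" "?s ! k = c ! i" for k
  proof (rule ccontr)
    assume "k \<noteq> 0"
    have v: "c ! ((i + k) mod ?L) = c ! i" using el[OF k(1)] k(2) by simp
    have ij: "(i + k) mod ?L = i \<or> (i + k) mod ?L = j"
      using normal_visits[OF n mod_less_divisor[OF L0] i(1,2) v refl i(4)[symmetric]] i(3) by blast
    have km: "k < ?L" using k(1) m(2) by linarith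
    have r: "(i + k) mod ?L = (if i + k < ?L then i + k else i + k - ?L)" using km i by (simp add: le_mod_geq)
    have "k < (if i \<le> j then j - i else j + ?L - i)" using k(1) unfolding mod_back[OF i(2,1)] .
    then show False using ij km \<open>k \<noteq> 0\<close> i(1,2) unfolding r by (auto split: if_splits)
  qed
  have str: "s \<in> strands [c] \<or> s = strand_at ?s 0" if s: "s \<in> strands [?s]" for s
  proof -
    obtain k where k: "k < ?m" "s = strand_at ?s k" using s len unfolding strands_def by auto
    then have "k = 0 \<or> s = strand_at c ((i + k) mod ?L)" using st by auto
    moreover have "strand_at c ((i + k) mod ?L) \<in> strands [c]"
      unfolding strands_def using mod_less_divisor[OF L0, of "i + k"] by auto
    ultimately show ?thesis using k(2) by blast
  qed
  have at_i: "s = strand_at ?s 0" if s: "s \<in> strands [?s]" "mid s = c ! i" for s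
  proof -
    obtain k where k: "k < ?m" "s = strand_at ?s k" using s len unfolding strands_def by auto
    then have "?s ! k = c ! i" using s(2) by (simp add: strand_at_def mid_def)
    then show ?thesis using mids k by blast
  qed
  have mid0: "mid (strand_at ?s 0) = c ! i" using el[OF m(1)] i(1) by (simp add: strand_at_def mid_def)
  have old: "s \<in> strands [c]" if "s \<in> strands [?s]" "mid s \<noteq> c ! i" for s
    using str that mid0 by blast
  show ?thesis
    unfolding normal_curve_def
  proof (intro conjI)
    show "[] \<notin> set [?s]" using len m(1) by (metis length_0_conv less_irrefl list.set(1,2) singletonD)
    show "\<forall>(a, b)\<in>set (curve_darts [?s]). {a, b} \<in> edges T" using sub n unfolding normal_curve_def by blast
    show "distinct (map (\<lambda>(a, b). {a, b}) (curve_darts [?s]))"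
      unfolding d take_map[symmetric] rotate_map[symmetric]
      by (intro distinct_take) (simp only: distinct_rotate normal_undirected[OF n])
    show "\<forall>x. card {s \<in> strands [?s]. mid s = x} \<le> 2"
    proof
      fix x
      show "card {s \<in> strands [?s]. mid s = x} \<le> 2"
      proof (cases "x = c ! i")
        case True
        have "card {s \<in> strands [?s]. mid s = x} \<le> 1" 
        proof (rule card_le_one)
          fix s s' assume "s \<in> {s \<in> strands [?s]. mid s = x}" "s' \<in> {s \<in> strands [?s]. mid s = x}"
          then have "s = strand_at ?s 0" "s' = strand_at ?s 0" by (auto intro: at_i[unfolded True[symmetric]])
          then show "s = s'" by (rule trans[OF _ sym])
        qed
        then show ?thesis by simp
      next
        case False
        then have "{s \<in> strands [?s]. mid s = x} \<subseteq> {s \<in> strands [c]. mid s = x}" using old by blast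
        then have "card {s \<in> strands [?s]. mid s = x} \<le> card {s \<in> strands [c]. mid s = x}"
          by (rule card_mono[rotated]) (simp add: finite_strands)
        then show ?thesis using normal_card[OF n, of x] by linarith
      qed
    qed
    show "\<forall>s\<in>strands [?s]. \<forall>s'\<in>strands [?s]. s \<noteq> s' \<and> mid s = mid s' \<longrightarrow>
        positive_wrt T s s' \<or> positive_wrt T s' s"
    proof (intro ballI impI, elim conjE)
      fix s s' assume *: "s \<in> strands [?s]" "s' \<in> strands [?s]" "s \<noteq> s'" "mid s = mid s'"
      have ne: "mid s \<noteq> c ! i"
      proof
        assume e: "mid s = c ! i"
        have "s = s'" unfolding at_i[OF *(1) e] by (rule sym, rule at_i[OF *(2)]) (use *(4) e in simp)
        then show False using *(3) by simp
      qed
      have ne': "mid s' \<noteq> c ! i" using ne unfolding *(4) .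
      show "positive_wrt T s s' \<or> positive_wrt T s' s"
        by (rule normal_crossing[OF n old[OF *(1) ne] old[OF *(2) ne'] *(3,4)])
    qed
  qed
qed

section \<open>Flat potentials and the number of faces\<close>

context ribbon
begin

text \<open>Both values belong to corners left of consecutive darts of a face. The gap between
  \<open>b\<close> and \<open>nc x b\<close> contains no edge of the graph, so the potential is
  constant across it, and flatness carries the value along the next dart.\<close>

lemma flat_pf:
  assumes z: "corner_potential T z G" and supp: "\<And>a b. (a, b) \<notin> D \<Longrightarrow> z a b = 0"
    and flat: "\<And>a b. (a, b) \<in> D \<Longrightarrow> jump G a b = 0" and h: "(x, b) \<in> D"
  shows "G (nc x b) x (nx (nc x b) x) = G x b (nx x b)"
proof -
  let ?e = "nc x b"
  note e = nc_D[OF h]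
  have t: "(x, b, nx x b) \<in> T" "(?e, x, nx ?e x) \<in> T" using link_iff D_link h e D_sym by blast+
  have "G x (nx ?e x) ?e - G x b (nx x b) = (\<Sum>d\<in>between T x b ?e. z x d)"
    by (rule potential_between[OF z t(1) rot[OF t(2)]]) (use nc_ne[OF h] in simp)
  also have "\<dots> = 0" by (rule sum.neutral) (use nc_between[OF h] supp in blast)
  finally show ?thesis using flat[OF D_sym[OF e]] unfolding jump_def by simp
qed

lemma flat_face:
  assumes z: "corner_potential T z G" and supp: "\<And>a b. (a, b) \<notin> D \<Longrightarrow> z a b = 0"
    and flat: "\<And>a b. (a, b) \<in> D \<Longrightarrow> jump G a b = 0" and h: "h \<in> D" "h' \<in> D" "face h = face h'"
  shows "G (fst h) (snd h) (nx (fst h) (snd h)) = G (fst h') (snd h') (nx (fst h') (snd h'))"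
proof -
  define val where "val g = G (fst g) (snd g) (nx (fst g) (snd g))" for g
  have "val (pf g) = val g" if "g \<in> D" for g
    using flat_pf[OF z supp flat, of "fst g" "snd g"] that unfolding val_def pf_def by simp
  then have *: "val ((pf ^^ k) g) = val g" if "g \<in> D" for g k
    using pf_pow_D[OF that] by (induction k) auto
  have "h' \<in> face_orbit h" using face_eq_iff h face_orbit_self by blast
  then obtain k where "h' = (pf ^^ k) h" unfolding face_orbit_def by blast
  then have "val h' = val h" using *[OF h(1)] by simp
  then show ?thesis unfolding val_def by simp
qed

text \<open>A flat potential takes one value on each face, and these values determine the cycle.\<close>

lemma card_faces:
  assumes fin: "finite U"
    and z: "\<And>u. u \<in> U \<Longrightarrow> corner_potential T (z u) (G u)"
    and supp: "\<And>u a b. u \<in> U \<Longrightarrow> (a, b) \<notin> D \<Longrightarrow> z u a b = 0"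
    and flat: "\<And>u a b. u \<in> U \<Longrightarrow> (a, b) \<in> D \<Longrightarrow> jump (G u) a b = 0"
    and indep: "\<And>m u. (\<And>a b. (a, b) \<in> D \<Longrightarrow> (\<Sum>u\<in>U. m u * z u a b) = 0) \<Longrightarrow> u \<in> U \<Longrightarrow> m u = 0"
  shows "card U \<le> card (face ` D)"
proof (rule ccontr)
  assume "\<not> ?thesis"
  then have less: "card (face ` D) < card U" by simp
  define val where "val u g = G u (fst g) (snd g) (nx (fst g) (snd g))" for u g
  define A where "A e u = val u (SOME h. h \<in> D \<and> face h = e)" for e u
  have A: "A (face h) u = val u h" if h: "h \<in> D" and u: "u \<in> U" for h u
  proof -
    have ex: "(SOME h'. h' \<in> D \<and> face h' = face h) \<in> D \<and> face (SOME h'. h' \<in> D \<and> face h' = face h) = face h"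
      by (rule someI[of _ h]) (use h in simp)
    show ?thesis
      unfolding A_def val_def
      by (rule flat_face[OF z[OF u] supp[OF u] flat[OF u]]) (use ex h in auto)
  qed
  obtain m where m: "\<exists>u\<in>U. m u \<noteq> 0" "\<forall>e\<in>face ` D. (\<Sum>u\<in>U. A e u * m u) = 0"
    using integer_kernel_nontrivial[of "face ` D" U A, OF _ fin less] finite_D by blast
  have 0: "(\<Sum>u\<in>U. val u h * m u) = 0" if "h \<in> D" for h
  proof -
    have "(\<Sum>u\<in>U. val u h * m u) = (\<Sum>u\<in>U. A (face h) u * m u)"
      by (rule sum.cong) (use A[OF that] in simp_all)
    then show ?thesis using m(2) that by simp
  qed
  \<comment> \<open>For a flat potential, \<open>z u a b\<close> is the value on the face left of
    the edge minus the value on the face right of it. A relation between the values on faces is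
    therefore one between the cycles.\<close>
  have "(\<Sum>u\<in>U. m u * z u a b) = 0" if ab: "(a, b) \<in> D" for a b
  proof -
    have zu: "m u * z u a b = val u (a, b) * m u - val u (b, a) * m u" if u: "u \<in> U" for u
    proof -
      have t: "(a, b, nx a b) \<in> T" "(b, a, nx b a) \<in> T" using link_iff D_link ab D_sym by blast+
      have "z u a b = G u a b (nx a b) - G u a (nx b a) b"
        by (rule corner_potentialD[OF z[OF u] rot[OF t(2)] t(1)])
      moreover have "G u a (nx b a) b = G u b a (nx b a)"
        using flat[OF u D_sym[OF ab]] unfolding jump_def by simp
      ultimately have "z u a b = val u (a, b) - val u (b, a)" unfolding val_def by simp
      then show ?thesis by (simp add: right_diff_distrib mult.commute)
    qed
    have "(\<Sum>u\<in>U. m u * z u a b) = (\<Sum>u\<in>U. val u (a, b) * m u) - (\<Sum>u\<in>U. val u (b, a) * m u)"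
      unfolding sum_subtractf[symmetric] by (rule sum.cong) (use zu in simp_all)
    then show ?thesis using 0[OF ab] 0[OF D_sym[OF ab]] by simp
  qed
  then show False using indep[of m] m(1) by blast
qed

end

text \<open>The double points of the curve are numbered \<open>1, \<dots>, n\<close>, and \<open>p t\<close> and \<open>q t\<close> are the two positions at
  which the curve visits the double point number \<open>t\<close>.\<close>

locale double_points = surf +
  fixes c :: "nat list" and n :: nat and p q :: "nat \<Rightarrow> nat"
  assumes normal: "normal_curve T [c]"
    and pos: "t \<in> {1..n} \<Longrightarrow> p t < length c" "t \<in> {1..n} \<Longrightarrow> q t < length c" "t \<in> {1..n} \<Longrightarrow> p t \<noteq> q t"
      "t \<in> {1..n} \<Longrightarrow> c ! p t = c ! q t"
    and sep: "s \<in> {1..n} \<Longrightarrow> t \<in> {1..n} \<Longrightarrow> s \<noteq> t \<Longrightarrow> p s \<noteq> p t"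
      "s \<in> {1..n} \<Longrightarrow> t \<in> {1..n} \<Longrightarrow> s \<noteq> t \<Longrightarrow> q s \<noteq> p t"
    and cover: "i < length c \<Longrightarrow> j < length c \<Longrightarrow> i \<noteq> j \<Longrightarrow> c ! i = c ! j \<Longrightarrow> \<exists>t\<in>{1..n}. {i, j} = {p t, q t}"
begin

abbreviation "L \<equiv> length c"

lemma L_pos: "0 < L" using normal unfolding normal_curve_def by auto

text \<open>Index \<open>0\<close> stands for the whole curve, so that the \<open>n + 1\<close>
  cycles can be treated alike.\<close>

definition loop :: "nat \<Rightarrow> nat list" where "loop t = (if t = 0 then c else segment c (q t) (p t))"

text \<open>The positions whose outgoing dart belongs to the loop: those met cyclically from
  \<open>q t\<close> on before \<open>p t\<close>, and all of them for index
  \<open>0\<close>.\<close>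

definition idx :: "nat \<Rightarrow> nat set" where
  "idx t = {l. l < L \<and> (t = 0 \<or> (l + L - q t) mod L < (p t + L - q t) mod L)}"

lemma loop_normal: "t \<le> n \<Longrightarrow> normal_curve T [loop t]"
  using normal normal_segment[OF normal, of "q t" "p t"] pos[of t] unfolding loop_def by auto

lemma darts_eq: "set (curve_darts [loop t]) = (!) (darts c) ` idx t" if "t \<le> n"
proof -
  have "set (darts (loop t)) = (!) (darts c) ` idx t"
  proof (cases "t = 0")
    case True
    have "set (darts c) = (!) (darts c) ` {..<L}" by (auto simp: set_conv_nth image_iff)
    then show ?thesis using True unfolding loop_def idx_def lessThan_def by simp
  next
    case False
    then show ?thesis using set_darts_segment[of "q t" c "p t"] pos[of t] that unfolding loop_def idx_def by auto
  qed
  then show ?thesis unfolding curve_darts_def by simp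
qed

lemma nth_darts_inj: "inj_on ((!) (darts c)) {..<L}"
  by (rule inj_onI) (use normal_darts(1)[OF normal] in \<open>auto simp: curve_darts_def nth_eq_iff_index_eq\<close>)

lemma idx_less: "idx t \<subseteq> {..<L}" unfolding idx_def by auto

lemma darts_idx: "(!) (darts c) ` idx t \<subseteq> set (darts c)"
proof (rule image_subsetI)
  fix l assume "l \<in> idx t"
  then show "darts c ! l \<in> set (darts c)" using idx_less[of t] by (intro nth_mem) auto
qed

lemma nth_dart: "l < L \<Longrightarrow> (c ! l, c ! (Suc l mod L)) \<in> set (darts c)"
  by (metis darts_nth length_darts nth_mem)

lemma loop_chain: "curve_chain [loop t] (c ! l) (c ! (Suc l mod L)) = of_bool (l \<in> idx t)" if t: "t \<le> n" and l: "l < L"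
proof -
  let ?a = "c ! l" and ?b = "c ! (Suc l mod L)"
  have d: "darts c ! l = (?a, ?b)" using l by (rule darts_nth)
  have "(?a, ?b) \<in> (!) (darts c) ` idx t \<longleftrightarrow> l \<in> idx t"
    unfolding d[symmetric] using inj_on_image_mem_iff[OF nth_darts_inj] l idx_less by blast
  moreover have "(?b, ?a) \<notin> (!) (darts c) ` idx t"
  proof
    assume "(?b, ?a) \<in> (!) (darts c) ` idx t"
    then have "(?b, ?a) \<in> set (darts c)" using darts_idx by blast
    then show False using normal_darts(3)[OF normal, of ?a ?b] nth_dart[OF l] by (simp add: curve_darts_def)
  qed
  ultimately show ?thesis
    unfolding curve_chain_eq[OF normal_darts(1)[OF loop_normal[OF t]]] darts_eq[OF t] by simp
qed

lemma loop_support: "curve_chain [loop t] a b = 0" if t: "t \<le> n" and "(a, b) \<notin> sym_darts c"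
proof -
  have "(a, b) \<notin> (!) (darts c) ` idx t" "(b, a) \<notin> (!) (darts c) ` idx t"
    using that(2) darts_idx unfolding sym_darts_def by blast+
  then show ?thesis unfolding curve_chain_eq[OF normal_darts(1)[OF loop_normal[OF t]]] darts_eq[OF t] by simp
qed

lemma idx_mod: "t \<in> {1..n} \<Longrightarrow> l < L \<Longrightarrow> l \<in> idx t \<longleftrightarrow>
    (if q t < p t then q t \<le> l \<and> l < p t else q t \<le> l \<or> l < p t)"
  using pos[of t] mod_back[of l L "q t"] mod_back[of "p t" L "q t"] unfolding idx_def by auto

text \<open>At position \<open>p t\<close> the curve leaves loop \<open>t\<close> and neither enters
  nor leaves any other, since the ends of the other loops are at other positions. Comparing the
  relation on the darts before and after \<open>p t\<close> isolates \<open>m t\<close>; the whole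
  curve is then the only one left.\<close>

lemma loop_independent:
  assumes zero: "\<And>a b. (a, b) \<in> sym_darts c \<Longrightarrow> (\<Sum>t\<le>n. m t * curve_chain [loop t] a b) = 0" and "t \<le> n"
  shows "m t = 0"
proof -
  have S: "(\<Sum>t\<le>n. m t * of_bool (l \<in> idx t)) = 0" if l: "l < L" for l
  proof -
    have "(\<Sum>t\<le>n. m t * of_bool (l \<in> idx t)) = (\<Sum>t\<le>n. m t * curve_chain [loop t] (c ! l) (c ! (Suc l mod L)))"
      by (rule sum.cong) (use loop_chain l in simp_all)
    also have "\<dots> = 0" by (rule zero) (use nth_dart[OF l] in \<open>simp add: sym_darts_def\<close>)
    finally show ?thesis .
  qed
  have pos0: "m t = 0" if t: "t \<in> {1..n}" for t
  proof -
    \<comment> \<open>The position cyclically before \<open>p t\<close>.\<close>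
    define l where "l = (if p t = 0 then L - 1 else p t - 1)"
    have l: "l < L" using pos(1)[OF t] L_pos unfolding l_def by auto
    have prev: "p t = 0 \<and> Suc l = L \<or> p t = Suc l" using L_pos unfolding l_def by auto
    have same: "p t \<in> idx s \<longleftrightarrow> l \<in> idx s" if s: "s \<le> n" "s \<noteq> t" for s
    proof (cases "s = 0")
      case True
      then show ?thesis using l pos(1)[OF t] unfolding idx_def by simp
    next
      case False
      then have s': "s \<in> {1..n}" using s by auto
      show ?thesis
        unfolding idx_mod[OF s' l] idx_mod[OF s' pos(1)[OF t]]
        using sep(1,2)[OF s' t s(2)] pos(1-3)[OF s'] pos(1)[OF t] prev by auto
    qed
    have self: "p t \<notin> idx t" "l \<in> idx t"
      unfolding idx_mod[OF t l] idx_mod[OF t pos(1)[OF t]] using pos(1-3)[OF t] prev by auto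
    have "0 = (\<Sum>s\<le>n. m s * of_bool (l \<in> idx s)) - (\<Sum>s\<le>n. m s * of_bool (p t \<in> idx s))"
      using S[OF l] S[OF pos(1)[OF t]] by simp
    also have "\<dots> = (\<Sum>s\<le>n. if s = t then m s else 0)"
      unfolding sum_subtractf[symmetric] by (rule sum.cong) (use same self in auto)
    also have "\<dots> = m t" using t by simp
    finally show ?thesis by simp
  qed
  have "0 = (\<Sum>s\<le>n. m s * of_bool (0 \<in> idx s))" using S[OF L_pos] by simp
  also have "\<dots> = (\<Sum>s\<le>n. if s = 0 then m s else 0)"
    by (rule sum.cong) (use pos0 L_pos in \<open>auto simp: idx_def\<close>)
  also have "\<dots> = m 0" by simp
  finally show ?thesis using pos0[of t] \<open>t \<le> n\<close> by (cases "t = 0") auto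
qed

text \<open>The jumps sum to zero over every loop, so their partial sums along the curve agree at
  the two visits of each double point. They define a function on vertices, and subtracting it from
  the potential removes all jumps along the curve.\<close>

lemma flat_potential:
  assumes z: "z \<in> cycles T" and orth: "\<And>t. t \<le> n \<Longrightarrow> pairing T z (curve_chain [loop t]) = 0"
  shows "\<exists>G. corner_potential T z G \<and> (\<forall>(a, b)\<in>sym_darts c. jump G a b = 0)"
proof -
  obtain G where G: "corner_potential T z G" using potential_exists z by blast
  define h where "h l = jump G (c ! l) (c ! (Suc l mod L))" for l
  define P where "P i = (\<Sum>l<i. h l)" for i
  have sum0: "sum h (idx t) = 0" if t: "t \<le> n" for t
  proof -
    have "0 = flux T G (curve_chain [loop t])"
      using orth[OF t] pairing_eq[OF G z curve_chain_cycle[OF loop_normal[OF t]]] by simp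
    also have "\<dots> = 2 * (\<Sum>(a, b)\<in>(!) (darts c) ` idx t. jump G a b)"
      unfolding flux_jump[OF loop_normal[OF t] G z] darts_eq[OF t] ..
    also have "(\<Sum>(a, b)\<in>(!) (darts c) ` idx t. jump G a b) = (\<Sum>l\<in>idx t. case darts c ! l of (a, b) \<Rightarrow> jump G a b)"
      by (rule sum.reindex[OF inj_on_subset[OF nth_darts_inj idx_less], unfolded o_def])
    also have "\<dots> = sum h (idx t)"
    proof (rule sum.cong, simp)
      fix l assume "l \<in> idx t"
      then have "l < L" using idx_less by blast
      then show "(case darts c ! l of (a, b) \<Rightarrow> jump G a b) = h l" by (simp add: h_def darts_nth)
    qed
    finally show ?thesis by simp
  qed
  have PL: "P L = 0" using sum0[of 0] unfolding P_def idx_def lessThan_def by simp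
  have split: "P j = P i + sum h {i..<j}" if "i \<le> j" for i j
    unfolding P_def using that by (simp add: lessThan_atLeast0 sum.atLeastLessThan_concat)
  \<comment> \<open>The loop runs from \<open>q t\<close> to \<open>p t\<close> and may pass the end
    of the list. In that case it splits into two intervals, joined by the vanishing total
    \<open>P L\<close>.\<close>
  have Ppq: "P (p t) = P (q t)" if t: "t \<in> {1..n}" for t
  proof (cases "q t < p t")
    case True
    have "idx t = {q t..<p t}"
    proof (intro equalityI subsetI)
      show "l \<in> {q t..<p t}" if "l \<in> idx t" for l using idx_mod[OF t, of l] that True unfolding idx_def by simp
      show "l \<in> idx t" if "l \<in> {q t..<p t}" for l using idx_mod[OF t, of l] that True pos(1)[OF t] by simp
    qed
    then show ?thesis using split[of "q t" "p t"] True sum0[of t] t by simp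
  next
    case False
    then have le: "p t < q t" using pos(3)[OF t] by simp
    have "idx t = {..<p t} \<union> {q t..<L}"
    proof (intro equalityI subsetI)
      show "l \<in> {..<p t} \<union> {q t..<L}" if "l \<in> idx t" for l using idx_mod[OF t, of l] that False unfolding idx_def by auto
      show "l \<in> idx t" if "l \<in> {..<p t} \<union> {q t..<L}" for l
        using idx_mod[OF t, of l] that False pos(1)[OF t] by auto
    qed
    moreover have "sum h ({..<p t} \<union> {q t..<L}) = sum h {..<p t} + sum h {q t..<L}"
      by (rule sum.union_disjoint) (use le in auto)
    ultimately have "P (p t) + sum h {q t..<L} = 0" using sum0[of t] t unfolding P_def by simp
    then show ?thesis using split[of "q t" L] pos(2)[OF t] PL by simp
  qed
  have well: "P i = P j" if ij: "i < L" "j < L" "c ! i = c ! j" for i j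
  proof (cases "i = j")
    case False
    then obtain t where "t \<in> {1..n}" "{i, j} = {p t, q t}" using cover[OF ij(1,2) _ ij(3)] by blast
    then show ?thesis using Ppq[of t] by (auto simp: doubleton_eq_iff)
  qed simp
  define k where "k x = P (SOME i. i < L \<and> c ! i = x)" for x
  have k: "k (c ! i) = P i" if "i < L" for i
  proof -
    have "(SOME j. j < L \<and> c ! j = c ! i) < L \<and> c ! (SOME j. j < L \<and> c ! j = c ! i) = c ! i"
      by (rule someI[of _ i]) (use that in simp)
    then show ?thesis unfolding k_def using well that by blast
  qed
  define G' where "G' a b d = G a b d - k a" for a b d
  have G': "corner_potential T z G'" unfolding G'_def by (rule corner_potential_shift[OF G])
  have along: "jump G' a b = 0" if ab: "(a, b) \<in> set (darts c)" for a b
  proof -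
    obtain l where l: "l < L" "darts c ! l = (a, b)" using ab by (metis in_set_conv_nth length_darts)
    then have e: "a = c ! l" "b = c ! (Suc l mod L)" by (simp_all add: darts_nth)
    have "P (Suc l mod L) = P (Suc l)"
    proof (cases "Suc l = L")
      case True
      then show ?thesis using PL by (simp add: P_def)
    qed (use l in simp)
    also have "\<dots> = P l + h l" unfolding P_def by simp
    finally have "k b = k a + jump G a b" using k[OF l(1)] k[of "Suc l mod L"] L_pos unfolding h_def e by simp
    then show ?thesis unfolding jump_def G'_def by simp
  qed
  have "jump G' a b = 0" if ab: "(a, b) \<in> sym_darts c" for a b
  proof (cases "(a, b) \<in> set (darts c)")
    case False
    then have ba: "(b, a) \<in> set (darts c)" using ab unfolding sym_darts_def by simp
    then have "(b, a, nx b a) \<in> T" using normal_darts(2)[OF normal] link_iff by (simp add: curve_darts_def)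
    then show ?thesis using jump_antisym[OF G' z] along[OF ba] by simp
  qed (rule along)
  then show ?thesis using G' by blast
qed

text \<open>Dropping the position \<open>q t\<close> of every double point leaves positions with
  pairwise different vertices.\<close>

lemma card_vertices: "L \<le> card (set c) + n"
proof -
  let ?I = "{..<L} - q ` {1..n}"
  have "inj_on ((!) c) ?I"
  proof (rule inj_onI, rule ccontr)
    fix i j assume ij: "i \<in> ?I" "j \<in> ?I" "c ! i = c ! j" "i \<noteq> j"
    then obtain t where "t \<in> {1..n}" "{i, j} = {p t, q t}" using cover[of i j] by auto
    then show False using ij by (auto simp: doubleton_eq_iff)
  qed
  then have "card ?I = card ((!) c ` ?I)" by (simp add: card_image)
  also have "\<dots> \<le> card (set c)" by (rule card_mono) auto
  finally have "card ?I \<le> card (set c)" .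
  moreover have "L - n \<le> card ?I"
    using diff_card_le_card_Diff[of "q ` {1..n}" "{..<L}"] card_image_le[of "{1..n}" q] by simp
  ultimately show ?thesis by simp
qed

text \<open>At least \<open>L - n\<close> vertices, exactly \<open>L\<close> edges and at least
  \<open>n + 1\<close> faces; the loops, with flat potentials, witness the last number.\<close>

lemma capped_euler_char_pos:
  assumes orth: "\<And>s t. s \<le> n \<Longrightarrow> t \<le> n \<Longrightarrow> pairing T (curve_chain [loop s]) (curve_chain [loop t]) = 0"
  shows "euler_char (ribbon.capped T (sym_darts c)) \<ge> 1"
proof -
  interpret R: ribbon T "sym_darts c" by (rule ribbon_sym_darts[OF normal])
  have "\<exists>G. corner_potential T (curve_chain [loop t]) G \<and> (\<forall>(a, b)\<in>sym_darts c. jump G a b = 0)" if "t \<le> n" for t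
    by (rule flat_potential[OF curve_chain_cycle[OF loop_normal[OF that]] orth[OF that]])
  then obtain G where G: "\<And>t. t \<le> n \<Longrightarrow> corner_potential T (curve_chain [loop t]) (G t)"
    "\<And>t. t \<le> n \<Longrightarrow> \<forall>(a, b)\<in>sym_darts c. jump (G t) a b = 0" by metis
  have "card {..n} \<le> card (R.face ` sym_darts c)"
  proof (rule R.card_faces)
    show "finite {..n}" by simp
    show "corner_potential T (curve_chain [loop t]) (G t)" if "t \<in> {..n}" for t using G(1) that by simp
    show "curve_chain [loop t] a b = 0" if "t \<in> {..n}" "(a, b) \<notin> sym_darts c" for t a b
      using loop_support that by simp
    show "jump (G t) a b = 0" if "t \<in> {..n}" "(a, b) \<in> sym_darts c" for t a b
      using G(2)[of t] that by auto
    show "m t = 0" if "\<And>a b. (a, b) \<in> sym_darts c \<Longrightarrow> (\<Sum>u\<in>{..n}. m u * curve_chain [loop u] a b) = 0" "t \<in> {..n}" for m t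
      using loop_independent[of m t] that by simp
  qed
  then show ?thesis
    using R.capped_euler_char card_vertices card_sym_darts[OF normal] unfolding fst_sym_darts by simp
qed

end

section \<open>Double points read off from the signed Gauss word\<close>

context surf
begin

context
  fixes n :: nat and w :: "symbol list" and c :: "nat list" and lab :: "nat \<Rightarrow> nat" and k :: nat
  assumes word: "signed_gauss_word n w" and normal: "normal_curve T [c]"
    and lab: "bij_betw lab (crossings [c]) {1..n}" and read: "read_word T c lab = rotate k w"
begin

lemma repeated_crossing:
  assumes "i < length c" "j < length c" "i \<noteq> j" "c ! i = c ! j" shows "c ! i \<in> crossings [c]"
proof -
  have "strand_at c i \<in> strands [c]" "strand_at c j \<in> strands [c]" unfolding strands_def using assms by auto
  moreover have "strand_at c i \<noteq> strand_at c j" using strand_at_inj[OF normal] assms by blast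
  moreover have "mid (strand_at c i) = c ! i" "mid (strand_at c j) = c ! i"
    using assms by (simp_all add: strand_at_def mid_def)
  ultimately show ?thesis unfolding crossings_def by blast
qed

text \<open>Each symbol occurs exactly once in the word, and rotating does not change this. So each
  is read at exactly one position, which makes the definite description in \<open>occurrence\<close>
  meaningful.\<close>

lemma read_symbol_bij:
  "bij_betw (read_symbol T c lab) {i. i < length c \<and> c ! i \<in> crossings [c]} (Pos ` {1..n} \<union> Inv ` {1..n})"
proof -
  let ?X = "filter (\<lambda>i. c ! i \<in> crossings [c]) [0..<length c]"
  have X: "set ?X = {i. i < length c \<and> c ! i \<in> crossings [c]}" by auto
  have "distinct (read_word T c lab)" "set (read_word T c lab) = Pos ` {1..n} \<union> Inv ` {1..n}"
    using word unfolding read signed_gauss_word_def by simp_all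
  then show ?thesis unfolding read_word_def bij_betw_def X[symmetric] by (simp add: distinct_map)
qed

lemma occurrence:
  assumes a: "a \<in> Pos ` {1..n} \<union> Inv ` {1..n}"
  shows "occurrence T c lab a < length c" "c ! occurrence T c lab a \<in> crossings [c]"
    "read_symbol T c lab (occurrence T c lab a) = a"
    and "\<And>i. i < length c \<Longrightarrow> c ! i \<in> crossings [c] \<Longrightarrow> read_symbol T c lab i = a \<Longrightarrow> i = occurrence T c lab a"
proof -
  have ex: "\<exists>!i. i < length c \<and> c ! i \<in> crossings [c] \<and> read_symbol T c lab i = a"
  proof -
    let ?X = "{i. i < length c \<and> c ! i \<in> crossings [c]}"
    have "a \<in> read_symbol T c lab ` ?X" using a bij_betw_imp_surj_on[OF read_symbol_bij] by simp
    then obtain i where i: "i \<in> ?X" "read_symbol T c lab i = a" by auto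
    have "l = i" if "l \<in> ?X" "read_symbol T c lab l = a" for l
      by (rule inj_onD[OF bij_betw_imp_inj_on[OF read_symbol_bij] _ that(1) i(1)]) (simp add: that(2) i(2))
    then show ?thesis using i by (intro ex1I[of _ i]) (unfold mem_Collect_eq, blast+)
  qed
  show "occurrence T c lab a < length c" "c ! occurrence T c lab a \<in> crossings [c]"
    "read_symbol T c lab (occurrence T c lab a) = a"
    using theI'[OF ex, folded occurrence_def] by blast+
  show "i = occurrence T c lab a" if "i < length c" "c ! i \<in> crossings [c]" "read_symbol T c lab i = a" for i
    unfolding occurrence_def by (rule the1_equality[OF ex, symmetric]) (use that in blast)
qed

lemma occurrence_lab:
  assumes t: "t \<in> {1..n}"
  shows "lab (c ! occurrence T c lab (Pos t)) = t" "lab (c ! occurrence T c lab (Inv t)) = t"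
  using occurrence(3)[of "Pos t"] occurrence(3)[of "Inv t"] t by (auto simp: read_symbol_def split: if_splits)

text \<open>The two symbols of a letter are read at the same vertex because \<open>lab\<close> is
  injective on crossings. Conversely a vertex visited twice is a crossing, and each of its visits
  reads one of the two symbols of its label.\<close>

lemma double_points_occurrence:
  "double_points T c n (\<lambda>t. occurrence T c lab (Pos t)) (\<lambda>t. occurrence T c lab (Inv t))"
proof
  let ?p = "\<lambda>t. occurrence T c lab (Pos t)" and ?q = "\<lambda>t. occurrence T c lab (Inv t)"
  show "normal_curve T [c]" by (rule normal)
  show "?p t < length c" "?q t < length c" if "t \<in> {1..n}" for t
    using occurrence(1) that by auto
  show "?p t \<noteq> ?q t" if "t \<in> {1..n}" for t
    using occurrence(3)[of "Pos t"] occurrence(3)[of "Inv t"] that by force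
  show "c ! ?p t = c ! ?q t" if t: "t \<in> {1..n}" for t
    by (rule inj_onD[OF bij_betw_imp_inj_on[OF lab]])
      (use t occurrence(2)[of "Pos t"] occurrence(2)[of "Inv t"] occurrence_lab[OF t] in auto)
  show "?p s \<noteq> ?p t" if "s \<in> {1..n}" "t \<in> {1..n}" "s \<noteq> t" for s t
    using occurrence(3)[of "Pos s"] occurrence(3)[of "Pos t"] that by force
  show "?q s \<noteq> ?p t" if "s \<in> {1..n}" "t \<in> {1..n}" "s \<noteq> t" for s t
    using occurrence(3)[of "Inv s"] occurrence(3)[of "Pos t"] that by force
  fix i j assume ij: "i < length c" "j < length c" "i \<noteq> j" "c ! i = c ! j"
  define t where "t = lab (c ! i)"
  have x: "c ! i \<in> crossings [c]" by (rule repeated_crossing[OF ij])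
  have t: "t \<in> {1..n}" using lab x unfolding t_def bij_betw_def by blast
  have "l = ?p t \<or> l = ?q t" if l: "l < length c" "c ! l = c ! i" for l
  proof -
    have "read_symbol T c lab l = Pos t \<or> read_symbol T c lab l = Inv t"
      unfolding read_symbol_def t_def using l by simp
    then show ?thesis using occurrence(4)[of "Pos t" l] occurrence(4)[of "Inv t" l] t l x by auto
  qed
  then have "i \<in> {?p t, ?q t}" "j \<in> {?p t, ?q t}" using ij by simp_all
  then have "{i, j} = {?p t, ?q t}" using ij(3) by auto
  then show "\<exists>t\<in>{1..n}. {i, j} = {?p t, ?q t}" using t by blast
qed

end

end

theorem theorem11:
  fixes n :: nat and w :: "symbol list"
    and S :: surface and \<gamma> :: "nat list" and lab :: "nat \<Rightarrow> nat"
  assumes "signed_gauss_word n w"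
    and "minimal_realization n w S \<gamma> lab"
  shows "trivial_group (H1 S) \<longleftrightarrow>
    (\<forall>j\<in>{1..n}. alpha S \<gamma> lab j = 0) \<and>
    (\<forall>i\<in>{1..n}. \<forall>j\<in>{1..n}. beta S \<gamma> lab i j = 0)"
proof -
  have real: "realization n w S \<gamma> lab"
    and minimal: "\<And>T c l. realization n w T c l \<Longrightarrow> genus S \<le> genus T"
    using assms(2) unfolding minimal_realization_def by blast+
  have S: "closed_oriented_surface S" "connected_surface S" "normal_curve S [\<gamma>]"
    "bij_betw lab (crossings [\<gamma>]) {1..n}" using real unfolding realization_def by blast+
  obtain k where k: "read_word S \<gamma> lab = rotate k w" using real unfolding realization_def by blast
  interpret csurf S by unfold_locales (rule S)+
  interpret P: double_points S \<gamma> n "\<lambda>t. occurrence S \<gamma> lab (Pos t)" "\<lambda>t. occurrence S \<gamma> lab (Inv t)"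
    by (rule double_points_occurrence[OF assms(1) S(3,4) k])
  have loop: "P.loop 0 = \<gamma>" "split_curve S \<gamma> lab t = P.loop t" if "t \<in> {1..n}" for t
    using that unfolding P.loop_def split_curve_def split_def Let_def by auto
  \<comment> \<open>Stated separately because for \<open>n = 0\<close> the preceding fact has no
    instance.\<close>
  have loop0: "P.loop 0 = \<gamma>" unfolding P.loop_def by simp
  let ?z = "\<lambda>t. curve_chain [P.loop t]"
  have z: "?z t \<in> cycles S" if "t \<le> n" for t by (rule curve_chain_cycle[OF P.loop_normal[OF that]])
  have alpha: "alpha S \<gamma> lab t = intersection_number S (chain_class S (?z 0)) (chain_class S (?z t))"
    if "t \<in> {1..n}" for t
    unfolding alpha_def curve_class_def loop(2)[OF that] loop0 ..
  have beta: "beta S \<gamma> lab s t = intersection_number S (chain_class S (?z s)) (chain_class S (?z t))"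
    if "s \<in> {1..n}" "t \<in> {1..n}" for s t
    unfolding beta_def curve_class_def loop(2)[OF that(1)] loop(2)[OF that(2)] ..
  show ?thesis
  proof
    assume "trivial_group (H1 S)"
    then have "cycles S \<subseteq> boundaries S" unfolding H1_trivial_iff .
    then have "intersection_number S (chain_class S (?z s)) (chain_class S (?z t)) = 0" if "s \<le> n" "t \<le> n" for s t
      using intersection_number_boundary z that by blast
    then show "(\<forall>j\<in>{1..n}. alpha S \<gamma> lab j = 0) \<and> (\<forall>i\<in>{1..n}. \<forall>j\<in>{1..n}. beta S \<gamma> lab i j = 0)"
      using alpha beta by simp
  next
    assume zero: "(\<forall>j\<in>{1..n}. alpha S \<gamma> lab j = 0) \<and> (\<forall>i\<in>{1..n}. \<forall>j\<in>{1..n}. beta S \<gamma> lab i j = 0)"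
    have num: "pairing S (?z s) (?z t) = 2 * intersection_number S (chain_class S (?z s)) (chain_class S (?z t))"
      if "s \<le> n" "t \<le> n" for s t
      using intersection_number_normal[OF P.loop_normal[OF that(1)] z[OF that(2)]] unfolding curve_class_def by simp
    have orth: "pairing S (?z s) (?z t) = 0" if st: "s \<le> n" "t \<le> n" for s t
    proof -
      have a: "pairing S (?z 0) (?z t) = 0" if "t \<in> {1..n}" for t
        using num[of 0 t] alpha[OF that] zero that by simp
      have b: "pairing S (?z s) (?z t) = 0" if "s \<in> {1..n}" "t \<in> {1..n}" for s t
        using num[of s t] beta[OF that] zero that by simp
      have anti: "pairing S (?z s) (?z t) = - pairing S (?z t) (?z s)" if "s \<le> n" "t \<le> n" for s t
        by (rule pairing_antisym[OF z[OF that(1)] z[OF that(2)]])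
      show ?thesis
      \<comment> \<open>The hypotheses cover the pairs \<open>(0, t)\<close> and
        \<open>(s, t)\<close> with positive entries; antisymmetry supplies \<open>(s, 0)\<close> and
        the pairing of the whole curve with itself.\<close>
      proof (cases "s = 0 \<or> t = 0")
        case True
        then show ?thesis using a[of s] a[of t] anti[of s t] st by (cases "s = 0"; cases "t = 0") auto
      next
        case False
        then show ?thesis using b[of s t] st by simp
      qed
    qed
    have "euler_char (ribbon.capped S (sym_darts \<gamma>)) \<ge> 1" by (rule P.capped_euler_char_pos[OF orth])
    \<comment> \<open>Rounding down in \<open>genus\<close> makes \<open>euler_char \<ge> 1\<close>
      equivalent to \<open>genus \<le> 0\<close>, so the bound passes through minimality and
      back.\<close>
    then have "genus (ribbon.capped S (sym_darts \<gamma>)) \<le> 0" unfolding genus_def by linarith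
    then have "genus S \<le> 0" using minimal[OF capped_realization[OF S(3) real]] by linarith
    then have "euler_char S \<ge> 1" unfolding genus_def by linarith
    then show "trivial_group (H1 S)" unfolding H1_trivial_iff by (rule cycles_bound_if_euler_char_pos)
  qed
qed

end
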